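(* Let $\mathcal{T}$ be a Krull-Schmidt, Hom-finite triangulated category over $k$ with suspension functor $[1]$, let $R$ be a basic rigid object of $\mathcal{T}$, and let $\Gamma=\operatorname{End}_{\mathcal{T}}(R)$. For an object $X\in\operatorname{pr}(R)$ without nonzero direct summands in $\operatorname{add}(R[1])$, we have $$\operatorname{pd}_\Gamma\operatorname{Hom}_{\mathcal{T}}(R,X)\leq 1\quad\text{if and only if}\quad X(R[1],R[1])=0.$$ In particular, for a basic object $X\in\operatorname{pr}(R)$ which has no nonzero direct summands in $\operatorname{add}(R[1])$, $\operatorname{Hom}_{\mathcal{T}}(R,X)$ is a tilting $\Gamma$-module if and only if $X(R[1],R[1])=0$ and $X$ is maximal $R[1]$-rigid with respect to $\operatorname{pr}(R)$.
   Context: $k$ is an algebraically closed field. An object (or module) is basic if it has no repeated indecomposable direct summands up to isomorphism; $|M|$ is the number of non-isomorphic indecomposable direct summands of $M$; $\operatorname{add}M$ is the full subcategory of finite direct sums of direct summands of $M$. For objects $X,Y,Z$ of $\mathcal{T}$, $Z(X,Y)\subseteq\operatorname{Hom}_{\mathcal{T}}(X,Y)$ denotes the subgroup of morphisms that factor through an object of $\operatorname{add}Z$. In particular $X(R[1],R[1])$ is the set of endomorphisms of $R[1]$ factoring through $\operatorname{add}X$. An object $X$ is rigid if $\operatorname{Hom}_{\mathcal{T}}(X,X[1])=0$. For the rigid object $R$: $\operatorname{pr}(R)$ is the full subcategory of $\mathcal{T}$ of objects $X$ for which there is a triangle $R_1\to R_0\to X\to R_1[1]$ with $R_0,R_1\in\operatorname{add}R$.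 An object $X\in\mathcal{T}$ is $R[1]$-rigid if $R[1](X,X[1])=0$. An object $X\in\operatorname{pr}(R)$ is maximal $R[1]$-rigid with respect to $\operatorname{pr}(R)$ if $X$ is $R[1]$-rigid and, for every $Z\in\operatorname{pr}(R)$ with $R[1](X\oplus Z,X[1]\oplus Z[1])=0$, one has $Z\in\operatorname{add}X$. $\Gamma$-modules are finitely generated right $\Gamma$-modules; $\operatorname{pd}_\Gamma$ denotes projective dimension. A basic $\Gamma$-module $M$ is a tilting module if $\operatorname{pd}_\Gamma M\le 1$, $\operatorname{Ext}^1_\Gamma(M,M)=0$ and $|M|=|\Gamma|$. $\operatorname{Hom}_{\mathcal{T}}(R,X)$ is a right $\Gamma$-module via composition. *)

theory Defs
  imports "HOL-Algebra.Algebra" "HOL-Library.Extended_Nat"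
begin

text \<open>The following notation of \<^theory>\<open>HOL-Algebra.Polynomials\<close> prevents \<open>X\<close> from being used as a variable.\<close>

no_notation var (\<open>X\<index>\<close>)
no_notation univ_poly (\<open>(\<open>open_block notation=\<open>postfix X\<close>\<close>_ [X]\<index>)\<close> 80)

section \<open>Right modules\<close>

text \<open>
  The record type of \<^theory>\<open>HOL-Algebra.Module\<close> is reused, but its locale \<^term>\<open>module\<close>
  requires a commutative ring.  Below, \<open>r \<odot>\<^bsub>M\<^esub> x\<close> stands for the right action \<open>x \<cdot> r\<close>.
\<close>

locale right_module = R?: ring R + M?: abelian_group M
  for R :: "('a, 'r) ring_scheme" (structure) and M :: "('a, 'b, 'c) module_scheme" (structure) +
  assumes smult_closed: "\<lbrakk>a \<in> carrier R; x \<in> carrier M\<rbrakk> \<Longrightarrow> a \<odot>\<^bsub>M\<^esub> x \<in> carrier M"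
    and smult_ring_distr: "\<lbrakk>a \<in> carrier R; b \<in> carrier R; x \<in> carrier M\<rbrakk> \<Longrightarrow>
      (a \<oplus> b) \<odot>\<^bsub>M\<^esub> x = a \<odot>\<^bsub>M\<^esub> x \<oplus>\<^bsub>M\<^esub> b \<odot>\<^bsub>M\<^esub> x"
    and smult_module_distr: "\<lbrakk>a \<in> carrier R; x \<in> carrier M; y \<in> carrier M\<rbrakk> \<Longrightarrow>
      a \<odot>\<^bsub>M\<^esub> (x \<oplus>\<^bsub>M\<^esub> y) = a \<odot>\<^bsub>M\<^esub> x \<oplus>\<^bsub>M\<^esub> a \<odot>\<^bsub>M\<^esub> y"
    and smult_assoc: "\<lbrakk>a \<in> carrier R; b \<in> carrier R; x \<in> carrier M\<rbrakk> \<Longrightarrow>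
      (a \<otimes> b) \<odot>\<^bsub>M\<^esub> x = b \<odot>\<^bsub>M\<^esub> (a \<odot>\<^bsub>M\<^esub> x)"
    and smult_one: "x \<in> carrier M \<Longrightarrow> \<one> \<odot>\<^bsub>M\<^esub> x = x"

definition finitely_generated ::
    "('a, 'r) ring_scheme \<Rightarrow> ('a, 'b, 'c) module_scheme \<Rightarrow> bool" where
  "finitely_generated R M \<longleftrightarrow>
     (\<exists>S. finite S \<and> S \<subseteq> carrier M \<and>
        (\<forall>x \<in> carrier M. \<exists>c \<in> S \<rightarrow> carrier R. x = (\<Oplus>\<^bsub>M\<^esub> s \<in> S. c s \<odot>\<^bsub>M\<^esub> s)))"

definition fg_module :: "('a, 'r) ring_scheme \<Rightarrow> ('a, 'b, 'c) module_scheme \<Rightarrow> bool" where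
  "fg_module R M \<longleftrightarrow> right_module R M \<and> finitely_generated R M"

definition regular_module :: "('a, 'r) ring_scheme \<Rightarrow> ('a, 'a) module" where
  "regular_module R =
     \<lparr>carrier = carrier R, monoid.mult = monoid.mult R, one = one R, ring.zero = ring.zero R, ring.add = ring.add R,
      smult = (\<lambda>a x. x \<otimes>\<^bsub>R\<^esub> a)\<rparr>"

text \<open>Homomorphisms are extensional, so that they form a group under pointwise addition.\<close>

definition module_hom :: "('a, 'r) ring_scheme \<Rightarrow> ('a, 'b, 'c) module_scheme \<Rightarrow>
    ('a, 'd, 'e) module_scheme \<Rightarrow> ('b \<Rightarrow> 'd) set" where
  "module_hom R M N = {f \<in> carrier M \<rightarrow>\<^sub>E carrier N.
     (\<forall>x \<in> carrier M. \<forall>y \<in> carrier M. f (x \<oplus>\<^bsub>M\<^esub> y) = f x \<oplus>\<^bsub>N\<^esub> f y) \<and>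
     (\<forall>a \<in> carrier R. \<forall>x \<in> carrier M. f (a \<odot>\<^bsub>M\<^esub> x) = a \<odot>\<^bsub>N\<^esub> f x)}"

definition module_iso :: "('a, 'r) ring_scheme \<Rightarrow> ('a, 'b, 'c) module_scheme \<Rightarrow>
    ('a, 'd, 'e) module_scheme \<Rightarrow> bool" where
  "module_iso R M N \<longleftrightarrow> (\<exists>f \<in> module_hom R M N. bij_betw f (carrier M) (carrier N))"


subsection \<open>Indecomposable direct summands\<close>

definition internal_direct_sum :: "('a, 'r) ring_scheme \<Rightarrow> ('a, 'b, 'c) module_scheme \<Rightarrow>
    'b set \<Rightarrow> 'b set \<Rightarrow> bool" where
  "internal_direct_sum R M N N' \<longleftrightarrow>
     submodule N R M \<and> submodule N' R M \<and> N \<inter> N' = {\<zero>\<^bsub>M\<^esub>} \<and> N <+>\<^bsub>M\<^esub> N' = carrier M"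

definition indecomposable_module ::
    "('a, 'r) ring_scheme \<Rightarrow> ('a, 'b, 'c) module_scheme \<Rightarrow> bool" where
  "indecomposable_module R M \<longleftrightarrow> carrier M \<noteq> {\<zero>\<^bsub>M\<^esub>} \<and>
     (\<forall>N N'. internal_direct_sum R M N N' \<longrightarrow> N = {\<zero>\<^bsub>M\<^esub>} \<or> N' = {\<zero>\<^bsub>M\<^esub>})"

definition indecomposable_summands ::
    "('a, 'r) ring_scheme \<Rightarrow> ('a, 'b, 'c) module_scheme \<Rightarrow> 'b set set" where
  "indecomposable_summands R M =
     {N. (\<exists>N'. internal_direct_sum R M N N') \<and> indecomposable_module R (M\<lparr>carrier := N\<rparr>)}"

definition num_summands :: "('a, 'r) ring_scheme \<Rightarrow> ('a, 'b, 'c) module_scheme \<Rightarrow> nat" where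
  "num_summands R M = card (indecomposable_summands R M //
     {(N, N'). N \<in> indecomposable_summands R M \<and> N' \<in> indecomposable_summands R M \<and>
        module_iso R (M\<lparr>carrier := N\<rparr>) (M\<lparr>carrier := N'\<rparr>)})"

text \<open>No decomposition \<open>M = N \<oplus> N' \<oplus> C\<close> has \<open>N \<cong> N'\<close> indecomposable.\<close>

definition basic_module :: "('a, 'r) ring_scheme \<Rightarrow> ('a, 'b, 'c) module_scheme \<Rightarrow> bool" where
  "basic_module R M \<longleftrightarrow>
     \<not> (\<exists>N N' C. submodule N R M \<and> submodule N' R M \<and> N \<inter> N' = {\<zero>\<^bsub>M\<^esub>} \<and>
          internal_direct_sum R M (N <+>\<^bsub>M\<^esub> N') C \<and>
          indecomposable_module R (M\<lparr>carrier := N\<rparr>) \<and>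
          module_iso R (M\<lparr>carrier := N\<rparr>) (M\<lparr>carrier := N'\<rparr>))"


subsection \<open>Projective dimension, extension groups, tilting modules\<close>

text \<open>
  HOL cannot quantify over the carrier types of modules.  Every finitely generated \<open>R\<close>-module is a
  quotient of some \<open>R\<^sup>n\<close>, hence isomorphic to one whose carrier consists of (representatives given
  by) functions \<open>nat \<Rightarrow> 'a\<close>, where \<open>'a\<close> is the type of ring elements.  So quantifying over the
  following type loses no finitely generated module.
\<close>

type_synonym 'a small_module = "('a, nat \<Rightarrow> 'a) module"

definition projective_module ::
    "('a, 'r) ring_scheme \<Rightarrow> ('a, 'b, 'c) module_scheme \<Rightarrow> bool" where
  "projective_module R P \<longleftrightarrow> fg_module R P \<and>
     (\<forall>(A :: 'a small_module) (B :: 'a small_module). \<forall>g \<in> module_hom R A B. \<forall>f \<in> module_hom R P B.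
        fg_module R A \<and> fg_module R B \<and> g ` carrier A = carrier B \<longrightarrow>
        (\<exists>h \<in> module_hom R P A. \<forall>x \<in> carrier P. g (h x) = f x))"

text \<open>\<open>\<dots> \<rightarrow> P 2 \<rightarrow> P 1 \<rightarrow> P 0 \<rightarrow> M \<rightarrow> 0\<close> is exact, with \<open>d n : P (n + 1) \<rightarrow> P n\<close> and \<open>e : P 0 \<rightarrow> M\<close>.\<close>

definition projective_resolution ::
    "('a, 'r) ring_scheme \<Rightarrow> ('a, 'b, 'c) module_scheme \<Rightarrow> (nat \<Rightarrow> 'a small_module) \<Rightarrow>
     (nat \<Rightarrow> (nat \<Rightarrow> 'a) \<Rightarrow> (nat \<Rightarrow> 'a)) \<Rightarrow> ((nat \<Rightarrow> 'a) \<Rightarrow> 'b) \<Rightarrow> bool" where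
  "projective_resolution R M P d e \<longleftrightarrow>
     (\<forall>n. projective_module R (P n)) \<and>
     (\<forall>n. d n \<in> module_hom R (P (Suc n)) (P n)) \<and>
     e \<in> module_hom R (P 0) M \<and>
     e ` carrier (P 0) = carrier M \<and>
     d 0 ` carrier (P 1) = a_kernel (P 0) M e \<and>
     (\<forall>n. d (Suc n) ` carrier (P (Suc (Suc n))) = a_kernel (P (Suc n)) (P n) (d n))"

definition proj_dim :: "('a, 'r) ring_scheme \<Rightarrow> ('a, 'b, 'c) module_scheme \<Rightarrow> enat" where
  "proj_dim R M =
     Inf {enat n | n. \<exists>P d e. projective_resolution R M P d e \<and>
        (\<forall>i > n. carrier (P i) = {\<zero>\<^bsub>P i\<^esub>})}"

definition hom_group :: "('a, 'r) ring_scheme \<Rightarrow> ('a, 'b, 'c) module_scheme \<Rightarrow>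
    ('a, 'd, 'e) module_scheme \<Rightarrow> ('b \<Rightarrow> 'd) monoid" where
  "hom_group R M N =
     \<lparr>carrier = module_hom R M N,
      monoid.mult = (\<lambda>f g. \<lambda>x \<in> carrier M. f x \<oplus>\<^bsub>N\<^esub> g x),
      one = (\<lambda>x \<in> carrier M. \<zero>\<^bsub>N\<^esub>)\<rparr>"

text \<open>\<open>Ext\<^sup>n(M, N)\<close> is the \<open>n\<close>-th cohomology group of the complex \<open>Hom(P 0, N) \<rightarrow> Hom(P 1, N) \<rightarrow> \<dots>\<close>.\<close>

definition ext_cocycles :: "('a, 'r) ring_scheme \<Rightarrow> (nat \<Rightarrow> 'a small_module) \<Rightarrow>
    (nat \<Rightarrow> (nat \<Rightarrow> 'a) \<Rightarrow> (nat \<Rightarrow> 'a)) \<Rightarrow> ('a, 'b, 'c) module_scheme \<Rightarrow> nat \<Rightarrow>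
    ((nat \<Rightarrow> 'a) \<Rightarrow> 'b) set" where
  "ext_cocycles R P d N n =
     {f \<in> module_hom R (P n) N. \<forall>x \<in> carrier (P (Suc n)). f (d n x) = \<zero>\<^bsub>N\<^esub>}"

fun ext_coboundaries :: "('a, 'r) ring_scheme \<Rightarrow> (nat \<Rightarrow> 'a small_module) \<Rightarrow>
    (nat \<Rightarrow> (nat \<Rightarrow> 'a) \<Rightarrow> (nat \<Rightarrow> 'a)) \<Rightarrow> ('a, 'b, 'c) module_scheme \<Rightarrow> nat \<Rightarrow>
    ((nat \<Rightarrow> 'a) \<Rightarrow> 'b) set" where
  "ext_coboundaries R P d N 0 = {\<one>\<^bsub>hom_group R (P 0) N\<^esub>}"
| "ext_coboundaries R P d N (Suc n) =
     (\<lambda>f. compose (carrier (P (Suc n))) f (d n)) ` module_hom R (P n) N"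

text \<open>
  Up to isomorphism the group below does not depend on the chosen resolution, which exists whenever
  \<open>R\<close> is right noetherian and \<open>M\<close> is finitely generated.
\<close>

definition ext_group :: "('a, 'r) ring_scheme \<Rightarrow> nat \<Rightarrow> ('a, 'b, 'c) module_scheme \<Rightarrow>
    ('a, 'd, 'e) module_scheme \<Rightarrow> ((nat \<Rightarrow> 'a) \<Rightarrow> 'd) set monoid" where
  "ext_group R n M N =
     (let (P, d, e) = (SOME (P, d, e). projective_resolution R M P d e)
      in (hom_group R (P n) N)\<lparr>carrier := ext_cocycles R P d N n\<rparr> Mod ext_coboundaries R P d N n)"

definition tilting_module ::
    "('a, 'r) ring_scheme \<Rightarrow> ('a, 'b, 'c) module_scheme \<Rightarrow> bool" where
  "tilting_module R M \<longleftrightarrow> fg_module R M \<and> basic_module R M \<and>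
     proj_dim R M \<le> 1 \<and>
     trivial_group (ext_group R 1 M M) \<and>
     num_summands R M = num_summands R (regular_module R)"


section \<open>Linear categories\<close>

text \<open>
  Objects are the elements of the type \<open>'o\<close>.  Each \<open>Hom X Y\<close> carries a vector space structure; the
  components \<^const>\<open>monoid.mult\<close> and \<^const>\<open>one\<close> of the record \<open>Hom X Y\<close> are never used.
\<close>

record ('o, 'm, 'k) lin_cat =
  Hom :: "'o \<Rightarrow> 'o \<Rightarrow> ('k, 'm) module"
  Comp :: "'m \<Rightarrow> 'm \<Rightarrow> 'm"  (infixl \<open>\<cdot>\<index>\<close> 70)
  Id :: "'o \<Rightarrow> 'm"

abbreviation arr :: "('o, 'm, 'k, 'z) lin_cat_scheme \<Rightarrow> 'o \<Rightarrow> 'o \<Rightarrow> 'm set" where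
  "arr T X Y \<equiv> carrier (Hom T X Y)"

abbreviation zero_arr :: "('o, 'm, 'k, 'z) lin_cat_scheme \<Rightarrow> 'o \<Rightarrow> 'o \<Rightarrow> 'm" where
  "zero_arr T X Y \<equiv> \<zero>\<^bsub>Hom T X Y\<^esub>"

locale linear_category =
  fixes K :: "'k ring" and T :: "('o, 'm, 'k, 'z) lin_cat_scheme" (structure)
  assumes field_K: "field K"
    and vector_space_Hom: "module K (Hom T X Y)"
    and Id_closed: "Id T X \<in> arr T X X"
    and Comp_closed: "\<lbrakk>f \<in> arr T X Y; g \<in> arr T Y Z\<rbrakk> \<Longrightarrow> g \<cdot> f \<in> arr T X Z"
    and Comp_Id: "f \<in> arr T X Y \<Longrightarrow> f \<cdot> Id T X = f"
    and Id_Comp: "f \<in> arr T X Y \<Longrightarrow> Id T Y \<cdot> f = f"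
    and Comp_assoc: "\<lbrakk>f \<in> arr T W X; g \<in> arr T X Y; h \<in> arr T Y Z\<rbrakk> \<Longrightarrow>
      (h \<cdot> g) \<cdot> f = h \<cdot> (g \<cdot> f)"
    and Comp_add_left: "\<lbrakk>f \<in> arr T X Y; g \<in> arr T Y Z; g' \<in> arr T Y Z\<rbrakk> \<Longrightarrow>
      (g \<oplus>\<^bsub>Hom T Y Z\<^esub> g') \<cdot> f = g \<cdot> f \<oplus>\<^bsub>Hom T X Z\<^esub> g' \<cdot> f"
    and Comp_add_right: "\<lbrakk>f \<in> arr T X Y; f' \<in> arr T X Y; g \<in> arr T Y Z\<rbrakk> \<Longrightarrow>
      g \<cdot> (f \<oplus>\<^bsub>Hom T X Y\<^esub> f') = g \<cdot> f \<oplus>\<^bsub>Hom T X Z\<^esub> g \<cdot> f'"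
    and Comp_smult_left: "\<lbrakk>a \<in> carrier K; f \<in> arr T X Y; g \<in> arr T Y Z\<rbrakk> \<Longrightarrow>
      (a \<odot>\<^bsub>Hom T Y Z\<^esub> g) \<cdot> f = a \<odot>\<^bsub>Hom T X Z\<^esub> (g \<cdot> f)"
    and Comp_smult_right: "\<lbrakk>a \<in> carrier K; f \<in> arr T X Y; g \<in> arr T Y Z\<rbrakk> \<Longrightarrow>
      g \<cdot> (a \<odot>\<^bsub>Hom T X Y\<^esub> f) = a \<odot>\<^bsub>Hom T X Z\<^esub> (g \<cdot> f)"

definition iso_arr :: "('o, 'm, 'k, 'z) lin_cat_scheme \<Rightarrow> 'o \<Rightarrow> 'o \<Rightarrow> 'm \<Rightarrow> bool" where
  "iso_arr T X Y f \<longleftrightarrow> f \<in> arr T X Y \<and>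
     (\<exists>g \<in> arr T Y X. g \<cdot>\<^bsub>T\<^esub> f = Id T X \<and> f \<cdot>\<^bsub>T\<^esub> g = Id T Y)"

definition is_zero :: "('o, 'm, 'k, 'z) lin_cat_scheme \<Rightarrow> 'o \<Rightarrow> bool" where
  "is_zero T X \<longleftrightarrow> Id T X = zero_arr T X X"

text \<open>\<open>X\<close> is a biproduct of the objects in the list \<open>Ys\<close>.\<close>

definition direct_sum :: "('o, 'm, 'k, 'z) lin_cat_scheme \<Rightarrow> 'o \<Rightarrow> 'o list \<Rightarrow> bool" where
  "direct_sum T X Ys \<longleftrightarrow>
     (\<exists>i p. (\<forall>a < length Ys. i a \<in> arr T (Ys ! a) X \<and> p a \<in> arr T X (Ys ! a)) \<and>
        (\<forall>a < length Ys. \<forall>b < length Ys.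
           p a \<cdot>\<^bsub>T\<^esub> i b = (if a = b then Id T (Ys ! a) else zero_arr T (Ys ! b) (Ys ! a))) \<and>
        (\<Oplus>\<^bsub>Hom T X X\<^esub> a \<in> {..<length Ys}. i a \<cdot>\<^bsub>T\<^esub> p a) = Id T X)"

definition direct_summand :: "('o, 'm, 'k, 'z) lin_cat_scheme \<Rightarrow> 'o \<Rightarrow> 'o \<Rightarrow> bool" where
  "direct_summand T Y X \<longleftrightarrow> (\<exists>Z. direct_sum T X [Y, Z])"

definition indecomposable :: "('o, 'm, 'k, 'z) lin_cat_scheme \<Rightarrow> 'o \<Rightarrow> bool" where
  "indecomposable T X \<longleftrightarrow> \<not> is_zero T X \<and>
     (\<forall>Y Z. direct_sum T X [Y, Z] \<longrightarrow> is_zero T Y \<or> is_zero T Z)"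

definition basic :: "('o, 'm, 'k, 'z) lin_cat_scheme \<Rightarrow> 'o \<Rightarrow> bool" where
  "basic T X \<longleftrightarrow> \<not> (\<exists>Y Z. indecomposable T Y \<and> direct_sum T X [Y, Y, Z])"

definition add_closure :: "('o, 'm, 'k, 'z) lin_cat_scheme \<Rightarrow> 'o \<Rightarrow> 'o set" where
  "add_closure T M = {X. \<exists>Ys. (\<forall>Y \<in> set Ys. direct_summand T Y M) \<and> direct_sum T X Ys}"

text \<open>\<open>factoring T Z X Y\<close> is the subgroup \<open>Z(X, Y)\<close> of \<open>Hom(X, Y)\<close>.\<close>

definition factoring :: "('o, 'm, 'k, 'z) lin_cat_scheme \<Rightarrow> 'o \<Rightarrow> 'o \<Rightarrow> 'o \<Rightarrow> 'm set" where
  "factoring T Z X Y =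
     {g \<cdot>\<^bsub>T\<^esub> f | f g W. W \<in> add_closure T Z \<and> f \<in> arr T X W \<and> g \<in> arr T W Y}"

definition End_ring :: "('o, 'm, 'k, 'z) lin_cat_scheme \<Rightarrow> 'o \<Rightarrow> 'm ring" where
  "End_ring T X =
     \<lparr>carrier = arr T X X, monoid.mult = Comp T, one = Id T X,
      ring.zero = zero_arr T X X, ring.add = ring.add (Hom T X X)\<rparr>"

definition Hom_module :: "('o, 'm, 'k, 'z) lin_cat_scheme \<Rightarrow> 'o \<Rightarrow> 'o \<Rightarrow> ('m, 'm) module" where
  "Hom_module T R X =
     \<lparr>carrier = arr T R X, monoid.mult = undefined, one = undefined,
      ring.zero = zero_arr T R X, ring.add = ring.add (Hom T R X),
      smult = (\<lambda>r f. f \<cdot>\<^bsub>T\<^esub> r)\<rparr>"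

definition hom_finite :: "'k ring \<Rightarrow> ('o, 'm, 'k, 'z) lin_cat_scheme \<Rightarrow> bool" where
  "hom_finite K T \<longleftrightarrow> (\<forall>X Y. finitely_generated K (Hom T X Y))"

definition local_ring :: "('a, 'r) ring_scheme \<Rightarrow> bool" where
  "local_ring A \<longleftrightarrow> ring A \<and> \<one>\<^bsub>A\<^esub> \<noteq> \<zero>\<^bsub>A\<^esub> \<and>
     (\<forall>a \<in> carrier A - Units A. \<forall>b \<in> carrier A - Units A. a \<oplus>\<^bsub>A\<^esub> b \<notin> Units A)"

definition krull_schmidt :: "('o, 'm, 'k, 'z) lin_cat_scheme \<Rightarrow> bool" where
  "krull_schmidt T \<longleftrightarrow>
     (\<forall>X. \<exists>Ys. direct_sum T X Ys \<and> (\<forall>Y \<in> set Ys. local_ring (End_ring T Y)))"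


section \<open>Triangulated categories\<close>

text \<open>
  \<open>shift\<close> and \<open>shift_arr\<close> are the object and morphism parts of the suspension functor, an
  autoequivalence (not necessarily an automorphism).  \<open>triangle X Y Z f g h\<close> means that
  \<open>X \<rightarrow> Y \<rightarrow> Z \<rightarrow> X[1]\<close> with maps \<open>f\<close>, \<open>g\<close>, \<open>h\<close> is distinguished.
\<close>

record ('o, 'm, 'k) tri_cat = "('o, 'm, 'k) lin_cat" +
  shift :: "'o \<Rightarrow> 'o"
  shift_arr :: "'o \<Rightarrow> 'o \<Rightarrow> 'm \<Rightarrow> 'm"
  triangle :: "'o \<Rightarrow> 'o \<Rightarrow> 'o \<Rightarrow> 'm \<Rightarrow> 'm \<Rightarrow> 'm \<Rightarrow> bool"

locale triangulated_category = linear_category K T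
  for K :: "'k ring" and T :: "('o, 'm, 'k, 'z) tri_cat_scheme" (structure) +
  assumes zero_object: "\<exists>X. is_zero T X"
    and biproducts: "\<exists>B. direct_sum T B [X, Y]"
    \<comment> \<open>the suspension is a linear autoequivalence\<close>
    and shift_bij: "bij_betw (shift_arr T X Y) (arr T X Y) (arr T (shift T X) (shift T Y))"
    and shift_Id: "shift_arr T X X (Id T X) = Id T (shift T X)"
    and shift_Comp: "\<lbrakk>f \<in> arr T X Y; g \<in> arr T Y Z\<rbrakk> \<Longrightarrow>
      shift_arr T X Z (g \<cdot> f) = shift_arr T Y Z g \<cdot> shift_arr T X Y f"
    and shift_add: "\<lbrakk>f \<in> arr T X Y; g \<in> arr T X Y\<rbrakk> \<Longrightarrow>
      shift_arr T X Y (f \<oplus>\<^bsub>Hom T X Y\<^esub> g) =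
        shift_arr T X Y f \<oplus>\<^bsub>Hom T (shift T X) (shift T Y)\<^esub> shift_arr T X Y g"
    and shift_smult: "\<lbrakk>s \<in> carrier K; f \<in> arr T X Y\<rbrakk> \<Longrightarrow>
      shift_arr T X Y (s \<odot>\<^bsub>Hom T X Y\<^esub> f) =
        s \<odot>\<^bsub>Hom T (shift T X) (shift T Y)\<^esub> shift_arr T X Y f"
    and shift_ess_surj: "\<exists>X f. iso_arr T (shift T X) Y f"
    \<comment> \<open>TR1\<close>
    and triangle_closed: "triangle T X Y Z f g h \<Longrightarrow>
      f \<in> arr T X Y \<and> g \<in> arr T Y Z \<and> h \<in> arr T Z (shift T X)"
    and triangle_iso: "\<lbrakk>triangle T X Y Z f g h;
        f' \<in> arr T X' Y'; g' \<in> arr T Y' Z'; h' \<in> arr T Z' (shift T X');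
        iso_arr T X X' u; iso_arr T Y Y' v; iso_arr T Z Z' w;
        v \<cdot> f = f' \<cdot> u; w \<cdot> g = g' \<cdot> v; shift_arr T X X' u \<cdot> h = h' \<cdot> w\<rbrakk> \<Longrightarrow>
      triangle T X' Y' Z' f' g' h'"
    and triangle_Id: "is_zero T Z \<Longrightarrow>
      triangle T X X Z (Id T X) (zero_arr T X Z) (zero_arr T Z (shift T X))"
    and triangle_complete: "f \<in> arr T X Y \<Longrightarrow> \<exists>Z g h. triangle T X Y Z f g h"
    \<comment> \<open>TR2\<close>
    and triangle_rotate: "\<lbrakk>f \<in> arr T X Y; g \<in> arr T Y Z; h \<in> arr T Z (shift T X)\<rbrakk> \<Longrightarrow>
      triangle T X Y Z f g h \<longleftrightarrow>
      triangle T Y Z (shift T X) g h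
        (\<ominus>\<^bsub>Hom T (shift T X) (shift T Y)\<^esub> shift_arr T X Y f)"
    \<comment> \<open>TR3\<close>
    and triangle_fill: "\<lbrakk>triangle T X Y Z f g h; triangle T X' Y' Z' f' g' h';
        u \<in> arr T X X'; v \<in> arr T Y Y'; v \<cdot> f = f' \<cdot> u\<rbrakk> \<Longrightarrow>
      \<exists>w \<in> arr T Z Z'. w \<cdot> g = g' \<cdot> v \<and> shift_arr T X X' u \<cdot> h = h' \<cdot> w"
    \<comment> \<open>TR4\<close>
    and octahedron: "\<lbrakk>triangle T X Y A f a a'; triangle T Y Z B g b b';
        triangle T X Z C (g \<cdot> f) c c'\<rbrakk> \<Longrightarrow>
      \<exists>u v. triangle T A C B u v (shift_arr T Y A a \<cdot> b') \<and>
        u \<cdot> a = c \<cdot> g \<and> c' \<cdot> u = a' \<and> v \<cdot> c = b \<and> b' \<cdot> v = shift_arr T X Y f \<cdot> c'"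

definition rigid :: "('o, 'm, 'k, 'z) tri_cat_scheme \<Rightarrow> 'o \<Rightarrow> bool" where
  "rigid T X \<longleftrightarrow> arr T X (shift T X) = {zero_arr T X (shift T X)}"

definition pr :: "('o, 'm, 'k, 'z) tri_cat_scheme \<Rightarrow> 'o \<Rightarrow> 'o set" where
  "pr T R = {X. \<exists>R1 R0 f g h. R1 \<in> add_closure T R \<and> R0 \<in> add_closure T R \<and>
     triangle T R1 R0 X f g h}"

definition shift_rigid :: "('o, 'm, 'k, 'z) tri_cat_scheme \<Rightarrow> 'o \<Rightarrow> 'o \<Rightarrow> bool" where
  "shift_rigid T R X \<longleftrightarrow>
     factoring T (shift T R) X (shift T X) = {zero_arr T X (shift T X)}"

text \<open>\<open>B\<close> and \<open>B'\<close> are \<open>X \<oplus> Z\<close> and \<open>X[1] \<oplus> Z[1]\<close>, which are determined up to isomorphism.\<close>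

definition maximal_shift_rigid ::
    "('o, 'm, 'k, 'z) tri_cat_scheme \<Rightarrow> 'o \<Rightarrow> 'o \<Rightarrow> bool" where
  "maximal_shift_rigid T R X \<longleftrightarrow> X \<in> pr T R \<and> shift_rigid T R X \<and>
     (\<forall>Z \<in> pr T R. \<forall>B B'.
        direct_sum T B [X, Z] \<and> direct_sum T B' [shift T X, shift T Z] \<and>
        factoring T (shift T R) B B' = {zero_arr T B B'} \<longrightarrow> Z \<in> add_closure T X)"

definition no_shift_summand :: "('o, 'm, 'k, 'z) tri_cat_scheme \<Rightarrow> 'o \<Rightarrow> 'o \<Rightarrow> bool" where
  "no_shift_summand T R X \<longleftrightarrow>
     (\<forall>Y. direct_summand T Y X \<and> Y \<in> add_closure T (shift T R) \<longrightarrow> is_zero T Y)"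

end

theory Submission
  imports Defs
begin

text \<open>
  Let \<open>R1 \<rightarrow> R0 \<rightarrow> X \<rightarrow> R1[1]\<close>, with maps \<open>f\<close>, \<open>g\<close>, \<open>h\<close>, be a triangle as in the definition of \<open>pr(R)\<close>.
  As \<open>R\<close> is rigid, \<open>Hom(R, -)\<close> turns it into a projective presentation of \<open>Hom(R, X)\<close>, and the first
  part of the theorem is about the injectivity of \<open>Hom(R, f)\<close>.

  \<^item> By exactness, a map \<open>u : R \<rightarrow> R1\<close> satisfies \<open>f \<cdot> u = 0\<close> if and only if \<open>u[1]\<close> lifts along \<open>h\<close> to a map
    \<open>R[1] \<rightarrow> X\<close>, and by rigidity every map \<open>X \<rightarrow> R[1]\<close> factors through \<open>h\<close>.  So \<open>X(R[1], R[1]) = 0\<close> if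
    and only if \<open>Hom(R, f)\<close> is injective (\<open>factoring_iff_mono\<close>).
  \<^item> If \<open>Hom(R, f)\<close> is injective, the presentation is a resolution of length one.  Conversely, the
    comparison of the presentation with a resolution of length one produces an idempotent
    endomorphism of \<open>R1\<close> that is killed by \<open>f\<close> and is the identity on everything that \<open>f\<close> kills.  Its
    image, shifted, is a summand of \<open>X\<close> in \<open>add(R[1])\<close> and therefore zero (\<open>proj_dim_mono\<close>).

  For the second part, suppose that \<open>Hom(R, f)\<close> is injective.

  \<^item> The group \<open>Ext\<^sup>1\<close> of \<open>Hom(R, X)\<close> with itself vanishes if and only if every morphism \<open>R1 \<rightarrow> X\<close> factors
    through \<open>f\<close>, that is, if and only if \<open>R[1](X, X[1]) = 0\<close> (\<open>trivial_ext_shift_rigid\<close>).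
  \<^item> On \<open>pr(R)\<close> the functor \<open>Hom(R, -)\<close> is full.  On indecomposable objects outside \<open>add(R[1])\<close> it
    preserves locality of endomorphism rings and reflects isomorphisms, so it identifies the
    indecomposable summands of \<open>X\<close> with those of \<open>Hom(R, X)\<close>.  Hence \<open>|Hom(R, X)| = |X|\<close> and
    \<open>|\<Gamma>| = |R|\<close> (\<open>num_summands_eq\<close>), and \<open>Hom(R, X)\<close> is basic with \<open>X\<close> (\<open>basic_module_Hom\<close>).
  \<^item> It remains to see that an \<open>R[1]\<close>-rigid object \<open>X\<close> of \<open>pr(R)\<close> is maximal if and only if \<open>|X| = |R|\<close>
    (\<open>maximal_iff_count\<close>).  An approximation \<open>X0 \<rightarrow> R[1]\<close> by \<open>add X\<close> has a cocone \<open>E\<close> in \<open>pr(R)\<close> such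
    that \<open>X \<oplus> E\<close> is \<open>R[1]\<close>-rigid (\<open>bongartz\<close>), so the claim follows from the count \<open>silting_count\<close>: if \<open>S\<close>
    is an \<open>R[1]\<close>-rigid object of \<open>pr(R)\<close> and \<open>R \<rightarrow> S0 \<rightarrow> S1 \<rightarrow> R[1]\<close> is a triangle with \<open>S0\<close> and \<open>S1\<close> in
    \<open>add S\<close>, then \<open>|S| = |R|\<close>.

  The last count needs no linear algebra.  The indices of the summands of \<open>S\<close> with respect to \<open>R\<close> and of
  the summands of \<open>R[1]\<close> with respect to \<open>S\<close> are well defined by a Schanuel argument on homotopy
  pullbacks.  They form two integer matrices such that both of their products, up to sign, have ones on
  the diagonal.  The common trace of the products is \<open>|R|\<close> on one side and \<open>|S|\<close> on the other.

  The Krull--Schmidt theorem is used for the objects of the triangulated category and for the modules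
  \<open>Hom(R, X)\<close>.  It is proved once, by an exchange argument for objects with local endomorphism rings.
\<close>

section \<open>Idempotents and the exchange property in preadditive categories\<close>

text \<open>
  The arrows between all objects live in one type, and the operations on them are total.  Equations
  between composites can then be rewritten by the simplifier, with side conditions that only compare
  sources and targets.  Biproducts and a zero object come later, since the modules \<open>Hom(R, X)\<close> are
  also treated as objects of such a category, without closing them under direct sums.
\<close>

locale preadditive =
  fixes arw :: "'a \<Rightarrow> bool" and src tgt :: "'a \<Rightarrow> 'o"
    and cmp :: "'a \<Rightarrow> 'a \<Rightarrow> 'a" (infixr \<open>\<bullet>\<close> 75)
    and pls :: "'a \<Rightarrow> 'a \<Rightarrow> 'a" (infixl \<open>\<^bold>+\<close> 65)
    and ng :: "'a \<Rightarrow> 'a" and zr :: "'o \<Rightarrow> 'o \<Rightarrow> 'a" and idt :: "'o \<Rightarrow> 'a"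
  assumes arw_cmp [simp]: "\<lbrakk>arw g; arw f; src g = tgt f\<rbrakk> \<Longrightarrow> arw (g \<bullet> f)"
    and src_cmp [simp]: "src (g \<bullet> f) = src f"
    and tgt_cmp [simp]: "tgt (g \<bullet> f) = tgt g"
    and arw_pls [simp]: "\<lbrakk>arw f; arw g; src f = src g; tgt f = tgt g\<rbrakk> \<Longrightarrow> arw (f \<^bold>+ g)"
    and src_pls [simp]: "src (f \<^bold>+ g) = src f"
    and tgt_pls [simp]: "tgt (f \<^bold>+ g) = tgt f"
    and arw_ng [simp]: "arw f \<Longrightarrow> arw (ng f)"
    and src_ng [simp]: "src (ng f) = src f"
    and tgt_ng [simp]: "tgt (ng f) = tgt f"
    and arw_zr [simp]: "arw (zr X Y)"
    and src_zr [simp]: "src (zr X Y) = X"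
    and tgt_zr [simp]: "tgt (zr X Y) = Y"
    and arw_idt [simp]: "arw (idt X)"
    and src_idt [simp]: "src (idt X) = X"
    and tgt_idt [simp]: "tgt (idt X) = X"
    and cmp_assoc [simp]: "\<lbrakk>arw h; arw g; arw f; src h = tgt g; src g = tgt f\<rbrakk> \<Longrightarrow>
      (h \<bullet> g) \<bullet> f = h \<bullet> (g \<bullet> f)"
    and cmp_idt [simp]: "\<lbrakk>arw f; src f = X\<rbrakk> \<Longrightarrow> f \<bullet> idt X = f"
    and idt_cmp [simp]: "\<lbrakk>arw f; tgt f = X\<rbrakk> \<Longrightarrow> idt X \<bullet> f = f"
    and cmp_pls_left: "\<lbrakk>arw g; arw g'; arw f; src g = src g'; tgt g = tgt g'; src g = tgt f\<rbrakk> \<Longrightarrow>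
      (g \<^bold>+ g') \<bullet> f = g \<bullet> f \<^bold>+ g' \<bullet> f"
    and cmp_pls_right: "\<lbrakk>arw g; arw f; arw f'; src f = src f'; tgt f = tgt f'; src g = tgt f\<rbrakk> \<Longrightarrow>
      g \<bullet> (f \<^bold>+ f') = g \<bullet> f \<^bold>+ g \<bullet> f'"
    and pls_assoc: "\<lbrakk>arw f; arw g; arw h; src f = src g; src g = src h; tgt f = tgt g; tgt g = tgt h\<rbrakk>
      \<Longrightarrow> (f \<^bold>+ g) \<^bold>+ h = f \<^bold>+ (g \<^bold>+ h)"
    and pls_commute: "\<lbrakk>arw f; arw g; src f = src g; tgt f = tgt g\<rbrakk> \<Longrightarrow> f \<^bold>+ g = g \<^bold>+ f"
    and pls_zr [simp]: "\<lbrakk>arw f; src f = X; tgt f = Y\<rbrakk> \<Longrightarrow> f \<^bold>+ zr X Y = f"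
    and pls_ng: "arw f \<Longrightarrow> f \<^bold>+ ng f = zr (src f) (tgt f)"
begin

definition hm :: "'o \<Rightarrow> 'o \<Rightarrow> 'a set" where
  "hm X Y = {f. arw f \<and> src f = X \<and> tgt f = Y}"

lemma hm_iff [simp]: "f \<in> hm X Y \<longleftrightarrow> arw f \<and> src f = X \<and> tgt f = Y"
  by (simp add: hm_def)

definition mns (infixl \<open>\<^bold>-\<close> 65) where "f \<^bold>- g = f \<^bold>+ ng g"

lemma arw_mns [simp]: "\<lbrakk>arw f; arw g; src f = src g; tgt f = tgt g\<rbrakk> \<Longrightarrow> arw (f \<^bold>- g)"
  and src_mns [simp]: "src (f \<^bold>- g) = src f"
  and tgt_mns [simp]: "tgt (f \<^bold>- g) = tgt f"
  by (simp_all add: mns_def)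

lemma zr_pls [simp]: "\<lbrakk>arw f; src f = X; tgt f = Y\<rbrakk> \<Longrightarrow> zr X Y \<^bold>+ f = f"
  using pls_commute[of f "zr X Y"] by simp

lemma pls_left_commute: "\<lbrakk>arw f; arw g; arw h; src f = src g; src g = src h; tgt f = tgt g; tgt g = tgt h\<rbrakk>
      \<Longrightarrow> f \<^bold>+ (g \<^bold>+ h) = g \<^bold>+ (f \<^bold>+ h)"
  using pls_assoc[of f g h] pls_assoc[of g f h] pls_commute[of f g] by simp

lemma pls_left_cancel:
  assumes "arw f" "arw g" "arw h" "src f = src g" "src g = src h" "tgt f = tgt g" "tgt g = tgt h"
  shows "f \<^bold>+ g = f \<^bold>+ h \<longleftrightarrow> g = h"
proof
  assume "f \<^bold>+ g = f \<^bold>+ h"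
  then have "ng f \<^bold>+ (f \<^bold>+ g) = ng f \<^bold>+ (f \<^bold>+ h)" by simp
  moreover have "ng f \<^bold>+ f = zr (src f) (tgt f)" using pls_ng[of f] pls_commute[of f "ng f"] assms by simp
  ultimately show "g = h" using assms by (simp flip: pls_assoc)
qed simp

lemma pls_right_cancel:
  assumes "arw f" "arw g" "arw h" "src f = src g" "src g = src h" "tgt f = tgt g" "tgt g = tgt h"
  shows "g \<^bold>+ f = h \<^bold>+ f \<longleftrightarrow> g = h"
  using pls_left_cancel[OF assms] pls_commute[of f g] pls_commute[of f h] assms by simp

lemma mns_self [simp]: "arw f \<Longrightarrow> f \<^bold>- f = zr (src f) (tgt f)"
  by (simp add: mns_def pls_ng)

lemma mns_eq_iff:
  assumes "arw f" "arw g" "arw h" "src f = src g" "src g = src h" "tgt f = tgt g" "tgt g = tgt h"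
  shows "f \<^bold>- g = h \<longleftrightarrow> f = h \<^bold>+ g"
proof -
  have "f \<^bold>- g = h \<longleftrightarrow> (f \<^bold>- g) \<^bold>+ g = h \<^bold>+ g"
    using assms by (subst pls_right_cancel) auto
  also have "(f \<^bold>- g) \<^bold>+ g = f \<^bold>+ (g \<^bold>+ ng g)"
    using assms pls_commute[of g "ng g"] by (simp add: mns_def pls_assoc)
  also have "\<dots> = f" using assms by (simp add: pls_ng)
  finally show ?thesis .
qed

lemma eq_mns_iff:
  assumes "arw f" "arw g" "arw h" "src f = src g" "src g = src h" "tgt f = tgt g" "tgt g = tgt h"
  shows "h = f \<^bold>- g \<longleftrightarrow> h \<^bold>+ g = f"
  using mns_eq_iff[OF assms] by auto

lemma pls_mns_assoc:
  assumes "arw f" "arw g" "arw h" "src f = src g" "src g = src h" "tgt f = tgt g" "tgt g = tgt h"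
  shows "f \<^bold>+ (g \<^bold>- h) = (f \<^bold>+ g) \<^bold>- h"
  using assms by (simp add: mns_def pls_assoc)

lemma mns_pls:
  assumes "arw f" "arw g" "arw h" "src f = src g" "src g = src h" "tgt f = tgt g" "tgt g = tgt h"
  shows "(f \<^bold>- g) \<^bold>+ h = (f \<^bold>+ h) \<^bold>- g"
  using assms pls_commute[of "ng g" h] by (simp add: mns_def pls_assoc)

lemma cmp_zr [simp]:
  assumes "arw g" "src g = Y"
  shows "g \<bullet> zr X Y = zr X (tgt g)"
proof -
  have "g \<bullet> zr X Y \<^bold>+ g \<bullet> zr X Y = g \<bullet> (zr X Y \<^bold>+ zr X Y)"
    using assms by (subst cmp_pls_right) auto
  then have "g \<bullet> zr X Y \<^bold>+ g \<bullet> zr X Y = g \<bullet> zr X Y \<^bold>+ zr X (tgt g)"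
    using assms by simp
  moreover have "arw (g \<bullet> zr X Y)" using assms by simp
  ultimately show ?thesis using pls_left_cancel[of "g \<bullet> zr X Y" "g \<bullet> zr X Y" "zr X (tgt g)"] by simp
qed

lemma zr_cmp [simp]:
  assumes "arw g" "tgt g = X"
  shows "zr X Y \<bullet> g = zr (src g) Y"
proof -
  have "zr X Y \<bullet> g \<^bold>+ zr X Y \<bullet> g = (zr X Y \<^bold>+ zr X Y) \<bullet> g"
    using assms by (subst cmp_pls_left) auto
  then have "zr X Y \<bullet> g \<^bold>+ zr X Y \<bullet> g = zr X Y \<bullet> g \<^bold>+ zr (src g) Y"
    using assms by simp
  moreover have "arw (zr X Y \<bullet> g)" using assms by simp
  ultimately show ?thesis using pls_left_cancel[of "zr X Y \<bullet> g" "zr X Y \<bullet> g" "zr (src g) Y"] by simp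
qed

lemma ng_unique:
  assumes "arw f" "arw g" "src f = src g" "tgt f = tgt g" "f \<^bold>+ g = zr (src f) (tgt f)"
  shows "g = ng f"
proof -
  have "f \<^bold>+ g = f \<^bold>+ ng f" unfolding pls_ng[OF assms(1)] by (rule assms(5))
  then show ?thesis using assms(1-4) pls_left_cancel[of f g "ng f"] by simp
qed

lemma ng_zr [simp]: "ng (zr X Y) = zr X Y"
  using ng_unique[of "zr X Y" "zr X Y"] by simp

lemma ng_ng [simp]: "arw f \<Longrightarrow> ng (ng f) = f"
  using ng_unique[of "ng f" f] pls_ng[of f] pls_commute[of f "ng f"] by simp

lemma cmp_ng [simp]:
  assumes "arw g" "arw f" "src g = tgt f"
  shows "g \<bullet> ng f = ng (g \<bullet> f)"
proof (rule ng_unique)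
  show "g \<bullet> f \<^bold>+ g \<bullet> ng f = zr (src (g \<bullet> f)) (tgt (g \<bullet> f))"
    using assms cmp_pls_right[of g f "ng f"] by (simp add: pls_ng)
qed (use assms in auto)

lemma ng_cmp [simp]:
  assumes "arw g" "arw f" "src g = tgt f"
  shows "ng g \<bullet> f = ng (g \<bullet> f)"
proof (rule ng_unique)
  show "g \<bullet> f \<^bold>+ ng g \<bullet> f = zr (src (g \<bullet> f)) (tgt (g \<bullet> f))"
    using assms cmp_pls_left[of g "ng g" f] by (simp add: pls_ng)
qed (use assms in auto)

lemma ng_eq_zr [simp]: "arw f \<Longrightarrow> ng f = zr X Y \<longleftrightarrow> f = zr X Y"
  using ng_ng ng_zr by metis

lemma mns_zr [simp]: "\<lbrakk>arw f; src f = X; tgt f = Y\<rbrakk> \<Longrightarrow> f \<^bold>- zr X Y = f"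
  by (simp add: mns_def)

lemma zr_mns [simp]: "\<lbrakk>arw f; src f = X; tgt f = Y\<rbrakk> \<Longrightarrow> zr X Y \<^bold>- f = ng f"
  by (simp add: mns_def)

lemma ng_pls:
  assumes "arw f" "arw g" "src f = src g" "tgt f = tgt g"
  shows "ng (f \<^bold>+ g) = ng f \<^bold>+ ng g"
proof (rule ng_unique[symmetric])
  have "(f \<^bold>+ g) \<^bold>+ (ng f \<^bold>+ ng g) = (f \<^bold>+ ng f) \<^bold>+ (g \<^bold>+ ng g)"
    using assms pls_left_commute[of g "ng f" "ng g"] by (simp add: pls_assoc)
  then show "(f \<^bold>+ g) \<^bold>+ (ng f \<^bold>+ ng g) = zr (src (f \<^bold>+ g)) (tgt (f \<^bold>+ g))"
    using assms by (simp add: pls_ng)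
qed (use assms in auto)

lemma mns_mns:
  assumes "arw f" "arw g" "arw h" "src f = src g" "src g = src h" "tgt f = tgt g" "tgt g = tgt h"
  shows "(f \<^bold>- g) \<^bold>- h = f \<^bold>- (g \<^bold>+ h)"
  using assms by (simp add: mns_def ng_pls pls_assoc)

lemma mns_mns2:
  assumes "arw f" "arw g" "arw h" "src f = src g" "src g = src h" "tgt f = tgt g" "tgt g = tgt h"
  shows "f \<^bold>- (g \<^bold>- h) = (f \<^bold>+ h) \<^bold>- g"
  using assms pls_commute[of h "ng g"] by (simp add: mns_def ng_pls pls_assoc)

lemma cmp_mns_right: "\<lbrakk>arw g; arw f; arw f'; src f = src f'; tgt f = tgt f'; src g = tgt f\<rbrakk> \<Longrightarrow>
      g \<bullet> (f \<^bold>- f') = g \<bullet> f \<^bold>- g \<bullet> f'"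
  by (simp add: mns_def cmp_pls_right)

lemma cmp_mns_left: "\<lbrakk>arw g; arw g'; arw f; src g = src g'; tgt g = tgt g'; src g = tgt f\<rbrakk> \<Longrightarrow>
      (g \<^bold>- g') \<bullet> f = g \<bullet> f \<^bold>- g' \<bullet> f"
  by (simp add: mns_def cmp_pls_left)

lemma mns_eq_zr: "\<lbrakk>arw f; arw g; src f = src g; tgt f = tgt g; src f = X; tgt f = Y\<rbrakk> \<Longrightarrow> f \<^bold>- g = zr X Y \<longleftrightarrow> f = g"
  by (simp add: mns_eq_iff)

lemma mns_pls_cancel: "\<lbrakk>arw f; arw g; src f = src g; tgt f = tgt g\<rbrakk> \<Longrightarrow> (f \<^bold>- g) \<^bold>+ g = f"
  by (simp add: mns_pls mns_eq_iff)

lemma mns_mns_cancel: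
  assumes "arw f" "arw g" "arw h" "src f = src g" "src g = src h" "tgt f = tgt g" "tgt g = tgt h"
  shows "(f \<^bold>- h) \<^bold>- (g \<^bold>- h) = f \<^bold>- g"
  using assms by (subst mns_mns2) (simp_all add: mns_pls_cancel)

text \<open>Expands composites over sums and moves all subtractions outwards, as the library rules for rings do.\<close>

lemmas lin_simps = cmp_pls_left cmp_pls_right cmp_mns_left cmp_mns_right
  pls_assoc pls_commute pls_left_commute pls_mns_assoc mns_pls mns_mns mns_mns2 mns_eq_iff eq_mns_iff
  pls_left_cancel pls_right_cancel

text \<open>Makes an equation between composites usable inside longer, right-bracketed composites.\<close>

lemma cmp_reassoc: "\<lbrakk>a \<bullet> b = c; arw a; arw b; src a = tgt b; arw x; tgt x = src b\<rbrakk> \<Longrightarrow> a \<bullet> (b \<bullet> x) = c \<bullet> x"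
  using cmp_assoc[of a b x] by simp

subsection \<open>Isomorphisms\<close>

definition inv_arws :: "'a \<Rightarrow> 'a \<Rightarrow> bool" where
  "inv_arws f g \<longleftrightarrow> arw f \<and> arw g \<and> src g = tgt f \<and> tgt g = src f \<and> g \<bullet> f = idt (src f) \<and> f \<bullet> g = idt (src g)"

definition iso_arw :: "'a \<Rightarrow> bool" where
  "iso_arw f \<longleftrightarrow> (\<exists>g. inv_arws f g)"

definition isom :: "'o \<Rightarrow> 'o \<Rightarrow> bool" where
  "isom X Y \<longleftrightarrow> (\<exists>f. iso_arw f \<and> src f = X \<and> tgt f = Y)"

lemma isom_refl: "isom X X"
  unfolding isom_def iso_arw_def inv_arws_def by (rule exI[of _ "idt X"], simp, rule exI[of _ "idt X"], simp)

lemma isom_sym: "isom X Y \<Longrightarrow> isom Y X"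
  unfolding isom_def iso_arw_def inv_arws_def by metis

lemma inv_arws_sym: "inv_arws f g \<Longrightarrow> inv_arws g f"
  unfolding inv_arws_def by auto

lemma inv_arws_hm:
  "inv_arws f g \<longleftrightarrow> (\<exists>X Y. f \<in> hm X Y \<and> g \<in> hm Y X \<and> g \<bullet> f = idt X \<and> f \<bullet> g = idt Y)"
  unfolding inv_arws_def by auto

lemma inv_arws_cmp:
  assumes "inv_arws f f'" "inv_arws g g'" "src g = tgt f"
  shows "inv_arws (g \<bullet> f) (f' \<bullet> g')"
proof -
  from assms obtain X Y Z where h: "f \<in> hm X Y" "f' \<in> hm Y X" "g \<in> hm Y Z" "g' \<in> hm Z Y"
    and e: "f' \<bullet> f = idt X" "f \<bullet> f' = idt Y" "g' \<bullet> g = idt Y" "g \<bullet> g' = idt Z"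
    unfolding inv_arws_hm by auto
  have *: "g' \<bullet> (g \<bullet> f) = f" "f \<bullet> (f' \<bullet> g') = g'"
    using h cmp_reassoc[OF e(3), of f] cmp_reassoc[OF e(2), of g'] by simp_all
  show ?thesis
    unfolding inv_arws_hm using h e by (intro exI[of _ X] exI[of _ Z]) (simp add: *)
qed

lemma iso_arw_cmp: "\<lbrakk>iso_arw f; iso_arw g; src g = tgt f\<rbrakk> \<Longrightarrow> iso_arw (g \<bullet> f)"
  unfolding iso_arw_def using inv_arws_cmp by blast

lemma isom_trans: "\<lbrakk>isom X Y; isom Y Z\<rbrakk> \<Longrightarrow> isom X Z"
  unfolding isom_def using iso_arw_cmp src_cmp tgt_cmp by metis

lemma isomI: "\<lbrakk>f \<in> hm X Y; g \<in> hm Y X; g \<bullet> f = idt X; f \<bullet> g = idt Y\<rbrakk> \<Longrightarrow> isom X Y"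
  unfolding isom_def iso_arw_def inv_arws_def by (rule exI[of _ f], simp, rule exI[of _ g], simp)

lemma isomE:
  assumes "isom X Y"
  obtains f g where "f \<in> hm X Y" "g \<in> hm Y X" "g \<bullet> f = idt X" "f \<bullet> g = idt Y"
  using assms unfolding isom_def iso_arw_def inv_arws_def by auto

text \<open>The endomorphism ring of \<open>X\<close> is local, in the form in which locality is used.\<close>

definition loc :: "'o \<Rightarrow> bool" where
  "loc X \<longleftrightarrow> idt X \<noteq> zr X X \<and> (\<forall>f \<in> hm X X. iso_arw f \<or> iso_arw (idt X \<^bold>- f))"

lemma iso_endoE:
  assumes "iso_arw u" "src u = X" "tgt u = X"
  obtains v where "v \<in> hm X X" "u \<bullet> v = idt X" "v \<bullet> u = idt X"
  using assms unfolding iso_arw_def inv_arws_def by auto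

text \<open>
  If \<open>f\<close> is invertible, cancel it in \<open>f \<bullet> f = f\<close>; otherwise cancel \<open>1 - f\<close> in \<open>(1 - f) \<bullet> f = 0\<close>.
\<close>

lemma loc_idem:
  assumes "loc X" "f \<in> hm X X" "f \<bullet> f = f"
  shows "f = zr X X \<or> f = idt X"
proof -
  have X: "idt X \<noteq> zr X X" and "iso_arw f \<or> iso_arw (idt X \<^bold>- f)"
    using assms unfolding loc_def by auto
  then consider "iso_arw f" | "iso_arw (idt X \<^bold>- f)" by blast
  then show ?thesis
  proof cases
    case 1
    then obtain v where v: "v \<in> hm X X" "f \<bullet> v = idt X" "v \<bullet> f = idt X"
      using assms by (auto elim: iso_endoE)
    have "v \<bullet> (f \<bullet> f) = f" using cmp_reassoc[OF v(3)] v assms(2) by simp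
    then show ?thesis using assms(3) v by simp
  next
    case 2
    then obtain v where v: "v \<in> hm X X" "(idt X \<^bold>- f) \<bullet> v = idt X" "v \<bullet> (idt X \<^bold>- f) = idt X"
      using assms(2) by (auto elim: iso_endoE)
    have "(v \<bullet> (idt X \<^bold>- f)) \<bullet> f = v \<bullet> ((idt X \<^bold>- f) \<bullet> f)"
      using v(1) assms(2) by simp
    also have "(idt X \<^bold>- f) \<bullet> f = zr X X" using assms by (simp add: cmp_mns_left)
    finally show ?thesis using v assms(2) by simp
  qed
qed

subsection \<open>Decompositions of idempotents\<close>

text \<open>
  The idempotent \<open>e\<close> of \<open>X\<close> is a sum of orthogonal idempotents \<open>i \<bullet> p\<close> whose images are the objects
  \<open>Ys\<close>.  For \<open>e = idt X\<close> this is a direct sum decomposition of \<open>X\<close>; other idempotents occur because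
  idempotents need not split in this generality.
\<close>

inductive dec :: "'o \<Rightarrow> 'a \<Rightarrow> 'o list \<Rightarrow> bool" for X where
  dec_Nil: "dec X (zr X X) []"
| dec_Cons: "\<lbrakk>dec X c Ys; i \<in> hm Y X; p \<in> hm X Y; p \<bullet> i = idt Y; p \<bullet> c = zr X Y; c \<bullet> i = zr Y X\<rbrakk> \<Longrightarrow>
    dec X (i \<bullet> p \<^bold>+ c) (Y # Ys)"

lemma dec_idem: "dec X c Ys \<Longrightarrow> c \<in> hm X X \<and> c \<bullet> c = c"
proof (induction rule: dec.induct)
  case (dec_Cons c Ys i Y p)
  note r = dec_Cons.hyps(2-6) dec_Cons.IH
  show ?case using r cmp_reassoc[of p i "idt Y" p] cmp_reassoc[of c i "zr Y X" p] by (simp add: lin_simps)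
qed simp

text \<open>
  The composite \<open>om \<bullet> th\<close> is the identity on the image of \<open>k\<close>, so it drops out between two maps that
  factor through that image.
\<close>

lemma absorb_middle:
  assumes "k \<in> hm X X" "th \<in> hm X X'" "om \<in> hm X' X" "k \<bullet> (om \<bullet> (th \<bullet> k)) = k"
    and "arw a" "arw b" "src a = X" "tgt b = X" and a: "a \<bullet> k = a" and b: "k \<bullet> b = b"
  shows "a \<bullet> (om \<bullet> (th \<bullet> b)) = a \<bullet> b"
proof -
  have "a \<bullet> (om \<bullet> (th \<bullet> b)) = (a \<bullet> k) \<bullet> (om \<bullet> (th \<bullet> (k \<bullet> b)))" unfolding a b ..
  also have "\<dots> = a \<bullet> ((k \<bullet> (om \<bullet> (th \<bullet> k))) \<bullet> b)" using assms(1-3,5-8) by simp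
  also have "\<dots> = a \<bullet> b" unfolding assms(4) b ..
  finally show ?thesis .
qed

text \<open>
  On the image of \<open>c\<close> the map \<open>om\<close> inverts \<open>th\<close>, so composing the inclusions with \<open>th\<close> and the
  projections with \<open>om\<close> preserves all relations between them.
\<close>

lemma dec_transport:
  assumes "dec X c Ys" "th \<in> hm X X'" "om \<in> hm X' X" "c \<bullet> (om \<bullet> (th \<bullet> c)) = c"
  shows "dec X' (th \<bullet> (c \<bullet> om)) Ys"
  using assms
proof (induction rule: dec.induct)
  case dec_Nil
  then show ?case using dec.dec_Nil[of X'] by simp
next
  case (dec_Cons c Ys i Y p)
  let ?k = "i \<bullet> p \<^bold>+ c"
  have c: "c \<in> hm X X" "c \<bullet> c = c" using dec_idem dec_Cons.hyps by blast+
  note f = dec_Cons.hyps(2-6) dec_Cons.prems(1,2) c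
  note r = cmp_reassoc[OF f(3)] cmp_reassoc[OF f(4)] cmp_reassoc[OF f(5)] cmp_reassoc[OF f(9)]
  have ck: "c \<bullet> ?k = c" "?k \<bullet> c = c" "p \<bullet> ?k = p" "?k \<bullet> i = i"
    using f by (simp_all add: lin_simps r)
  have k: "?k \<bullet> (om \<bullet> (th \<bullet> ?k)) = ?k" by fact
  have hk: "?k \<in> hm X X" using f by simp
  note rk = cmp_reassoc[OF ck(1)] cmp_reassoc[OF ck(2)] cmp_reassoc[OF ck(3)] cmp_reassoc[OF ck(4)]
  have gen: "a \<bullet> (om \<bullet> (th \<bullet> b)) = a \<bullet> b" if "arw a" "arw b" "src a = X" "tgt b = X" "a \<bullet> ?k = a" "?k \<bullet> b = b" for a b
    by (rule absorb_middle[OF hk f(6,7) k]) (use that in auto)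
  have 1: "dec X' (th \<bullet> (c \<bullet> om)) Ys"
    using dec_Cons.IH f gen[of c c] ck by simp
  have "dec X' ((th \<bullet> i) \<bullet> (p \<bullet> om) \<^bold>+ (th \<bullet> (c \<bullet> om))) (Y # Ys)"
  proof (rule dec.dec_Cons[OF 1])
    show "(p \<bullet> om) \<bullet> (th \<bullet> i) = idt Y" using f gen[of p i] ck by simp
    have "(p \<bullet> om) \<bullet> (th \<bullet> (c \<bullet> om)) = (p \<bullet> (om \<bullet> (th \<bullet> c))) \<bullet> om" using f by simp
    also have "p \<bullet> (om \<bullet> (th \<bullet> c)) = zr X Y" using f gen[of p c] ck by simp
    finally show "(p \<bullet> om) \<bullet> th \<bullet> c \<bullet> om = zr X' Y" using f by simp
    have "(th \<bullet> (c \<bullet> om)) \<bullet> (th \<bullet> i) = th \<bullet> (c \<bullet> (om \<bullet> (th \<bullet> i)))" using f by simp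
    also have "c \<bullet> (om \<bullet> (th \<bullet> i)) = zr Y X" using f gen[of c i] ck by simp
    finally show "(th \<bullet> c \<bullet> om) \<bullet> th \<bullet> i = zr Y X'" using f by simp
  qed (use f in auto)
  then show ?case using f by (simp add: lin_simps)
qed

lemma dec_split:
  assumes "dec X c (Y # Ys)"
  obtains i p c' where "dec X c' Ys" "i \<in> hm Y X" "p \<in> hm X Y" "p \<bullet> i = idt Y" "p \<bullet> c' = zr X Y" "c' \<bullet> i = zr Y X"
    "c = i \<bullet> p \<^bold>+ c'"
  using assms by (cases rule: dec.cases) auto

text \<open>
  As \<open>p \<bullet> (e \<bullet> i)\<close> has an inverse \<open>v\<close>, the maps \<open>j = e \<bullet> i\<close> and \<open>q = v \<bullet> (p \<bullet> e)\<close> exhibit \<open>Y\<close> as a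
  summand of the image of \<open>e\<close>.  The other summands, which made up the complement of \<open>i \<bullet> p\<close>, are carried
  into the complement of \<open>j \<bullet> q\<close> by \<open>1 - j \<bullet> q\<close>, with \<open>1 - j \<bullet> (v \<bullet> p)\<close> going back.
\<close>

lemma exchange_step:
  assumes d: "dec X c Ys" and i: "i \<in> hm Y X" and p: "p \<in> hm X Y" and pi: "p \<bullet> i = idt Y" and pc: "p \<bullet> c = zr X Y" and ci: "c \<bullet> i = zr Y X"
    and e: "e \<in> hm X X" "e \<bullet> e = e" and ek: "e \<bullet> (i \<bullet> p \<^bold>+ c) = e" and ke: "(i \<bullet> p \<^bold>+ c) \<bullet> e = e"
    and u: "iso_arw (p \<bullet> (e \<bullet> i))"
  obtains j q where "j \<in> hm Y X" "q \<in> hm X Y" "q \<bullet> j = idt Y" "e \<bullet> j = j" "q \<bullet> e = q"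
    "dec X ((i \<bullet> p \<^bold>+ c) \<^bold>- j \<bullet> q) Ys"
proof -
  have c: "c \<in> hm X X" "c \<bullet> c = c" using dec_idem[OF d] by auto
  obtain v where v: "v \<in> hm Y Y" "(p \<bullet> (e \<bullet> i)) \<bullet> v = idt Y" "v \<bullet> (p \<bullet> (e \<bullet> i)) = idt Y"
    using u i p by (auto elim: iso_endoE)
  note f = i p c e v(1)
  have v2: "p \<bullet> (e \<bullet> (i \<bullet> v)) = idt Y" using v(2) f by simp
  let ?j = "e \<bullet> i" and ?q = "v \<bullet> (p \<bullet> e)" and ?k = "i \<bullet> p \<^bold>+ c"
  note r = cmp_reassoc[OF pi] cmp_reassoc[OF pc] cmp_reassoc[OF ci] cmp_reassoc[OF c(2)] cmp_reassoc[OF e(2)]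
  have v2r: "p \<bullet> (e \<bullet> (i \<bullet> (v \<bullet> x))) = x" if "arw x" "tgt x = Y" for x
  proof -
    have "p \<bullet> (e \<bullet> (i \<bullet> (v \<bullet> x))) = (p \<bullet> (e \<bullet> (i \<bullet> v))) \<bullet> x" using f that by simp
    then show ?thesis using v2 that by simp
  qed
  have v3r: "v \<bullet> (p \<bullet> (e \<bullet> (i \<bullet> x))) = x" if "arw x" "tgt x = Y" for x
  proof -
    have "v \<bullet> (p \<bullet> (e \<bullet> (i \<bullet> x))) = (v \<bullet> (p \<bullet> (e \<bullet> i))) \<bullet> x" using f that by simp
    then show ?thesis using v(3) that by simp
  qed
  let ?th = "idt X \<^bold>- ?j \<bullet> ?q" and ?om = "idt X \<^bold>- ?j \<bullet> (v \<bullet> p)"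
  have qj: "?q \<bullet> ?j = idt Y" using f v(3) by (simp add: r)
  have om_th: "c \<bullet> (?om \<bullet> (?th \<bullet> c)) = c"
  proof -
    have th: "?om \<bullet> ?th = idt X \<^bold>- ?j \<bullet> (v \<bullet> p)"
      using f by (simp add: lin_simps r v2r v3r e(2))
    have "c \<bullet> (?om \<bullet> (?th \<bullet> c)) = c \<bullet> ((?om \<bullet> ?th) \<bullet> c)" using f by simp
    also have "\<dots> = c" unfolding th using f pc c(2) by (simp add: lin_simps r)
    finally show ?thesis .
  qed
  have "dec X (?th \<bullet> (c \<bullet> ?om)) Ys"
    using dec_transport[OF d _ _ om_th] f by simp
  moreover have "?th \<bullet> (c \<bullet> ?om) = ?k \<^bold>- ?j \<bullet> ?q"
  proof -
    have ke': "i \<bullet> (p \<bullet> e) \<^bold>+ c \<bullet> e = e" using ke f by (simp add: cmp_pls_left)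
    have ce: "c \<bullet> e = e \<^bold>- i \<bullet> (p \<bullet> e)"
      using ke' f by (simp add: eq_mns_iff pls_commute)
    have "c \<bullet> (e \<bullet> (i \<bullet> (v \<bullet> p))) = e \<bullet> (i \<bullet> (v \<bullet> p)) \<^bold>- i \<bullet> p"
      using f cmp_reassoc[OF ce, of "i \<bullet> (v \<bullet> p)"] by (simp add: cmp_mns_left v2r)
    then have com: "c \<bullet> ?om = ?k \<^bold>- e \<bullet> (i \<bullet> (v \<bullet> p))"
      using f by (simp add: cmp_mns_right mns_mns2 pls_commute)
    have "?q \<bullet> (c \<bullet> ?om) = v \<bullet> (p \<bullet> (e \<bullet> (?k \<^bold>- e \<bullet> (i \<bullet> (v \<bullet> p)))))"
      unfolding com using f by simp
    also have "\<dots> = ?q \<^bold>- v \<bullet> p"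
      using f ek by (simp add: r cmp_mns_right v2r)
    finally have q: "?q \<bullet> (c \<bullet> ?om) = ?q \<^bold>- v \<bullet> p" .
    have "?th \<bullet> (c \<bullet> ?om) = c \<bullet> ?om \<^bold>- ?j \<bullet> (?q \<bullet> (c \<bullet> ?om))"
      using f by (simp add: cmp_mns_left)
    also have "\<dots> = (?k \<^bold>- e \<bullet> (i \<bullet> (v \<bullet> p))) \<^bold>- (e \<bullet> (i \<bullet> ?q) \<^bold>- e \<bullet> (i \<bullet> (v \<bullet> p)))"
      unfolding q unfolding com using f by (simp add: cmp_mns_right)
    also have "\<dots> = ?k \<^bold>- ?j \<bullet> ?q"
      using f by (simp add: mns_mns_cancel)
    finally show ?thesis .
  qed
  ultimately show ?thesis
    using that[of ?j ?q] f qj e(2) by (simp add: r)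
qed

text \<open>
  On the first summand \<open>Y\<close> the restrictions of \<open>e\<close> and of \<open>c - e\<close> add up to the identity, so one of the
  two is invertible because \<open>Y\<close> is local.  By \<open>exchange_step\<close>, \<open>Y\<close> splits off from the image of that
  one, and the remaining summands are distributed by induction.
\<close>

lemma exchange:
  assumes "dec X c Ys" "\<forall>Y \<in> set Ys. loc Y" "e \<in> hm X X" "e \<bullet> e = e" "e \<bullet> c = e" "c \<bullet> e = e"
  shows "\<exists>As Bs. dec X e As \<and> dec X (c \<^bold>- e) Bs \<and> mset Ys = mset As + mset Bs"
  using assms
proof (induction Ys arbitrary: c e rule: list.induct)
  case Nil
  then have c: "c = zr X X" by (auto elim: dec.cases)
  then have "e = zr X X" using Nil by simp
  then show ?case using c dec_Nil[of X] by (intro exI[of _ "[]"]) simp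
next
  case (Cons Y Ys)
  obtain i p c' where d: "dec X c' Ys" and i: "i \<in> hm Y X" and p: "p \<in> hm X Y" and pi: "p \<bullet> i = idt Y"
    and pc: "p \<bullet> c' = zr X Y" and ci: "c' \<bullet> i = zr Y X" and c: "c = i \<bullet> p \<^bold>+ c'"
    using Cons.prems(1) by (rule dec_split)
  have c': "c' \<in> hm X X" using dec_idem[OF d] by simp
  have ch: "c \<in> hm X X" "c \<bullet> c = c" using dec_idem[OF Cons.prems(1)] by auto
  have step: "\<exists>As Bs. dec X e As \<and> dec X (c \<^bold>- e) Bs \<and> mset (Y # Ys) = mset As + mset Bs"
    if e: "e \<in> hm X X" "e \<bullet> e = e" "e \<bullet> c = e" "c \<bullet> e = e" and u: "iso_arw (p \<bullet> (e \<bullet> i))" for e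
  proof -
    obtain j q where j: "j \<in> hm Y X" "q \<in> hm X Y" "q \<bullet> j = idt Y" "e \<bullet> j = j" "q \<bullet> e = q"
      and dj: "dec X (c \<^bold>- j \<bullet> q) Ys"
      using exchange_step[OF d i p pi pc ci e(1,2) e(3,4)[unfolded c] u] unfolding c by metis
    have cj: "c \<bullet> j = j" using cmp_reassoc[OF e(4), of j] j e ch by simp
    have qc: "q \<bullet> c = q"
    proof -
      have "q \<bullet> c = q \<bullet> (e \<bullet> c)" using cmp_reassoc[OF j(5), of c] j e ch by simp
      then show ?thesis using e j by simp
    qed
    note r = cmp_reassoc[OF j(3)] cmp_reassoc[OF j(4)] cmp_reassoc[OF cj]
    let ?g = "j \<bullet> q"
    have g: "?g \<in> hm X X" "?g \<bullet> ?g = ?g" "e \<bullet> ?g = ?g" "?g \<bullet> e = ?g" "c \<bullet> ?g = ?g" "?g \<bullet> c = ?g"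
      using j ch e qc by (simp_all add: r)
    have "\<exists>As Bs. dec X (e \<^bold>- ?g) As \<and> dec X ((c \<^bold>- ?g) \<^bold>- (e \<^bold>- ?g)) Bs \<and> mset Ys = mset As + mset Bs"
      by (rule Cons.IH[OF dj])
        (use Cons.prems(2) e g ch in \<open>auto simp: cmp_mns_left cmp_mns_right simp del: cmp_assoc\<close>)
    moreover have "(c \<^bold>- ?g) \<^bold>- (e \<^bold>- ?g) = c \<^bold>- e"
      using g ch e by (simp add: mns_mns_cancel)
    ultimately obtain As Bs where A: "dec X (e \<^bold>- ?g) As" and B: "dec X (c \<^bold>- e) Bs"
      and m: "mset Ys = mset As + mset Bs" by auto
    have "dec X (?g \<^bold>+ (e \<^bold>- ?g)) (Y # As)"
      by (rule dec_Cons[OF A j(1-3)]) (use j e g in \<open>simp_all add: cmp_mns_left cmp_mns_right r\<close>)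
    moreover have "?g \<^bold>+ (e \<^bold>- ?g) = e"
      using g e by (subst pls_commute) (simp_all add: mns_pls_cancel)
    ultimately show ?thesis using B m by (intro exI[of _ "Y # As"] exI[of _ Bs]) simp
  qed
  let ?e = "c \<^bold>- e"
  have e: "e \<in> hm X X" "e \<bullet> e = e" "e \<bullet> c = e" "c \<bullet> e = e" using Cons.prems by auto
  have e': "?e \<in> hm X X" "?e \<bullet> ?e = ?e" "?e \<bullet> c = ?e" "c \<bullet> ?e = ?e"
    using e ch by (simp_all add: cmp_mns_left cmp_mns_right)
  have ci': "c \<bullet> i = i" unfolding c using i p c' pi ci by (simp add: cmp_pls_left)
  have "p \<bullet> (?e \<bullet> i) = idt Y \<^bold>- p \<bullet> (e \<bullet> i)"
    using e ch i p pi ci' by (simp add: cmp_mns_left cmp_mns_right)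
  moreover have "loc Y" using Cons.prems(2) by simp
  ultimately have "iso_arw (p \<bullet> (e \<bullet> i)) \<or> iso_arw (p \<bullet> (?e \<bullet> i))"
    using e i p unfolding loc_def by simp
  then show ?case
  proof
    assume "iso_arw (p \<bullet> (e \<bullet> i))"
    then show ?case using step[OF e] by blast
  next
    assume "iso_arw (p \<bullet> (?e \<bullet> i))"
    then obtain As Bs where "dec X ?e As" "dec X (c \<^bold>- ?e) Bs" "mset (Y # Ys) = mset As + mset Bs"
      using step[OF e'] by blast
    moreover have "c \<^bold>- ?e = e" using e ch by (simp add: mns_eq_iff pls_mns_assoc eq_mns_iff pls_commute)
    ultimately show ?case by (intro exI[of _ Bs] exI[of _ As]) simp
  qed
qed

text \<open>
  For the first summand \<open>A\<close> of the image \<open>Z\<close>, the composite \<open>Z \<rightarrow> A \<rightarrow> Z\<close> is a nonzero idempotent of a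
  local object, hence the identity.  Nothing is left for further summands.
\<close>

lemma dec_local_single:
  assumes d: "dec X (j \<bullet> q) As" and l: "\<forall>A \<in> set As. loc A" and Z: "loc Z" "j \<in> hm Z X" "q \<in> hm X Z" "q \<bullet> j = idt Z"
  obtains A where "As = [A]" "isom A Z"
proof -
  note Zr = cmp_reassoc[OF Z(4)]
  have nz: "j \<bullet> q \<noteq> zr X X"
  proof
    assume "j \<bullet> q = zr X X"
    then have "q \<bullet> ((j \<bullet> q) \<bullet> j) = zr Z Z" using Z by simp
    then show False using Z unfolding loc_def by (simp add: Zr)
  qed
  then obtain A As' where As: "As = A # As'" using d by (cases As) (auto elim: dec.cases)
  obtain i p e where e: "dec X e As'" and i: "i \<in> hm A X" "p \<in> hm X A" "p \<bullet> i = idt A"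
    and pe: "p \<bullet> e = zr X A" "e \<bullet> i = zr A X" and eq: "j \<bullet> q = i \<bullet> p \<^bold>+ e"
    using d unfolding As by (rule dec_split)
  have eh: "e \<in> hm X X" "e \<bullet> e = e" using dec_idem[OF e] by auto
  note r = Zr cmp_reassoc[OF i(3)] cmp_reassoc[OF pe(1)] cmp_reassoc[OF pe(2)]
  have k1: "p \<bullet> (j \<bullet> q) = p" and k2: "(j \<bullet> q) \<bullet> i = i"
    unfolding eq using i pe eh by (simp_all add: cmp_pls_left cmp_pls_right r)
  have pq: "(p \<bullet> j) \<bullet> (q \<bullet> i) = idt A"
    using cmp_reassoc[OF k1, of i] i Z by simp
  let ?f = "(q \<bullet> i) \<bullet> (p \<bullet> j)"
  have f: "?f \<in> hm Z Z" "?f \<bullet> ?f = ?f"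
    using i Z cmp_reassoc[OF pq, of "p \<bullet> j"] by simp_all
  have A: "loc A" using l As by simp
  have "?f \<noteq> zr Z Z"
  proof
    assume "?f = zr Z Z"
    then have "(p \<bullet> j) \<bullet> (?f \<bullet> (q \<bullet> i)) = zr A A" using Z i by simp
    then show False using A pq cmp_reassoc[OF pq, of "idt A"] Z i unfolding loc_def by simp
  qed
  then have f1: "?f = idt Z" using loc_idem[OF Z(1) f] by auto
  have AZ: "isom A Z" using pq f1 Z i by (intro isomI[of "q \<bullet> i" _ _ "p \<bullet> j"]) auto
  have "e = (j \<bullet> q) \<^bold>- i \<bullet> p" unfolding eq using i eh by (simp add: eq_mns_iff pls_commute)
  moreover have "j \<bullet> q = i \<bullet> p"
  proof -
    have "j \<bullet> q = j \<bullet> (?f \<bullet> q)" unfolding f1 using Z by simp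
    also have "\<dots> = ((j \<bullet> q) \<bullet> i) \<bullet> (p \<bullet> (j \<bullet> q))" using Z i by simp
    also have "\<dots> = i \<bullet> p" unfolding k1 k2 ..
    finally show ?thesis .
  qed
  ultimately have e0: "e = zr X X" using Z i by simp
  have "As' = []"
  proof (cases As')
    case (Cons B Bs)
    obtain i p e' where e': "dec X e' Bs" and i: "i \<in> hm B X" "p \<in> hm X B" "p \<bullet> i = idt B"
      and pe: "p \<bullet> e' = zr X B" "e' \<bullet> i = zr B X" and eq: "e = i \<bullet> p \<^bold>+ e'"
      using e unfolding Cons by (rule dec_split)
    have "p \<bullet> (e \<bullet> i) = idt B" unfolding eq using i pe dec_idem[OF e'] by (simp add: cmp_pls_left cmp_pls_right)
    then show ?thesis using e0 i l unfolding As Cons loc_def by simp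
  qed simp
  then show ?thesis using that AZ As by simp
qed

definition icl :: "'o \<Rightarrow> 'o set" where "icl Y = {Y'. isom Y Y'}"

lemma icl_eq: "icl Y = icl Z \<longleftrightarrow> isom Y Z"
  unfolding icl_def using isom_refl isom_sym isom_trans by blast

text \<open>
  Apply the exchange lemma to the idempotent that cuts out the first member of \<open>Zs\<close>: the part of \<open>Ys\<close>
  that decomposes it is one object isomorphic to it, and the rest decomposes the complement.
\<close>

theorem krull_schmidt_unique:
  assumes "dec X c Ys" "dec X c Zs" "\<forall>Y \<in> set Ys. loc Y" "\<forall>Z \<in> set Zs. loc Z"
  shows "image_mset icl (mset Ys) = image_mset icl (mset Zs)"
  using assms
proof (induction Zs arbitrary: c Ys rule: list.induct)
  case Nil
  then have c: "c = zr X X" by (auto elim: dec.cases)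
  have "Ys = []"
  proof (cases Ys)
    case (Cons B Bs)
    obtain i p e' where e': "dec X e' Bs" and i: "i \<in> hm B X" "p \<in> hm X B" "p \<bullet> i = idt B"
      and pe: "p \<bullet> e' = zr X B" "e' \<bullet> i = zr B X" and eq: "c = i \<bullet> p \<^bold>+ e'"
      using Nil(1) unfolding Cons by (rule dec_split)
    have "p \<bullet> (c \<bullet> i) = idt B" unfolding eq using i pe dec_idem[OF e'] by (simp add: cmp_pls_left cmp_pls_right)
    then show ?thesis using c i Nil(3) unfolding Cons loc_def by simp
  qed simp
  then show ?case by simp
next
  case (Cons Z Zs)
  obtain j q c' where d: "dec X c' Zs" and j: "j \<in> hm Z X" and q: "q \<in> hm X Z" and qj: "q \<bullet> j = idt Z"
    and qc: "q \<bullet> c' = zr X Z" and cj: "c' \<bullet> j = zr Z X" and c: "c = j \<bullet> q \<^bold>+ c'"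
    using Cons.prems(2) by (rule dec_split)
  have c': "c' \<in> hm X X" using dec_idem[OF d] by simp
  note r = cmp_reassoc[OF qj] cmp_reassoc[OF qc] cmp_reassoc[OF cj]
  have "\<exists>As Bs. dec X (j \<bullet> q) As \<and> dec X (c \<^bold>- j \<bullet> q) Bs \<and> mset Ys = mset As + mset Bs"
    by (rule exchange[OF Cons.prems(1,3)])
      (use j q qj qc cj c' c in \<open>simp_all add: r cmp_pls_left cmp_pls_right\<close>)
  moreover have "c \<^bold>- j \<bullet> q = c'" unfolding c using c' j q by (simp add: mns_eq_iff pls_commute)
  ultimately obtain As Bs where A: "dec X (j \<bullet> q) As" and B: "dec X c' Bs" and m: "mset Ys = mset As + mset Bs"
    by auto
  have s: "set Ys = set As \<union> set Bs" using m by (metis set_mset_mset set_mset_union)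
  obtain A where "As = [A]" "isom A Z"
    using dec_local_single[OF A _ _ j q qj] Cons.prems s by auto
  moreover have "image_mset icl (mset Bs) = image_mset icl (mset Zs)"
    by (rule Cons.IH[OF B d]) (use Cons.prems s in auto)
  ultimately show ?case using m by (simp add: icl_eq)
qed

subsection \<open>Biproducts\<close>

definition bip :: "'o \<Rightarrow> 'o \<Rightarrow> 'o \<Rightarrow> 'a \<Rightarrow> 'a \<Rightarrow> 'a \<Rightarrow> 'a \<Rightarrow> bool" where
  "bip W A B i p j q \<longleftrightarrow> i \<in> hm A W \<and> p \<in> hm W A \<and> j \<in> hm B W \<and> q \<in> hm W B \<and>
     p \<bullet> i = idt A \<and> q \<bullet> j = idt B \<and> p \<bullet> j = zr B A \<and> q \<bullet> i = zr A B \<and> i \<bullet> p \<^bold>+ j \<bullet> q = idt W"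

lemma dec_append:
  assumes "dec X c Ys" "dec X c' Zs" "c \<bullet> c' = zr X X" "c' \<bullet> c = zr X X"
  shows "dec X (c \<^bold>+ c') (Ys @ Zs)"
  using assms
proof (induction Ys arbitrary: c rule: list.induct)
  case Nil
  then have "c = zr X X" by (auto elim: dec.cases)
  then show ?case using Nil dec_idem[OF Nil(2)] by simp
next
  case (Cons Y Ys)
  obtain i p e where d: "dec X e Ys" and i: "i \<in> hm Y X" and p: "p \<in> hm X Y" and pi: "p \<bullet> i = idt Y"
    and pc: "p \<bullet> e = zr X Y" and ci: "e \<bullet> i = zr Y X" and c: "c = i \<bullet> p \<^bold>+ e"
    using Cons.prems(1) by (rule dec_split)
  have e: "e \<in> hm X X" "e \<bullet> e = e" using dec_idem[OF d] by auto
  have c': "c' \<in> hm X X" using dec_idem[OF Cons.prems(2)] by auto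
  have ch: "c \<in> hm X X" using c i p e by simp
  note r = cmp_reassoc[OF pi] cmp_reassoc[OF pc] cmp_reassoc[OF ci]
  have pk: "p \<bullet> c = p" "c \<bullet> i = i" "e \<bullet> c = e" "c \<bullet> e = e"
    unfolding c using i p e pi pc ci by (simp_all add: cmp_pls_left cmp_pls_right r)
  have pc': "p \<bullet> c' = zr X Y" using cmp_reassoc[OF pk(1), of c'] c' ch p Cons.prems(3) by simp
  have ci': "c' \<bullet> i = zr Y X" using cmp_reassoc[OF Cons.prems(4), of i] c' ch i pk by simp
  have ec: "e \<bullet> c' = zr X X" using cmp_reassoc[OF pk(3), of c'] c' ch e Cons.prems(3) by simp
  have ce: "c' \<bullet> e = zr X X" using cmp_reassoc[OF Cons.prems(4), of e] c' ch e pk by simp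
  have "dec X (e \<^bold>+ c') (Ys @ Zs)" by (rule Cons.IH[OF d Cons.prems(2) ec ce])
  then have "dec X (i \<bullet> p \<^bold>+ (e \<^bold>+ c')) (Y # (Ys @ Zs))"
    by (rule dec_Cons[OF _ i p pi]) (use e c' i p pc ci pc' ci' in \<open>simp_all add: cmp_pls_left cmp_pls_right\<close>)
  then show ?case unfolding c using e c' i p by (simp add: pls_assoc)
qed

lemma dec_retract:
  assumes "dec Y (idt Y) Ys" "i \<in> hm Y X" "p \<in> hm X Y" "p \<bullet> i = idt Y"
  shows "dec X (i \<bullet> p) Ys"
  using dec_transport[OF assms(1), of i X p] assms by simp

lemma bip_dec:
  assumes b: "bip W A B i p j q" and A: "dec A (idt A) As" and B: "dec B (idt B) Bs"
  shows "dec W (idt W) (As @ Bs)"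
proof -
  have "dec W (i \<bullet> p) As" "dec W (j \<bullet> q) Bs"
    using b dec_retract[OF A, of i W p] dec_retract[OF B, of j W q] unfolding bip_def by simp_all
  moreover have "(i \<bullet> p) \<bullet> (j \<bullet> q) = zr W W" "(j \<bullet> q) \<bullet> (i \<bullet> p) = zr W W"
    using b cmp_reassoc[of p j "zr B A" q] cmp_reassoc[of q i "zr A B" p] unfolding bip_def by simp_all
  ultimately show ?thesis using dec_append[of W "i \<bullet> p" As "j \<bullet> q" Bs] b unfolding bip_def by simp
qed

lemma dec_single: "dec X (idt X) [X]"
  using dec_Cons[OF dec_Nil, of "idt X" X X "idt X"] by simp

lemma bip_dec2: "bip W A B i p j q \<Longrightarrow> dec W (idt W) [A, B]"
  using bip_dec[OF _ dec_single dec_single] by simp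

lemma dec_retract_member:
  assumes "dec X c Ys" "Y \<in> set Ys"
  obtains i p where "i \<in> hm Y X" "p \<in> hm X Y" "p \<bullet> i = idt Y" "c \<bullet> i = i" "p \<bullet> c = p"
proof -
  have "\<exists>i p. i \<in> hm Y X \<and> p \<in> hm X Y \<and> p \<bullet> i = idt Y \<and> c \<bullet> i = i \<and> p \<bullet> c = p"
    using assms
  proof (induction rule: dec.induct)
    case (dec_Cons c Ys i Y' p)
    note f = dec_Cons.hyps(2-6) dec_idem[OF dec_Cons.hyps(1)]
    note r = cmp_reassoc[OF f(3)] cmp_reassoc[OF f(4)] cmp_reassoc[OF f(5)]
    show ?case
    proof (cases "Y = Y'")
      case True
      then show ?thesis using f by (intro exI[of _ i] exI[of _ p]) (simp add: cmp_pls_left cmp_pls_right r)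
    next
      case False
      then obtain i' p' where g: "i' \<in> hm Y X" "p' \<in> hm X Y" "p' \<bullet> i' = idt Y" "c \<bullet> i' = i'" "p' \<bullet> c = p'"
        using dec_Cons by auto
      have "p \<bullet> i' = zr Y Y'" using cmp_reassoc[OF f(4), of i'] f g by simp
      moreover have "p' \<bullet> i = zr Y' Y" using cmp_reassoc[OF g(5), of i] f g by simp
      ultimately show ?thesis using f g cmp_reassoc[of p' i "zr Y' Y" p]
        by (intro exI[of _ i'] exI[of _ p']) (simp add: cmp_pls_left cmp_pls_right)
    qed
  qed simp
  then show ?thesis using that by blast
qed

end

context preadditive
begin

subsection \<open>Morphisms through an object\<close>

text \<open>
  The morphisms that factor through \<open>add U\<close>, as sums of composites through \<open>U\<close> itself.  This form makes
  sense without biproducts and supports induction over the summands.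
\<close>

inductive_set thru :: "'o \<Rightarrow> 'o \<Rightarrow> 'o \<Rightarrow> 'a set" for U X Y where
  thru_zr: "zr X Y \<in> thru U X Y"
| thru_step: "\<lbrakk>f \<in> hm X U; g \<in> hm U Y; r \<in> thru U X Y\<rbrakk> \<Longrightarrow> g \<bullet> f \<^bold>+ r \<in> thru U X Y"

text \<open>
  \<open>Q\<close> lies in \<open>add U\<close>: the maps supplied by the membership in \<open>thru\<close> exhibit it as a retract of a
  power of \<open>U\<close>.
\<close>

definition gen :: "'o \<Rightarrow> 'o \<Rightarrow> bool" where
  "gen U Q \<longleftrightarrow> idt Q \<in> thru U Q Q"

lemma thru_hm: "x \<in> thru U X Y \<Longrightarrow> x \<in> hm X Y"
  by (induction rule: thru.induct) simp_all

lemma thru_single: "\<lbrakk>f \<in> hm X U; g \<in> hm U Y\<rbrakk> \<Longrightarrow> g \<bullet> f \<in> thru U X Y"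
  using thru_step[OF _ _ thru_zr, of f X U g Y] by simp

lemma thru_pls: "\<lbrakk>x \<in> thru U X Y; y \<in> thru U X Y\<rbrakk> \<Longrightarrow> x \<^bold>+ y \<in> thru U X Y"
proof (induction rule: thru.induct)
  case thru_zr
  then show ?case using thru_hm[OF thru_zr] by simp
next
  case (thru_step f g r)
  then have "g \<bullet> f \<^bold>+ (r \<^bold>+ y) \<in> thru U X Y" by (intro thru.thru_step) auto
  then show ?case using thru_step thru_hm[of r] thru_hm[of y] by (simp add: pls_assoc)
qed

lemma thru_cmp_left: "\<lbrakk>x \<in> thru U X Y; h \<in> hm Y Z\<rbrakk> \<Longrightarrow> h \<bullet> x \<in> thru U X Z"
proof (induction rule: thru.induct)
  case thru_zr
  then show ?case using thru.thru_zr by simp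
next
  case (thru_step f g r)
  then have "(h \<bullet> g) \<bullet> f \<^bold>+ h \<bullet> r \<in> thru U X Z" by (intro thru.thru_step) auto
  then show ?case using thru_step thru_hm[of r] by (simp add: cmp_pls_right)
qed

lemma thru_cmp_right: "\<lbrakk>x \<in> thru U X Y; h \<in> hm Z X\<rbrakk> \<Longrightarrow> x \<bullet> h \<in> thru U Z Y"
proof (induction rule: thru.induct)
  case thru_zr
  then show ?case using thru.thru_zr by simp
next
  case (thru_step f g r)
  then have "g \<bullet> (f \<bullet> h) \<^bold>+ r \<bullet> h \<in> thru U Z Y" by (intro thru.thru_step) auto
  then show ?case using thru_step thru_hm[of r] by (simp add: cmp_pls_left)
qed

lemma thru_gen:
  assumes "gen U W" "f \<in> hm X W" "g \<in> hm W Y"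
  shows "g \<bullet> f \<in> thru U X Y"
  using thru_cmp_right[OF thru_cmp_left[of "idt W" U W W g Y], of f X] assms unfolding gen_def by simp

lemma gen_refl: "gen U U"
  unfolding gen_def using thru_single[of "idt U" U U "idt U" U] by simp

lemma gen_retract: "\<lbrakk>gen U X; i \<in> hm Y X; p \<in> hm X Y; p \<bullet> i = idt Y\<rbrakk> \<Longrightarrow> gen U Y"
  using thru_gen[of U X i Y p Y] unfolding gen_def by simp

lemma gen_isom: "\<lbrakk>gen U X; isom X Y\<rbrakk> \<Longrightarrow> gen U Y"
  using gen_retract by (metis isomE)

lemma thru_trans:
  assumes "gen U V" "x \<in> thru V X Y" shows "x \<in> thru U X Y"
  using assms(2)
proof (induction rule: thru.induct)
  case thru_zr
  then show ?case by (rule thru.thru_zr)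
next
  case (thru_step f g r)
  then show ?case using thru_pls thru_gen[OF assms(1)] by blast
qed

lemma gen_trans: "\<lbrakk>gen U V; gen V W\<rbrakk> \<Longrightarrow> gen U W"
  unfolding gen_def[of _ W] by (rule thru_trans)

text \<open>
  The identity of \<open>W\<close> is a sum of maps through \<open>U\<close>, so a vanishing that holds on maps from \<open>U\<close> holds on
  maps from \<open>W\<close>.  The next three lemmas are variants of this.
\<close>

lemma gen_vanish_right:
  assumes "gen U W" "k \<in> hm Y Z" "\<And>f. f \<in> hm U Y \<Longrightarrow> k \<bullet> f = zr U Z" "f \<in> hm W Y"
  shows "k \<bullet> f = zr W Z"
proof -
  have "x \<in> thru U W W \<Longrightarrow> (k \<bullet> f) \<bullet> x = zr W Z" for x
  proof (induction rule: thru.induct)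
    case thru_zr then show ?case using assms by simp
  next
    case (thru_step u v r)
    have "k \<bullet> (f \<bullet> v) = zr U Z" using assms(3)[of "f \<bullet> v"] assms(4) thru_step by simp
    then have "(k \<bullet> f) \<bullet> (v \<bullet> u) = zr W Z" using cmp_reassoc[of k "f \<bullet> v" "zr U Z" u] assms thru_step by simp
    then show ?case using thru_step thru_hm[of r] assms(2,4) by (simp add: cmp_pls_right)
  qed
  from this[of "idt W"] show ?thesis using assms unfolding gen_def by simp
qed

lemma gen_zero_right:
  assumes "gen U W" "\<And>f. f \<in> hm U Y \<Longrightarrow> f = zr U Y" "f \<in> hm W Y"
  shows "f = zr W Y"
proof -
  have "idt Y \<bullet> f = zr W Y"
    by (rule gen_vanish_right[OF assms(1) _ _ assms(3)]) (simp, drule assms(2), simp)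
  then show ?thesis using assms(3) by simp
qed

lemma gen_vanish_left:
  assumes "gen U W" "k \<in> hm Y Z" "\<And>f. f \<in> hm Z U \<Longrightarrow> f \<bullet> k = zr Y U" "f \<in> hm Z W"
  shows "f \<bullet> k = zr Y W"
proof -
  have "x \<in> thru U W W \<Longrightarrow> x \<bullet> (f \<bullet> k) = zr Y W" for x
  proof (induction rule: thru.induct)
    case thru_zr then show ?case using assms by simp
  next
    case (thru_step u v r)
    have "(u \<bullet> f) \<bullet> k = zr Y U" by (rule assms(3)) (use assms thru_step in simp)
    then have "u \<bullet> (f \<bullet> k) = zr Y U" using assms(2,4) thru_step by simp
    then show ?case using thru_step thru_hm[of r] assms(2,4) by (simp add: cmp_pls_left)
  qed
  from this[of "idt W"] show ?thesis using assms unfolding gen_def by simp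
qed

lemma gen_zero_left:
  assumes "gen U W" "\<And>f. f \<in> hm Z U \<Longrightarrow> f = zr Z U" "f \<in> hm Z W"
  shows "f = zr Z W"
proof -
  have "f \<bullet> idt Z = zr Z W"
    by (rule gen_vanish_left[OF assms(1) _ _ assms(3)]) (simp, drule assms(2), simp)
  then show ?thesis using assms(3) by simp
qed

text \<open>
  In a local ring a sum is invertible only if one of its terms is; induction over the sum finds an
  invertible composite \<open>L \<rightarrow> U \<rightarrow> L\<close>.
\<close>

lemma loc_thru_retract:
  assumes L: "loc L" and x: "x \<in> thru U L L" and i: "iso_arw x"
  obtains f g where "f \<in> hm L U" "g \<in> hm U L" "g \<bullet> f = idt L"
proof -
  have "\<exists>f g. f \<in> hm L U \<and> g \<in> hm U L \<and> iso_arw (g \<bullet> f)"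
    using x i
  proof (induction rule: thru.induct)
    case thru_zr
    then obtain v where "v \<in> hm L L" "zr L L \<bullet> v = idt L" by (metis iso_endoE src_zr tgt_zr)
    then have "idt L = zr L L" by simp
    then show ?case using L unfolding loc_def by blast
  next
    case (thru_step f g r)
    have r: "r \<in> hm L L" by (rule thru_hm) fact
    obtain v where v: "v \<in> hm L L" "(g \<bullet> f \<^bold>+ r) \<bullet> v = idt L" "v \<bullet> (g \<bullet> f \<^bold>+ r) = idt L"
      by (rule iso_endoE[OF thru_step.prems]) (use thru_step.hyps(1,2) in simp_all)
    have h: "v \<bullet> (g \<bullet> f) \<in> hm L L" "g \<bullet> f \<in> hm L L" using v(1) thru_step.hyps(1,2) by simp_all
    have "v \<bullet> (g \<bullet> f) \<^bold>+ v \<bullet> r = idt L"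
      using v(1,3) r thru_step.hyps(1,2) by (simp add: cmp_pls_right)
    then have "idt L \<^bold>- v \<bullet> (g \<bullet> f) = v \<bullet> r"
      using v(1) r h by (subst mns_eq_iff) (simp_all add: pls_commute)
    then consider "iso_arw (v \<bullet> (g \<bullet> f))" | "iso_arw (v \<bullet> r)"
      using L h(1) unfolding loc_def by metis
    moreover have "inv_arws v (g \<bullet> f \<^bold>+ r)"
      unfolding inv_arws_hm using v r h(2) by (intro exI[of _ L]) simp
    then have gi: "iso_arw (g \<bullet> f \<^bold>+ r)" using inv_arws_sym unfolding iso_arw_def by blast
    ultimately show ?case
    proof cases
      case 1
      then show ?thesis using v(1) thru_step.hyps(1,2) by (intro exI[of _ f] exI[of _ "v \<bullet> g"]) simp
    next
      case 2
      have "(g \<bullet> f \<^bold>+ r) \<bullet> (v \<bullet> r) = r"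
        using cmp_reassoc[OF v(2), of r] v(1) r h(2) by simp
      then have "iso_arw r" using iso_arw_cmp[OF 2 gi] v(1) r h(2) by simp
      then show ?thesis by (rule thru_step.IH)
    qed
  qed
  then obtain f g where fg: "f \<in> hm L U" "g \<in> hm U L" "iso_arw (g \<bullet> f)" by blast
  then obtain v where v: "v \<in> hm L L" "v \<bullet> (g \<bullet> f) = idt L" by (metis iso_endoE hm_iff src_cmp tgt_cmp)
  show ?thesis using that[of f "v \<bullet> g"] v fg by simp
qed

lemma loc_gen_retract:
  assumes "loc L" "gen U L"
  obtains i p where "i \<in> hm L U" "p \<in> hm U L" "p \<bullet> i = idt L"
proof (rule loc_thru_retract[OF assms(1)])
  show "idt L \<in> thru U L L" using assms(2) unfolding gen_def .
  show "iso_arw (idt L)" unfolding iso_arw_def inv_arws_def by (intro exI[of _ "idt L"]) simp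
qed (use that in auto)

lemma dec_gen:
  assumes "dec X c Ys" "\<forall>Y \<in> set Ys. gen U Y"
  shows "c \<in> thru U X X"
  using assms
proof (induction rule: dec.induct)
  case dec_Nil show ?case by (rule thru_zr)
next
  case (dec_Cons c Ys i Y p)
  then show ?case using thru_pls thru_gen[of U Y p X i X] by simp
qed

end

section \<open>Krull--Schmidt categories\<close>

locale ks_cat = preadditive arw src tgt cmp pls ng zr idt
  for arw :: "'a \<Rightarrow> bool" and src tgt :: "'a \<Rightarrow> 'o"
    and cmp :: "'a \<Rightarrow> 'a \<Rightarrow> 'a" (infixr \<open>\<bullet>\<close> 75)
    and pls :: "'a \<Rightarrow> 'a \<Rightarrow> 'a" (infixl \<open>\<^bold>+\<close> 65)
    and ng :: "'a \<Rightarrow> 'a" and zr :: "'o \<Rightarrow> 'o \<Rightarrow> 'a" and idt :: "'o \<Rightarrow> 'a" +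
  assumes ks: "\<exists>Ys. dec X (idt X) Ys \<and> (\<forall>Y \<in> set Ys. loc Y)"
    and bips: "\<exists>W i p j q. bip W A B i p j q"
    and zero_ob: "\<exists>Z. idt Z = zr Z Z"
begin

text \<open>
  The isomorphism classes of the indecomposable summands of \<open>X\<close>, with multiplicities.  The choice is
  harmless by \<open>krull_schmidt_unique\<close>.  The number \<open>|X|\<close> is the number of distinct elements.
\<close>

definition cls :: "'o \<Rightarrow> 'o set multiset" where
  "cls X = image_mset icl (mset (SOME Ys. dec X (idt X) Ys \<and> (\<forall>Y \<in> set Ys. loc Y)))"

lemma cls_eq:
  assumes "dec X (idt X) Ys" "\<forall>Y \<in> set Ys. loc Y"
  shows "cls X = image_mset icl (mset Ys)"
  unfolding cls_def using someI_ex[OF ks, of X] krull_schmidt_unique[OF _ assms(1) _ assms(2)] by blast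

lemma cls_loc: "loc X \<Longrightarrow> cls X = {#icl X#}"
  using cls_eq[OF dec_single] by simp

lemma cls_bip:
  assumes "bip W A B i p j q"
  shows "cls W = cls A + cls B"
proof -
  obtain As Bs where A: "dec A (idt A) As" "\<forall>Y \<in> set As. loc Y" and B: "dec B (idt B) Bs" "\<forall>Y \<in> set Bs. loc Y"
    using ks[of A] ks[of B] by blast
  then show ?thesis using cls_eq[OF bip_dec[OF assms A(1) B(1)]] cls_eq[OF A] cls_eq[OF B] by auto
qed

lemma cls_zero: "idt Z = zr Z Z \<Longrightarrow> cls Z = {#}"
  using cls_eq[of Z "[]"] dec_Nil[of Z] by simp

text \<open>The image of the idempotent is the biproduct of the objects that decompose it.\<close>

lemma idem_object:
  assumes "dec X e As"
  shows "\<exists>Y i p. i \<in> hm Y X \<and> p \<in> hm X Y \<and> p \<bullet> i = idt Y \<and> i \<bullet> p = e \<and> dec Y (idt Y) As"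
  using assms
proof (induction rule: dec.induct)
  case dec_Nil
  obtain Z where Z: "idt Z = zr Z Z" using zero_ob by blast
  then show ?case using dec.dec_Nil[of Z] by (intro exI[of _ Z] exI[of _ "zr Z X"] exI[of _ "zr X Z"]) simp
next
  case (dec_Cons c As i A p)
  obtain Y j q where Y: "j \<in> hm Y X" "q \<in> hm X Y" "q \<bullet> j = idt Y" "j \<bullet> q = c" "dec Y (idt Y) As"
    using dec_Cons.IH by blast
  obtain W i1 p1 i2 p2 where b: "bip W A Y i1 p1 i2 p2" using bips by blast
  note h = dec_Cons.hyps(2-6) Y(1-4) b[unfolded bip_def]
  have c: "c \<in> hm X X" using dec_idem[OF dec_Cons.hyps(1)] by simp
  have pj: "p \<bullet> j = zr Y A"
  proof -
    have "p \<bullet> (c \<bullet> j) = zr Y A" using cmp_reassoc[OF h(4), of j] h(1,2) Y(1) c by simp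
    moreover have "c \<bullet> j = j" using Y(1-3) unfolding Y(4)[symmetric] by simp
    ultimately show ?thesis by simp
  qed
  have qi: "q \<bullet> i = zr A Y"
  proof -
    have "q \<bullet> (c \<bullet> i) = zr A Y" unfolding h(5) using Y(2) by simp
    moreover have "q \<bullet> c = q" using Y(1-3) cmp_reassoc[OF Y(3), of q] unfolding Y(4)[symmetric] by simp
    ultimately show ?thesis using cmp_reassoc[of q c q i] h(1) c Y(2) by simp
  qed
  note r = cmp_reassoc[OF h(3)] cmp_reassoc[OF h(8)] cmp_reassoc[OF pj] cmp_reassoc[OF qi]
  have b': "i1 \<in> hm A W" "p1 \<in> hm W A" "i2 \<in> hm Y W" "p2 \<in> hm W Y"
     "p1 \<bullet> i1 = idt A" "p2 \<bullet> i2 = idt Y" "p1 \<bullet> i2 = zr Y A" "p2 \<bullet> i1 = zr A Y" "i1 \<bullet> p1 \<^bold>+ i2 \<bullet> p2 = idt W"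
    using b unfolding bip_def by auto
  note r2 = cmp_reassoc[OF b'(5)] cmp_reassoc[OF b'(6)] cmp_reassoc[OF b'(7)] cmp_reassoc[OF b'(8)]
  let ?I = "i \<bullet> p1 \<^bold>+ j \<bullet> p2" and ?P = "i1 \<bullet> p \<^bold>+ i2 \<bullet> q"
  have "?P \<bullet> ?I = idt W" "?I \<bullet> ?P = i \<bullet> p \<^bold>+ c"
    using h(1,2) Y(1,2) b' unfolding Y(4)[symmetric] by (simp_all add: cmp_pls_left cmp_pls_right r r2)
  moreover have "dec W (idt W) (A # As)" using bip_dec[OF b dec_single Y(5)] by simp
  ultimately show ?case using h(1,2) Y(1,2) b'(1-4) by (intro exI[of _ W] exI[of _ ?I] exI[of _ ?P]) simp
qed

text \<open>
  The exchange lemma decomposes \<open>e\<close> and \<open>1 - e\<close>, and both have an image by \<open>idem_object\<close>.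
\<close>

lemma idem_split:
  assumes "e \<in> hm X X" "e \<bullet> e = e"
  obtains Y Z i p j q where "bip X Y Z i p j q" "i \<bullet> p = e"
proof -
  obtain Ys where Ys: "dec X (idt X) Ys" "\<forall>Y \<in> set Ys. loc Y" using ks by blast
  obtain As Bs where A: "dec X e As" "dec X (idt X \<^bold>- e) Bs"
    using exchange[OF Ys assms] assms by auto
  obtain Y i p where Y: "i \<in> hm Y X" "p \<in> hm X Y" "p \<bullet> i = idt Y" "i \<bullet> p = e" using idem_object[OF A(1)] by blast
  obtain Z j q where Z: "j \<in> hm Z X" "q \<in> hm X Z" "q \<bullet> j = idt Z" "j \<bullet> q = idt X \<^bold>- e"
    using idem_object[OF A(2)] by blast
  have ei: "e \<bullet> i = i" unfolding Y(4)[symmetric] using Y(1-3) by simp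
  have pe: "p \<bullet> e = p" unfolding Y(4)[symmetric] using Y(1-3) cmp_reassoc[OF Y(3), of p] by simp
  have "p \<bullet> (j \<bullet> q) = zr X Y" "(j \<bullet> q) \<bullet> i = zr Y X"
    unfolding Z(4) using Y(1,2) assms ei pe by (simp_all add: cmp_mns_left cmp_mns_right)
  then have "(p \<bullet> (j \<bullet> q)) \<bullet> j = zr Z Y" "q \<bullet> ((j \<bullet> q) \<bullet> i) = zr Y Z" using Y(1,2) Z(1,2) by simp_all
  then have z: "p \<bullet> j = zr Z Y" "q \<bullet> i = zr Y Z"
    using Y(1,2) Z(1-3) cmp_reassoc[OF Z(3), of "q \<bullet> i"] by simp_all
  have "i \<bullet> p \<^bold>+ j \<bullet> q = idt X" unfolding Y(4) Z(4) using assms by (subst pls_commute) (simp_all add: mns_pls_cancel)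
  then show ?thesis using that[of Y Z i p j q] Y Z z unfolding bip_def by blast
qed

lemma retract_bip:
  assumes "i \<in> hm Y X" "p \<in> hm X Y" "p \<bullet> i = idt Y"
  obtains Z j q where "bip X Y Z i p j q"
proof -
  have "i \<bullet> p \<in> hm X X" "(i \<bullet> p) \<bullet> (i \<bullet> p) = i \<bullet> p" using assms cmp_reassoc[OF assms(3), of p] by simp_all
  then have "idt X \<^bold>- i \<bullet> p \<in> hm X X" "(idt X \<^bold>- i \<bullet> p) \<bullet> (idt X \<^bold>- i \<bullet> p) = (idt X \<^bold>- i \<bullet> p)"
    using assms by (simp_all add: cmp_mns_left cmp_mns_right)
  then obtain Z A j q k l where b: "bip X Z A j q k l" "j \<bullet> q = idt X \<^bold>- i \<bullet> p" by (rule idem_split)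
  then have h: "j \<in> hm Z X" "q \<in> hm X Z" "q \<bullet> j = idt Z" unfolding bip_def by auto
  have "p \<bullet> (j \<bullet> q) = zr X Y" "(j \<bullet> q) \<bullet> i = zr Y X"
    unfolding b(2) using assms cmp_reassoc[OF assms(3), of p] by (simp_all add: cmp_mns_left cmp_mns_right)
  then have "(p \<bullet> (j \<bullet> q)) \<bullet> j = zr Z Y" "q \<bullet> ((j \<bullet> q) \<bullet> i) = zr Y Z" using assms h by simp_all
  then have "p \<bullet> j = zr Z Y" "q \<bullet> i = zr Y Z"
    using assms h cmp_reassoc[OF h(3), of "q \<bullet> i"] by simp_all
  moreover have "i \<bullet> p \<^bold>+ j \<bullet> q = idt X" unfolding b(2) using assms by (subst pls_commute) (simp_all add: mns_pls_cancel)
  ultimately show ?thesis using that[of Z j q] assms h unfolding bip_def by blast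
qed

lemma cls_retract:
  assumes "i \<in> hm Y X" "p \<in> hm X Y" "p \<bullet> i = idt Y"
  shows "cls Y \<subseteq># cls X"
  using retract_bip[OF assms] cls_bip by (metis mset_subset_eq_add_left)

lemma cls_member:
  assumes "r \<in># cls X"
  obtains L i p where "loc L" "icl L = r" "i \<in> hm L X" "p \<in> hm X L" "p \<bullet> i = idt L"
proof -
  obtain Ys where Ys: "dec X (idt X) Ys" "\<forall>Y \<in> set Ys. loc Y" using ks by blast
  then obtain L where "L \<in> set Ys" "icl L = r" using assms cls_eq[OF Ys] by auto
  then show ?thesis using that Ys dec_retract_member[OF Ys(1)] by metis
qed

text \<open>
  A local summand of an object of \<open>add U\<close> is a retract of \<open>U\<close> by \<open>loc_gen_retract\<close>, so it appears in
  every decomposition of \<open>U\<close>.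
\<close>

lemma gen_iff_cls: "gen U Q \<longleftrightarrow> set_mset (cls Q) \<subseteq> set_mset (cls U)"
proof
  assume g: "gen U Q"
  show "set_mset (cls Q) \<subseteq> set_mset (cls U)"
  proof
    fix r assume "r \<in># cls Q"
    then obtain L i p where L: "loc L" "icl L = r" "i \<in> hm L Q" "p \<in> hm Q L" "p \<bullet> i = idt L" by (rule cls_member)
    have "gen U L" by (rule gen_retract[OF g L(3-5)])
    then obtain j q where "j \<in> hm L U" "q \<in> hm U L" "q \<bullet> j = idt L" using loc_gen_retract[OF L(1)] by blast
    then have "cls L \<subseteq># cls U" by (rule cls_retract)
    then show "r \<in># cls U" using cls_loc[OF L(1)] L(2) by simp
  qed
next
  assume s: "set_mset (cls Q) \<subseteq> set_mset (cls U)"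
  obtain Ys where Ys: "dec Q (idt Q) Ys" "\<forall>Y \<in> set Ys. loc Y" using ks by blast
  have "gen U Y" if "Y \<in> set Ys" for Y
  proof -
    have "icl Y \<in># cls U" using that s cls_eq[OF Ys] by auto
    then obtain L i p where L: "loc L" "icl L = icl Y" "i \<in> hm L U" "p \<in> hm U L" "p \<bullet> i = idt L" by (rule cls_member)
    have "gen U L" by (rule gen_retract[OF gen_refl L(3-5)])
    then show ?thesis using gen_isom L(2) icl_eq by blast
  qed
  then show "gen U Q" using dec_gen[OF Ys(1)] unfolding gen_def by blast
qed

lemma gen_bip: "\<lbrakk>bip W A B i p j q; gen U A; gen U B\<rbrakk> \<Longrightarrow> gen U W"
  using gen_iff_cls cls_bip by auto

lemma dec_Cons_bip:
  assumes "dec Z (idt Z) (Y # Ys)"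
  obtains Z' i p j q where "bip Z Y Z' i p j q" "dec Z' (idt Z') Ys"
proof -
  obtain i p c where c: "dec Z c Ys" "i \<in> hm Y Z" "p \<in> hm Z Y" "p \<bullet> i = idt Y" "p \<bullet> c = zr Z Y" "c \<bullet> i = zr Y Z"
    "idt Z = i \<bullet> p \<^bold>+ c" using assms by (rule dec_split)
  obtain Z' j q where Z: "j \<in> hm Z' Z" "q \<in> hm Z Z'" "q \<bullet> j = idt Z'" "j \<bullet> q = c" "dec Z' (idt Z') Ys"
    using idem_object[OF c(1)] by blast
  have "(p \<bullet> (j \<bullet> q)) \<bullet> j = zr Z' Y" "q \<bullet> ((j \<bullet> q) \<bullet> i) = zr Y Z'" unfolding Z(4) c(5,6) using Z(1,2) by simp_all
  then have "p \<bullet> j = zr Z' Y" "q \<bullet> i = zr Y Z'"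
    using c(2,3) Z(1-3) cmp_reassoc[OF Z(3), of "q \<bullet> i"] by simp_all
  then have "bip Z Y Z' i p j q" using c(2-4,7) Z(1-4) unfolding bip_def by simp
  then show ?thesis using that Z(5) by blast
qed

lemma cls_dec: "dec X (idt X) Ys \<Longrightarrow> cls X = (\<Sum>Y\<leftarrow>Ys. cls Y)"
proof (induction Ys arbitrary: X rule: list.induct)
  case Nil
  then have "idt X = zr X X" by (auto elim: dec.cases)
  then show ?case using cls_zero by simp
next
  case (Cons Y Ys)
  obtain Z' i p j q where b: "bip X Y Z' i p j q" and d: "dec Z' (idt Z') Ys"
    using dec_Cons_bip[OF Cons.prems] .
  show ?case using cls_bip[OF b] Cons.IH[OF d] by simp
qed

lemma cls_empty: "cls X = {#} \<Longrightarrow> idt X = zr X X"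
proof -
  assume c: "cls X = {#}"
  obtain Ys where Ys: "dec X (idt X) Ys" "\<forall>Y \<in> set Ys. loc Y" using ks by blast
  then have "Ys = []" using cls_eq[OF Ys] c by simp
  then show ?thesis using Ys(1) by (auto elim: dec.cases)
qed

lemma retract_icl:
  assumes "loc L" "icl L \<in># cls X"
  obtains i p where "i \<in> hm L X" "p \<in> hm X L" "p \<bullet> i = idt L"
proof -
  have "gen X L" using assms gen_iff_cls cls_loc by simp
  then show ?thesis using loc_gen_retract[OF assms(1)] that by blast
qed

lemma repeated_summand:
  assumes "loc L" "count (cls X) (icl L) \<ge> 2"
  obtains Z where "dec X (idt X) [L, L, Z]"
proof -
  have "icl L \<in># cls X" using assms(2) by (metis count_eq_zero_iff not_numeral_le_zero)
  then obtain i p where i: "i \<in> hm L X" "p \<in> hm X L" "p \<bullet> i = idt L" by (rule retract_icl[OF assms(1)])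
  obtain Z' j q where b: "bip X L Z' i p j q" using retract_bip[OF i] .
  have "icl L \<in># cls Z'" using cls_bip[OF b] cls_loc[OF assms(1)] assms(2) by (auto simp: not_in_iff)
  then obtain i' p' where i': "i' \<in> hm L Z'" "p' \<in> hm Z' L" "p' \<bullet> i' = idt L" by (rule retract_icl[OF assms(1)])
  obtain Z j' q' where b': "bip Z' L Z i' p' j' q'" using retract_bip[OF i'] .
  show ?thesis using that bip_dec[OF b dec_single bip_dec2[OF b']] by simp
qed

end

section \<open>Triangulated categories\<close>

locale tri_ks = ks_cat arw src tgt cmp pls ng zr idt
  for arw :: "'a \<Rightarrow> bool" and src tgt :: "'a \<Rightarrow> 'o"
    and cmp :: "'a \<Rightarrow> 'a \<Rightarrow> 'a" (infixr \<open>\<bullet>\<close> 75)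
    and pls :: "'a \<Rightarrow> 'a \<Rightarrow> 'a" (infixl \<open>\<^bold>+\<close> 65)
    and ng :: "'a \<Rightarrow> 'a" and zr :: "'o \<Rightarrow> 'o \<Rightarrow> 'a" and idt :: "'o \<Rightarrow> 'a" +
  fixes Sh :: "'o \<Rightarrow> 'o" and sh :: "'a \<Rightarrow> 'a" and tri :: "'o \<Rightarrow> 'o \<Rightarrow> 'o \<Rightarrow> 'a \<Rightarrow> 'a \<Rightarrow> 'a \<Rightarrow> bool"
  assumes arw_sh [simp]: "arw f \<Longrightarrow> arw (sh f)"
    and src_sh [simp]: "src (sh f) = Sh (src f)"
    and tgt_sh [simp]: "tgt (sh f) = Sh (tgt f)"
    and sh_inj: "\<lbrakk>f \<in> hm X Y; g \<in> hm X Y; sh f = sh g\<rbrakk> \<Longrightarrow> f = g"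
    and sh_surj: "g \<in> hm (Sh X) (Sh Y) \<Longrightarrow> \<exists>f \<in> hm X Y. sh f = g"
    and sh_idt [simp]: "sh (idt X) = idt (Sh X)"
    and sh_cmp: "\<lbrakk>arw g; arw f; src g = tgt f\<rbrakk> \<Longrightarrow> sh (g \<bullet> f) = sh g \<bullet> sh f"
    and sh_pls: "\<lbrakk>arw f; arw g; src f = src g; tgt f = tgt g\<rbrakk> \<Longrightarrow> sh (f \<^bold>+ g) = sh f \<^bold>+ sh g"
    and sh_ess: "\<exists>X. isom (Sh X) Y"
    and tri_hm: "tri X Y Z f g h \<Longrightarrow> f \<in> hm X Y \<and> g \<in> hm Y Z \<and> h \<in> hm Z (Sh X)"
    and tri_iso: "\<lbrakk>tri X Y Z f g h; f' \<in> hm X' Y'; g' \<in> hm Y' Z'; h' \<in> hm Z' (Sh X');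
      inv_arws u u'; inv_arws v v'; inv_arws w w'; u \<in> hm X X'; v \<in> hm Y Y'; w \<in> hm Z Z';
      v \<bullet> f = f' \<bullet> u; w \<bullet> g = g' \<bullet> v; sh u \<bullet> h = h' \<bullet> w\<rbrakk> \<Longrightarrow> tri X' Y' Z' f' g' h'"
    and tri_idt: "idt Z = zr Z Z \<Longrightarrow> tri X X Z (idt X) (zr X Z) (zr Z (Sh X))"
    and tri_complete: "f \<in> hm X Y \<Longrightarrow> \<exists>Z g h. tri X Y Z f g h"
    and tri_rot: "\<lbrakk>f \<in> hm X Y; g \<in> hm Y Z; h \<in> hm Z (Sh X)\<rbrakk> \<Longrightarrow>
      tri X Y Z f g h \<longleftrightarrow> tri Y Z (Sh X) g h (ng (sh f))"
    and tri_fill: "\<lbrakk>tri X Y Z f g h; tri X' Y' Z' f' g' h'; u \<in> hm X X'; v \<in> hm Y Y'; v \<bullet> f = f' \<bullet> u\<rbrakk> \<Longrightarrow>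
      \<exists>w \<in> hm Z Z'. w \<bullet> g = g' \<bullet> v \<and> sh u \<bullet> h = h' \<bullet> w"
    and tri_octa: "\<lbrakk>tri X Y A f a a'; tri Y Z B g b b'; tri X Z C (g \<bullet> f) c c'\<rbrakk> \<Longrightarrow>
      \<exists>u v. tri A C B u v (sh a \<bullet> b') \<and> u \<bullet> a = c \<bullet> g \<and> c' \<bullet> u = a' \<and> v \<bullet> c = b \<and> b' \<bullet> v = sh f \<bullet> c'"
begin

lemma sh_zr [simp]: "sh (zr X Y) = zr (Sh X) (Sh Y)"
proof -
  have "sh (zr X Y) \<^bold>+ sh (zr X Y) = sh (zr X Y \<^bold>+ zr X Y)" by (subst sh_pls) auto
  then have e: "sh (zr X Y) \<^bold>+ sh (zr X Y) = sh (zr X Y) \<^bold>+ zr (Sh X) (Sh Y)" by simp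
  show ?thesis by (rule iffD1[OF pls_left_cancel e]) simp_all
qed

lemma sh_ng [simp]: "arw f \<Longrightarrow> sh (ng f) = ng (sh f)"
  by (rule ng_unique) (simp_all add: pls_ng flip: sh_pls)

lemma tri_rotate: "tri X Y Z f g h \<Longrightarrow> tri Y Z (Sh X) g h (ng (sh f))"
  using tri_rot tri_hm by blast

lemma tri_zero:
  assumes t: "tri X Y Z f g h" shows "g \<bullet> f = zr X Z"
proof -
  obtain O' where O: "idt O' = zr O' O'" using zero_ob by blast
  have h: "f \<in> hm X Y" "g \<in> hm Y Z" using tri_hm[OF t] by auto
  then obtain w where "w \<in> hm O' Z" "w \<bullet> zr X O' = g \<bullet> f"
    using tri_fill[OF tri_idt[OF O, of X] t, where u = "idt X" and v = f] by auto
  then show ?thesis by (metis cmp_zr hm_iff)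
qed

lemma tri_zero2: "tri X Y Z f g h \<Longrightarrow> h \<bullet> g = zr Y (Sh X)"
  using tri_zero[OF tri_rotate] .

text \<open>
  Filling in between the rotated triangles on the identity of \<open>W\<close> and on \<open>f\<close> gives a map
  \<open>W[1] \<rightarrow> X[1]\<close>, which comes from a map \<open>W \<rightarrow> X\<close> because the shift is full and faithful.
\<close>

lemma tri_exact1:
  assumes t: "tri X Y Z f g h" and a: "a \<in> hm W Y" "g \<bullet> a = zr W Z"
  obtains b where "b \<in> hm W X" "f \<bullet> b = a"
proof -
  obtain O' where O: "idt O' = zr O' O'" using zero_ob by blast
  have h: "f \<in> hm X Y" "g \<in> hm Y Z" "h \<in> hm Z (Sh X)" using tri_hm[OF t] by auto
  obtain w where w: "w \<in> hm (Sh W) (Sh X)" "sh a \<bullet> ng (sh (idt W)) = ng (sh f) \<bullet> w"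
    using tri_fill[OF tri_rotate[OF tri_idt[OF O, of W]] tri_rotate[OF t] a(1), where v = "zr O' Z"] a h by auto
  obtain b where b: "b \<in> hm W X" "sh b = w" using sh_surj[OF w(1)] by blast
  have "ng (sh a) = ng (sh (f \<bullet> b))" using w(2) a(1) h b w(1) by (simp add: sh_cmp)
  then have "sh (f \<bullet> b) = sh a" using a(1) h(1) b(1) by (metis arw_cmp arw_sh hm_iff ng_ng)
  then have "f \<bullet> b = a" using sh_inj[of "f \<bullet> b" W Y a] a(1) h(1) b(1) by simp
  then show ?thesis using that b by blast
qed

lemma tri_exact2:
  assumes t: "tri X Y Z f g h" and a: "a \<in> hm W Z" "h \<bullet> a = zr W (Sh X)"
  obtains b where "b \<in> hm W Y" "g \<bullet> b = a"
  using tri_exact1[OF tri_rotate[OF t] a] .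

lemma tri_exact3:
  assumes t: "tri X Y Z f g h" and a: "a \<in> hm W (Sh X)" "sh f \<bullet> a = zr W (Sh Y)"
  obtains b where "b \<in> hm W Z" "h \<bullet> b = a"
proof (rule tri_exact1[OF tri_rotate[OF tri_rotate[OF t]] a(1)])
  show "ng (sh f) \<bullet> a = zr W (Sh Y)" using a tri_hm[OF t] by simp
qed (rule that)

lemma tri_zero_idt:
  assumes O0: "idt O0 = zr O0 O0"
  shows "tri O0 W W (zr O0 W) (idt W) (zr W (Sh O0))"
proof -
  have SO: "idt (Sh O0) = zr (Sh O0) (Sh O0)" using O0 by (metis sh_idt sh_zr)
  have "tri W W (Sh O0) (idt W) (zr W (Sh O0)) (ng (sh (zr O0 W)))" using tri_idt[OF SO, of W] by simp
  then show ?thesis by (subst tri_rot) simp_all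
qed

lemma tri_coexact1:
  assumes t: "tri X Y Z f g h" and a: "a \<in> hm Y W" "a \<bullet> f = zr X W"
  obtains b where "b \<in> hm Z W" "b \<bullet> g = a"
proof -
  obtain O0 where O0: "idt O0 = zr O0 O0" using zero_ob by blast
  have hh: "f \<in> hm X Y" "g \<in> hm Y Z" "h \<in> hm Z (Sh X)" using tri_hm[OF t] by auto
  note t' = tri_zero_idt[OF O0, of W]
  have "\<exists>w \<in> hm Z W. w \<bullet> g = idt W \<bullet> a \<and> sh (zr X O0) \<bullet> h = zr W (Sh O0) \<bullet> w"
    by (rule tri_fill[OF t t']) (use a hh in simp_all)
  then obtain w where "w \<in> hm Z W" "w \<bullet> g = idt W \<bullet> a" by blast
  then show ?thesis using that a by simp
qed

lemma tri_coexact2: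
  assumes t: "tri X Y Z f g h" and a: "a \<in> hm Z W" "a \<bullet> g = zr Y W"
  obtains b where "b \<in> hm (Sh X) W" "b \<bullet> h = a"
  using tri_coexact1[OF tri_rotate[OF t] a] .

lemma tri_coexact3:
  assumes t: "tri X Y Z f g h" and a: "a \<in> hm (Sh X) W" "a \<bullet> h = zr Z W"
  obtains b where "b \<in> hm (Sh Y) W" "b \<bullet> sh f = a"
proof -
  obtain b where b: "b \<in> hm (Sh Y) W" "b \<bullet> ng (sh f) = a"
    using tri_coexact2[OF tri_rotate[OF t] a] .
  have "f \<in> hm X Y" using tri_hm[OF t] by auto
  then show ?thesis using that[of "ng b"] b by simp
qed

text \<open>
  With \<open>h = 0\<close>, the identity of \<open>Z\<close> lifts to a section \<open>s\<close> of \<open>g\<close>, and \<open>f\<close> is a monomorphism since what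
  it kills comes from \<open>h\<close>.  The retraction of \<open>f\<close> is the lift of \<open>1 - s \<bullet> g\<close> along \<open>f\<close>.
\<close>

lemma tri_split:
  assumes t: "tri X Y Z f g h" and h0: "h = zr Z (Sh X)"
  obtains p s where "bip Y X Z f p s g"
proof -
  have hh: "f \<in> hm X Y" "g \<in> hm Y Z" "h \<in> hm Z (Sh X)" using tri_hm[OF t] by auto
  obtain s where s: "s \<in> hm Z Y" "g \<bullet> s = idt Z"
    by (rule tri_exact2[OF t, of "idt Z" Z]) (use h0 in auto)
  note r = cmp_reassoc[OF s(2)]
  have gf: "g \<bullet> f = zr X Z" by (rule tri_zero[OF t])
  note r2 = cmp_reassoc[OF gf]
  have mono: "b = zr W X" if bb: "b \<in> hm W X" "f \<bullet> b = zr W Y" for b W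
  proof -
    have z: "sh f \<bullet> sh b = zr (Sh W) (Sh Y)" using bb hh by (metis sh_cmp sh_zr hm_iff)
    obtain c where "c \<in> hm (Sh W) Z" "h \<bullet> c = sh b"
      by (rule tri_exact3[OF t, of "sh b" "Sh W"]) (use bb z in simp_all)
    then have "sh b = sh (zr W X)" using h0 bb by simp
    then show ?thesis using sh_inj[of b W X "zr W X"] bb by simp
  qed
  obtain p where p: "p \<in> hm Y X" "f \<bullet> p = idt Y \<^bold>- s \<bullet> g"
    by (rule tri_exact1[OF t, of "idt Y \<^bold>- s \<bullet> g" Y]) (use hh s in \<open>simp_all add: cmp_mns_right r\<close>)
  have "f \<bullet> (p \<bullet> f \<^bold>- idt X) = zr X Y"
    using cmp_reassoc[OF p(2), of f] p(1) hh s(1) gf by (simp add: cmp_mns_right cmp_mns_left)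
  then have "p \<bullet> f \<^bold>- idt X = zr X X" by (intro mono) (use p(1) hh in simp_all)
  then have pf: "p \<bullet> f = idt X" using p(1) hh by (simp add: mns_eq_zr)
  have "f \<bullet> (p \<bullet> s) = zr Z Y"
    using cmp_reassoc[OF p(2), of s] p(1) hh s by (simp add: cmp_mns_left)
  then have ps: "p \<bullet> s = zr Z X" by (intro mono) (use p(1) s(1) in simp_all)
  have "f \<bullet> p \<^bold>+ s \<bullet> g = idt Y" unfolding p(2) using s hh by (simp add: mns_pls_cancel)
  then show ?thesis using that[of p s] hh p(1) s gf pf ps unfolding bip_def by blast
qed

text \<open>
  Complete \<open>k\<close> to a triangle and rotate back twice.  Its third object is a shift only up to
  isomorphism, and the signs of the two rotations are absorbed into the maps.
\<close>

lemma tri_cocone: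
  assumes k: "k \<in> hm B (Sh A)"
  obtains W a b where "tri A W B a b k"
proof -
  obtain C c c' where t: "tri B (Sh A) C k c c'" using tri_complete[OF k] by blast
  have hh: "c \<in> hm (Sh A) C" "c' \<in> hm C (Sh B)" using tri_hm[OF t] by auto
  obtain W where "isom (Sh W) C" using sh_ess by blast
  then obtain th th' where th: "th \<in> hm (Sh W) C" "th' \<in> hm C (Sh W)" "th' \<bullet> th = idt (Sh W)" "th \<bullet> th' = idt C"
    by (rule isomE)
  obtain a where a: "a \<in> hm A W" "sh a = th' \<bullet> c" using sh_surj[of "th' \<bullet> c" A W] th hh by auto
  obtain b where b: "b \<in> hm W B" "sh b = c' \<bullet> th" using sh_surj[of "c' \<bullet> th" W B] th hh by auto
  have "tri B (Sh A) (Sh W) k (sh a) (sh b)"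
  proof (rule tri_iso[OF t])
    show "inv_arws (idt B) (idt B)" "inv_arws (idt (Sh A)) (idt (Sh A))" unfolding inv_arws_def by simp_all
    show "inv_arws th' th" using th unfolding inv_arws_def by simp
    show "th' \<bullet> c = sh a \<bullet> idt (Sh A)" using a th hh by simp
    show "sh (idt B) \<bullet> c' = sh b \<bullet> th'" using b th hh by simp
  qed (use a b th hh k in simp_all)
  then have "tri B (Sh A) (Sh W) k (ng (sh (ng a))) (ng (sh (ng b)))" using a(1) b(1) by simp
  then have "tri W B (Sh A) (ng b) k (ng (sh (ng a)))" using a(1) b(1) k by (subst tri_rot) simp_all
  then have "tri A W B (ng a) (ng b) k" using a(1) b(1) k by (subst tri_rot) simp_all
  then show ?thesis by (rule that)
qed

text \<open>
  The octahedral axiom for the composite \<open>w \<bullet> b'\<close>.  The object \<open>W\<close> is the homotopy pullback of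
  \<open>b\<close> and \<open>b'\<close>: it lies over \<open>B'\<close> with fibre \<open>A\<close> and over \<open>B\<close> with fibre \<open>A'\<close>.
\<close>

lemma homotopy_pullback:
  assumes t: "tri A B C a b w" and t': "tri A' B' C a' b' w'"
  obtains W u v x y where "tri A W B' u v (w \<bullet> b')" "tri A' W B x y (w' \<bullet> b)"
proof -
  have hh: "a \<in> hm A B" "b \<in> hm B C" "w \<in> hm C (Sh A)" using tri_hm[OF t] by auto
  have hh': "a' \<in> hm A' B'" "b' \<in> hm B' C" "w' \<in> hm C (Sh A')" using tri_hm[OF t'] by auto
  obtain W u v where W: "tri A W B' u v (w \<bullet> b')" using tri_cocone[of "w \<bullet> b'" B' A] hh hh' by auto
  have hW: "u \<in> hm A W" "v \<in> hm W B'" using tri_hm[OF W] by auto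
  \<comment> \<open>the octahedron gives the second triangle shifted once; the sign of the third map moves to the identity of \<open>Sh W\<close>\<close>
  obtain x y where xy: "tri (Sh A') (Sh W) (Sh B) x y (sh w' \<bullet> ng (sh b))"
    using tri_octa[OF tri_rotate[OF t'] tri_rotate[OF tri_rotate[OF t]] tri_rotate[OF tri_rotate[OF W]]] by blast
  have hx: "x \<in> hm (Sh A') (Sh W)" "y \<in> hm (Sh W) (Sh B)" using tri_hm[OF xy] by auto
  obtain x0 where x0: "x0 \<in> hm A' W" "sh x0 = x" using sh_surj[OF hx(1)] by blast
  obtain y0 where y0: "y0 \<in> hm W B" "sh y0 = y" using sh_surj[OF hx(2)] by blast
  have "tri (Sh A') (Sh W) (Sh B) (ng (sh x0)) (ng (sh y0)) (ng (sh (w' \<bullet> b)))"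
  proof (rule tri_iso[OF xy, where u = "idt (Sh A')" and v = "ng (idt (Sh W))" and w = "idt (Sh B)"
      and u' = "idt (Sh A')" and v' = "ng (idt (Sh W))" and w' = "idt (Sh B)"])
    show "ng (idt (Sh W)) \<bullet> x = ng (sh x0) \<bullet> idt (Sh A')"
      "idt (Sh B) \<bullet> y = ng (sh y0) \<bullet> ng (idt (Sh W))" using x0 y0 by auto
    show "sh (idt (Sh A')) \<bullet> sh w' \<bullet> ng (sh b) = ng (sh (w' \<bullet> b)) \<bullet> idt (Sh B)"
      using hh hh' by (simp add: sh_cmp)
  qed (use x0(1) y0(1) hh hh' in \<open>simp_all add: inv_arws_def\<close>)
  then have "tri B (Sh A') (Sh W) (w' \<bullet> b) (ng (sh x0)) (ng (sh y0))"
    using x0(1) y0(1) hh hh' by (subst tri_rot) simp_all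
  then have "tri W B (Sh A') y0 (w' \<bullet> b) (ng (sh x0))"
    using x0(1) y0(1) hh hh' by (subst tri_rot) simp_all
  then have "tri A' W B x0 y0 (w' \<bullet> b)"
    using x0(1) y0(1) hh hh' by (subst tri_rot) simp_all
  then show ?thesis using that W by blast
qed

lemma bip_hm: "bip W A B i p j q \<Longrightarrow> i \<in> hm A W \<and> p \<in> hm W A \<and> j \<in> hm B W \<and> q \<in> hm W B"
  unfolding bip_def by blast

lemma bip_eqs: "bip W A B i p j q \<Longrightarrow>
     p \<bullet> i = idt A \<and> q \<bullet> j = idt B \<and> p \<bullet> j = zr B A \<and> q \<bullet> i = zr A B"
  unfolding bip_def by blast

lemma bip_expand:
  assumes "bip W A B i p j q" "a \<in> hm V W"
  shows "a = i \<bullet> (p \<bullet> a) \<^bold>+ j \<bullet> (q \<bullet> a)"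
proof -
  have "idt W \<bullet> a = (i \<bullet> p \<^bold>+ j \<bullet> q) \<bullet> a" using assms(1) unfolding bip_def by simp
  then show ?thesis using assms bip_hm[OF assms(1)] by (simp add: cmp_pls_left)
qed

lemma bip_ext:
  assumes b: "bip W A B i p j q" and "a \<in> hm V W" "a' \<in> hm V W" "p \<bullet> a = p \<bullet> a'" "q \<bullet> a = q \<bullet> a'"
  shows "a = a'"
  using bip_expand[OF b assms(2)] bip_expand[OF b assms(3)] assms(4,5) by simp

lemma bip_sh:
  assumes "bip W A B i p j q"
  shows "bip (Sh W) (Sh A) (Sh B) (sh i) (sh p) (sh j) (sh q)"
proof -
  note h = bip_hm[OF assms] and e = bip_eqs[OF assms]
  have "sh (i \<bullet> p \<^bold>+ j \<bullet> q) = idt (Sh W)" using assms unfolding bip_def by simp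
  moreover have "sh (i \<bullet> p \<^bold>+ j \<bullet> q) = sh i \<bullet> sh p \<^bold>+ sh j \<bullet> sh q" using h by (simp add: sh_pls sh_cmp)
  moreover have "sh (p \<bullet> i) = sh p \<bullet> sh i" "sh (q \<bullet> j) = sh q \<bullet> sh j"
    "sh (p \<bullet> j) = sh p \<bullet> sh j" "sh (q \<bullet> i) = sh q \<bullet> sh i" using h by (simp_all add: sh_cmp)
  ultimately show ?thesis using h e unfolding bip_def by simp
qed

text \<open>
  Filling in on both summands gives a map from \<open>ZZ\<close> to a cone of the direct sum of \<open>f\<close> and \<open>f'\<close>.  By
  the argument of the five lemma it induces bijections on the maps from every object, so it is an
  isomorphism of triangles.
\<close>

lemma tri_bip:
  assumes t: "tri X Y Z f g h" and t': "tri X' Y' Z' f' g' h'"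
    and bX: "bip XX X X' iX pX jX qX" and bY: "bip YY Y Y' iY pY jY qY" and bZ: "bip ZZ Z Z' iZ pZ jZ qZ"
  shows "tri XX YY ZZ (iY \<bullet> (f \<bullet> pX) \<^bold>+ jY \<bullet> (f' \<bullet> qX)) (iZ \<bullet> (g \<bullet> pY) \<^bold>+ jZ \<bullet> (g' \<bullet> qY))
      (sh iX \<bullet> (h \<bullet> pZ) \<^bold>+ sh jX \<bullet> (h' \<bullet> qZ))"
proof -
  let ?F = "iY \<bullet> (f \<bullet> pX) \<^bold>+ jY \<bullet> (f' \<bullet> qX)"
  let ?G = "iZ \<bullet> (g \<bullet> pY) \<^bold>+ jZ \<bullet> (g' \<bullet> qY)"
  let ?H = "sh iX \<bullet> (h \<bullet> pZ) \<^bold>+ sh jX \<bullet> (h' \<bullet> qZ)"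
  note hx = bip_hm[OF bX] bip_hm[OF bY] bip_hm[OF bZ] bip_hm[OF bip_sh[OF bX]] tri_hm[OF t] tri_hm[OF t']
  note eq = bip_eqs[OF bX] bip_eqs[OF bY] bip_eqs[OF bZ] bip_eqs[OF bip_sh[OF bX]]
  have re: "pX \<bullet> (iX \<bullet> x) = x" if "x \<in> hm W X" for x W using eq hx that cmp_reassoc[of pX iX "idt X" x] by simp
  have FX: "?F \<in> hm XX YY" "?G \<in> hm YY ZZ" "?H \<in> hm ZZ (Sh XX)" using hx by simp_all
  have proj: "pY \<bullet> ?F = f \<bullet> pX" "qY \<bullet> ?F = f' \<bullet> qX" "pZ \<bullet> ?G = g \<bullet> pY" "qZ \<bullet> ?G = g' \<bullet> qY"
    "sh pX \<bullet> ?H = h \<bullet> pZ" "sh qX \<bullet> ?H = h' \<bullet> qZ"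
    using hx eq cmp_reassoc[of pY iY "idt Y"] cmp_reassoc[of pY jY "zr Y' Y"] cmp_reassoc[of qY jY "idt Y'"] cmp_reassoc[of qY iY "zr Y Y'"]
     cmp_reassoc[of pZ iZ "idt Z"] cmp_reassoc[of pZ jZ "zr Z' Z"] cmp_reassoc[of qZ jZ "idt Z'"] cmp_reassoc[of qZ iZ "zr Z Z'"]
     cmp_reassoc[of "sh pX" "sh iX" "idt (Sh X)"] cmp_reassoc[of "sh pX" "sh jX" "zr (Sh X') (Sh X)"]
     cmp_reassoc[of "sh qX" "sh jX" "idt (Sh X')"] cmp_reassoc[of "sh qX" "sh iX" "zr (Sh X) (Sh X')"]
    by (simp_all add: cmp_pls_right)
  have Fi: "?F \<bullet> iX = iY \<bullet> f" "?F \<bullet> jX = jY \<bullet> f'"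
    using hx eq by (simp_all add: cmp_pls_left)
  \<comment> \<open>a cone of the direct sum, to be compared with \<open>ZZ\<close>\<close>
  obtain C G H where T: "tri XX YY C ?F G H" using tri_complete[OF FX(1)] by blast
  have hT: "G \<in> hm YY C" "H \<in> hm C (Sh XX)" using tri_hm[OF T] by auto
  have "\<exists>w \<in> hm Z C. w \<bullet> g = G \<bullet> iY \<and> sh iX \<bullet> h = H \<bullet> w"
    by (rule tri_fill[OF t T]) (use hx Fi in simp_all)
  then obtain z where z: "z \<in> hm Z C" "z \<bullet> g = G \<bullet> iY" "sh iX \<bullet> h = H \<bullet> z" by blast
  have "\<exists>w \<in> hm Z' C. w \<bullet> g' = G \<bullet> jY \<and> sh jX \<bullet> h' = H \<bullet> w"
    by (rule tri_fill[OF t' T]) (use hx Fi in simp_all)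
  then obtain z' where z': "z' \<in> hm Z' C" "z' \<bullet> g' = G \<bullet> jY" "sh jX \<bullet> h' = H \<bullet> z'" by blast
  let ?th = "z \<bullet> pZ \<^bold>+ z' \<bullet> qZ"
  have th: "?th \<in> hm ZZ C" using z(1) z'(1) hx by simp
  have thG: "?th \<bullet> ?G = G"
  proof -
    have "?th \<bullet> ?G = z \<bullet> (pZ \<bullet> ?G) \<^bold>+ z' \<bullet> (qZ \<bullet> ?G)" using z(1) z'(1) hx FX by (simp add: cmp_pls_left)
    also have "\<dots> = (z \<bullet> g) \<bullet> pY \<^bold>+ (z' \<bullet> g') \<bullet> qY" unfolding proj using z(1) z'(1) hx by simp
    also have "\<dots> = G \<bullet> (iY \<bullet> pY \<^bold>+ jY \<bullet> qY)" unfolding z(2) z'(2) using hT hx by (simp add: cmp_pls_right)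
    also have "\<dots> = G" using hT bY unfolding bip_def by simp
    finally show ?thesis .
  qed
  have Hth: "H \<bullet> ?th = ?H"
  proof -
    have "H \<bullet> ?th = (H \<bullet> z) \<bullet> pZ \<^bold>+ (H \<bullet> z') \<bullet> qZ" using z(1) z'(1) hx hT by (simp add: cmp_pls_right)
    also have "\<dots> = ?H" unfolding z(3)[symmetric] z'(3)[symmetric] using hx by simp
    finally show ?thesis .
  qed
  have mono: "a = zr W ZZ" if a: "a \<in> hm W ZZ" "?th \<bullet> a = zr W C" for a W
  proof -
    have "?H \<bullet> a = zr W (Sh XX)" unfolding Hth[symmetric] using a th hT by simp
    then have Ha: "(sh pX \<bullet> ?H) \<bullet> a = zr W (Sh X)" "(sh qX \<bullet> ?H) \<bullet> a = zr W (Sh X')"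
      using a(1) hx FX by simp_all
    obtain y1 where y1: "y1 \<in> hm W Y" "g \<bullet> y1 = pZ \<bullet> a"
      by (rule tri_exact2[OF t, of "pZ \<bullet> a" W]) (use Ha(1)[unfolded proj] hx a(1) in simp_all)
    obtain y2 where y2: "y2 \<in> hm W Y'" "g' \<bullet> y2 = qZ \<bullet> a"
      by (rule tri_exact2[OF t', of "qZ \<bullet> a" W]) (use Ha(2)[unfolded proj] hx a(1) in simp_all)
    let ?y = "iY \<bullet> y1 \<^bold>+ jY \<bullet> y2"
    have y: "?y \<in> hm W YY" using y1 y2 hx by simp
    have py: "pY \<bullet> ?y = y1" "qY \<bullet> ?y = y2"
      using y1(1) y2(1) hx eq cmp_reassoc[of pY iY "idt Y" y1] cmp_reassoc[of pY jY "zr Y' Y" y2]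
        cmp_reassoc[of qY jY "idt Y'" y2] cmp_reassoc[of qY iY "zr Y Y'" y1] by (simp_all add: cmp_pls_right)
    have Gy: "?G \<bullet> ?y = a"
    proof (rule bip_ext[OF bZ])
      have "pZ \<bullet> (?G \<bullet> ?y) = (pZ \<bullet> ?G) \<bullet> ?y" using hx FX y by simp
      also have "\<dots> = g \<bullet> (pY \<bullet> ?y)" unfolding proj using hx y by simp
      finally show "pZ \<bullet> (?G \<bullet> ?y) = pZ \<bullet> a" unfolding py y1 .
      have "qZ \<bullet> (?G \<bullet> ?y) = (qZ \<bullet> ?G) \<bullet> ?y" using hx FX y by simp
      also have "\<dots> = g' \<bullet> (qY \<bullet> ?y)" unfolding proj using hx y by simp
      finally show "qZ \<bullet> (?G \<bullet> ?y) = qZ \<bullet> a" unfolding py y2 .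
    qed (use FX y a in simp_all)
    have "G \<bullet> ?y = zr W C"
      using cmp_reassoc[OF thG, of ?y] th FX y a(2) unfolding Gy by simp
    then obtain x where x: "x \<in> hm W XX" "?F \<bullet> x = ?y" using tri_exact1[OF T y] by metis
    have "y1 = f \<bullet> (pX \<bullet> x)" using py(1) cmp_reassoc[OF proj(1), of x] x FX hx by simp
    then have "pZ \<bullet> a = zr W Z" using y1(2) cmp_reassoc[OF tri_zero[OF t], of "pX \<bullet> x"] x(1) hx by simp
    moreover have "y2 = f' \<bullet> (qX \<bullet> x)" using py(2) cmp_reassoc[OF proj(2), of x] x FX hx by simp
    then have "qZ \<bullet> a = zr W Z'" using y2(2) cmp_reassoc[OF tri_zero[OF t'], of "qX \<bullet> x"] x(1) hx by simp
    ultimately show ?thesis using bip_expand[OF bZ a(1)] hx by simp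
  qed
  have epi: "\<exists>a \<in> hm W ZZ. ?th \<bullet> a = c" if c: "c \<in> hm W C" for c W
  proof -
    have z0: "sh ?F \<bullet> (H \<bullet> c) = zr W (Sh YY)"
      using cmp_reassoc[OF tri_zero[OF tri_rotate[OF tri_rotate[OF T]]], of c] hT c FX by simp
    have shF: "sh ?F = sh iY \<bullet> (sh f \<bullet> sh pX) \<^bold>+ sh jY \<bullet> (sh f' \<bullet> sh qX)"
      using hx by (simp add: sh_pls sh_cmp)
    have sp: "sh pY \<bullet> sh ?F = sh f \<bullet> sh pX" "sh qY \<bullet> sh ?F = sh f' \<bullet> sh qX"
      using proj(1,2) FX hx by (metis hm_iff sh_cmp)+
    have "sh f \<bullet> (sh pX \<bullet> (H \<bullet> c)) = zr W (Sh Y)"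
      using cmp_reassoc[OF sp(1), of "H \<bullet> c"] z0 FX hx hT c by simp
    then obtain a1 where a1: "a1 \<in> hm W Z" "h \<bullet> a1 = sh pX \<bullet> (H \<bullet> c)"
      using tri_exact3[OF t, of "sh pX \<bullet> (H \<bullet> c)" W] hx hT c by auto
    have "sh f' \<bullet> (sh qX \<bullet> (H \<bullet> c)) = zr W (Sh Y')"
      using cmp_reassoc[OF sp(2), of "H \<bullet> c"] z0 FX hx hT c by simp
    then obtain a2 where a2: "a2 \<in> hm W Z'" "h' \<bullet> a2 = sh qX \<bullet> (H \<bullet> c)"
      using tri_exact3[OF t', of "sh qX \<bullet> (H \<bullet> c)" W] hx hT c by auto
    let ?a = "iZ \<bullet> a1 \<^bold>+ jZ \<bullet> a2"
    have a: "?a \<in> hm W ZZ" using a1 a2 hx by simp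
    have pa: "pZ \<bullet> ?a = a1" "qZ \<bullet> ?a = a2"
      using a1(1) a2(1) hx eq cmp_reassoc[of pZ iZ "idt Z" a1] cmp_reassoc[of pZ jZ "zr Z' Z" a2]
        cmp_reassoc[of qZ jZ "idt Z'" a2] cmp_reassoc[of qZ iZ "zr Z Z'" a1] by (simp_all add: cmp_pls_right)
    have Ha: "?H \<bullet> ?a = H \<bullet> c"
    proof (rule bip_ext[OF bip_sh[OF bX]])
      have "sh pX \<bullet> (?H \<bullet> ?a) = (sh pX \<bullet> ?H) \<bullet> ?a" using hx FX a by simp
      also have "\<dots> = h \<bullet> (pZ \<bullet> ?a)" unfolding proj using hx a by simp
      finally show "sh pX \<bullet> (?H \<bullet> ?a) = sh pX \<bullet> (H \<bullet> c)" unfolding pa a1 .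
      have "sh qX \<bullet> (?H \<bullet> ?a) = (sh qX \<bullet> ?H) \<bullet> ?a" using hx FX a by simp
      also have "\<dots> = h' \<bullet> (qZ \<bullet> ?a)" unfolding proj using hx a by simp
      finally show "sh qX \<bullet> (?H \<bullet> ?a) = sh qX \<bullet> (H \<bullet> c)" unfolding pa a2 .
    qed (use FX a hT c in simp_all)
    have "H \<bullet> (?th \<bullet> ?a) = H \<bullet> c" using cmp_reassoc[OF Hth, of ?a] Ha hT th a by simp
    then have d: "c \<^bold>- ?th \<bullet> ?a \<in> hm W C" "H \<bullet> (c \<^bold>- ?th \<bullet> ?a) = zr W (Sh XX)"
      using hT th a c by (simp_all add: cmp_mns_right)
    obtain y where y: "y \<in> hm W YY" "G \<bullet> y = c \<^bold>- ?th \<bullet> ?a" by (rule tri_exact2[OF T d])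
    have "?th \<bullet> (?G \<bullet> y) = c \<^bold>- ?th \<bullet> ?a" using cmp_reassoc[OF thG, of y] th FX y by simp
    then have "?th \<bullet> (?G \<bullet> y \<^bold>+ ?a) = (c \<^bold>- ?th \<bullet> ?a) \<^bold>+ ?th \<bullet> ?a"
      using th FX y(1) a by (simp add: cmp_pls_right[of ?th])
    also have "\<dots> = c" using th a c by (intro mns_pls_cancel) simp_all
    finally show ?thesis using FX y(1) a by (intro bexI[of _ "?G \<bullet> y \<^bold>+ ?a"]) simp_all
  qed
  obtain v where v: "v \<in> hm C ZZ" "?th \<bullet> v = idt C" using epi[of "idt C" C] by auto
  have "?th \<bullet> (v \<bullet> ?th \<^bold>- idt ZZ) = zr ZZ C"
    using cmp_reassoc[OF v(2), of ?th] v(1) th by (simp add: cmp_mns_right[of ?th])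
  then have "v \<bullet> ?th \<^bold>- idt ZZ = zr ZZ ZZ" by (intro mono) (use v(1) th in simp_all)
  then have v2: "v \<bullet> ?th = idt ZZ" using v(1) th by (simp add: mns_eq_zr)
  show ?thesis
  proof (rule tri_iso[OF T FX, where u = "idt XX" and v = "idt YY" and w = v and u' = "idt XX" and v' = "idt YY" and w' = ?th])
    show "inv_arws v ?th" using v v2 th unfolding inv_arws_hm by blast
    show "v \<bullet> G = ?G \<bullet> idt YY" using cmp_reassoc[OF v2, of ?G] thG v(1) th FX by simp
    show "sh (idt XX) \<bullet> H = ?H \<bullet> v" using cmp_reassoc[of H ?th ?H v] Hth v th hT by simp
  qed (use v FX in \<open>simp_all add: inv_arws_def\<close>)
qed

end

context tri_ks
begin

lemma tri_fibre:
  assumes g: "g \<in> hm Y Z"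
  obtains X f h where "tri X Y Z f g h"
proof -
  obtain C c d where t: "tri Y Z C g c d" using tri_complete[OF g] by blast
  have hh: "c \<in> hm Z C" "d \<in> hm C (Sh Y)" using tri_hm[OF t] by auto
  obtain X where "isom (Sh X) C" using sh_ess by blast
  then obtain th th' where th: "th \<in> hm (Sh X) C" "th' \<in> hm C (Sh X)" "th' \<bullet> th = idt (Sh X)" "th \<bullet> th' = idt C"
    by (rule isomE)
  obtain f where f: "f \<in> hm X Y" "sh f = d \<bullet> th" using sh_surj[of "d \<bullet> th" X Y] th hh by auto
  have "tri Y Z (Sh X) g (th' \<bullet> c) (sh f)"
  proof (rule tri_iso[OF t, where u = "idt Y" and u' = "idt Y" and v = "idt Z" and v' = "idt Z" and w = th' and w' = th])
    show "inv_arws th' th" using th unfolding inv_arws_def by simp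
    show "sh (idt Y) \<bullet> d = sh f \<bullet> th'" using f th hh by simp
  qed (use f(1) th hh g in \<open>simp_all add: inv_arws_def\<close>)
  then have "tri Y Z (Sh X) g (th' \<bullet> c) (ng (sh (ng f)))" using f(1) by simp
  then have "tri X Y Z (ng f) g (th' \<bullet> c)" by (subst tri_rot) (use f(1) g th hh in simp_all)
  then show ?thesis by (rule that)
qed

lemma thru_sh: "x \<in> thru U X Y \<Longrightarrow> sh x \<in> thru (Sh U) (Sh X) (Sh Y)"
proof (induction rule: thru.induct)
  case thru_zr
  then show ?case using thru.thru_zr by simp
next
  case (thru_step f g r)
  then have "sh g \<bullet> sh f \<^bold>+ sh r \<in> thru (Sh U) (Sh X) (Sh Y)" by (intro thru.thru_step) auto
  then show ?case using thru_step thru_hm[of r] by (simp add: sh_pls sh_cmp)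
qed

lemma gen_sh: "gen U Q \<Longrightarrow> gen (Sh U) (Sh Q)"
  unfolding gen_def using thru_sh by fastforce

lemma dec_sh: "dec X c Ys \<Longrightarrow> dec (Sh X) (sh c) (map Sh Ys)"
proof (induction rule: dec.induct)
  case dec_Nil
  then show ?case using dec.dec_Nil[of "Sh X"] by simp
next
  case (dec_Cons c Ys i Y p)
  note h = dec_Cons.hyps(2,3) dec_idem[OF dec_Cons.hyps(1)]
  have "dec (Sh X) (sh i \<bullet> sh p \<^bold>+ sh c) (Sh Y # map Sh Ys)"
  proof (rule dec.dec_Cons[OF dec_Cons.IH])
    have "sh (p \<bullet> i) = idt (Sh Y)" "sh (p \<bullet> c) = zr (Sh X) (Sh Y)" "sh (c \<bullet> i) = zr (Sh Y) (Sh X)"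
      unfolding dec_Cons.hyps by simp_all
    then show "sh p \<bullet> sh i = idt (Sh Y)" "sh p \<bullet> sh c = zr (Sh X) (Sh Y)" "sh c \<bullet> sh i = zr (Sh Y) (Sh X)"
      using h by (simp_all add: sh_cmp)
  qed (use h in simp_all)
  then show ?case using h by (simp add: sh_pls sh_cmp)
qed

lemma isom_sh: "isom X Y \<Longrightarrow> isom (Sh X) (Sh Y)"
proof -
  assume "isom X Y"
  then obtain f g where fg: "f \<in> hm X Y" "g \<in> hm Y X" "g \<bullet> f = idt X" "f \<bullet> g = idt Y" by (rule isomE)
  then have "sh (g \<bullet> f) = idt (Sh X)" "sh (f \<bullet> g) = idt (Sh Y)" by simp_all
  then show ?thesis using fg(1,2) by (intro isomI[of "sh f" _ _ "sh g"]) (simp_all add: sh_cmp)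
qed

section \<open>Presentations and indices\<close>

definition kills :: "'o \<Rightarrow> 'a \<Rightarrow> bool" where
  "kills U w \<longleftrightarrow> (\<forall>b \<in> hm U (src w). w \<bullet> b = zr U (tgt w))"

text \<open>
  If \<open>U\<close> is rigid, the last condition holds for every such triangle, and \<open>pres\<close> below describes
  \<open>pr(U)\<close>.  It is imposed separately because presentations by an object \<open>S\<close> that is only
  \<open>R[1]\<close>-rigid are needed as well, and it is all that the uniqueness of indices requires.
\<close>

definition upres :: "'o \<Rightarrow> 'o \<Rightarrow> 'o \<Rightarrow> 'o \<Rightarrow> 'a \<Rightarrow> 'a \<Rightarrow> 'a \<Rightarrow> bool" where
  "upres U C U1 U0 f g w \<longleftrightarrow> tri U1 U0 C f g w \<and> gen U U1 \<and> gen U U0 \<and> kills U w"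

definition pres :: "'o \<Rightarrow> 'o \<Rightarrow> bool" where
  "pres U C \<longleftrightarrow> (\<exists>U1 U0 f g w. upres U C U1 U0 f g w)"

text \<open>
  The class \<open>[U0] - [U1]\<close> in the split Grothendieck group of \<open>add U\<close>, as a function of the isomorphism
  class of the summand; it does not depend on the presentation by \<open>idx_eq\<close>.
\<close>

definition idx :: "'o \<Rightarrow> 'o \<Rightarrow> 'o set \<Rightarrow> int" where
  "idx U C = (SOME d. \<exists>U1 U0 f g w. upres U C U1 U0 f g w \<and>
     d = (\<lambda>r. int (count (cls U0) r) - int (count (cls U1) r)))"

lemma kills_gen:
  assumes "kills U w" "w \<in> hm C Z" "gen U V" "b \<in> hm V C"
  shows "w \<bullet> b = zr V Z"
  by (rule gen_vanish_right[OF assms(3,2) _ assms(4)]) (use assms(1,2) in \<open>simp add: kills_def\<close>)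

text \<open>
  The homotopy pullback of \<open>b\<close> and \<open>b'\<close> is an extension of \<open>B'\<close> by \<open>A\<close> and one of \<open>B\<close> by \<open>A'\<close>.  Both
  split, since \<open>w\<close> and \<open>w'\<close> vanish on objects of \<open>add U\<close>.
\<close>

lemma schanuel:
  assumes t: "tri A B C a b w" "kills U w" "gen U B" and t': "tri A' B' C a' b' w'" "kills U w'" "gen U B'"
  shows "cls A + cls B' = cls A' + cls B"
proof -
  have hh: "b \<in> hm B C" "w \<in> hm C (Sh A)" "b' \<in> hm B' C" "w' \<in> hm C (Sh A')"
    using tri_hm[OF t(1)] tri_hm[OF t'(1)] by auto
  obtain W u v x y where W: "tri A W B' u v (w \<bullet> b')" "tri A' W B x y (w' \<bullet> b)"
    using homotopy_pullback[OF t(1) t'(1)] .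
  have "w \<bullet> b' = zr B' (Sh A)" "w' \<bullet> b = zr B (Sh A')"
    using kills_gen[OF t(2)] kills_gen[OF t'(2)] t(3) t'(3) hh by blast+
  then show ?thesis using tri_split[OF W(1)] tri_split[OF W(2)] cls_bip by metis
qed

lemma idx_eq:
  assumes "upres U C U1 U0 f g w"
  shows "idx U C = (\<lambda>r. int (count (cls U0) r) - int (count (cls U1) r))"
proof -
  let ?P = "\<lambda>d. \<exists>V1 V0 f g w. upres U C V1 V0 f g w \<and> d = (\<lambda>r. int (count (cls V0) r) - int (count (cls V1) r))"
  have "?P (\<lambda>r. int (count (cls U0) r) - int (count (cls U1) r))"
    by (intro exI conjI, rule assms, rule refl)
  then have "?P (idx U C)" unfolding idx_def by (rule someI[of ?P])
  then obtain V1 V0 f' g' w' where V: "upres U C V1 V0 f' g' w'"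
    and e: "idx U C = (\<lambda>r. int (count (cls V0) r) - int (count (cls V1) r))" by blast
  have u: "tri U1 U0 C f g w" "kills U w" "gen U U0" and v: "tri V1 V0 C f' g' w'" "kills U w'" "gen U V0"
    using assms V unfolding upres_def by auto
  have s: "cls U1 + cls V0 = cls V1 + cls U0" by (rule schanuel[OF u v])
  show ?thesis unfolding e
  proof
    fix r
    have "int (count (cls U1 + cls V0) r) = int (count (cls V1 + cls U0) r)" unfolding s ..
    then show "int (count (cls V0) r) - int (count (cls V1) r) = int (count (cls U0) r) - int (count (cls U1) r)" by simp
  qed
qed

lemma upres_isom:
  assumes p: "upres U C U1 U0 f g w" and i: "isom C C'"
  obtains g' w' where "upres U C' U1 U0 f g' w'"
proof -
  have t: "tri U1 U0 C f g w" using p unfolding upres_def by blast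
  have hh: "f \<in> hm U1 U0" "g \<in> hm U0 C" "w \<in> hm C (Sh U1)" using tri_hm[OF t] by auto
  obtain th th' where th: "th \<in> hm C C'" "th' \<in> hm C' C" "th' \<bullet> th = idt C" "th \<bullet> th' = idt C'"
    using i by (rule isomE)
  have "tri U1 U0 C' f (th \<bullet> g) (w \<bullet> th')"
  proof (rule tri_iso[OF t, where u = "idt U1" and u' = "idt U1" and v = "idt U0" and v' = "idt U0" and w = th and w' = th'])
    show "inv_arws th th'" using th unfolding inv_arws_def by simp
  qed (use th hh in \<open>simp_all add: inv_arws_def\<close>)
  moreover have "kills U (w \<bullet> th')"
    using p th(1,2) hh unfolding upres_def kills_def by simp
  ultimately show ?thesis using that p unfolding upres_def by blast
qed

lemma pres_isom: "\<lbrakk>pres U C; isom C C'\<rbrakk> \<Longrightarrow> pres U C' \<and> idx U C' = idx U C"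
proof -
  assume "pres U C" "isom C C'"
  then obtain U1 U0 f g w where u1: "upres U C U1 U0 f g w" unfolding pres_def by blast
  obtain g' w' where u2: "upres U C' U1 U0 f g' w'" using upres_isom[OF u1 \<open>isom C C'\<close>] .
  note u = u1 u2
  have "pres U C'" unfolding pres_def using u2 by blast
  moreover have "idx U C' = idx U C" unfolding idx_eq[OF u(1)] idx_eq[OF u(2)] ..
  ultimately show ?thesis ..
qed

lemma pres_bip:
  assumes "pres U C" "pres U C'" and b: "bip D C C' i p j q"
  shows "pres U D \<and> idx U D = (\<lambda>r. idx U C r + idx U C' r)"
proof -
  obtain U1 U0 f g w where u: "upres U C U1 U0 f g w" using assms(1) unfolding pres_def by blast
  obtain V1 V0 f' g' w' where v: "upres U C' V1 V0 f' g' w'" using assms(2) unfolding pres_def by blast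
  obtain W1 i1 p1 j1 q1 where b1: "bip W1 U1 V1 i1 p1 j1 q1" using bips by blast
  obtain W0 i0 p0 j0 q0 where b0: "bip W0 U0 V0 i0 p0 j0 q0" using bips by blast
  have t: "tri U1 U0 C f g w" "tri V1 V0 C' f' g' w'" using u v unfolding upres_def by auto
  have hh: "w \<in> hm C (Sh U1)" "w' \<in> hm C' (Sh V1)" using tri_hm[OF t(1)] tri_hm[OF t(2)] by auto
  let ?w = "sh i1 \<bullet> (w \<bullet> p) \<^bold>+ sh j1 \<bullet> (w' \<bullet> q)"
  have k: "kills U w" "kills U w'" using u v unfolding upres_def by auto
  have "kills U ?w"
    unfolding kills_def
  proof
    fix x assume x: "x \<in> hm U (src ?w)"
    then have "w \<bullet> (p \<bullet> x) = zr U (Sh U1)" "w' \<bullet> (q \<bullet> x) = zr U (Sh V1)"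
      using k hh bip_hm[OF b] unfolding kills_def by simp_all
    then show "?w \<bullet> x = zr U (tgt ?w)" using x hh bip_hm[OF b] bip_hm[OF b1] by (simp add: cmp_pls_left)
  qed
  moreover have "gen U W1" "gen U W0" using gen_bip[OF b1] gen_bip[OF b0] u v unfolding upres_def by auto
  ultimately obtain F G where p: "upres U D W1 W0 F G ?w"
    using tri_bip[OF t b1 b0 b] unfolding upres_def by blast
  then show ?thesis using idx_eq[OF p] idx_eq[OF u] idx_eq[OF v] cls_bip[OF b1] cls_bip[OF b0]
    unfolding pres_def by (intro conjI) (blast, simp only: fun_eq_iff count_union of_nat_add, simp)
qed

lemma bip_swap: "bip W A B i p j q \<Longrightarrow> bip W B A j q i p"
  unfolding bip_def by (simp add: pls_commute)

text \<open>
  The third map \<open>v\<close> vanishes on maps \<open>x\<close> from \<open>U\<close>, because \<open>i \<bullet> x\<close> lifts along \<open>g\<close> and hence \<open>x\<close>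
  along \<open>p \<bullet> g\<close>.
\<close>

lemma pres_retract_aux:
  assumes p: "upres U S U1 U0 f g w" and b: "bip S A B i p j q"
  obtains K k v where "tri K U0 A k (p \<bullet> g) v" "kills U v"
proof -
  have t: "tri U1 U0 S f g w" and k: "kills U w" using p unfolding upres_def by auto
  have hh: "g \<in> hm U0 S" "w \<in> hm S (Sh U1)" using tri_hm[OF t] by auto
  obtain K k v where K: "tri K U0 A k (p \<bullet> g) v" using tri_fibre[of "p \<bullet> g" U0 A] hh bip_hm[OF b] by auto
  have hv: "v \<in> hm A (Sh K)" using tri_hm[OF K] by auto
  have "v \<bullet> x = zr U (Sh K)" if x: "x \<in> hm U A" for x
  proof -
    have "i \<bullet> x \<in> hm U S" "w \<bullet> (i \<bullet> x) = zr U (Sh U1)" using x bip_hm[OF b] hh k unfolding kills_def by auto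
    then obtain y where y: "y \<in> hm U U0" "g \<bullet> y = i \<bullet> x" by (rule tri_exact2[OF t])
    have "(p \<bullet> g) \<bullet> y = x" using y x bip_hm[OF b] bip_eqs[OF b] hh cmp_reassoc[of p i "idt A" x] by simp
    then show ?thesis using cmp_reassoc[OF tri_zero2[OF K], of y] y(1) hv hh bip_hm[OF b] by simp
  qed
  then have "kills U v" using hv unfolding kills_def by simp
  then show ?thesis using that K by blast
qed

text \<open>
  Let \<open>K\<close> and \<open>L\<close> be the fibres of the maps from \<open>U0\<close> to \<open>A\<close> and to its complement \<open>B\<close>.  Comparing the
  sum of these two triangles with the presentation of \<open>S\<close> by \<open>schanuel\<close> shows that \<open>K\<close> and \<open>L\<close> lie in
  \<open>add U\<close>.
\<close>

lemma pres_retract: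
  assumes "pres U S" "i \<in> hm A S" "p \<in> hm S A" "p \<bullet> i = idt A"
  shows "pres U A"
proof -
  obtain B j q where b: "bip S A B i p j q" using retract_bip[OF assms(2-4)] .
  obtain U1 U0 f g w where u: "upres U S U1 U0 f g w" using assms(1) unfolding pres_def by blast
  obtain K k v where K: "tri K U0 A k (p \<bullet> g) v" "kills U v" using pres_retract_aux[OF u b] .
  obtain L l v' where L: "tri L U0 B l (q \<bullet> g) v'" "kills U v'" using pres_retract_aux[OF u bip_swap[OF b]] .
  obtain W1 i1 p1 j1 q1 where b1: "bip W1 K L i1 p1 j1 q1" using bips by blast
  obtain W0 i0 p0 j0 q0 where b0: "bip W0 U0 U0 i0 p0 j0 q0" using bips by blast
  let ?w = "sh i1 \<bullet> (v \<bullet> p) \<^bold>+ sh j1 \<bullet> (v' \<bullet> q)"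
  have hh: "v \<in> hm A (Sh K)" "v' \<in> hm B (Sh L)" using tri_hm[OF K(1)] tri_hm[OF L(1)] by auto
  have "kills U ?w"
    unfolding kills_def
  proof
    fix x assume x: "x \<in> hm U (src ?w)"
    then have "v \<bullet> (p \<bullet> x) = zr U (Sh K)" "v' \<bullet> (q \<bullet> x) = zr U (Sh L)"
      using K(2) L(2) hh bip_hm[OF b] unfolding kills_def by simp_all
    then show "?w \<bullet> x = zr U (tgt ?w)" using x hh bip_hm[OF b] bip_hm[OF b1] by (simp add: cmp_pls_left)
  qed
  moreover have gU: "gen U U0" "gen U U1" "kills U w" "tri U1 U0 S f g w" using u unfolding upres_def by auto
  moreover have "gen U W0" using gen_bip[OF b0] gU by blast
  ultimately have "cls W1 + cls U0 = cls U1 + cls W0"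
    using schanuel[OF tri_bip[OF K(1) L(1) b1 b0 b], of U U1 U0 f g w] by blast
  then have "set_mset (cls W1) \<subseteq> set_mset (cls U1 + cls W0)" by (metis set_mset_union sup_ge1)
  moreover have "set_mset (cls U1 + cls W0) \<subseteq> set_mset (cls U)" using gen_iff_cls gU \<open>gen U W0\<close> by auto
  ultimately have "gen U W1" using gen_iff_cls by blast
  then have "gen U K" using gen_retract bip_hm[OF b1] bip_eqs[OF b1] by blast
  then show ?thesis using K gU unfolding pres_def upres_def by blast
qed

lemma pres_gen:
  assumes "gen U Q"
  shows "pres U Q \<and> idx U Q = (\<lambda>r. int (count (cls Q) r))"
proof -
  obtain O0 where O0: "idt O0 = zr O0 O0" using zero_ob by blast
  have "upres U Q O0 Q (zr O0 Q) (idt Q) (zr Q (Sh O0))"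
    unfolding upres_def kills_def using tri_zero_idt[OF O0] assms gen_iff_cls cls_zero[OF O0] by auto
  then show ?thesis using idx_eq cls_zero[OF O0] unfolding pres_def by fastforce
qed

lemma pres_dec:
  assumes "dec Z (idt Z) Ys" "\<forall>Y \<in> set Ys. pres U Y"
  shows "pres U Z \<and> idx U Z = (\<lambda>r. \<Sum>Y\<leftarrow>Ys. idx U Y r)"
  using assms
proof (induction Ys arbitrary: Z rule: list.induct)
  case Nil
  then have "idt Z = zr Z Z" by (auto elim: dec.cases)
  then have z: "cls Z = {#}" by (rule cls_zero)
  then show ?case using pres_gen[of U Z] gen_iff_cls[of U Z] by simp
next
  case (Cons Y Ys)
  obtain Z' i p j q where b: "bip Z Y Z' i p j q" and d: "dec Z' (idt Z') Ys"
    using dec_Cons_bip[OF Cons.prems(1)] .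
  then show ?case using Cons.IH[OF d] Cons.prems(2) pres_bip[OF _ _ b, of U] by simp
qed

lemma pres_trans:
  assumes "pres U X" "gen X V" shows "pres U V"
proof -
  obtain Ys where Ys: "dec V (idt V) Ys" "\<forall>Y \<in> set Ys. loc Y" using ks by blast
  have "pres U Y" if Y: "Y \<in> set Ys" for Y
  proof -
    obtain i p where "i \<in> hm Y V" "p \<in> hm V Y" "p \<bullet> i = idt Y" using dec_retract_member[OF Ys(1) Y] by blast
    then have "gen X Y" using gen_retract[OF assms(2)] by blast
    then obtain i p where "i \<in> hm Y X" "p \<in> hm X Y" "p \<bullet> i = idt Y" using loc_gen_retract Ys(2) Y by metis
    then show ?thesis using pres_retract[OF assms(1)] by blast
  qed
  then show ?thesis using pres_dec[OF Ys(1)] by blast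
qed

text \<open>
  Pull the presentation of \<open>C\<close> back along \<open>b\<close>.  The homotopy pullback of \<open>B\<close> and \<open>U0\<close> is
  \<open>A \<oplus> U0\<close> because \<open>w\<close> vanishes on \<open>U0\<close>, and it maps to \<open>B\<close> with fibre \<open>U1\<close>.
\<close>

lemma pres_extension:
  assumes A: "gen U A" and t: "tri A B C a b w" and k: "kills U w" and C: "pres U C"
  shows "pres U B \<and> idx U B = (\<lambda>r. int (count (cls A) r) + idx U C r)"
proof -
  obtain U1 U0 f g v where u: "upres U C U1 U0 f g v" using C unfolding pres_def by blast
  have t': "tri U1 U0 C f g v" and U: "gen U U1" "gen U U0" "kills U v" using u unfolding upres_def by auto
  have hh: "b \<in> hm B C" "w \<in> hm C (Sh A)" "g \<in> hm U0 C" "v \<in> hm C (Sh U1)"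
    using tri_hm[OF t] tri_hm[OF t'] by auto
  obtain W x y x' y' where W: "tri A W U0 x y (w \<bullet> g)" "tri U1 W B x' y' (v \<bullet> b)"
    using homotopy_pullback[OF t t'] .
  have "w \<bullet> g = zr U0 (Sh A)" using kills_gen[OF k] U hh by blast
  then obtain p s where b: "bip W A U0 x p s y" by (rule tri_split[OF W(1)])
  have "kills U (v \<bullet> b)" using U(3) hh unfolding kills_def by simp
  then have u': "upres U B U1 W x' y' (v \<bullet> b)" using W(2) U gen_bip[OF b A U(2)] unfolding upres_def by blast
  then show ?thesis using idx_eq[OF u'] idx_eq[OF u] cls_bip[OF b] unfolding pres_def
    by (intro conjI) (blast, simp add: fun_eq_iff)
qed

end

section \<open>Rigidity and the number of summands\<close>

text \<open>
  With \<open>f = icl\<close> this regroups a sum over the summands of an object by isomorphism class.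
\<close>

lemma sum_list_image_mset:
  fixes F :: "'c \<Rightarrow> int"
  assumes "finite I" "f ` set Ls \<subseteq> I"
  shows "(\<Sum>L\<leftarrow>Ls. F (f L)) = (\<Sum>r\<in>I. int (count (image_mset f (mset Ls)) r) * F r)"
  using assms(2)
proof (induction Ls)
  case (Cons L Ls)
  have "(\<Sum>r\<in>I. int (count (image_mset f (mset (L # Ls))) r) * F r) =
    (\<Sum>r\<in>I. (if r = f L then F r else 0) + int (count (image_mset f (mset Ls)) r) * F r)"
    by (intro sum.cong) (auto simp: algebra_simps)
  also have "\<dots> = F (f L) + (\<Sum>r\<in>I. int (count (image_mset f (mset Ls)) r) * F r)"
    using assms(1) Cons.prems by (simp add: sum.distrib)
  finally show ?case using Cons by simp
qed simp

context tri_ks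
begin

text \<open>
  The vanishing of \<open>R[1](X, Y[1])\<close>, tested on composites through \<open>R[1]\<close> itself.
\<close>

definition erel :: "'o \<Rightarrow> 'o \<Rightarrow> 'o \<Rightarrow> bool" where
  "erel R X Y \<longleftrightarrow> (\<forall>f \<in> hm X (Sh R). \<forall>g \<in> hm (Sh R) (Sh Y). g \<bullet> f = zr X (Sh Y))"

definition rig :: "'o \<Rightarrow> bool" where
  "rig R \<longleftrightarrow> hm R (Sh R) = {zr R (Sh R)}"

lemma erelD: "\<lbrakk>erel R X Y; f \<in> hm X (Sh R); g \<in> hm (Sh R) (Sh Y)\<rbrakk> \<Longrightarrow> g \<bullet> f = zr X (Sh Y)"
  unfolding erel_def by blast

lemma rigD: "\<lbrakk>rig R; f \<in> hm R (Sh R)\<rbrakk> \<Longrightarrow> f = zr R (Sh R)"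
  unfolding rig_def by blast

lemma rig_gen:
  assumes R: "rig R" and Q: "gen R Q" "gen R Q'" and f: "f \<in> hm Q (Sh Q')"
  shows "f = zr Q (Sh Q')"
proof (rule gen_zero_right[OF Q(1) _ f])
  fix g assume g: "g \<in> hm R (Sh Q')"
  show "g = zr R (Sh Q')" by (rule gen_zero_left[OF gen_sh[OF Q(2)] _ g]) (rule rigD[OF R])
qed

lemma rig_kills: "\<lbrakk>rig R; gen R Q; w \<in> hm C (Sh Q)\<rbrakk> \<Longrightarrow> kills R w"
  unfolding kills_def using rig_gen[OF _ gen_refl] by fastforce

lemma erel_gen:
  assumes e: "erel R X Y" and X: "gen X X'" and Y: "gen Y Y'"
  shows "erel R X' Y'"
  unfolding erel_def
proof (intro ballI)
  fix f g assume f: "f \<in> hm X' (Sh R)" and g: "g \<in> hm (Sh R) (Sh Y')"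
  show "g \<bullet> f = zr X' (Sh Y')"
  proof (rule gen_vanish_right[OF X g _ f])
    fix f' assume f': "f' \<in> hm X (Sh R)"
    show "g \<bullet> f' = zr X (Sh Y')"
      by (rule gen_vanish_left[OF gen_sh[OF Y] f' _ g]) (rule erelD[OF e f'])
  qed
qed

lemma erel_thru:
  assumes e: "erel R X Y" and x: "x \<in> thru (Sh R) X (Sh Y)"
  shows "x = zr X (Sh Y)"
  using x
proof (induction rule: thru.induct)
  case (thru_step f g r)
  have "g \<bullet> f = zr X (Sh Y)" by (rule erelD[OF e thru_step.hyps(1,2)])
  then show ?case using thru_step.IH by simp
qed simp

lemma erel_bip_right:
  assumes e: "erel R X A" "erel R X B" and b: "bip W A B i p j q"
  shows "erel R X W"
  unfolding erel_def
proof (intro ballI)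
  fix f g assume f: "f \<in> hm X (Sh R)" and g: "g \<in> hm (Sh R) (Sh W)"
  note b' = bip_sh[OF b]
  have "(sh p \<bullet> g) \<bullet> f = zr X (Sh A)" "(sh q \<bullet> g) \<bullet> f = zr X (Sh B)"
    by (rule erelD[OF e(1) f] erelD[OF e(2) f], use g bip_hm[OF b'] in simp)+
  then have "sh p \<bullet> (g \<bullet> f) = zr X (Sh A)" "sh q \<bullet> (g \<bullet> f) = zr X (Sh B)"
    using f g bip_hm[OF b'] by simp_all
  then show "g \<bullet> f = zr X (Sh W)"
    by (intro bip_ext[OF b', of "g \<bullet> f" X "zr X (Sh W)"]) (use f g bip_hm[OF b'] in simp_all)
qed

lemma erel_bip_left:
  assumes e: "erel R A X" "erel R B X" and b: "bip W A B i p j q"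
  shows "erel R W X"
  unfolding erel_def
proof (intro ballI)
  fix f g assume f: "f \<in> hm W (Sh R)" and g: "g \<in> hm (Sh R) (Sh X)"
  have "g \<bullet> (f \<bullet> i) = zr A (Sh X)" "g \<bullet> (f \<bullet> j) = zr B (Sh X)"
    by (rule erelD[OF e(1) _ g] erelD[OF e(2) _ g], use f bip_hm[OF b] in simp)+
  then have "(g \<bullet> (f \<bullet> i)) \<bullet> p \<^bold>+ (g \<bullet> (f \<bullet> j)) \<bullet> q = zr W (Sh X)" using bip_hm[OF b] by simp
  moreover have "(g \<bullet> (f \<bullet> i)) \<bullet> p \<^bold>+ (g \<bullet> (f \<bullet> j)) \<bullet> q = (g \<bullet> f) \<bullet> (i \<bullet> p \<^bold>+ j \<bullet> q)"
    using f g bip_hm[OF b] by (simp add: cmp_pls_right)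
  moreover have "i \<bullet> p \<^bold>+ j \<bullet> q = idt W" using b unfolding bip_def by blast
  ultimately show "g \<bullet> f = zr W (Sh X)" using f g by simp
qed

text \<open>A choice of one local object in each isomorphism class of summands of \<open>X\<close>.\<close>

definition reps :: "'o \<Rightarrow> ('o set \<Rightarrow> 'o) \<Rightarrow> bool" where
  "reps X ro \<longleftrightarrow> (\<forall>r \<in># cls X. loc (ro r) \<and> icl (ro r) = r \<and> gen X (ro r))"

lemma reps_exist: obtains ro where "reps X ro"
proof -
  have "\<exists>L. loc L \<and> icl L = r \<and> gen X L" if "r \<in># cls X" for r
  proof -
    obtain L i p where L: "loc L" "icl L = r" "i \<in> hm L X" "p \<in> hm X L" "p \<bullet> i = idt L"
      using cls_member[OF \<open>r \<in># cls X\<close>] .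
    then show ?thesis using gen_retract[OF gen_refl L(3-5)] by blast
  qed
  then have "\<exists>ro. \<forall>r \<in># cls X. loc (ro r) \<and> icl (ro r) = r \<and> gen X (ro r)" by (rule bchoice[OF ballI])
  then show ?thesis using that unfolding reps_def by blast
qed

text \<open>
  Indices are additive over the local summands of \<open>V\<close>, collected here by isomorphism class.
\<close>

lemma idx_reps:
  assumes ro: "reps S ro" and V: "gen S V" and P: "\<forall>r \<in># cls S. pres U (ro r)"
  shows "pres U V \<and> idx U V x = (\<Sum>r\<in>set_mset (cls S). int (count (cls V) r) * idx U (ro r) x)"
proof -
  obtain Ls where Ls: "dec V (idt V) Ls" "\<forall>Y \<in> set Ls. loc Y" using ks by blast
  have c: "cls V = image_mset icl (mset Ls)" by (rule cls_eq[OF Ls])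
  have sub: "icl ` set Ls \<subseteq> set_mset (cls S)" using V gen_iff_cls c by auto
  have L: "pres U L \<and> idx U L = idx U (ro (icl L))" if "L \<in> set Ls" for L
  proof -
    have r: "icl L \<in># cls S" using sub that by auto
    then have "isom (ro (icl L)) L" using ro unfolding reps_def icl_eq[symmetric] by blast
    then show ?thesis using pres_isom P r by blast
  qed
  have p: "pres U V \<and> idx U V = (\<lambda>r. \<Sum>Y\<leftarrow>Ls. idx U Y r)" by (rule pres_dec[OF Ls(1)]) (use L in blast)
  have "(\<Sum>Y\<leftarrow>Ls. idx U Y x) = (\<Sum>Y\<leftarrow>Ls. idx U (ro (icl Y)) x)"
    using L by (intro arg_cong[where f = sum_list] map_cong) auto
  also have "\<dots> = (\<Sum>r\<in>set_mset (cls S). int (count (cls V) r) * idx U (ro r) x)"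
    unfolding c by (rule sum_list_image_mset[OF _ sub]) simp
  finally show ?thesis using p by simp
qed

lemma idx_sh_reps:
  assumes ro: "reps R ro" and Q: "gen R Q" and P: "\<forall>r \<in># cls R. pres U (Sh (ro r))"
  shows "pres U (Sh Q) \<and> idx U (Sh Q) x = (\<Sum>r\<in>set_mset (cls R). int (count (cls Q) r) * idx U (Sh (ro r)) x)"
proof -
  obtain Ls where Ls: "dec Q (idt Q) Ls" "\<forall>Y \<in> set Ls. loc Y" using ks by blast
  have c: "cls Q = image_mset icl (mset Ls)" by (rule cls_eq[OF Ls])
  have sub: "icl ` set Ls \<subseteq> set_mset (cls R)" using Q gen_iff_cls c by auto
  have L: "pres U (Sh L) \<and> idx U (Sh L) = idx U (Sh (ro (icl L)))" if "L \<in> set Ls" for L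
  proof -
    have r: "icl L \<in># cls R" using sub that by auto
    then have "isom (ro (icl L)) L" using ro unfolding reps_def icl_eq[symmetric] by blast
    then show ?thesis using pres_isom isom_sh P r by blast
  qed
  have d: "dec (Sh Q) (idt (Sh Q)) (map Sh Ls)" using dec_sh[OF Ls(1)] by simp
  have p: "pres U (Sh Q) \<and> idx U (Sh Q) = (\<lambda>r. \<Sum>Y\<leftarrow>map Sh Ls. idx U Y r)" by (rule pres_dec[OF d]) (use L in auto)
  have "(\<Sum>Y\<leftarrow>map Sh Ls. idx U Y x) = (\<Sum>Y\<leftarrow>Ls. idx U (Sh (ro (icl Y))) x)"
    using L by (auto intro!: arg_cong[where f = sum_list])
  also have "\<dots> = (\<Sum>r\<in>set_mset (cls R). int (count (cls Q) r) * idx U (Sh (ro r)) x)"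
    unfolding c by (rule sum_list_image_mset[OF _ sub]) simp
  finally show ?thesis using p by simp
qed

text \<open>
  Let \<open>G s r\<close> be the multiplicity of \<open>r\<close> in the index of the summand \<open>s\<close> of \<open>S\<close> with respect to \<open>R\<close>, and
  \<open>C r s\<close> the negative of the multiplicity of \<open>s\<close> in the index of \<open>r[1]\<close> with respect to \<open>S\<close>.  Additivity
  of the first index on the rotated \<open>S\<close>-presentation of \<open>r[1]\<close> gives \<open>\<Sum>s. C r s * G s r = 1\<close> for each
  summand \<open>r\<close> of \<open>R\<close>, and additivity of the second one on the rotated \<open>R\<close>-presentation of \<open>s\<close> gives
  \<open>\<Sum>r. C r s * G s r = 1\<close> for each summand \<open>s\<close> of \<open>S\<close>.  The sum over all \<open>r\<close> and \<open>s\<close> therefore counts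
  both the summands of \<open>R\<close> and those of \<open>S\<close>.
\<close>

theorem silting_count:
  assumes R: "rig R" and S: "pres R S" "erel R S S" and t: "tri R S0 S1 a b w" and g: "gen S S0" "gen S S1"
  shows "card (set_mset (cls R)) = card (set_mset (cls S))"
proof -
  let ?I = "set_mset (cls R)" and ?J = "set_mset (cls S)"
  have hh: "a \<in> hm R S0" "b \<in> hm S0 S1" "w \<in> hm S1 (Sh R)" using tri_hm[OF t] by auto
  obtain ro where ro: "reps R ro" by (rule reps_exist)
  obtain so where so: "reps S so" by (rule reps_exist)
  \<comment> \<open>\<open>S\<close> is \<open>R[1]\<close>-rigid, so maps from \<open>add(R[1])\<close> to \<open>add(S[1])\<close> vanish on \<open>S\<close>\<close>
  have killS: "kills S (ng (sh x))" if x: "x \<in> hm Q Y" and Q: "gen R Q" and Y: "gen S Y" for x Q Y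
    unfolding kills_def
  proof
    fix y assume y: "y \<in> hm S (src (ng (sh x)))"
    have "sh x \<bullet> y \<in> thru (Sh R) S (Sh Y)" by (rule thru_gen[OF gen_sh[OF Q]]) (use x y in simp_all)
    then have "sh x \<bullet> y = zr S (Sh Y)" using erel_thru erel_gen[OF S(2) gen_refl Y] by blast
    then show "ng (sh x) \<bullet> y = zr S (tgt (ng (sh x)))" using x y by simp
  qed
  have pR: "pres R V" if "gen S V" for V using pres_trans[OF S(1) that] .
  have pso: "\<forall>s \<in># cls S. pres R (so s)" using so pR unfolding reps_def by blast
  \<comment> \<open>the rotated triangle presents \<open>R[1]\<close> by \<open>S\<close>, and then all of \<open>add(R[1])\<close> has such presentations\<close>
  have "upres S (Sh R) S0 S1 b w (ng (sh a))"
    unfolding upres_def using tri_rotate[OF t] g killS[OF hh(1) gen_refl g(1)] by blast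
  then have "pres S (Sh R)" unfolding pres_def by blast
  then have pSR: "pres S (Sh Q)" if "gen R Q" for Q by (rule pres_trans[OF _ gen_sh[OF that]])
  have pro: "\<forall>r \<in># cls R. pres S (Sh (ro r))"
    using ro pSR unfolding reps_def by blast
  \<comment> \<open>only the diagonal entries of the two matrix products are computed\<close>
  define G where "G s r = idx R (so s) r" for s r
  define C where "C r s = - idx S (Sh (ro r)) s" for r s
  have one: "count (cls L) r = 1" if "loc L" "icl L = r" for L r using cls_loc[OF that(1)] that(2) by simp
  have CG: "(\<Sum>s\<in>?J. C r s * G s r) = 1" if r: "r \<in> ?I" for r
  proof -
    have L: "loc (ro r)" "icl (ro r) = r" "gen R (ro r)" using ro r unfolding reps_def by auto
    obtain V0 V1 f g v where u: "upres S (Sh (ro r)) V0 V1 f g v" using pro r unfolding pres_def by blast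
    have t1: "tri V0 V1 (Sh (ro r)) f g v" and V: "gen S V0" "gen S V1" using u unfolding upres_def by auto
    have h1: "f \<in> hm V0 V1" "g \<in> hm V1 (Sh (ro r))" "v \<in> hm (Sh (ro r)) (Sh V0)" using tri_hm[OF t1] by auto
    obtain v0 where v0: "v0 \<in> hm (ro r) V0" "sh v0 = v" using sh_surj[OF h1(3)] by blast
    \<comment> \<open>the presentation of \<open>r[1]\<close> rotated back to a triangle that starts at \<open>r\<close>\<close>
    have t2: "tri (ro r) V0 V1 (ng v0) f g"
      by (rule iffD2[OF tri_rot]) (use h1 v0 t1 in simp_all)
    have "kills R g" by (rule rig_kills[OF R L(3) h1(2)])
    then have "idx R V0 = (\<lambda>x. int (count (cls (ro r)) x) + idx R V1 x)"
      using pres_extension[OF L(3) t2 _ pR[OF V(2)]] by blast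
    then have "idx R V0 r - idx R V1 r = 1" using one[OF L(1,2)] by simp
    moreover have "idx R V0 r = (\<Sum>s\<in>?J. int (count (cls V0) s) * G s r)"
      and "idx R V1 r = (\<Sum>s\<in>?J. int (count (cls V1) s) * G s r)"
      unfolding G_def using idx_reps[OF so V(1) pso] idx_reps[OF so V(2) pso] by blast+
    ultimately have "(\<Sum>s\<in>?J. (int (count (cls V0) s) - int (count (cls V1) s)) * G s r) = 1"
      by (simp add: left_diff_distrib sum_subtractf)
    moreover have "C r s = int (count (cls V0) s) - int (count (cls V1) s)" for s
      unfolding C_def idx_eq[OF u] by simp
    ultimately show ?thesis by simp
  qed
  have GC: "(\<Sum>r\<in>?I. C r s * G s r) = 1" if s: "s \<in> ?J" for s
  proof -
    have L: "loc (so s)" "icl (so s) = s" "gen S (so s)" using so s unfolding reps_def by auto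
    obtain R1 R0 f g v where u: "upres R (so s) R1 R0 f g v" using pso s unfolding pres_def by blast
    have t1: "tri R1 R0 (so s) f g v" and Q: "gen R R1" "gen R R0" using u unfolding upres_def by auto
    have h1: "f \<in> hm R1 R0" "g \<in> hm R0 (so s)" using tri_hm[OF t1] by auto
    \<comment> \<open>the presentation of \<open>s\<close> rotated forward; its last map vanishes on \<open>S\<close> by \<open>killS\<close>\<close>
    have t2: "tri (so s) (Sh R1) (Sh R0) v (ng (sh f)) (ng (sh g))" by (rule tri_rotate[OF tri_rotate[OF t1]])
    have p: "pres S (Sh R0)" using idx_sh_reps[OF ro Q(2) pro] by blast
    have "idx S (Sh R1) = (\<lambda>x. int (count (cls (so s)) x) + idx S (Sh R0) x)"
      using pres_extension[OF L(3) t2 killS[OF h1(2) Q(2) L(3)] p] by blast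
    then have "idx S (Sh R1) s - idx S (Sh R0) s = 1" using one[OF L(1,2)] by simp
    moreover have "idx S (Sh R1) s = (\<Sum>r\<in>?I. - int (count (cls R1) r) * C r s)"
      and "idx S (Sh R0) s = (\<Sum>r\<in>?I. - int (count (cls R0) r) * C r s)"
      unfolding C_def using idx_sh_reps[OF ro Q(1) pro, of s] idx_sh_reps[OF ro Q(2) pro, of s] by simp_all
    ultimately have "(\<Sum>r\<in>?I. (int (count (cls R0) r) - int (count (cls R1) r)) * C r s) = 1"
      by (simp add: left_diff_distrib sum_subtractf sum_negf)
    moreover have "G s r = int (count (cls R0) r) - int (count (cls R1) r)" for r
      unfolding G_def idx_eq[OF u] by simp
    ultimately show ?thesis by (simp add: mult.commute)
  qed
  have "int (card ?I) = (\<Sum>r\<in>?I. \<Sum>s\<in>?J. C r s * G s r)" using CG by simp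
  also have "\<dots> = (\<Sum>s\<in>?J. \<Sum>r\<in>?I. C r s * G s r)" by (rule sum.swap)
  also have "\<dots> = int (card ?J)" using GC by simp
  finally show ?thesis by simp
qed

end

text \<open>
  Every object \<open>V\<close> has a right \<open>add X\<close>-approximation, which follows from finite-dimensional Hom spaces.
\<close>

locale tri_ks_approx = tri_ks arw src tgt cmp pls ng zr idt Sh sh tri
  for arw :: "'a \<Rightarrow> bool" and src tgt :: "'a \<Rightarrow> 'o"
    and cmp :: "'a \<Rightarrow> 'a \<Rightarrow> 'a" (infixr \<open>\<bullet>\<close> 75)
    and pls :: "'a \<Rightarrow> 'a \<Rightarrow> 'a" (infixl \<open>\<^bold>+\<close> 65)
    and ng :: "'a \<Rightarrow> 'a" and zr :: "'o \<Rightarrow> 'o \<Rightarrow> 'a" and idt :: "'o \<Rightarrow> 'a"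
    and Sh :: "'o \<Rightarrow> 'o" and sh :: "'a \<Rightarrow> 'a" and tri :: "'o \<Rightarrow> 'o \<Rightarrow> 'o \<Rightarrow> 'a \<Rightarrow> 'a \<Rightarrow> 'a \<Rightarrow> bool" +
  assumes approx: "\<exists>W w. gen X W \<and> w \<in> hm W V \<and> (\<forall>x \<in> hm X V. \<exists>y \<in> hm X W. w \<bullet> y = x)"
begin

text \<open>
  The Bongartz completion of \<open>X\<close>: the cocone of an approximation \<open>w : X0 \<rightarrow> R[1]\<close>.  A map
  \<open>g \<bullet> f : X \<rightarrow> E[1]\<close> through \<open>R[1]\<close> becomes zero in \<open>X0[1]\<close>, so it lifts to \<open>R[1]\<close>, hence factors
  through \<open>w\<close>, and \<open>w\<close> becomes zero in \<open>E[1]\<close>.  In the other direction, maps \<open>E \<rightarrow> R[1]\<close> vanish on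
  \<open>R\<close> and therefore factor through \<open>X0\<close>.
\<close>

lemma bongartz:
  assumes R: "rig R" and X: "pres R X" "erel R X X"
  obtains E X0 a b w where "tri R E X0 a b w" "gen X X0" "pres R E" "erel R X E" "erel R E X" "erel R E E"
proof -
  obtain X0 w where X0: "gen X X0" and w: "w \<in> hm X0 (Sh R)"
    and ap: "\<And>x. x \<in> hm X (Sh R) \<Longrightarrow> \<exists>y \<in> hm X X0. w \<bullet> y = x" using approx by blast
  obtain E a b where t: "tri R E X0 a b w" using tri_cocone[OF w] .
  have hh: "a \<in> hm R E" "b \<in> hm E X0" using tri_hm[OF t] by auto
  have pE: "pres R E"
    using pres_extension[OF gen_refl t rig_kills[OF R gen_refl w] pres_trans[OF X(1) X0]] by blast
  have XE: "erel R X E"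
    unfolding erel_def
  proof (intro ballI)
    fix f g assume f: "f \<in> hm X (Sh R)" and g: "g \<in> hm (Sh R) (Sh E)"
    have t3: "tri (Sh R) (Sh E) (Sh X0) (ng (sh a)) (ng (sh b)) (ng (sh w))"
      by (rule tri_rotate[OF tri_rotate[OF tri_rotate[OF t]]])
    have "(sh b \<bullet> g) \<bullet> f = zr X (Sh X0)"
      by (rule erelD[OF erel_gen[OF X(2) gen_refl X0] f]) (use hh g in simp)
    then have "ng (sh b) \<bullet> (g \<bullet> f) = zr X (Sh X0)" using hh f g by simp
    moreover have "g \<bullet> f \<in> hm X (Sh E)" using f g by simp
    ultimately obtain y where y: "y \<in> hm X (Sh R)" "ng (sh a) \<bullet> y = g \<bullet> f"
      using tri_exact1[OF t3] by metis
    obtain y' where y': "y' \<in> hm X X0" "w \<bullet> y' = y" using ap[OF y(1)] by blast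
    have "ng (sh a) \<bullet> w = zr X0 (Sh E)" by (rule tri_zero[OF tri_rotate[OF tri_rotate[OF t]]])
    then have "ng (sh a) \<bullet> (w \<bullet> y') = zr X0 (Sh E) \<bullet> y'" by (rule cmp_reassoc) (use hh w y' in simp_all)
    then show "g \<bullet> f = zr X (Sh E)" using y y' by simp
  qed
  have EY: "erel R E Y" if Y: "erel R X Y" for Y
    unfolding erel_def
  proof (intro ballI)
    fix f g assume f: "f \<in> hm E (Sh R)" and g: "g \<in> hm (Sh R) (Sh Y)"
    have "f \<bullet> a = zr R (Sh R)" by (rule rigD[OF R]) (use f hh in simp)
    then obtain f' where f': "f' \<in> hm X0 (Sh R)" "f' \<bullet> b = f" using tri_coexact1[OF t f] by blast
    have "g \<bullet> f' = zr X0 (Sh Y)" by (rule erelD[OF erel_gen[OF Y X0 gen_refl] f'(1) g])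
    then have "g \<bullet> (f' \<bullet> b) = zr X0 (Sh Y) \<bullet> b" by (rule cmp_reassoc) (use f' g hh in simp_all)
    then show "g \<bullet> f = zr E (Sh Y)" using f' hh by simp
  qed
  show ?thesis using that[OF t X0 pE XE EY[OF X(2)] EY[OF XE]] .
qed

text \<open>
  The triangle of the Bongartz completion \<open>E\<close> makes \<open>silting_count\<close> applicable to every \<open>R[1]\<close>-rigid
  object of \<open>pr(R)\<close> whose \<open>add\<close> contains \<open>X\<close> and \<open>E\<close>.  If \<open>X\<close> is maximal, this is \<open>X\<close> itself.  If
  \<open>|X| = |R|\<close>, then \<open>X \<oplus> E\<close> has no more classes of summands than \<open>X\<close>, so \<open>E\<close> lies in \<open>add X\<close>; the same
  count for \<open>X \<oplus> Z\<close> then shows that \<open>Z\<close> does.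
\<close>

theorem maximal_iff_count:
  assumes R: "rig R" and X: "pres R X" "erel R X X"
  shows "card (set_mset (cls X)) = card (set_mset (cls R)) \<longleftrightarrow>
    (\<forall>Z. pres R Z \<and> erel R X Z \<and> erel R Z X \<and> erel R Z Z \<longrightarrow> gen X Z)"
proof -
  obtain E X0 a b w where t: "tri R E X0 a b w" and X0: "gen X X0" and E: "pres R E" "erel R X E" "erel R E X" "erel R E E"
    using bongartz[OF R X] .
  \<comment> \<open>used first with \<open>Z = E\<close>, and then for arbitrary \<open>Z\<close> once \<open>E\<close> is known to lie in \<open>add X\<close>\<close>
  have count: "gen X Z"
    if c: "card (set_mset (cls X)) = card (set_mset (cls R))" and Z: "pres R Z" "erel R X Z" "erel R Z X" "erel R Z Z"
      and XE: "gen X E \<or> E = Z" for Z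
  proof -
    obtain S i p j q where b: "bip S X Z i p j q" using bips by blast
    have gS: "gen S X" "gen S Z" using gen_retract[OF gen_refl, of i X S p] gen_retract[OF gen_refl, of j Z S q]
      bip_hm[OF b] bip_eqs[OF b] by blast+
    have "pres R S" using pres_bip[OF X(1) Z(1) b] by blast
    moreover have "erel R S S"
      by (intro erel_bip_left[OF _ _ b] erel_bip_right[OF _ _ b] X Z)
    moreover have "gen S E" using XE gen_trans[OF gS(1)] gS(2) by blast
    ultimately have "card (set_mset (cls R)) = card (set_mset (cls S))"
      using silting_count[OF R _ _ t _ gen_trans[OF gS(1) X0]] by blast
    moreover have "set_mset (cls X) \<subseteq> set_mset (cls S)" using gS(1) gen_iff_cls by blast
    ultimately have "set_mset (cls X) = set_mset (cls S)" using c by (intro card_subset_eq) auto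
    then show ?thesis using gS(2) gen_iff_cls by auto
  qed
  show ?thesis
  proof (intro iffI allI impI)
    fix Z assume c: "card (set_mset (cls X)) = card (set_mset (cls R))"
      and Z: "pres R Z \<and> erel R X Z \<and> erel R Z X \<and> erel R Z Z"
    have "gen X E" using count[OF c E] by blast
    then show "gen X Z" using count[OF c, of Z] Z by blast
  next
    assume "\<forall>Z. pres R Z \<and> erel R X Z \<and> erel R Z X \<and> erel R Z Z \<longrightarrow> gen X Z"
    then have "gen X E" using E by blast
    then show "card (set_mset (cls X)) = card (set_mset (cls R))"
      using silting_count[OF R X t _ X0] by simp
  qed
qed

end

section \<open>Arrows tagged with source and target\<close>

text \<open>
  A category given by separate Hom groups becomes one with total operations if each morphism is
  paired with its source and target.  This is applied to the triangulated category and to the modules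
  \<open>Hom(R, X)\<close>.
\<close>

locale hom_groups =
  fixes G :: "'o \<Rightarrow> 'o \<Rightarrow> ('b, 'z) ring_scheme" and C :: "'o \<Rightarrow> 'o \<Rightarrow> 'o \<Rightarrow> 'b \<Rightarrow> 'b \<Rightarrow> 'b" and I :: "'o \<Rightarrow> 'b"
  assumes G_group: "abelian_group (G X Y)"
    and I_closed: "I X \<in> carrier (G X X)"
    and C_closed: "\<lbrakk>f \<in> carrier (G X Y); g \<in> carrier (G Y Z)\<rbrakk> \<Longrightarrow> C X Y Z g f \<in> carrier (G X Z)"
    and C_I: "f \<in> carrier (G X Y) \<Longrightarrow> C X X Y f (I X) = f"
    and I_C: "f \<in> carrier (G X Y) \<Longrightarrow> C X Y Y (I Y) f = f"
    and C_assoc: "\<lbrakk>f \<in> carrier (G W X); g \<in> carrier (G X Y); h \<in> carrier (G Y Z)\<rbrakk> \<Longrightarrow>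
      C W X Z (C X Y Z h g) f = C W Y Z h (C W X Y g f)"
    and C_add_left: "\<lbrakk>f \<in> carrier (G X Y); g \<in> carrier (G Y Z); g' \<in> carrier (G Y Z)\<rbrakk> \<Longrightarrow>
      C X Y Z (g \<oplus>\<^bsub>G Y Z\<^esub> g') f = C X Y Z g f \<oplus>\<^bsub>G X Z\<^esub> C X Y Z g' f"
    and C_add_right: "\<lbrakk>f \<in> carrier (G X Y); f' \<in> carrier (G X Y); g \<in> carrier (G Y Z)\<rbrakk> \<Longrightarrow>
      C X Y Z g (f \<oplus>\<^bsub>G X Y\<^esub> f') = C X Y Z g f \<oplus>\<^bsub>G X Z\<^esub> C X Y Z g f'"
begin

definition t_arw :: "'o \<times> 'o \<times> 'b \<Rightarrow> bool" where "t_arw = (\<lambda>(X, Y, f). f \<in> carrier (G X Y))"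
definition t_src :: "'o \<times> 'o \<times> 'b \<Rightarrow> 'o" where "t_src = (\<lambda>(X, Y, f). X)"
definition t_tgt :: "'o \<times> 'o \<times> 'b \<Rightarrow> 'o" where "t_tgt = (\<lambda>(X, Y, f). Y)"
definition t_cmp :: "'o \<times> 'o \<times> 'b \<Rightarrow> 'o \<times> 'o \<times> 'b \<Rightarrow> 'o \<times> 'o \<times> 'b" where
  "t_cmp = (\<lambda>(Y, Z, g) (X, Y', f). (X, Z, C X Y Z g f))"
definition t_pls :: "'o \<times> 'o \<times> 'b \<Rightarrow> 'o \<times> 'o \<times> 'b \<Rightarrow> 'o \<times> 'o \<times> 'b" where
  "t_pls = (\<lambda>(X, Y, f) (X', Y', g). (X, Y, f \<oplus>\<^bsub>G X Y\<^esub> g))"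
definition t_ng :: "'o \<times> 'o \<times> 'b \<Rightarrow> 'o \<times> 'o \<times> 'b" where "t_ng = (\<lambda>(X, Y, f). (X, Y, \<ominus>\<^bsub>G X Y\<^esub> f))"
definition t_zr :: "'o \<Rightarrow> 'o \<Rightarrow> 'o \<times> 'o \<times> 'b" where "t_zr X Y = (X, Y, \<zero>\<^bsub>G X Y\<^esub>)"
definition t_idt :: "'o \<Rightarrow> 'o \<times> 'o \<times> 'b" where "t_idt X = (X, X, I X)"

lemma tag_simps [simp]:
  "t_arw (X, Y, f) \<longleftrightarrow> f \<in> carrier (G X Y)" "t_src (X, Y, f) = X" "t_tgt (X, Y, f) = Y"
  "t_cmp (Y, Z, g) (X, Y', f) = (X, Z, C X Y Z g f)" "t_pls (X, Y, f) (X', Y', g) = (X, Y, f \<oplus>\<^bsub>G X Y\<^esub> g)"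
  "t_ng (X, Y, f) = (X, Y, \<ominus>\<^bsub>G X Y\<^esub> f)"
  by (simp_all add: t_arw_def t_src_def t_tgt_def t_cmp_def t_pls_def t_ng_def)

lemma G_simps [simp]:
  "\<zero>\<^bsub>G X Y\<^esub> \<in> carrier (G X Y)"
  "f \<in> carrier (G X Y) \<Longrightarrow> \<ominus>\<^bsub>G X Y\<^esub> f \<in> carrier (G X Y)"
  "\<lbrakk>f \<in> carrier (G X Y); g \<in> carrier (G X Y)\<rbrakk> \<Longrightarrow> f \<oplus>\<^bsub>G X Y\<^esub> g \<in> carrier (G X Y)"
  "f \<in> carrier (G X Y) \<Longrightarrow> f \<oplus>\<^bsub>G X Y\<^esub> \<zero>\<^bsub>G X Y\<^esub> = f"
  "f \<in> carrier (G X Y) \<Longrightarrow> \<zero>\<^bsub>G X Y\<^esub> \<oplus>\<^bsub>G X Y\<^esub> f = f"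
  "f \<in> carrier (G X Y) \<Longrightarrow> f \<oplus>\<^bsub>G X Y\<^esub> \<ominus>\<^bsub>G X Y\<^esub> f = \<zero>\<^bsub>G X Y\<^esub>"
proof -
  interpret abelian_group "G X Y" by (rule G_group)
  show "\<zero>\<^bsub>G X Y\<^esub> \<in> carrier (G X Y)"
    "f \<in> carrier (G X Y) \<Longrightarrow> \<ominus>\<^bsub>G X Y\<^esub> f \<in> carrier (G X Y)"
    "\<lbrakk>f \<in> carrier (G X Y); g \<in> carrier (G X Y)\<rbrakk> \<Longrightarrow> f \<oplus>\<^bsub>G X Y\<^esub> g \<in> carrier (G X Y)"
    "f \<in> carrier (G X Y) \<Longrightarrow> f \<oplus>\<^bsub>G X Y\<^esub> \<zero>\<^bsub>G X Y\<^esub> = f"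
    "f \<in> carrier (G X Y) \<Longrightarrow> \<zero>\<^bsub>G X Y\<^esub> \<oplus>\<^bsub>G X Y\<^esub> f = f"
    "f \<in> carrier (G X Y) \<Longrightarrow> f \<oplus>\<^bsub>G X Y\<^esub> \<ominus>\<^bsub>G X Y\<^esub> f = \<zero>\<^bsub>G X Y\<^esub>"
    by (simp_all add: r_neg)
qed

lemma G_assoc:
  "\<lbrakk>f \<in> carrier (G X Y); g \<in> carrier (G X Y); h \<in> carrier (G X Y)\<rbrakk> \<Longrightarrow>
    (f \<oplus>\<^bsub>G X Y\<^esub> g) \<oplus>\<^bsub>G X Y\<^esub> h = f \<oplus>\<^bsub>G X Y\<^esub> (g \<oplus>\<^bsub>G X Y\<^esub> h)"
  and G_comm: "\<lbrakk>f \<in> carrier (G X Y); g \<in> carrier (G X Y)\<rbrakk> \<Longrightarrow> f \<oplus>\<^bsub>G X Y\<^esub> g = g \<oplus>\<^bsub>G X Y\<^esub> f"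
  using abelian_monoid.a_assoc[of "G X Y"] abelian_monoid.a_comm[of "G X Y"] G_group[of X Y]
  unfolding abelian_group_def by blast+

sublocale preadditive t_arw t_src t_tgt t_cmp t_pls t_ng t_zr t_idt
  by unfold_locales (auto simp: t_zr_def t_idt_def I_closed C_closed C_I I_C C_assoc C_add_left C_add_right G_assoc
    intro: G_comm split: prod.splits)

lemma hm_tag [simp]: "(X', Y', f) \<in> hm X Y \<longleftrightarrow> X' = X \<and> Y' = Y \<and> f \<in> carrier (G X Y)"
  by auto

lemma hmE:
  assumes "u \<in> hm X Y" obtains f where "u = (X, Y, f)" "f \<in> carrier (G X Y)"
  using assms by (cases u) auto

lemmas t_zr_eq = t_zr_def and t_idt_eq = t_idt_def

lemma C_zero:
  assumes "g \<in> carrier (G Y Z)"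
  shows "C X Y Z g \<zero>\<^bsub>G X Y\<^esub> = \<zero>\<^bsub>G X Z\<^esub>" "C W X Z \<zero>\<^bsub>G X Z\<^esub> f = \<zero>\<^bsub>G W Z\<^esub> \<or> f \<notin> carrier (G W X)"
  using cmp_zr[of "(Y, Z, g)" Y X] zr_cmp[of "(W, X, f)" X Z] assms by (auto simp: t_zr_def t_idt_def)

lemma C_finsum_right_zero:
  assumes "finite A" "\<And>a. a \<in> A \<Longrightarrow> f a \<in> carrier (G X Y)" "g \<in> carrier (G Y Z)"
    "\<And>a. a \<in> A \<Longrightarrow> C X Y Z g (f a) = \<zero>\<^bsub>G X Z\<^esub>"
  shows "C X Y Z g (finsum (G X Y) f A) = \<zero>\<^bsub>G X Z\<^esub>"
proof -
  interpret abelian_group "G X Y" by (rule G_group)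
  show ?thesis using assms
  proof (induction A rule: finite_induct)
    case (insert a A)
    have "f a \<in> carrier (G X Y)" "f \<in> A \<rightarrow> carrier (G X Y)" using insert by auto
    then show ?case using insert by (simp add: C_add_right finsum_closed)
  qed (simp add: C_zero)
qed

lemma C_finsum_left_zero:
  assumes "finite A" "\<And>a. a \<in> A \<Longrightarrow> f a \<in> carrier (G Y Z)" "g \<in> carrier (G X Y)"
    "\<And>a. a \<in> A \<Longrightarrow> C X Y Z (f a) g = \<zero>\<^bsub>G X Z\<^esub>"
  shows "C X Y Z (finsum (G Y Z) f A) g = \<zero>\<^bsub>G X Z\<^esub>"
proof -
  interpret abelian_group "G Y Z" by (rule G_group)
  show ?thesis using assms
  proof (induction A rule: finite_induct)
    case empty
    then show ?case using zr_cmp[of "(X, Y, g)" Y Z] by (simp add: t_zr_def t_idt_def)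
  next
    case (insert a A)
    have "f a \<in> carrier (G Y Z)" "f \<in> A \<rightarrow> carrier (G Y Z)" using insert by auto
    then show ?case using insert by (simp add: C_add_left finsum_closed)
  qed
qed

text \<open>
  For \<open>c = I X\<close> this is a biproduct diagram.  The induction that compares it with \<open>dec\<close> passes through
  the other idempotents \<open>c\<close>.
\<close>

definition sum_family :: "'o \<Rightarrow> 'b \<Rightarrow> 'o list \<Rightarrow> (nat \<Rightarrow> 'b) \<Rightarrow> (nat \<Rightarrow> 'b) \<Rightarrow> bool" where
  "sum_family X c Ys i p \<longleftrightarrow>
     (\<forall>a < length Ys. i a \<in> carrier (G (Ys ! a) X) \<and> p a \<in> carrier (G X (Ys ! a))) \<and>
     (\<forall>a < length Ys. \<forall>b < length Ys. C (Ys ! b) X (Ys ! a) (p a) (i b) =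
        (if a = b then I (Ys ! a) else \<zero>\<^bsub>G (Ys ! b) (Ys ! a)\<^esub>)) \<and>
     finsum (G X X) (\<lambda>a. C X (Ys ! a) X (i a) (p a)) {..<length Ys} = c"

lemma finsum_shift:
  assumes "\<And>a. a < Suc n \<Longrightarrow> h a \<in> carrier (G X X)"
  shows "finsum (G X X) h {..<Suc n} = h 0 \<oplus>\<^bsub>G X X\<^esub> finsum (G X X) (\<lambda>a. h (Suc a)) {..<n}"
proof -
  interpret abelian_group "G X X" by (rule G_group)
  have "{..<Suc n} = insert 0 (Suc ` {..<n})" by (auto simp: lessThan_Suc_eq_insert_0)
  then have "finsum (G X X) h {..<Suc n} = h 0 \<oplus>\<^bsub>G X X\<^esub> finsum (G X X) h (Suc ` {..<n})"
    using assms by (simp add: finsum_insert Pi_iff)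
  also have "finsum (G X X) h (Suc ` {..<n}) = finsum (G X X) (\<lambda>a. h (Suc a)) {..<n}"
    by (rule finsum_reindex) (use assms in auto)
  finally show ?thesis .
qed

lemma sum_family_dec: "sum_family X c Ys i p \<Longrightarrow> dec X (X, X, c) Ys"
proof (induction Ys arbitrary: i p c)
  case Nil
  interpret abelian_group "G X X" by (rule G_group)
  have "c = \<zero>\<^bsub>G X X\<^esub>" using Nil by (simp add: sum_family_def)
  then have "(X, X, c) = t_zr X X" by (simp add: t_zr_eq)
  then show ?case using dec_Nil[of X] by (simp only:)
next
  case (Cons Y Ys)
  interpret abelian_group "G X X" by (rule G_group)
  let ?i = "\<lambda>a. i (Suc a)" and ?p = "\<lambda>a. p (Suc a)"
  let ?c = "finsum (G X X) (\<lambda>a. C X (Ys ! a) X (?i a) (?p a)) {..<length Ys}"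
  have h: "i a \<in> carrier (G ((Y # Ys) ! a) X)" "p a \<in> carrier (G X ((Y # Ys) ! a))" if "a < Suc (length Ys)" for a
    using Cons.prems that unfolding sum_family_def by auto
  have o: "C ((Y # Ys) ! b) X ((Y # Ys) ! a) (p a) (i b) = (if a = b then I ((Y # Ys) ! a) else \<zero>\<^bsub>G ((Y # Ys) ! b) ((Y # Ys) ! a)\<^esub>)"
    if "a < Suc (length Ys)" "b < Suc (length Ys)" for a b
    using Cons.prems that unfolding sum_family_def by auto
  have hS: "?i a \<in> carrier (G (Ys ! a) X)" "?p a \<in> carrier (G X (Ys ! a))" if "a < length Ys" for a
    using h[of "Suc a"] that by auto
  have cc: "C X (Ys ! a) X (?i a) (?p a) \<in> carrier (G X X)" if "a < length Ys" for a
    using hS[OF that] C_closed by blast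
  have "sum_family X ?c Ys ?i ?p"
    unfolding sum_family_def using hS o[of "Suc _" "Suc _"] by auto
  then have d: "dec X (X, X, ?c) Ys" by (rule Cons.IH)
  have h0: "i 0 \<in> carrier (G Y X)" "p 0 \<in> carrier (G X Y)" using h[of 0] by auto
  have pc: "C X X Y (p 0) ?c = \<zero>\<^bsub>G X Y\<^esub>"
  proof (rule C_finsum_right_zero)
    fix a assume a: "a \<in> {..<length Ys}"
    then have "C X X Y (p 0) (C X (Ys ! a) X (?i a) (?p a)) = C X (Ys ! a) Y (C (Ys ! a) X Y (p 0) (?i a)) (?p a)"
      using hS[of a] h0 by (subst C_assoc) auto
    also have "C (Ys ! a) X Y (p 0) (?i a) = \<zero>\<^bsub>G (Ys ! a) Y\<^esub>" using o[of 0 "Suc a"] a by auto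
    finally show "C X X Y (p 0) (C X (Ys ! a) X (?i a) (?p a)) = \<zero>\<^bsub>G X Y\<^esub>"
      using zr_cmp[of "(X, Ys ! a, ?p a)" "Ys ! a" Y] hS(2)[of a] a by (simp add: t_zr_def t_idt_def)
  qed (use cc h0 in auto)
  have ci: "C Y X X ?c (i 0) = \<zero>\<^bsub>G Y X\<^esub>"
  proof (rule C_finsum_left_zero)
    fix a assume a: "a \<in> {..<length Ys}"
    then have "C Y X X (C X (Ys ! a) X (?i a) (?p a)) (i 0) = C Y (Ys ! a) X (?i a) (C Y X (Ys ! a) (?p a) (i 0))"
      using hS[of a] h0 by (subst C_assoc) auto
    also have "C Y X (Ys ! a) (?p a) (i 0) = \<zero>\<^bsub>G Y (Ys ! a)\<^esub>" using o[of "Suc a" 0] a by auto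
    finally show "C Y X X (C X (Ys ! a) X (?i a) (?p a)) (i 0) = \<zero>\<^bsub>G Y X\<^esub>"
      using C_zero(1) hS(1)[of a] a by simp
  qed (use cc h0 in auto)
  have e: "c = C X Y X (i 0) (p 0) \<oplus>\<^bsub>G X X\<^esub> ?c"
    using Cons.prems finsum_shift[of "length Ys" "\<lambda>a. C X ((Y # Ys) ! a) X (i a) (p a)" X] h C_closed
    unfolding sum_family_def by simp
  have "dec X (t_pls (t_cmp (Y, X, i 0) (X, Y, p 0)) (X, X, ?c)) (Y # Ys)"
    by (rule dec_Cons[OF d]) (use h0 pc ci o[of 0 0] in \<open>simp_all add: t_zr_eq t_idt_eq\<close>)
  then show ?case by (simp add: e)
qed

lemma dec_sum_family:
  assumes "dec X u Ys"
  shows "\<exists>i p c. u = (X, X, c) \<and> sum_family X c Ys i p \<and>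
    (\<forall>a < length Ys. C (Ys ! a) X X c (i a) = i a \<and> C X X (Ys ! a) (p a) c = p a)"
  using assms
proof (induction rule: dec.induct)
  case dec_Nil
  interpret abelian_group "G X X" by (rule G_group)
  show ?case by (auto simp: sum_family_def t_zr_eq)
next
  case (dec_Cons u Ys i0 Y p0)
  obtain i p c where u: "u = (X, X, c)" and s: "sum_family X c Ys i p"
    and k: "\<And>a. a < length Ys \<Longrightarrow> C (Ys ! a) X X c (i a) = i a \<and> C X X (Ys ! a) (p a) c = p a"
    using dec_Cons.IH by blast
  obtain i' where i': "i0 = (Y, X, i')" "i' \<in> carrier (G Y X)" using dec_Cons.hyps(2) by (rule hmE)
  obtain p' where p': "p0 = (X, Y, p')" "p' \<in> carrier (G X Y)" using dec_Cons.hyps(3) by (rule hmE)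
  have c: "c \<in> carrier (G X X)" using dec_idem[OF dec_Cons.hyps(1)] u by simp
  have e: "C Y X Y p' i' = I Y" "C X X Y p' c = \<zero>\<^bsub>G X Y\<^esub>" "C Y X X c i' = \<zero>\<^bsub>G Y X\<^esub>"
    using dec_Cons.hyps(4-6) unfolding i' p' u by (simp_all add: t_zr_eq t_idt_eq)
  let ?c = "C X Y X i' p' \<oplus>\<^bsub>G X X\<^esub> c"
  let ?i = "case_nat i' i" and ?p = "case_nat p' p"
  have h: "i a \<in> carrier (G (Ys ! a) X)" "p a \<in> carrier (G X (Ys ! a))" if "a < length Ys" for a
    using s that unfolding sum_family_def by auto
  have z1: "C (Ys ! a) X Y p' (i a) = \<zero>\<^bsub>G (Ys ! a) Y\<^esub>" if a: "a < length Ys" for a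
    using C_assoc[of "i a" "Ys ! a" X c X p' Y] k[OF a] e(2) h[OF a] c p' zr_cmp[of "(Ys ! a, X, i a)" X Y] by (simp add: t_zr_def t_idt_def)
  have z2: "C Y X (Ys ! a) (p a) i' = \<zero>\<^bsub>G Y (Ys ! a)\<^esub>" if a: "a < length Ys" for a
    using C_assoc[of i' Y X c X "p a" "Ys ! a"] k[OF a] e(3) h[OF a] c i' C_zero(1) by simp
  have hh: "?i a \<in> carrier (G ((Y # Ys) ! a) X)" "?p a \<in> carrier (G X ((Y # Ys) ! a))" if "a < Suc (length Ys)" for a
    using h i' p' that by (auto split: nat.split)
  have cl: "C X Y X i' p' \<in> carrier (G X X)" using i' p' C_closed by blast
  have fs: "finsum (G X X) (\<lambda>a. C X ((Y # Ys) ! a) X (?i a) (?p a)) {..<Suc (length Ys)} = ?c"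
    using s finsum_shift[of "length Ys" "\<lambda>a. C X ((Y # Ys) ! a) X (?i a) (?p a)" X] hh C_closed
    unfolding sum_family_def by simp
  have orth: "C ((Y # Ys) ! b) X ((Y # Ys) ! a) (?p a) (?i b) = (if a = b then I ((Y # Ys) ! a) else \<zero>\<^bsub>G ((Y # Ys) ! b) ((Y # Ys) ! a)\<^esub>)"
    if "a < Suc (length Ys)" "b < Suc (length Ys)" for a b
    using that s e(1) z1 z2 unfolding sum_family_def by (cases a; cases b) auto
  have sf: "sum_family X ?c (Y # Ys) ?i ?p" unfolding sum_family_def using fs orth hh by simp
  have kk: "C ((Y # Ys) ! a) X X ?c (?i a) = ?i a \<and> C X X ((Y # Ys) ! a) (?p a) ?c = ?p a" if a: "a < length (Y # Ys)" for a
  proof (cases a)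
    case 0
    have "C Y X X (C X Y X i' p') i' = i'" "C X X Y p' (C X Y X i' p') = p'"
      using e(1) i' p' C_I I_C C_assoc[of i' Y X p' Y i' X] C_assoc[of p' X Y i' X p' Y, symmetric] by simp_all
    then show ?thesis using 0 e i' p' c cl by (simp add: C_add_left C_add_right)
  next
    case (Suc b)
    then have b: "b < length Ys" using a by simp
    have "C (Ys ! b) X X (C X Y X i' p') (i b) = \<zero>\<^bsub>G (Ys ! b) X\<^esub>"
      using C_assoc[of "i b" "Ys ! b" X p' Y i' X] z1[OF b] h[OF b] i' p' C_zero(1) by simp
    moreover have "C X X (Ys ! b) (p b) (C X Y X i' p') = \<zero>\<^bsub>G X (Ys ! b)\<^esub>"
      using C_assoc[of p' X Y i' X "p b" "Ys ! b", symmetric] z2[OF b] h[OF b] i' p' zr_cmp[of "(X, Y, p')" Y "Ys ! b"] by (simp add: t_zr_def t_idt_def)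
    ultimately show ?thesis using Suc k[OF b] c cl h[OF b] by (simp add: C_add_left C_add_right)
  qed
  show ?case
    by (rule exI[of _ ?i], rule exI[of _ ?p], rule exI[of _ ?c]) (use sf kk in \<open>simp add: i' p' u\<close>)
qed

end

section \<open>The triangulated category with tagged arrows\<close>

context linear_category
begin

lemma Hom_group: "abelian_group (Hom T X Y)"
  using vector_space_Hom module.axioms(2) by blast

sublocale hom_groups "Hom T" "\<lambda>X Y Z. Comp T" "Id T"
  by (rule hom_groups.intro) (auto simp: Id_closed Comp_closed Comp_Id Id_Comp Comp_assoc Comp_add_left Comp_add_right
    intro: Hom_group)

lemma direct_sum_dec: "direct_sum T X Ys \<longleftrightarrow> dec X (t_idt X) Ys"
proof
  assume "direct_sum T X Ys"
  then obtain i p where "sum_family X (Id T X) Ys i p" unfolding direct_sum_def sum_family_def by blast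
  then show "dec X (t_idt X) Ys" unfolding t_idt_eq[of X] by (rule sum_family_dec)
next
  assume "dec X (t_idt X) Ys"
  then obtain i p where "sum_family X (Id T X) Ys i p" using dec_sum_family unfolding t_idt_eq[of X] by blast
  then show "direct_sum T X Ys" unfolding direct_sum_def sum_family_def by blast
qed

lemma is_zero_iff: "is_zero T X \<longleftrightarrow> t_idt X = t_zr X X"
  unfolding is_zero_def t_idt_eq t_zr_eq by simp

lemma iso_arr_iff: "iso_arr T X Y f \<longleftrightarrow> (\<exists>g. inv_arws (X, Y, f) g)"
  unfolding iso_arr_def inv_arws_def by (force simp: t_idt_eq)

text \<open>
  If neither \<open>f\<close> nor \<open>1 - f\<close> were a unit, their sum \<open>1\<close> would not be one either.
\<close>

lemma End_local_loc:
  assumes "local_ring (End_ring T Y)"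
  shows "loc Y"
  unfolding loc_def
proof (intro conjI ballI)
  have r: "ring (End_ring T Y)" using assms unfolding local_ring_def by blast
  interpret ring "End_ring T Y" by (rule r)
  have s: "carrier (End_ring T Y) = arr T Y Y" "\<And>f g. f \<otimes>\<^bsub>End_ring T Y\<^esub> g = f \<cdot> g" "\<one>\<^bsub>End_ring T Y\<^esub> = Id T Y"
    "\<zero>\<^bsub>End_ring T Y\<^esub> = zero_arr T Y Y" "\<And>f g. f \<oplus>\<^bsub>End_ring T Y\<^esub> g = f \<oplus>\<^bsub>Hom T Y Y\<^esub> g"
    unfolding End_ring_def by simp_all
  show "t_idt Y \<noteq> t_zr Y Y" using assms s unfolding local_ring_def t_idt_eq t_zr_eq by simp
  fix f assume "f \<in> hm Y Y"
  then obtain f' where f: "f = (Y, Y, f')" "f' \<in> arr T Y Y" by (rule hmE)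
  obtain e' where e: "mns (t_idt Y) f = (Y, Y, e')" "e' \<in> arr T Y Y"
    using hmE[of "mns (t_idt Y) f" Y Y] f by auto
  have u: "iso_arw (Y, Y, h)" if h: "h \<in> Units (End_ring T Y)" for h
  proof -
    obtain k where "k \<in> arr T Y Y" "k \<cdot> h = Id T Y" "h \<cdot> k = Id T Y" "h \<in> arr T Y Y"
      using h unfolding Units_def by (auto simp: s)
    then show ?thesis unfolding iso_arw_def inv_arws_def by (intro exI[of _ "(Y, Y, k)"]) (simp add: t_idt_eq)
  qed
  have "t_pls (mns (t_idt Y) f) f = t_idt Y" using f by (intro mns_pls_cancel) auto
  then have "t_pls (Y, Y, e') (Y, Y, f') = t_idt Y" unfolding e(1) unfolding f(1) .
  then have "e' \<oplus>\<^bsub>Hom T Y Y\<^esub> f' = Id T Y" by (simp add: t_idt_eq)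
  then have "e' \<oplus>\<^bsub>End_ring T Y\<^esub> f' \<in> Units (End_ring T Y)" using s Units_one_closed by simp
  then have "e' \<in> Units (End_ring T Y) \<or> f' \<in> Units (End_ring T Y)"
    using assms e(2) f(2) s(1) unfolding local_ring_def by blast
  then show "iso_arw f \<or> iso_arw (mns (t_idt Y) f)" using u[of e'] u[of f'] unfolding e(1)[symmetric] f(1)[symmetric] by blast
qed

end

locale tri_setup = triangulated_category K T
  for K :: "'k ring" and T :: "('o, 'm, 'k, 'z) tri_cat_scheme" (structure) +
  assumes KS: "krull_schmidt T" and HF: "hom_finite K T"
begin

definition t_sh :: "'o \<times> 'o \<times> 'm \<Rightarrow> 'o \<times> 'o \<times> 'm" where
  "t_sh = (\<lambda>(X, Y, f). (shift T X, shift T Y, shift_arr T X Y f))"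

definition t_tri :: "'o \<Rightarrow> 'o \<Rightarrow> 'o \<Rightarrow> 'o \<times> 'o \<times> 'm \<Rightarrow> 'o \<times> 'o \<times> 'm \<Rightarrow> 'o \<times> 'o \<times> 'm \<Rightarrow> bool" where
  "t_tri X Y Z u v w \<longleftrightarrow> (\<exists>f g h. u = (X, Y, f) \<and> v = (Y, Z, g) \<and> w = (Z, shift T X, h) \<and> triangle T X Y Z f g h)"

lemma t_sh_tag [simp]: "t_sh (X, Y, f) = (shift T X, shift T Y, shift_arr T X Y f)"
  by (simp add: t_sh_def)

lemma t_tri_tag: "triangle T X Y Z f g h \<Longrightarrow> t_tri X Y Z (X, Y, f) (Y, Z, g) (Z, shift T X, h)"
  unfolding t_tri_def by blast

lemma t_tri_iff: "t_tri X Y Z (X', Y', f) (Y'', Z', g) (Z'', S, h) \<longleftrightarrow>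
  X' = X \<and> Y' = Y \<and> Y'' = Y \<and> Z' = Z \<and> Z'' = Z \<and> S = shift T X \<and> triangle T X Y Z f g h"
  unfolding t_tri_def by auto

lemma shift_closed: "f \<in> arr T X Y \<Longrightarrow> shift_arr T X Y f \<in> arr T (shift T X) (shift T Y)"
  using shift_bij bij_betwE by metis

lemma ks_ex: "\<exists>Ys. dec X (t_idt X) Ys \<and> (\<forall>Y \<in> set Ys. loc Y)"
  using KS End_local_loc unfolding krull_schmidt_def direct_sum_dec by blast

lemma bip_ex: "\<exists>W i p j q. bip W A B i p j q"
proof -
  obtain W where "direct_sum T W [A, B]" using biproducts by blast
  then have "dec W (t_idt W) [A, B]" unfolding direct_sum_dec .
  then obtain i p c where c: "dec W c [B]" "i \<in> hm A W" "p \<in> hm W A" "t_cmp p i = t_idt A" "t_cmp p c = t_zr W A"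
    "t_cmp c i = t_zr A W" "t_idt W = t_pls (t_cmp i p) c"
    by (rule dec_split)
  obtain j q d where d: "dec W d []" "j \<in> hm B W" "q \<in> hm W B" "t_cmp q j = t_idt B" "c = t_pls (t_cmp j q) d"
    using c(1) by (rule dec_split)
  have d0: "d = t_zr W W" using d(1) by (auto elim: dec.cases)
  have cc: "c = t_cmp j q" unfolding d(5) d0 using d by simp
  have "t_cmp p j = t_zr B A"
  proof -
    have "t_cmp (t_cmp p c) j = t_zr B A" unfolding c(5) using d(2) by simp
    then show ?thesis unfolding cc using c(3) d(2-4) by simp
  qed
  moreover have "t_cmp q i = t_zr A B"
  proof -
    have "t_cmp q (t_cmp c i) = t_zr A B" unfolding c(6) using d(3) by simp
    then show ?thesis unfolding cc using c(2) d(2,3) cmp_reassoc[OF d(4), of "t_cmp q i"] by simp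
  qed
  ultimately have "bip W A B i p j q" unfolding bip_def using c d cc by simp
  then show ?thesis by blast
qed

sublocale ks_cat t_arw t_src t_tgt t_cmp t_pls t_ng t_zr t_idt
  using ks_ex bip_ex zero_object unfolding is_zero_iff by unfold_locales auto

lemma hm_eq: "u \<in> hm X Y \<longleftrightarrow> (\<exists>f. u = (X, Y, f) \<and> f \<in> arr T X Y)"
  by (cases u) auto

lemma inv_arws_iso_arr: "\<lbrakk>inv_arws u u'; u = (X, Y, f)\<rbrakk> \<Longrightarrow> iso_arr T X Y f"
  unfolding iso_arr_iff by blast

sublocale tri_ks t_arw t_src t_tgt t_cmp t_pls t_ng t_zr t_idt "shift T" t_sh t_tri
proof (unfold_locales, goal_cases)
  case (1 f) then show ?case by (cases f) (auto simp: shift_closed)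
next
  case (2 f) then show ?case by (cases f) auto
next
  case (3 f) then show ?case by (cases f) auto
next
  case (4 f X Y g)
  then obtain f' g' where "f = (X, Y, f')" "f' \<in> arr T X Y" "g = (X, Y, g')" "g' \<in> arr T X Y"
    unfolding hm_eq by blast
  then show ?case using 4 shift_bij[of X Y] unfolding bij_betw_def inj_on_def by auto
next
  case (5 g X Y)
  then obtain g' where g: "g = (shift T X, shift T Y, g')" "g' \<in> arr T (shift T X) (shift T Y)"
    unfolding hm_eq by blast
  have "shift_arr T X Y ` arr T X Y = arr T (shift T X) (shift T Y)"
    using shift_bij[of X Y] by (rule bij_betw_imp_surj_on)
  then have "g' \<in> shift_arr T X Y ` arr T X Y" using g(2) by simp
  then obtain f where "f \<in> arr T X Y" "shift_arr T X Y f = g'" by auto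
  then show ?case using g by (intro bexI[of _ "(X, Y, f)"]) auto
next
  case (6 X) then show ?case by (simp add: t_idt_eq shift_Id)
next
  case (7 g f) then show ?case by (cases f; cases g) (auto simp: shift_Comp)
next
  case (8 f g) then show ?case by (cases f; cases g) (auto simp: shift_add)
next
  case (9 Y)
  obtain X f where "iso_arr T (shift T X) Y f" using shift_ess_surj by blast
  then show ?case unfolding iso_arr_iff isom_def iso_arw_def
    by (intro exI[of _ X] exI[of _ "(shift T X, Y, f)"]) auto
next
  case (10 X Y Z f g h)
  then show ?case using triangle_closed unfolding t_tri_def by auto
next
  case (11 X Y Z f g h f' X' Y' g' Z' h' u u' v v' w w')
  obtain f1 g1 h1 where t: "f = (X, Y, f1)" "g = (Y, Z, g1)" "h = (Z, shift T X, h1)" "triangle T X Y Z f1 g1 h1"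
    using 11(1) unfolding t_tri_def by blast
  obtain f2 g2 h2 where t2: "f' = (X', Y', f2)" "f2 \<in> arr T X' Y'" "g' = (Y', Z', g2)" "g2 \<in> arr T Y' Z'"
     "h' = (Z', shift T X', h2)" "h2 \<in> arr T Z' (shift T X')"
    using 11(2-4) unfolding hm_eq by blast
  obtain u1 v1 w1 where t3: "u = (X, X', u1)" "v = (Y, Y', v1)" "w = (Z, Z', w1)"
    using 11(8-10) unfolding hm_eq by blast
  have "triangle T X' Y' Z' f2 g2 h2"
    by (rule triangle_iso[OF t(4) t2(2,4,6) inv_arws_iso_arr[OF 11(5) t3(1)] inv_arws_iso_arr[OF 11(6) t3(2)]
       inv_arws_iso_arr[OF 11(7) t3(3)]])
      (use 11(11-13) in \<open>simp_all add: t t2 t3\<close>)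
  then show ?case unfolding t2 by (rule t_tri_tag)
next
  case (12 Z X)
  then have "is_zero T Z" unfolding is_zero_iff .
  then show ?case unfolding t_idt_eq[of X] t_zr_eq[of X Z] t_zr_eq[of Z "shift T X"] by (intro t_tri_tag triangle_Id)
next
  case (13 f X Y)
  then obtain f' where f: "f = (X, Y, f')" "f' \<in> arr T X Y" unfolding hm_eq by blast
  obtain Z g h where "triangle T X Y Z f' g h" using triangle_complete[OF f(2)] by blast
  then show ?case using t_tri_tag f by blast
next
  case (14 f X Y g Z h)
  then obtain f' g' h' where f: "f = (X, Y, f')" "f' \<in> arr T X Y" "g = (Y, Z, g')" "g' \<in> arr T Y Z"
    "h = (Z, shift T X, h')" "h' \<in> arr T Z (shift T X)" unfolding hm_eq by blast
  show ?case unfolding f using triangle_rotate[OF f(2,4,6)] by (simp add: t_tri_iff)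
next
  case (15 X Y Z f g h X' Y' Z' f' g' h' u v)
  obtain f1 g1 h1 where t: "f = (X, Y, f1)" "g = (Y, Z, g1)" "h = (Z, shift T X, h1)" "triangle T X Y Z f1 g1 h1"
    using 15(1) unfolding t_tri_def by blast
  obtain f2 g2 h2 where t': "f' = (X', Y', f2)" "g' = (Y', Z', g2)" "h' = (Z', shift T X', h2)" "triangle T X' Y' Z' f2 g2 h2"
    using 15(2) unfolding t_tri_def by blast
  obtain u1 v1 where u: "u = (X, X', u1)" "u1 \<in> arr T X X'" "v = (Y, Y', v1)" "v1 \<in> arr T Y Y'"
    using 15(3,4) unfolding hm_eq by blast
  have "v1 \<cdot> f1 = f2 \<cdot> u1" using 15(5) unfolding t t' u by simp
  then obtain w where "w \<in> arr T Z Z'" "w \<cdot> g1 = g2 \<cdot> v1" "shift_arr T X X' u1 \<cdot> h1 = h2 \<cdot> w"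
    using triangle_fill[OF t(4) t'(4) u(2,4)] by blast
  then show ?case unfolding t t' u by (intro bexI[of _ "(Z, Z', w)"]) auto
next
  case (16 X Y A f a a' Z B g b b' C c c')
  obtain f1 a1 a2 where t: "f = (X, Y, f1)" "a = (Y, A, a1)" "a' = (A, shift T X, a2)" "triangle T X Y A f1 a1 a2"
    using 16(1) unfolding t_tri_def by blast
  obtain g1 b1 b2 where t': "g = (Y, Z, g1)" "b = (Z, B, b1)" "b' = (B, shift T Y, b2)" "triangle T Y Z B g1 b1 b2"
    using 16(2) unfolding t_tri_def by blast
  obtain c1 c2 where t'': "c = (Z, C, c1)" "c' = (C, shift T X, c2)" "triangle T X Z C (g1 \<cdot> f1) c1 c2"
    using 16(3) unfolding t_tri_def t t' by auto
  obtain u v where "triangle T A C B u v (shift_arr T Y A a1 \<cdot> b2)" "u \<cdot> a1 = c1 \<cdot> g1" "c2 \<cdot> u = a2" "v \<cdot> c1 = b1"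
    "b2 \<cdot> v = shift_arr T X Y f1 \<cdot> c2"
    using octahedron[OF t(4) t'(4) t''(3)] by blast
  then show ?case unfolding t t' t''(1,2)
    by (intro exI[of _ "(A, C, u)"] exI[of _ "(C, B, v)"]) (simp add: t_tri_iff)
qed

end

context tri_setup
begin

subsection \<open>Translation of the categorical notions\<close>

text \<open>
  A finite family of generators of the vector space \<open>Hom(X, V)\<close> combines to one map from a power of \<open>X\<close>.
\<close>

lemma approx_ex: "\<exists>W w. gen X W \<and> w \<in> hm W V \<and> (\<forall>x \<in> hm X V. \<exists>y \<in> hm X W. t_cmp w y = x)"
proof -
  have "finitely_generated K (Hom T X V)" using HF unfolding hom_finite_def by simp
  then obtain S where S: "finite S" "S \<subseteq> arr T X V"
    and span: "\<forall>x \<in> arr T X V. \<exists>c \<in> S \<rightarrow> carrier K. x = (\<Oplus>\<^bsub>Hom T X V\<^esub> s \<in> S. c s \<odot>\<^bsub>Hom T X V\<^esub> s)"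
    unfolding finitely_generated_def by (elim exE conjE) (rule that)
  have "\<exists>W w. gen X W \<and> w \<in> hm W V \<and> (\<forall>s \<in> S. \<exists>y \<in> hm X W. t_cmp w y = (X, V, s))"
    using S
  proof (induction S rule: finite_induct)
    case empty
    obtain Z where Z: "t_idt Z = t_zr Z Z" using zero_ob by blast
    have "gen X Z" using gen_iff_cls cls_zero[OF Z] by simp
    then show ?case by (intro exI[of _ Z] exI[of _ "t_zr Z V"]) simp
  next
    case (insert s S)
    then obtain W w where W: "gen X W" "w \<in> hm W V" "\<forall>s \<in> S. \<exists>y \<in> hm X W. t_cmp w y = (X, V, s)" by auto
    obtain B i p j q where b: "bip B W X i p j q" using bips by blast
    note h = bip_hm[OF b] and e = bip_eqs[OF b]
    have s: "(X, V, s) \<in> hm X V" using insert.prems by simp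
    let ?w = "t_pls (t_cmp w p) (t_cmp (X, V, s) q)"
    have w: "?w \<in> hm B V" using h W(2) s by simp
    have 1: "t_cmp ?w (t_cmp i y) = t_cmp w y" if "y \<in> hm X W" for y
      using that h W(2) s cmp_reassoc[of p i "t_idt W" y] cmp_reassoc[of q i "t_zr W X" y] e by (simp add: cmp_pls_left)
    have 2: "t_cmp ?w j = (X, V, s)" using h e W(2) s by (simp add: cmp_pls_left)
    have "\<exists>y \<in> hm X B. t_cmp ?w y = (X, V, s')" if s': "s' \<in> insert s S" for s'
    proof (cases "s' = s")
      case True
      then show ?thesis using 2 h by blast
    next
      case False
      then obtain y where y: "y \<in> hm X W" "t_cmp w y = (X, V, s')" using W(3) s' by blast
      then have "t_cmp ?w (t_cmp i y) = (X, V, s')" using 1 by simp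
      moreover have "t_cmp i y \<in> hm X B" using y(1) h by simp
      ultimately show ?thesis by blast
    qed
    then show ?case using gen_bip[OF b W(1) gen_refl] w by blast
  qed
  then obtain W w where W: "gen X W" "w \<in> hm W V" "\<forall>s \<in> S. \<exists>y \<in> hm X W. t_cmp w y = (X, V, s)" by blast
  obtain w' where w': "w = (W, V, w')" "w' \<in> arr T W V" using W(2) by (rule hmE)
  have lift: "\<exists>y \<in> arr T X W. w' \<cdot> y = (\<Oplus>\<^bsub>Hom T X V\<^esub> s \<in> A. c s \<odot>\<^bsub>Hom T X V\<^esub> s)"
    if "finite A" "A \<subseteq> S" "c \<in> S \<rightarrow> carrier K" for c A
    using that
  proof (induction A rule: finite_induct)
    case empty
    interpret abelian_group "Hom T X V" by (rule Hom_group)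
    show ?case using C_zero(1)[OF w'(2)] by (intro bexI[of _ "zero_arr T X W"]) auto
  next
    case (insert a A)
    interpret V: module K "Hom T X V" by (rule vector_space_Hom)
    interpret W: module K "Hom T X W" by (rule vector_space_Hom)
    obtain y where y: "y \<in> arr T X W" "w' \<cdot> y = (\<Oplus>\<^bsub>Hom T X V\<^esub> s \<in> A. c s \<odot>\<^bsub>Hom T X V\<^esub> s)"
      using insert by auto
    obtain z0 where z0: "z0 \<in> hm X W" "t_cmp w z0 = (X, V, a)" using W(3) insert.prems by auto
    then obtain z where z: "z0 = (X, W, z)" "z \<in> arr T X W" by (blast elim: hmE)
    then have z: "z \<in> arr T X W" "w' \<cdot> z = a" using z0(2) unfolding w' by simp_all
    have ca: "c a \<in> carrier K" "a \<in> arr T X V" using insert.prems S by auto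
    have cA: "(\<lambda>s. c s \<odot>\<^bsub>Hom T X V\<^esub> s) \<in> A \<rightarrow> arr T X V" using insert.prems S by auto
    have "w' \<cdot> (c a \<odot>\<^bsub>Hom T X W\<^esub> z \<oplus>\<^bsub>Hom T X W\<^esub> y) = c a \<odot>\<^bsub>Hom T X V\<^esub> a \<oplus>\<^bsub>Hom T X V\<^esub> (\<Oplus>\<^bsub>Hom T X V\<^esub> s \<in> A. c s \<odot>\<^bsub>Hom T X V\<^esub> s)"
      using w'(2) y z ca by (simp add: Comp_add_right Comp_smult_right)
    also have "\<dots> = (\<Oplus>\<^bsub>Hom T X V\<^esub> s \<in> insert a A. c s \<odot>\<^bsub>Hom T X V\<^esub> s)"
      using insert.hyps ca cA by (subst V.finsum_insert) auto
    finally show ?case using y z ca by (intro bexI[of _ "c a \<odot>\<^bsub>Hom T X W\<^esub> z \<oplus>\<^bsub>Hom T X W\<^esub> y"]) auto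
  qed
  have "\<exists>y \<in> hm X W. t_cmp w y = x" if x: "x \<in> hm X V" for x
  proof -
    obtain x' where x': "x = (X, V, x')" "x' \<in> arr T X V" using x by (rule hmE)
    obtain c where c: "c \<in> S \<rightarrow> carrier K" "x' = (\<Oplus>\<^bsub>Hom T X V\<^esub> s \<in> S. c s \<odot>\<^bsub>Hom T X V\<^esub> s)"
      using bspec[OF span x'(2)] by (elim bexE)
    obtain y where "y \<in> arr T X W" "w' \<cdot> y = x'" using lift[OF S(1) order_refl c(1)] unfolding c(2) by (elim bexE)
    then show ?thesis unfolding w' x' by (intro bexI[of _ "(X, W, y)"]) auto
  qed
  then show ?thesis using W(1,2) by blast
qed

sublocale tri_ks_approx t_arw t_src t_tgt t_cmp t_pls t_ng t_zr t_idt "shift T" t_sh t_tri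
  by unfold_locales (rule approx_ex)

text \<open>Passes from tagged arrows to the retractions of the original category.\<close>

lemma retract_arr:
  assumes "i \<in> hm Y X" "p \<in> hm X Y" "t_cmp p i = t_idt Y"
  shows "\<exists>i \<in> arr T Y X. \<exists>p \<in> arr T X Y. p \<cdot> i = Id T Y"
proof -
  obtain i' p' where "i = (Y, X, i')" "i' \<in> arr T Y X" "p = (X, Y, p')" "p' \<in> arr T X Y"
    using assms(1,2) unfolding hm_eq by blast
  then show ?thesis using assms(3) by (auto simp: t_idt_eq)
qed

lemma direct_summand_iff:
  "direct_summand T Y X \<longleftrightarrow> (\<exists>i \<in> arr T Y X. \<exists>p \<in> arr T X Y. p \<cdot> i = Id T Y)"
proof
  assume "direct_summand T Y X"
  then obtain Z where "dec X (t_idt X) [Y, Z]" unfolding direct_summand_def direct_sum_dec by blast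
  then obtain i p where ip: "i \<in> hm Y X" "p \<in> hm X Y" "t_cmp p i = t_idt Y"
    by (rule dec_retract_member[where Y = Y]) simp
  then show "\<exists>i \<in> arr T Y X. \<exists>p \<in> arr T X Y. p \<cdot> i = Id T Y" by (rule retract_arr)
next
  assume "\<exists>i \<in> arr T Y X. \<exists>p \<in> arr T X Y. p \<cdot> i = Id T Y"
  then obtain i p where "i \<in> arr T Y X" "p \<in> arr T X Y" "p \<cdot> i = Id T Y" by blast
  then have "(Y, X, i) \<in> hm Y X" "(X, Y, p) \<in> hm X Y" "t_cmp (X, Y, p) (Y, X, i) = t_idt Y" by (simp_all add: t_idt_eq)
  then obtain Z j q where "bip X Y Z (Y, X, i) (X, Y, p) j q" by (rule retract_bip)
  then show "direct_summand T Y X" unfolding direct_summand_def direct_sum_dec using bip_dec2 by blast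
qed

lemma direct_summand_gen: "direct_summand T Y X \<Longrightarrow> gen X Y"
proof -
  assume "direct_summand T Y X"
  then obtain i p where "i \<in> arr T Y X" "p \<in> arr T X Y" "p \<cdot> i = Id T Y" unfolding direct_summand_iff by blast
  then show ?thesis using gen_retract[OF gen_refl, of "(Y, X, i)" Y X "(X, Y, p)"] by (simp add: t_idt_eq)
qed

text \<open>
  A summand of \<open>M\<close> is a retract of \<open>M\<close>; conversely, the local summands of an object of \<open>add M\<close> are
  retracts of \<open>M\<close> because they are local.
\<close>

lemma add_closure_iff: "X \<in> add_closure T M \<longleftrightarrow> gen M X"
proof
  assume "X \<in> add_closure T M"
  then obtain Ys where Ys: "\<forall>Y \<in> set Ys. direct_summand T Y M" "dec X (t_idt X) Ys"
    unfolding add_closure_def direct_sum_dec by blast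
  then show "gen M X" using dec_gen[OF Ys(2)] direct_summand_gen unfolding gen_def by blast
next
  assume g: "gen M X"
  obtain Ys where Ys: "dec X (t_idt X) Ys" "\<forall>Y \<in> set Ys. loc Y" using ks by blast
  have "direct_summand T Y M" if Y: "Y \<in> set Ys" for Y
  proof -
    obtain i p where "i \<in> hm Y X" "p \<in> hm X Y" "t_cmp p i = t_idt Y" using dec_retract_member[OF Ys(1) Y] by blast
    then have "gen M Y" using gen_retract[OF g] by blast
    then obtain i p where "i \<in> hm Y M" "p \<in> hm M Y" "t_cmp p i = t_idt Y"
      using Ys(2) Y by (metis loc_gen_retract)
    then show ?thesis unfolding direct_summand_iff by (rule retract_arr)
  qed
  then show "X \<in> add_closure T M" unfolding add_closure_def direct_sum_dec using Ys(1) by blast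
qed

lemma factoring_iff:
  "x \<in> factoring T Z X Y \<longleftrightarrow> (\<exists>W f g. gen Z W \<and> f \<in> arr T X W \<and> g \<in> arr T W Y \<and> x = g \<cdot> f)"
  unfolding factoring_def add_closure_iff by blast

lemma zero_factoring: "zero_arr T X Y \<in> factoring T Z X Y"
  unfolding factoring_iff using gen_refl[of Z] C_zero(1)[of "zero_arr T Z Y" Z Y X]
  by (intro exI[of _ Z] exI[of _ "zero_arr T X Z"] exI[of _ "zero_arr T Z Y"]) simp

lemma pr_iff: "X \<in> pr T R \<longleftrightarrow> (\<exists>R1 R0 f g h. gen R R1 \<and> gen R R0 \<and> triangle T R1 R0 X f g h)"
  unfolding pr_def add_closure_iff by blast

lemma rig_iff: "rig R \<longleftrightarrow> rigid T R"
proof -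
  have "hm R (shift T R) = (\<lambda>f. (R, shift T R, f)) ` arr T R (shift T R)" unfolding hm_eq by (auto simp: hm_eq)
  moreover have "inj (\<lambda>f. (R, shift T R, f))" by (simp add: inj_on_def)
  moreover have "{t_zr R (shift T R)} = (\<lambda>f. (R, shift T R, f)) ` {zero_arr T R (shift T R)}" by (simp add: t_zr_eq)
  ultimately show ?thesis unfolding rig_def rigid_def using inj_image_eq_iff by metis
qed

text \<open>
  Rigidity forces \<open>Hom(R, R1[1]) = 0\<close>, which is the additional condition in \<open>upres\<close>.
\<close>

lemma pres_pr: "rigid T R \<Longrightarrow> pres R X \<longleftrightarrow> X \<in> pr T R"
proof
  assume "pres R X"
  then obtain U1 U0 f g w where u: "t_tri U1 U0 X f g w" "gen R U1" "gen R U0" unfolding pres_def upres_def by blast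
  then show "X \<in> pr T R" unfolding pr_iff using u(1)[unfolded t_tri_def] by blast
next
  assume R: "rigid T R" and "X \<in> pr T R"
  then obtain R1 R0 f g h where r: "gen R R1" "gen R R0" and t: "triangle T R1 R0 X f g h" unfolding pr_iff by blast
  have "kills R (X, shift T R1, h)"
    by (rule rig_kills[OF _ r(1)]) (use R rig_iff triangle_closed[OF t] in auto)
  then show "pres R X" unfolding pres_def upres_def using r t_tri_tag[OF t] by blast
qed

lemma factoring_shift_zero:
  "factoring T (shift T R) X (shift T Y) = {zero_arr T X (shift T Y)} \<longleftrightarrow> erel R X Y"
proof
  assume z: "factoring T (shift T R) X (shift T Y) = {zero_arr T X (shift T Y)}"
  show "erel R X Y" unfolding erel_def
  proof (intro ballI)
    fix f g assume "f \<in> hm X (shift T R)" "g \<in> hm (shift T R) (shift T Y)"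
    then obtain f' g' where f: "f = (X, shift T R, f')" "f' \<in> arr T X (shift T R)"
      and g: "g = (shift T R, shift T Y, g')" "g' \<in> arr T (shift T R) (shift T Y)" unfolding hm_eq by blast
    have "g' \<cdot> f' \<in> factoring T (shift T R) X (shift T Y)" unfolding factoring_iff using gen_refl f g by blast
    then show "t_cmp g f = t_zr X (shift T Y)" unfolding f g using z by (simp add: t_zr_eq)
  qed
next
  assume e: "erel R X Y"
  have "x = zero_arr T X (shift T Y)" if x: "x \<in> factoring T (shift T R) X (shift T Y)" for x
  proof -
    obtain W f g where "gen (shift T R) W" "f \<in> arr T X W" "g \<in> arr T W (shift T Y)" "x = g \<cdot> f"
      using x unfolding factoring_iff by blast
    then have "(X, shift T Y, x) \<in> thru (shift T R) X (shift T Y)"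
      using thru_gen[of "shift T R" W "(X, W, f)" X "(W, shift T Y, g)" "shift T Y"] by simp
    then have "(X, shift T Y, x) = t_zr X (shift T Y)" using erel_thru[OF e, of "(X, shift T Y, x)"] by simp
    then show ?thesis by (simp add: t_zr_eq)
  qed
  then show "factoring T (shift T R) X (shift T Y) = {zero_arr T X (shift T Y)}" using zero_factoring by blast
qed

lemma shift_rigid_iff: "shift_rigid T R X \<longleftrightarrow> erel R X X"
  unfolding shift_rigid_def using factoring_shift_zero by blast

lemma loc_indecomposable:
  assumes "loc L" shows "indecomposable T L"
  unfolding indecomposable_def is_zero_iff direct_sum_dec
proof (intro conjI allI impI)
  show "t_idt L \<noteq> t_zr L L" using assms unfolding loc_def by blast
  fix Y Z assume "dec L (t_idt L) [Y, Z]"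
  then have "cls Y + cls Z = {#icl L#}" using cls_dec cls_loc[OF assms] by fastforce
  then have "cls Y = {#} \<or> cls Z = {#}" by (simp add: union_is_single)  blast
  then show "t_idt Y = t_zr Y Y \<or> t_idt Z = t_zr Z Z" using cls_empty by blast
qed

lemma basic_count:
  assumes "basic T X" shows "count (cls X) r \<le> 1"
proof (rule ccontr)
  assume c: "\<not> count (cls X) r \<le> 1"
  then have "r \<in># cls X" by (metis count_eq_zero_iff zero_le_one)
  then obtain L i p where L: "loc L" "icl L = r" using cls_member by metis
  then obtain Z where "dec X (t_idt X) [L, L, Z]" using repeated_summand[OF L(1), of X] c by auto
  then show False using assms loc_indecomposable[OF L(1)] unfolding basic_def direct_sum_dec by blast
qed

text \<open>
  The direct sums \<open>X \<oplus> Z\<close> and \<open>X[1] \<oplus> Z[1]\<close> in the definition are arbitrary ones; composing with their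
  inclusions and projections reduces the condition on them to the four pairs formed from \<open>X\<close> and \<open>Z\<close>,
  so that \<open>maximal_iff_count\<close> applies.
\<close>

theorem maximal_shift_rigid_iff:
  assumes R: "rigid T R" and X: "X \<in> pr T R" "shift_rigid T R X"
  shows "maximal_shift_rigid T R X \<longleftrightarrow> card (set_mset (cls X)) = card (set_mset (cls R))"
proof -
  have rX: "erel R X X" using X(2) shift_rigid_iff by blast
  have eq: "(\<forall>B B'. direct_sum T B [X, Z] \<and> direct_sum T B' [shift T X, shift T Z] \<and>
        factoring T (shift T R) B B' = {zero_arr T B B'} \<longrightarrow> Z \<in> add_closure T X)
     \<longleftrightarrow> (erel R X Z \<and> erel R Z X \<and> erel R Z Z \<longrightarrow> gen X Z)" for Z
  proof
    assume a: "\<forall>B B'. direct_sum T B [X, Z] \<and> direct_sum T B' [shift T X, shift T Z] \<and>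
        factoring T (shift T R) B B' = {zero_arr T B B'} \<longrightarrow> Z \<in> add_closure T X"
    show "erel R X Z \<and> erel R Z X \<and> erel R Z Z \<longrightarrow> gen X Z"
    proof
      assume e: "erel R X Z \<and> erel R Z X \<and> erel R Z Z"
      obtain B i p j q where b: "bip B X Z i p j q" using bips by blast
      have "erel R B B" by (intro erel_bip_left[OF _ _ b] erel_bip_right[OF _ _ b]) (use e rX in auto)
      then have "factoring T (shift T R) B (shift T B) = {zero_arr T B (shift T B)}"
        using factoring_shift_zero by blast
      moreover have "direct_sum T B [X, Z]" unfolding direct_sum_dec by (rule bip_dec2[OF b])
      moreover have "direct_sum T (shift T B) [shift T X, shift T Z]"
        unfolding direct_sum_dec by (rule bip_dec2[OF bip_sh[OF b]])
      ultimately show "gen X Z" using a add_closure_iff by blast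
    qed
  next
    assume a: "erel R X Z \<and> erel R Z X \<and> erel R Z Z \<longrightarrow> gen X Z"
    show "\<forall>B B'. direct_sum T B [X, Z] \<and> direct_sum T B' [shift T X, shift T Z] \<and>
        factoring T (shift T R) B B' = {zero_arr T B B'} \<longrightarrow> Z \<in> add_closure T X"
    proof (intro allI impI, elim conjE)
      fix B B' assume B: "direct_sum T B [X, Z]" and B': "direct_sum T B' [shift T X, shift T Z]"
        and z: "factoring T (shift T R) B B' = {zero_arr T B B'}"
      have er: "erel R U V" if U: "U \<in> {X, Z}" and V: "V \<in> {X, Z}" for U V
      proof -
        obtain i p where i: "i \<in> hm U B" "p \<in> hm B U" "t_cmp p i = t_idt U"
          by (rule dec_retract_member[OF B[unfolded direct_sum_dec]]) (use U in auto)
        have "shift T V \<in> set [shift T X, shift T Z]" using V by auto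
        then obtain j q where j: "j \<in> hm (shift T V) B'" "q \<in> hm B' (shift T V)" "t_cmp q j = t_idt (shift T V)"
          by (rule dec_retract_member[OF B'[unfolded direct_sum_dec]])
        show ?thesis unfolding erel_def
        proof (intro ballI)
          fix f g assume f: "f \<in> hm U (shift T R)" and g: "g \<in> hm (shift T R) (shift T V)"
          have "t_cmp f p \<in> hm B (shift T R)" "t_cmp j g \<in> hm (shift T R) B'" using f g i j by simp_all
          then obtain f' g' where f': "t_cmp f p = (B, shift T R, f')" "f' \<in> arr T B (shift T R)"
            and g': "t_cmp j g = (shift T R, B', g')" "g' \<in> arr T (shift T R) B'" unfolding hm_eq by blast
          have "g' \<cdot> f' \<in> factoring T (shift T R) B B'" unfolding factoring_iff using gen_refl f' g' by blast
          then have z: "t_cmp (t_cmp j g) (t_cmp f p) = t_zr B B'" unfolding f' g' using z by (simp add: t_zr_eq)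
          have "t_cmp q (t_cmp (t_cmp (t_cmp j g) (t_cmp f p)) i) = t_cmp g f"
            using f g i j cmp_reassoc[OF j(3)] by simp
          then show "t_cmp g f = t_zr U (shift T V)" unfolding z using i j by simp
        qed
      qed
      then show "Z \<in> add_closure T X" unfolding add_closure_iff using a by blast
    qed
  qed
  have "maximal_shift_rigid T R X \<longleftrightarrow> (\<forall>Z. pres R Z \<and> erel R X Z \<and> erel R Z X \<and> erel R Z Z \<longrightarrow> gen X Z)"
    unfolding maximal_shift_rigid_def Ball_def eq pres_pr[OF R] using X by blast
  then show ?thesis using maximal_iff_count[of R X] R X rX rig_iff pres_pr by blast
qed

end

(* the infix of ideal products would clash with composition *)
no_notation ideal_prod (infixl \<open>\<cdot>\<index>\<close> 80)

section \<open>Right modules and their homomorphisms\<close>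

lemma right_module_ab: "right_module R M \<Longrightarrow> abelian_group M"
  unfolding right_module_def by blast

lemma right_module_ring: "right_module R M \<Longrightarrow> ring R"
  unfolding right_module_def by blast

lemma right_module_ops:
  assumes "right_module R M"
  shows "\<zero>\<^bsub>M\<^esub> \<in> carrier M"
    "\<And>x y. x \<in> carrier M \<Longrightarrow> y \<in> carrier M \<Longrightarrow> x \<oplus>\<^bsub>M\<^esub> y \<in> carrier M"
    "\<And>x. x \<in> carrier M \<Longrightarrow> \<ominus>\<^bsub>M\<^esub> x \<in> carrier M"
    "\<And>x y. x \<in> carrier M \<Longrightarrow> y \<in> carrier M \<Longrightarrow> x \<ominus>\<^bsub>M\<^esub> y \<in> carrier M"
    "\<And>a x. a \<in> carrier R \<Longrightarrow> x \<in> carrier M \<Longrightarrow> a \<odot>\<^bsub>M\<^esub> x \<in> carrier M"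
proof -
  interpret M: abelian_group M using assms by (rule right_module_ab)
  show "\<zero>\<^bsub>M\<^esub> \<in> carrier M"
    "\<And>x y. x \<in> carrier M \<Longrightarrow> y \<in> carrier M \<Longrightarrow> x \<oplus>\<^bsub>M\<^esub> y \<in> carrier M"
    "\<And>x. x \<in> carrier M \<Longrightarrow> \<ominus>\<^bsub>M\<^esub> x \<in> carrier M"
    "\<And>x y. x \<in> carrier M \<Longrightarrow> y \<in> carrier M \<Longrightarrow> x \<ominus>\<^bsub>M\<^esub> y \<in> carrier M" by auto
  show "\<And>a x. a \<in> carrier R \<Longrightarrow> x \<in> carrier M \<Longrightarrow> a \<odot>\<^bsub>M\<^esub> x \<in> carrier M"
    using right_module.smult_closed[OF assms] .
qed

lemma module_homD:
  assumes "f \<in> module_hom R M N"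
  shows "\<And>x. x \<in> carrier M \<Longrightarrow> f x \<in> carrier N"
    "\<And>x y. x \<in> carrier M \<Longrightarrow> y \<in> carrier M \<Longrightarrow> f (x \<oplus>\<^bsub>M\<^esub> y) = f x \<oplus>\<^bsub>N\<^esub> f y"
    "\<And>a x. a \<in> carrier R \<Longrightarrow> x \<in> carrier M \<Longrightarrow> f (a \<odot>\<^bsub>M\<^esub> x) = a \<odot>\<^bsub>N\<^esub> f x"
    "f \<in> extensional (carrier M)"
  using assms unfolding module_hom_def PiE_def by auto

lemma module_homI:
  assumes "right_module R M"
    "\<And>x. x \<in> carrier M \<Longrightarrow> f x \<in> carrier N"
    "\<And>x y. x \<in> carrier M \<Longrightarrow> y \<in> carrier M \<Longrightarrow> f (x \<oplus>\<^bsub>M\<^esub> y) = f x \<oplus>\<^bsub>N\<^esub> f y"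
    "\<And>a x. a \<in> carrier R \<Longrightarrow> x \<in> carrier M \<Longrightarrow> f (a \<odot>\<^bsub>M\<^esub> x) = a \<odot>\<^bsub>N\<^esub> f x"
  shows "restrict f (carrier M) \<in> module_hom R M N"
  using assms(2-) right_module_ops[OF assms(1)] unfolding module_hom_def by (simp add: restrict_apply)

lemma module_hom_ext:
  assumes "f \<in> module_hom R M N" "g \<in> module_hom R M N" "\<And>x. x \<in> carrier M \<Longrightarrow> f x = g x"
  shows "f = g"
  using extensionalityI[OF module_homD(4)[OF assms(1)] module_homD(4)[OF assms(2)]] assms(3) by blast

lemma module_hom_zero:
  assumes "right_module R M" "right_module R N" "f \<in> module_hom R M N"
  shows "f \<zero>\<^bsub>M\<^esub> = \<zero>\<^bsub>N\<^esub>"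
proof -
  interpret M: abelian_group M using assms(1) by (rule right_module_ab)
  interpret N: abelian_group N using assms(2) by (rule right_module_ab)
  have "f \<zero>\<^bsub>M\<^esub> \<in> carrier N" using module_homD(1)[OF assms(3)] by simp
  moreover have "f \<zero>\<^bsub>M\<^esub> \<oplus>\<^bsub>N\<^esub> f \<zero>\<^bsub>M\<^esub> = f \<zero>\<^bsub>M\<^esub>"
    using module_homD(2)[OF assms(3), of "\<zero>\<^bsub>M\<^esub>" "\<zero>\<^bsub>M\<^esub>"] by simp
  ultimately show ?thesis using N.add.r_cancel_one by blast
qed

lemma module_hom_neg:
  assumes "right_module R M" "right_module R N" "f \<in> module_hom R M N" "x \<in> carrier M"
  shows "f (\<ominus>\<^bsub>M\<^esub> x) = \<ominus>\<^bsub>N\<^esub> f x"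
proof -
  interpret M: abelian_group M using assms(1) by (rule right_module_ab)
  interpret N: abelian_group N using assms(2) by (rule right_module_ab)
  have "f (\<ominus>\<^bsub>M\<^esub> x) \<oplus>\<^bsub>N\<^esub> f x = \<zero>\<^bsub>N\<^esub>"
    using module_homD(2)[OF assms(3), of "\<ominus>\<^bsub>M\<^esub> x" x] assms(4) module_hom_zero[OF assms(1-3)] by (simp add: M.l_neg)
  then show ?thesis using module_homD(1)[OF assms(3)] assms(4) by (simp add: N.minus_equality)
qed

lemma module_hom_minus:
  assumes "right_module R M" "right_module R N" "f \<in> module_hom R M N" "x \<in> carrier M" "y \<in> carrier M"
  shows "f (x \<ominus>\<^bsub>M\<^esub> y) = f x \<ominus>\<^bsub>N\<^esub> f y"
  using module_homD(2)[OF assms(3), of x "\<ominus>\<^bsub>M\<^esub> y"] module_hom_neg[OF assms(1-3,5)] assms right_module_ops(3)[OF assms(1)]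
  unfolding a_minus_def by simp

lemma module_hom_compose:
  assumes "right_module R M" "f \<in> module_hom R M N" "g \<in> module_hom R N P"
  shows "compose (carrier M) g f \<in> module_hom R M P"
  unfolding compose_def
  by (rule module_homI[OF assms(1)]) (simp_all add: module_homD[OF assms(2)] module_homD[OF assms(3)])

lemma right_module_minus_add:
  assumes "right_module R M" "x \<in> carrier M" "x' \<in> carrier M" "y \<in> carrier M" "y' \<in> carrier M"
  shows "(x \<oplus>\<^bsub>M\<^esub> x') \<ominus>\<^bsub>M\<^esub> (y \<oplus>\<^bsub>M\<^esub> y') = (x \<ominus>\<^bsub>M\<^esub> y) \<oplus>\<^bsub>M\<^esub> (x' \<ominus>\<^bsub>M\<^esub> y')"
proof -
  interpret M: abelian_group M using assms(1) by (rule right_module_ab)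
  show ?thesis using assms(2-) by (simp add: a_minus_def M.minus_add M.a_ac)
qed

lemma right_module_smult_neg:
  assumes "right_module R M" "a \<in> carrier R" "x \<in> carrier M"
  shows "a \<odot>\<^bsub>M\<^esub> (\<ominus>\<^bsub>M\<^esub> x) = \<ominus>\<^bsub>M\<^esub> (a \<odot>\<^bsub>M\<^esub> x)"
proof -
  interpret M: abelian_group M using assms(1) by (rule right_module_ab)
  note ops = right_module_ops[OF assms(1)]
  have z: "a \<odot>\<^bsub>M\<^esub> \<zero>\<^bsub>M\<^esub> = \<zero>\<^bsub>M\<^esub>"
    using right_module.smult_module_distr[OF assms(1), of a "\<zero>\<^bsub>M\<^esub>" "\<zero>\<^bsub>M\<^esub>"] assms(2) ops(1,5) M.add.r_cancel_one by simp
  have "a \<odot>\<^bsub>M\<^esub> (\<ominus>\<^bsub>M\<^esub> x) \<oplus>\<^bsub>M\<^esub> a \<odot>\<^bsub>M\<^esub> x = \<zero>\<^bsub>M\<^esub>"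
    using right_module.smult_module_distr[OF assms(1), of a "\<ominus>\<^bsub>M\<^esub> x" x] assms ops z by (simp add: M.l_neg)
  then show ?thesis using ops assms by (simp add: M.minus_equality)
qed

lemma right_module_smult_minus:
  assumes "right_module R M" "a \<in> carrier R" "x \<in> carrier M" "y \<in> carrier M"
  shows "a \<odot>\<^bsub>M\<^esub> (x \<ominus>\<^bsub>M\<^esub> y) = a \<odot>\<^bsub>M\<^esub> x \<ominus>\<^bsub>M\<^esub> a \<odot>\<^bsub>M\<^esub> y"
  unfolding a_minus_def using right_module.smult_module_distr[OF assms(1,2), of x "\<ominus>\<^bsub>M\<^esub> y"]
    right_module_smult_neg[OF assms(1,2,4)] assms right_module_ops(3)[OF assms(1)] by simp

lemma a_kernel_iff: "x \<in> a_kernel M N f \<longleftrightarrow> x \<in> carrier M \<and> f x = \<zero>\<^bsub>N\<^esub>"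
  unfolding a_kernel_def' by simp

lemma submodule_kernel:
  assumes "right_module R M" "right_module R N" "f \<in> module_hom R M N"
  shows "submodule (a_kernel M N f) R M"
proof -
  interpret N: abelian_group N using assms(2) by (rule right_module_ab)
  note ops = right_module_ops[OF assms(1)] and h = module_homD[OF assms(3)]
  have z: "a \<odot>\<^bsub>N\<^esub> \<zero>\<^bsub>N\<^esub> = \<zero>\<^bsub>N\<^esub>" if "a \<in> carrier R" for a
    using right_module.smult_module_distr[OF assms(2) that, of "\<zero>\<^bsub>N\<^esub>" "\<zero>\<^bsub>N\<^esub>"] right_module_ops[OF assms(2)] that
      N.add.r_cancel_one by simp
  show ?thesis
    by unfold_locales
      (auto simp: a_kernel_iff ops h z module_hom_zero[OF assms] module_hom_neg[OF assms] simp flip: a_inv_def)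
qed

lemma submoduleD:
  assumes "submodule S R M"
  shows "S \<subseteq> carrier M" "\<zero>\<^bsub>M\<^esub> \<in> S" "\<And>x y. x \<in> S \<Longrightarrow> y \<in> S \<Longrightarrow> x \<oplus>\<^bsub>M\<^esub> y \<in> S"
    "\<And>x. x \<in> S \<Longrightarrow> \<ominus>\<^bsub>M\<^esub> x \<in> S" "\<And>a x. a \<in> carrier R \<Longrightarrow> x \<in> S \<Longrightarrow> a \<odot>\<^bsub>M\<^esub> x \<in> S"
proof -
  interpret submodule S R M by (rule assms)
  show "S \<subseteq> carrier M" "\<zero>\<^bsub>M\<^esub> \<in> S" "\<And>x y. x \<in> S \<Longrightarrow> y \<in> S \<Longrightarrow> x \<oplus>\<^bsub>M\<^esub> y \<in> S"
    "\<And>x. x \<in> S \<Longrightarrow> \<ominus>\<^bsub>M\<^esub> x \<in> S" "\<And>a x. a \<in> carrier R \<Longrightarrow> x \<in> S \<Longrightarrow> a \<odot>\<^bsub>M\<^esub> x \<in> S"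
    using subset one_closed m_closed m_inv_closed smult_closed by (auto simp: a_inv_def)
qed

lemma submodule_right_module:
  assumes M: "right_module R M" and S: "submodule S R M"
  shows "right_module R (M\<lparr>carrier := S\<rparr>)"
proof -
  interpret M: abelian_group M using M by (rule right_module_ab)
  note s = submoduleD[OF S]
  have "abelian_group (M\<lparr>carrier := S\<rparr>)"
  proof (rule abelian_groupI, goal_cases)
    case (6 x)
    then show ?case using s by (intro bexI[of _ "\<ominus>\<^bsub>M\<^esub> x"]) (auto simp: M.l_neg)
  qed (use s in \<open>auto simp: M.a_ac subset_iff\<close>)
  moreover have "right_module_axioms R (M\<lparr>carrier := S\<rparr>)"
    by unfold_locales (use s right_module.smult_ring_distr[OF M] right_module.smult_module_distr[OF M]
      right_module.smult_assoc[OF M] right_module.smult_one[OF M] in \<open>auto simp: subset_iff\<close>)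
  ultimately show ?thesis using right_module_ring[OF M] unfolding right_module_def by blast
qed

subsection \<open>Finite generation\<close>

text \<open>
  Linear combinations in which a generator may be repeated, so that sums and images are immediate.
\<close>

inductive_set rspan :: "('a, 'r) ring_scheme \<Rightarrow> ('a, 'b, 'c) module_scheme \<Rightarrow> 'b set \<Rightarrow> 'b set" for R M S where
  rspan_zero: "\<zero>\<^bsub>M\<^esub> \<in> rspan R M S"
| rspan_step: "\<lbrakk>a \<in> carrier R; s \<in> S; x \<in> rspan R M S\<rbrakk> \<Longrightarrow> a \<odot>\<^bsub>M\<^esub> s \<oplus>\<^bsub>M\<^esub> x \<in> rspan R M S"

lemma rspan_closed: "\<lbrakk>right_module R M; S \<subseteq> carrier M; x \<in> rspan R M S\<rbrakk> \<Longrightarrow> x \<in> carrier M"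
  by (erule rspan.induct) (auto simp: right_module_ops subset_iff)

lemma finsum_rspan:
  assumes M: "right_module R M" and "finite A" "A \<subseteq> S" "S \<subseteq> carrier M" "c \<in> A \<rightarrow> carrier R"
  shows "(\<Oplus>\<^bsub>M\<^esub> s \<in> A. c s \<odot>\<^bsub>M\<^esub> s) \<in> rspan R M S"
proof -
  interpret M: abelian_group M using M by (rule right_module_ab)
  show ?thesis using assms(2,3,5)
  proof (induction A rule: finite_induct)
    case empty then show ?case using rspan_zero[of M R S] by simp
  next
    case (insert s A)
    have "(\<Oplus>\<^bsub>M\<^esub> s \<in> insert s A. c s \<odot>\<^bsub>M\<^esub> s) = c s \<odot>\<^bsub>M\<^esub> s \<oplus>\<^bsub>M\<^esub> (\<Oplus>\<^bsub>M\<^esub> s \<in> A. c s \<odot>\<^bsub>M\<^esub> s)"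
      using insert assms(4) right_module_ops(5)[OF M] by (intro M.finsum_insert) (auto simp: subset_iff Pi_iff)
    then show ?case using insert rspan_step[of "c s" R s S] by simp
  qed
qed

lemma rspan_finsum:
  assumes M: "right_module R M" and "finite S" "S \<subseteq> carrier M" "x \<in> rspan R M S"
  shows "\<exists>c \<in> S \<rightarrow> carrier R. x = (\<Oplus>\<^bsub>M\<^esub> s \<in> S. c s \<odot>\<^bsub>M\<^esub> s)"
  using assms(4)
proof (induction rule: rspan.induct)
  case rspan_zero
  interpret M: abelian_group M using M by (rule right_module_ab)
  interpret R: ring R using M by (rule right_module_ring)
  have "\<zero>\<^bsub>R\<^esub> \<odot>\<^bsub>M\<^esub> s = \<zero>\<^bsub>M\<^esub>" if s: "s \<in> carrier M" for s
    using right_module.smult_ring_distr[OF M, of "\<zero>\<^bsub>R\<^esub>" "\<zero>\<^bsub>R\<^esub>" s] right_module_ops(5)[OF M, of "\<zero>\<^bsub>R\<^esub>" s] s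
     M.add.r_cancel_one by simp
  then have "(\<Oplus>\<^bsub>M\<^esub> s \<in> S. \<zero>\<^bsub>R\<^esub> \<odot>\<^bsub>M\<^esub> s) = \<zero>\<^bsub>M\<^esub>"
    using assms(3) by (intro M.add.finprod_one_eqI[folded finsum_def]) auto
  then show ?case by (intro bexI[of _ "\<lambda>s. \<zero>\<^bsub>R\<^esub>"]) auto
next
  case (rspan_step a s x)
  interpret M: abelian_group M using M by (rule right_module_ab)
  interpret R: ring R using M by (rule right_module_ring)
  obtain c where c: "c \<in> S \<rightarrow> carrier R" "x = (\<Oplus>\<^bsub>M\<^esub> s \<in> S. c s \<odot>\<^bsub>M\<^esub> s)" using rspan_step.IH by blast
  note ops = right_module_ops[OF M]
  have h: "(\<lambda>s. c s \<odot>\<^bsub>M\<^esub> s) \<in> S - {s} \<rightarrow> carrier M" "c s \<odot>\<^bsub>M\<^esub> s \<in> carrier M" "a \<odot>\<^bsub>M\<^esub> s \<in> carrier M"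
    using c(1) assms(3) rspan_step.hyps ops(5) by (auto simp: subset_iff)
  let ?c = "c(s := a \<oplus>\<^bsub>R\<^esub> c s)"
  have S: "S = insert s (S - {s})" using rspan_step.hyps by blast
  have cR: "?c \<in> S \<rightarrow> carrier R" using c(1) rspan_step.hyps by (auto simp: Pi_iff)
  have cM: "?c t \<odot>\<^bsub>M\<^esub> t \<in> carrier M" if "t \<in> S" for t
    using funcset_mem[OF cR that] that assms(3) by (intro ops(5)) auto
  have "(\<Oplus>\<^bsub>M\<^esub> t \<in> S. ?c t \<odot>\<^bsub>M\<^esub> t) = ?c s \<odot>\<^bsub>M\<^esub> s \<oplus>\<^bsub>M\<^esub> (\<Oplus>\<^bsub>M\<^esub> t \<in> S - {s}. ?c t \<odot>\<^bsub>M\<^esub> t)"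
    using assms(2) cM cM[OF rspan_step.hyps(2)] by (subst S, intro M.finsum_insert) auto
  also have "(\<Oplus>\<^bsub>M\<^esub> t \<in> S - {s}. ?c t \<odot>\<^bsub>M\<^esub> t) = (\<Oplus>\<^bsub>M\<^esub> t \<in> S - {s}. c t \<odot>\<^bsub>M\<^esub> t)"
    using h(1) by (intro M.finsum_cong') auto
  also have "?c s \<odot>\<^bsub>M\<^esub> s = a \<odot>\<^bsub>M\<^esub> s \<oplus>\<^bsub>M\<^esub> c s \<odot>\<^bsub>M\<^esub> s"
    using right_module.smult_ring_distr[OF M, of a "c s" s] rspan_step.hyps c(1) assms(3) by auto
  also have "a \<odot>\<^bsub>M\<^esub> s \<oplus>\<^bsub>M\<^esub> c s \<odot>\<^bsub>M\<^esub> s \<oplus>\<^bsub>M\<^esub> (\<Oplus>\<^bsub>M\<^esub> t \<in> S - {s}. c t \<odot>\<^bsub>M\<^esub> t)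
     = a \<odot>\<^bsub>M\<^esub> s \<oplus>\<^bsub>M\<^esub> (c s \<odot>\<^bsub>M\<^esub> s \<oplus>\<^bsub>M\<^esub> (\<Oplus>\<^bsub>M\<^esub> t \<in> S - {s}. c t \<odot>\<^bsub>M\<^esub> t))"
    using h by (intro M.a_assoc M.finsum_closed) auto
  also have "c s \<odot>\<^bsub>M\<^esub> s \<oplus>\<^bsub>M\<^esub> (\<Oplus>\<^bsub>M\<^esub> t \<in> S - {s}. c t \<odot>\<^bsub>M\<^esub> t) = x"
    unfolding c(2) using h assms(2) by (subst (2) S, intro M.finsum_insert[symmetric]) auto
  finally have "a \<odot>\<^bsub>M\<^esub> s \<oplus>\<^bsub>M\<^esub> x = (\<Oplus>\<^bsub>M\<^esub> t \<in> S. ?c t \<odot>\<^bsub>M\<^esub> t)" ..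
  then show ?case using cR by blast
qed

lemma finitely_generated_iff:
  assumes M: "right_module R M"
  shows "finitely_generated R M \<longleftrightarrow> (\<exists>S. finite S \<and> S \<subseteq> carrier M \<and> carrier M \<subseteq> rspan R M S)"
proof
  assume "finitely_generated R M"
  then obtain S where S: "finite S" "S \<subseteq> carrier M"
    "\<forall>x \<in> carrier M. \<exists>c \<in> S \<rightarrow> carrier R. x = (\<Oplus>\<^bsub>M\<^esub> s \<in> S. c s \<odot>\<^bsub>M\<^esub> s)"
    unfolding finitely_generated_def by (elim exE conjE) (rule that)
  have "x \<in> rspan R M S" if x: "x \<in> carrier M" for x
  proof -
    obtain c where "c \<in> S \<rightarrow> carrier R" "x = (\<Oplus>\<^bsub>M\<^esub> s \<in> S. c s \<odot>\<^bsub>M\<^esub> s)" using bspec[OF S(3) x] by (elim bexE)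
    then show ?thesis using finsum_rspan[OF M S(1) order_refl S(2)] by simp
  qed
  then show "\<exists>S. finite S \<and> S \<subseteq> carrier M \<and> carrier M \<subseteq> rspan R M S" using S by blast
next
  assume "\<exists>S. finite S \<and> S \<subseteq> carrier M \<and> carrier M \<subseteq> rspan R M S"
  then obtain S where S: "finite S" "S \<subseteq> carrier M" "carrier M \<subseteq> rspan R M S" by blast
  have "\<forall>x \<in> carrier M. \<exists>c \<in> S \<rightarrow> carrier R. x = (\<Oplus>\<^bsub>M\<^esub> s \<in> S. c s \<odot>\<^bsub>M\<^esub> s)"
    using rspan_finsum[OF M S(1,2)] S(3) by blast
  then show "finitely_generated R M" unfolding finitely_generated_def using S(1,2) by (intro exI[of _ S] conjI)
qed

lemma rspan_image:
  assumes M: "right_module R M" "right_module R N" "f \<in> module_hom R M N" and S: "S \<subseteq> carrier M" and x: "x \<in> rspan R M S"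
  shows "f x \<in> rspan R N (f ` S)"
  using x
proof (induction rule: rspan.induct)
  case rspan_zero
  then show ?case using module_hom_zero[OF M] rspan.rspan_zero[of N] by simp
next
  case (rspan_step a s x)
  have "x \<in> carrier M" by (rule rspan_closed[OF M(1) S rspan_step.hyps(3)])
  then have "f (a \<odot>\<^bsub>M\<^esub> s \<oplus>\<^bsub>M\<^esub> x) = a \<odot>\<^bsub>N\<^esub> f s \<oplus>\<^bsub>N\<^esub> f x"
    using rspan_step.hyps S right_module_ops(5)[OF M(1)] by (auto simp: module_homD[OF M(3)] subset_iff)
  then show ?case using rspan_step rspan.rspan_step[of a R "f s" "f ` S" "f x" N] by auto
qed

lemma fg_module_image:
  assumes M: "fg_module R M" and N: "right_module R N" and f: "f \<in> module_hom R M N" "f ` carrier M = carrier N"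
  shows "fg_module R N"
proof -
  have M': "right_module R M" using M unfolding fg_module_def by blast
  obtain S where S: "finite S" "S \<subseteq> carrier M" "carrier M \<subseteq> rspan R M S"
    using M finitely_generated_iff[OF M'] unfolding fg_module_def by blast
  have "carrier N \<subseteq> rspan R N (f ` S)"
  proof
    fix y assume "y \<in> carrier N"
    then obtain x where "x \<in> carrier M" "y = f x" using f(2) by blast
    then show "y \<in> rspan R N (f ` S)" using rspan_image[OF M' N f(1) S(2)] S(3) by blast
  qed
  moreover have "f ` S \<subseteq> carrier N" using f(2) S(2) by blast
  ultimately have "finitely_generated R N"
    unfolding finitely_generated_iff[OF N] using S(1) by (intro exI[of _ "f ` S"]) simp
  then show ?thesis using N unfolding fg_module_def by blast
qed

subsection \<open>Copies on the small carrier type\<close>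

text \<open>
  Resolutions consist of modules with carrier in \<open>nat \<Rightarrow> 'a\<close>, where \<open>'a\<close> is the type of ring elements.  A
  module whose carrier is already in \<open>'a\<close>, such as \<open>Hom(R, X)\<close>, is moved there by constant functions.
\<close>

definition small_copy :: "('a, 'a) module \<Rightarrow> 'a small_module" where
  "small_copy M = \<lparr>carrier = (\<lambda>x n. x) ` carrier M, monoid.mult = undefined, one = undefined,
     ring.zero = (\<lambda>n. \<zero>\<^bsub>M\<^esub>), ring.add = (\<lambda>f g n. f 0 \<oplus>\<^bsub>M\<^esub> g 0), smult = (\<lambda>a f n. a \<odot>\<^bsub>M\<^esub> f 0)\<rparr>"

lemma small_copy_simps [simp]:
  "carrier (small_copy M) = (\<lambda>x n. x) ` carrier M" "\<zero>\<^bsub>small_copy M\<^esub> = (\<lambda>n. \<zero>\<^bsub>M\<^esub>)"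
  "f \<oplus>\<^bsub>small_copy M\<^esub> g = (\<lambda>n. f 0 \<oplus>\<^bsub>M\<^esub> g 0)" "a \<odot>\<^bsub>small_copy M\<^esub> f = (\<lambda>n. a \<odot>\<^bsub>M\<^esub> f 0)"
  unfolding small_copy_def by simp_all

lemma small_copy_right_module:
  assumes M: "right_module R M"
  shows "right_module R (small_copy M)"
proof -
  interpret M: abelian_group M using M by (rule right_module_ab)
  note ops = right_module_ops[OF M]
  have "abelian_group (small_copy M)"
  proof (rule abelian_groupI, goal_cases)
    case (6 x)
    then show ?case by (auto simp: M.l_neg intro!: bexI[of _ "\<ominus>\<^bsub>M\<^esub> _"])
  qed (auto simp: M.a_ac ops)
  moreover have "right_module_axioms R (small_copy M)"
    by unfold_locales (auto simp: ops right_module.smult_ring_distr[OF M] right_module.smult_module_distr[OF M]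
      right_module.smult_assoc[OF M] right_module.smult_one[OF M])
  ultimately show ?thesis using right_module_ring[OF M] unfolding right_module_def by blast
qed

definition to_copy :: "('a, 'a) module \<Rightarrow> 'a \<Rightarrow> nat \<Rightarrow> 'a" where
  "to_copy M = (\<lambda>x \<in> carrier M. \<lambda>n. x)"
definition of_copy :: "('a, 'a) module \<Rightarrow> (nat \<Rightarrow> 'a) \<Rightarrow> 'a" where
  "of_copy M = (\<lambda>f \<in> carrier (small_copy M). f 0)"

lemma to_copy_hom: "right_module R M \<Longrightarrow> to_copy M \<in> module_hom R M (small_copy M)"
  unfolding to_copy_def by (rule module_homI) auto

lemma of_copy_hom: "right_module R M \<Longrightarrow> of_copy M \<in> module_hom R (small_copy M) M"
  unfolding of_copy_def by (rule module_homI) (auto intro: small_copy_right_module)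

lemma copy_inverse [simp]:
  "x \<in> carrier M \<Longrightarrow> of_copy M (to_copy M x) = x"
  "f \<in> carrier (small_copy M) \<Longrightarrow> to_copy M (of_copy M f) = f"
  unfolding to_copy_def of_copy_def by auto

lemma to_copy_surj: "to_copy M ` carrier M = carrier (small_copy M)"
  unfolding to_copy_def by auto

lemma fg_small_copy: "fg_module R M \<Longrightarrow> fg_module R (small_copy M)"
  using fg_module_image[OF _ small_copy_right_module to_copy_hom to_copy_surj] unfolding fg_module_def by blast

text \<open>
  The lifting property of a projective module is only stated for modules on the small carrier type.
\<close>

lemma projective_lift:
  fixes A B :: "('a, 'a) module"
  assumes P: "projective_module R P" and A: "fg_module R A" and B: "fg_module R B"
    and g: "g \<in> module_hom R A B" "g ` carrier A = carrier B" and f: "f \<in> module_hom R P B"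
  obtains h where "h \<in> module_hom R P A" "\<And>x. x \<in> carrier P \<Longrightarrow> g (h x) = f x"
proof -
  have m: "right_module R P" "right_module R A" "right_module R B"
    using P A B unfolding projective_module_def fg_module_def by blast+
  note mc = small_copy_right_module[OF m(2)] small_copy_right_module[OF m(3)]
  let ?g = "compose (carrier (small_copy A)) (compose (carrier A) (to_copy B) g) (of_copy A)"
  let ?f = "compose (carrier P) (to_copy B) f"
  have g': "?g \<in> module_hom R (small_copy A) (small_copy B)"
    by (intro module_hom_compose[OF mc(1) of_copy_hom] module_hom_compose[OF _ g(1) to_copy_hom] m)
  have f': "?f \<in> module_hom R P (small_copy B)"
    by (intro module_hom_compose[OF _ f to_copy_hom] m)
  have "?g ` carrier (small_copy A) = carrier (small_copy B)"
  proof -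
    have "?g (to_copy A x) = to_copy B (g x)" if "x \<in> carrier A" for x
      using that to_copy_surj[of A] by (auto simp: compose_def)
    then have "?g ` (to_copy A ` carrier A) = to_copy B ` (g ` carrier A)" by (simp add: image_image)
    then show ?thesis unfolding to_copy_surj g(2) .
  qed
  then obtain h where h: "h \<in> module_hom R P (small_copy A)" "\<forall>x \<in> carrier P. ?g (h x) = ?f x"
    using P g' f' fg_small_copy[OF A] fg_small_copy[OF B] unfolding projective_module_def by blast
  have hh: "compose (carrier P) (of_copy A) h \<in> module_hom R P A"
    by (rule module_hom_compose[OF m(1) h(1) of_copy_hom[OF m(2)]])
  have "g (compose (carrier P) (of_copy A) h x) = f x" if x: "x \<in> carrier P" for x
  proof -
    have c: "h x \<in> carrier (small_copy A)" "f x \<in> carrier B"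
      using module_homD(1)[OF h(1) x] module_homD(1)[OF f x] .
    have oc: "of_copy A (h x) \<in> carrier A" using module_homD(1)[OF of_copy_hom[OF m(2)] c(1)] .
    have "to_copy B (g (of_copy A (h x))) = to_copy B (f x)"
      using bspec[OF h(2) x] x c oc by (simp add: compose_def)
    then have "of_copy B (to_copy B (g (of_copy A (h x)))) = of_copy B (to_copy B (f x))" by simp
    then have "g (of_copy A (h x)) = f x" using module_homD(1)[OF g(1) oc] c by simp
    then show ?thesis using x by (simp add: compose_def)
  qed
  then show ?thesis using that hh by blast
qed

subsection \<open>The first extension group\<close>

text \<open>
  If \<open>P\<close> is projective and maps onto \<open>M\<close> by \<open>e\<close>, this says that \<open>Ext\<^sup>1(M, N)\<close> vanishes, computed from
  \<open>0 \<rightarrow> ker e \<rightarrow> P \<rightarrow> M \<rightarrow> 0\<close>.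
\<close>

definition extends_from_kernel where
  "extends_from_kernel R P M e N \<longleftrightarrow> (\<forall>k \<in> module_hom R (P\<lparr>carrier := a_kernel P M e\<rparr>) N.
     \<exists>h \<in> module_hom R P N. \<forall>x \<in> a_kernel P M e. h x = k x)"

text \<open>
  The comparison maps carry \<open>ker p\<close> to \<open>ker e\<close> by \<open>a\<close>.  If \<open>h\<close> extends \<open>k \<circ> a\<close>, then
  \<open>h \<circ> b + k \<circ> (1 - a \<circ> b)\<close> extends \<open>k\<close>.
\<close>

lemma extends_from_kernel_transfer:
  assumes P: "right_module R P" and Q: "right_module R Q" and M: "right_module R M" and N: "right_module R N"
    and e: "e \<in> module_hom R P M" and p: "p \<in> module_hom R Q M"
    and a: "a \<in> module_hom R Q P" "\<And>x. x \<in> carrier Q \<Longrightarrow> e (a x) = p x"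
    and b: "b \<in> module_hom R P Q" "\<And>x. x \<in> carrier P \<Longrightarrow> p (b x) = e x"
    and ext: "extends_from_kernel R Q M p N"
  shows "extends_from_kernel R P M e N"
  unfolding extends_from_kernel_def
proof
  let ?KP = "P\<lparr>carrier := a_kernel P M e\<rparr>" and ?KQ = "Q\<lparr>carrier := a_kernel Q M p\<rparr>"
  fix k assume k: "k \<in> module_hom R ?KP N"
  have sP: "submodule (a_kernel P M e) R P" and sQ: "submodule (a_kernel Q M p) R Q"
    using submodule_kernel P Q M e p by blast+
  note rKP = submodule_right_module[OF P sP] and rKQ = submodule_right_module[OF Q sQ]
  note A = module_homD[OF a(1)] and B = module_homD[OF b(1)] and k' = module_homD[OF k, simplified]
  note opsP = right_module_ops[OF P] and opsQ = right_module_ops[OF Q] and opsN = right_module_ops[OF N]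
  interpret N: abelian_group N using N by (rule right_module_ab)
  interpret M: abelian_group M using M by (rule right_module_ab)
  have aK: "a x \<in> a_kernel P M e" if "x \<in> a_kernel Q M p" for x
    using that a A by (simp add: a_kernel_iff)
  have "restrict (\<lambda>x. k (a x)) (carrier ?KQ) \<in> module_hom R ?KQ N"
  proof (rule module_homI[OF rKQ])
    fix x assume x: "x \<in> carrier ?KQ"
    then show "k (a x) \<in> carrier N" using aK k' by simp
    fix y assume y: "y \<in> carrier ?KQ"
    have "a (x \<oplus>\<^bsub>Q\<^esub> y) = a x \<oplus>\<^bsub>P\<^esub> a y" using A(2) x y by (simp add: a_kernel_iff)
    then show "k (a (x \<oplus>\<^bsub>?KQ\<^esub> y)) = k (a x) \<oplus>\<^bsub>N\<^esub> k (a y)"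
      using k'(2) aK x y by simp
  next
    fix r x assume r: "r \<in> carrier R" and x: "x \<in> carrier ?KQ"
    have "a (r \<odot>\<^bsub>Q\<^esub> x) = r \<odot>\<^bsub>P\<^esub> a x" using A(3) r x by (simp add: a_kernel_iff)
    then show "k (a (r \<odot>\<^bsub>?KQ\<^esub> x)) = r \<odot>\<^bsub>N\<^esub> k (a x)" using k'(3) aK r x by simp
  qed
  then obtain h where h: "h \<in> module_hom R Q N" "\<forall>x \<in> a_kernel Q M p. h x = restrict (\<lambda>x. k (a x)) (carrier ?KQ) x"
    using ext unfolding extends_from_kernel_def by blast
  note H = module_homD[OF h(1)]
  \<comment> \<open>\<open>1 - a \<circ> b\<close> maps \<open>P\<close> into \<open>ker e\<close>, and \<open>k\<close> can be applied to it\<close>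
  define d where "d x = x \<ominus>\<^bsub>P\<^esub> a (b x)" for x
  have dK: "d x \<in> a_kernel P M e" if x: "x \<in> carrier P" for x
  proof -
    have "e (d x) = e x \<ominus>\<^bsub>M\<^esub> e (a (b x))" unfolding d_def using x A(1) B(1) by (intro module_hom_minus[OF P M e]) auto
    also have "\<dots> = \<zero>\<^bsub>M\<^esub>" using a(2) b(2) B(1) x module_homD(1)[OF e] by (simp add: a_minus_def M.r_neg)
    finally show ?thesis unfolding a_kernel_iff d_def using x A(1) B(1) opsP(4) by blast
  qed
  have dadd: "d (x \<oplus>\<^bsub>P\<^esub> y) = d x \<oplus>\<^bsub>P\<^esub> d y" if "x \<in> carrier P" "y \<in> carrier P" for x y
    unfolding d_def using that A B by (simp add: right_module_minus_add[OF P])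
  have dsm: "d (r \<odot>\<^bsub>P\<^esub> x) = r \<odot>\<^bsub>P\<^esub> d x" if "r \<in> carrier R" "x \<in> carrier P" for r x
    unfolding d_def using that A B by (simp add: right_module_smult_minus[OF P])
  have "restrict (\<lambda>x. h (b x) \<oplus>\<^bsub>N\<^esub> k (d x)) (carrier P) \<in> module_hom R P N"
  proof (rule module_homI[OF P])
    fix x assume x: "x \<in> carrier P"
    then show "h (b x) \<oplus>\<^bsub>N\<^esub> k (d x) \<in> carrier N" using H B dK k' by simp
    fix y assume y: "y \<in> carrier P"
    show "h (b (x \<oplus>\<^bsub>P\<^esub> y)) \<oplus>\<^bsub>N\<^esub> k (d (x \<oplus>\<^bsub>P\<^esub> y)) = h (b x) \<oplus>\<^bsub>N\<^esub> k (d x) \<oplus>\<^bsub>N\<^esub> (h (b y) \<oplus>\<^bsub>N\<^esub> k (d y))"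
      using x y H B dK k' dadd by (simp add: N.a_ac)
  next
    fix r x assume r: "r \<in> carrier R" and x: "x \<in> carrier P"
    have "h (b x) \<in> carrier N" "k (d x) \<in> carrier N" using x H B dK k' by simp_all
    then show "h (b (r \<odot>\<^bsub>P\<^esub> x)) \<oplus>\<^bsub>N\<^esub> k (d (r \<odot>\<^bsub>P\<^esub> x)) = r \<odot>\<^bsub>N\<^esub> (h (b x) \<oplus>\<^bsub>N\<^esub> k (d x))"
      using r x H B dK k' dsm right_module.smult_module_distr[OF N] by simp
  qed
  moreover have "restrict (\<lambda>x. h (b x) \<oplus>\<^bsub>N\<^esub> k (d x)) (carrier P) x = k x" if x: "x \<in> a_kernel P M e" for x
  proof -
    have xP: "x \<in> carrier P" and ex: "e x = \<zero>\<^bsub>M\<^esub>" using x unfolding a_kernel_iff by auto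
    have bx: "b x \<in> a_kernel Q M p" unfolding a_kernel_iff using B(1) b(2) xP ex by simp
    have "h (b x) = k (a (b x))" using h(2) bx by simp
    then have "h (b x) \<oplus>\<^bsub>N\<^esub> k (d x) = k (a (b x) \<oplus>\<^bsub>P\<^esub> d x)" using k'(2)[OF aK[OF bx] dK[OF xP]] by simp
    also have "a (b x) \<oplus>\<^bsub>P\<^esub> d x = x"
    proof -
      interpret P: abelian_group P using P by (rule right_module_ab)
      show ?thesis unfolding d_def using xP A(1) B(1) by (simp add: a_minus_def P.a_lcomm P.r_neg)
    qed
    finally show ?thesis using xP by simp
  qed
  ultimately show "\<exists>h \<in> module_hom R P N. \<forall>x \<in> a_kernel P M e. h x = k x" by blast
qed

lemma resolution_modules:
  assumes "projective_resolution R M P d e"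
  shows "right_module R (P n)" "d n \<in> module_hom R (P (Suc n)) (P n)" "e \<in> module_hom R (P 0) M"
    "e ` carrier (P 0) = carrier M" "d 0 ` carrier (P (Suc 0)) = a_kernel (P 0) M e"
    "d (Suc n) ` carrier (P (Suc (Suc n))) = a_kernel (P (Suc n)) (P n) (d n)"
  using assms unfolding projective_resolution_def projective_module_def fg_module_def by auto

text \<open>
  By exactness \<open>P 1\<close> maps onto \<open>ker e\<close>, and its kernel is the image of \<open>P 2\<close>; so the 1-cocycles are the
  homomorphisms on \<open>ker e\<close>, and the coboundaries are those that extend to \<open>P 0\<close>.
\<close>

lemma cocycles_coboundaries_iff:
  assumes M: "right_module R M" and N: "right_module R N" and res: "projective_resolution R M P d e"
  shows "ext_cocycles R P d N 1 \<subseteq> ext_coboundaries R P d N 1 \<longleftrightarrow> extends_from_kernel R (P 0) M e N"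
proof -
  note r = resolution_modules[OF res]
  note d0 = module_homD[OF r(2)[of 0]] and d1 = module_homD[OF r(2)[of 1]]
  let ?P0 = "P 0" and ?P1 = "P (Suc 0)" and ?P2 = "P (Suc (Suc 0))"
  let ?K = "P 0\<lparr>carrier := a_kernel (P 0) M e\<rparr>"
  have sK: "submodule (a_kernel (P 0) M e) R (P 0)" by (rule submodule_kernel[OF r(1) M r(3)])
  note rK = submodule_right_module[OF r(1) sK]
  have d0K: "d 0 x \<in> a_kernel (P 0) M e" if "x \<in> carrier ?P1" for x using r(5) that by blast
  have dd: "d 0 (d 1 x) = \<zero>\<^bsub>?P0\<^esub>" if "x \<in> carrier ?P2" for x
    using r(6)[of 0] that unfolding a_kernel_def' by auto
  show ?thesis
  proof
    assume zb: "ext_cocycles R P d N 1 \<subseteq> ext_coboundaries R P d N 1"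
    show "extends_from_kernel R (P 0) M e N" unfolding extends_from_kernel_def
    proof
      fix k assume k: "k \<in> module_hom R ?K N"
      note k' = module_homD[OF k, simplified]
      let ?f = "restrict (\<lambda>x. k (d 0 x)) (carrier ?P1)"
      have f: "?f \<in> module_hom R ?P1 N"
        by (rule module_homI[OF r(1)]) (use k' d0 d0K in simp_all)
      have "k \<zero>\<^bsub>?P0\<^esub> = \<zero>\<^bsub>N\<^esub>" using module_hom_zero[OF rK N k] by simp
      then have "?f \<in> ext_cocycles R P d N 1" unfolding ext_cocycles_def using f dd d1 by simp
      then have "?f \<in> ext_coboundaries R P d N (Suc 0)" using zb by auto
      then obtain h where h: "h \<in> module_hom R ?P0 N" "?f = compose (carrier ?P1) h (d 0)" by auto
      have "h x = k x" if x: "x \<in> a_kernel (P 0) M e" for x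
      proof -
        obtain y where y: "y \<in> carrier ?P1" "x = d 0 y" using x r(5) by blast
        show ?thesis using fun_cong[OF h(2), of y] y by (simp add: compose_def)
      qed
      then show "\<exists>h \<in> module_hom R (P 0) N. \<forall>x \<in> a_kernel (P 0) M e. h x = k x" using h(1) by blast
    qed
  next
    assume ext: "extends_from_kernel R (P 0) M e N"
    show "ext_cocycles R P d N 1 \<subseteq> ext_coboundaries R P d N 1"
    proof
      fix f assume "f \<in> ext_cocycles R P d N 1"
      then have f: "f \<in> module_hom R ?P1 N" and fz: "\<And>x. x \<in> carrier ?P2 \<Longrightarrow> f (d 1 x) = \<zero>\<^bsub>N\<^esub>"
        unfolding ext_cocycles_def by auto
      note F = module_homD[OF f]
      interpret P1: abelian_group ?P1 using r(1) by (rule right_module_ab)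
      interpret P0: abelian_group ?P0 using r(1) by (rule right_module_ab)
      interpret N: abelian_group N using N by (rule right_module_ab)
      \<comment> \<open>a cocycle factors through the image of \<open>d 0\<close>\<close>
      have wd: "f x = f y" if "x \<in> carrier ?P1" "y \<in> carrier ?P1" "d 0 x = d 0 y" for x y
      proof -
        have "d 0 (x \<ominus>\<^bsub>?P1\<^esub> y) = d 0 x \<ominus>\<^bsub>?P0\<^esub> d 0 y"
          by (rule module_hom_minus[OF r(1) r(1) r(2) that(1,2)])
        then have "d 0 (x \<ominus>\<^bsub>?P1\<^esub> y) = \<zero>\<^bsub>?P0\<^esub>"
          using that d0(1) by (simp add: a_minus_def P0.r_neg)
        then have "x \<ominus>\<^bsub>?P1\<^esub> y \<in> a_kernel ?P1 ?P0 (d 0)" using that unfolding a_kernel_def' by simp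
        then obtain z where "z \<in> carrier ?P2" "x \<ominus>\<^bsub>?P1\<^esub> y = d 1 z" using r(6)[of 0] by auto
        then have "f x \<ominus>\<^bsub>N\<^esub> f y = \<zero>\<^bsub>N\<^esub>" using fz module_hom_minus[OF r(1) N f] that by metis
        moreover have "f x = (f x \<ominus>\<^bsub>N\<^esub> f y) \<oplus>\<^bsub>N\<^esub> f y" using F(1) that by (simp add: a_minus_def N.a_assoc N.l_neg)
        ultimately show ?thesis using F(1)[OF that(2)] N.l_zero by metis
      qed
      define s where "s x = (SOME y. y \<in> carrier ?P1 \<and> d 0 y = x)" for x
      have s: "s x \<in> carrier ?P1 \<and> d 0 (s x) = x" if "x \<in> a_kernel (P 0) M e" for x
      proof -
        have "x \<in> d 0 ` carrier ?P1" unfolding r(5) by (rule that)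
        then have "\<exists>y. y \<in> carrier ?P1 \<and> d 0 y = x" by auto
        from someI_ex[OF this] show ?thesis unfolding s_def .
      qed
      let ?k = "restrict (\<lambda>x. f (s x)) (carrier ?K)"
      have k: "?k \<in> module_hom R ?K N"
      proof (rule module_homI[OF rK])
        fix x assume x: "x \<in> carrier ?K"
        then show "f (s x) \<in> carrier N" using s F by simp
        fix y assume y: "y \<in> carrier ?K"
        have xy: "x \<oplus>\<^bsub>?P0\<^esub> y \<in> a_kernel (P 0) M e" using submoduleD[OF sK] x y by simp
        have "f (s (x \<oplus>\<^bsub>?P0\<^esub> y)) = f (s x \<oplus>\<^bsub>?P1\<^esub> s y)"
          by (rule wd) (use s x y xy d0 in simp_all)
        then show "f (s (x \<oplus>\<^bsub>?K\<^esub> y)) = f (s x) \<oplus>\<^bsub>N\<^esub> f (s y)" using F s x y by simp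
      next
        fix c x assume c: "c \<in> carrier R" and x: "x \<in> carrier ?K"
        have cx: "c \<odot>\<^bsub>?P0\<^esub> x \<in> a_kernel (P 0) M e" using submoduleD[OF sK] c x by simp
        have "f (s (c \<odot>\<^bsub>?P0\<^esub> x)) = f (c \<odot>\<^bsub>?P1\<^esub> s x)"
          by (rule wd) (use s x cx c d0 right_module_ops[OF r(1)] in simp_all)
        then show "f (s (c \<odot>\<^bsub>?K\<^esub> x)) = c \<odot>\<^bsub>N\<^esub> f (s x)" using F s x c by simp
      qed
      then obtain h where h: "h \<in> module_hom R (P 0) N" "\<forall>x \<in> a_kernel (P 0) M e. h x = ?k x"
        using ext unfolding extends_from_kernel_def by blast
      have "f = compose (carrier ?P1) h (d 0)"
      proof (rule module_hom_ext[OF f module_hom_compose[OF r(1) r(2) h(1)]])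
        fix x assume x: "x \<in> carrier ?P1"
        then have "h (d 0 x) = f (s (d 0 x))" using h(2) d0K by simp
        also have "\<dots> = f x" using wd s d0K x by blast
        finally show "f x = compose (carrier ?P1) h (d 0) x" using x by (simp add: compose_def)
      qed
      then have "f \<in> ext_coboundaries R P d N (Suc 0)" using h(1) by auto
      then show "f \<in> ext_coboundaries R P d N 1" by simp
    qed
  qed
qed

lemma trivial_FactGroup_iff:
  assumes G: "comm_group G" and H: "subgroup H G"
  shows "trivial_group (G Mod H) \<longleftrightarrow> carrier G \<subseteq> H"
proof -
  interpret G: comm_group G by (rule G)
  have n: "H \<lhd> G" using G.subgroup_imp_normal[OF H] .
  have g: "group (G Mod H)" using normal.factorgroup_is_group[OF n] .
  show ?thesis
  proof
    assume "trivial_group (G Mod H)"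
    then have c: "carrier (G Mod H) = {H}" unfolding trivial_group_def by simp
    show "carrier G \<subseteq> H"
    proof
      fix x assume x: "x \<in> carrier G"
      then have "H #>\<^bsub>G\<^esub> x = H" using c unfolding carrier_FactGroup by auto
      then show "x \<in> H" using G.rcos_self[OF x H] by simp
    qed
  next
    assume s: "carrier G \<subseteq> H"
    have "H #>\<^bsub>G\<^esub> x = H" if "x \<in> carrier G" for x using that s G.coset_join2[OF that H] by blast
    then have "carrier (G Mod H) = {H}" unfolding carrier_FactGroup using G.one_closed by auto
    then show "trivial_group (G Mod H)" unfolding trivial_group_def using g by simp
  qed
qed

lemma hom_group_comm:
  assumes M: "right_module R M" and N: "right_module R N"
  shows "comm_group (hom_group R M N)"
proof -
  interpret N: abelian_group N using N by (rule right_module_ab)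
  note opsM = right_module_ops[OF M] and opsN = right_module_ops[OF N]
  have z: "r \<odot>\<^bsub>N\<^esub> \<zero>\<^bsub>N\<^esub> = \<zero>\<^bsub>N\<^esub>" if "r \<in> carrier R" for r
    using right_module.smult_module_distr[OF N that, of "\<zero>\<^bsub>N\<^esub>" "\<zero>\<^bsub>N\<^esub>"] opsN that N.add.r_cancel_one by simp
  show ?thesis
  proof (rule comm_groupI, goal_cases)
    case (1 f g)
    then have f: "f \<in> module_hom R M N" and g: "g \<in> module_hom R M N" unfolding hom_group_def by simp_all
    have "restrict (\<lambda>x. f x \<oplus>\<^bsub>N\<^esub> g x) (carrier M) \<in> module_hom R M N"
      by (rule module_homI[OF M]) (simp_all add: module_homD[OF f] module_homD[OF g] N.a_ac right_module.smult_module_distr[OF N])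
    then show ?case unfolding hom_group_def by simp
  next
    case 2
    show ?case unfolding hom_group_def by (simp, rule module_homI[OF M]) (simp_all add: z)
  next
    case (3 f g h)
    then have m: "f \<in> module_hom R M N" "g \<in> module_hom R M N" "h \<in> module_hom R M N" unfolding hom_group_def by simp_all
    show ?case unfolding hom_group_def using module_homD(1)[OF m(1)] module_homD(1)[OF m(2)] module_homD(1)[OF m(3)]
      by (auto simp: N.a_assoc intro!: restrict_ext)
  next
    case (4 f g)
    then have m: "f \<in> module_hom R M N" "g \<in> module_hom R M N" unfolding hom_group_def by simp_all
    show ?case unfolding hom_group_def using module_homD(1)[OF m(1)] module_homD(1)[OF m(2)]
      by (auto simp: N.a_comm intro!: restrict_ext)
  next
    case (5 f)
    then have m: "f \<in> module_hom R M N" unfolding hom_group_def by simp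
    show ?case unfolding hom_group_def
      by (simp, rule extensionalityI[of _ "carrier M"]) (use module_homD[OF m] in auto)
  next
    case (6 f)
    then have m: "f \<in> module_hom R M N" unfolding hom_group_def by simp
    have "restrict (\<lambda>x. \<ominus>\<^bsub>N\<^esub> f x) (carrier M) \<in> module_hom R M N"
      by (rule module_homI[OF M]) (simp_all add: module_homD[OF m] N.minus_add right_module_smult_neg[OF N])
    then show ?case unfolding hom_group_def
      by (intro bexI[of _ "restrict (\<lambda>x. \<ominus>\<^bsub>N\<^esub> f x) (carrier M)"]) (auto simp: module_homD[OF m] N.l_neg intro!: restrict_ext)
  qed
qed

lemma hom_group_inv:
  assumes M: "right_module R M" and N: "right_module R N" and f: "f \<in> module_hom R M N"
  shows "inv\<^bsub>hom_group R M N\<^esub> f = restrict (\<lambda>x. \<ominus>\<^bsub>N\<^esub> f x) (carrier M)"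
proof -
  interpret N: abelian_group N using N by (rule right_module_ab)
  interpret H: comm_group "hom_group R M N" by (rule hom_group_comm[OF M N])
  have g: "restrict (\<lambda>x. \<ominus>\<^bsub>N\<^esub> f x) (carrier M) \<in> module_hom R M N"
    by (rule module_homI[OF M]) (simp_all add: module_homD[OF f] N.minus_add right_module_smult_neg[OF N])
  show ?thesis
    by (rule H.inv_equality) (use f g in \<open>auto simp: hom_group_def module_homD[OF f] N.l_neg intro!: restrict_ext\<close>)
qed

text \<open>
  The resolution that defines the extension group is an unspecified one, hence the existential
  quantifier; \<open>extends_from_kernel_transfer\<close> later replaces it by a concrete one.
\<close>

theorem trivial_ext_iff:
  assumes M: "right_module R M" and N: "right_module R N" and ex: "projective_resolution R M P0 d0 e0"
  shows "\<exists>P d e. projective_resolution R M P d e \<and> (trivial_group (ext_group R 1 M N) \<longleftrightarrow> extends_from_kernel R (P 0) M e N)"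
proof -
  define t where "t = (SOME (P, d, e). projective_resolution R M P d e)"
  obtain P d e where t: "t = (P, d, e)" by (cases t) auto
  have "(\<lambda>(P, d, e). projective_resolution R M P d e) t"
    unfolding t_def by (rule someI[of _ "(P0, d0, e0)"]) (use ex in simp)
  then have res: "projective_resolution R M P d e" unfolding t by simp
  note r = resolution_modules[OF res]
  let ?G = "hom_group R (P 1) N" and ?Z = "ext_cocycles R P d N 1" and ?B = "ext_coboundaries R P d N 1"
  have eg: "ext_group R 1 M N = ?G\<lparr>carrier := ?Z\<rparr> Mod ?B"
    unfolding ext_group_def t_def[symmetric] t by simp
  interpret N: abelian_group N using N by (rule right_module_ab)
  interpret H: comm_group ?G by (rule hom_group_comm[OF r(1) N])
  interpret H0: comm_group "hom_group R (P 0) N" by (rule hom_group_comm[OF r(1) N])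
  note d0 = module_homD[OF r(2)[of 0]] and d1 = module_homD[OF r(2)[of 1]]
  have gs: "carrier ?G = module_hom R (P 1) N" "\<And>f g. f \<otimes>\<^bsub>?G\<^esub> g = (\<lambda>x \<in> carrier (P 1). f x \<oplus>\<^bsub>N\<^esub> g x)"
    "\<one>\<^bsub>?G\<^esub> = (\<lambda>x \<in> carrier (P 1). \<zero>\<^bsub>N\<^esub>)" unfolding hom_group_def by simp_all
  have Z: "subgroup ?Z ?G"
  proof (rule H.subgroupI)
    show "?Z \<subseteq> carrier ?G" unfolding gs ext_cocycles_def by blast
    show "?Z \<noteq> {}" using H.one_closed d1 unfolding gs ext_cocycles_def by force
    fix f assume f: "f \<in> ?Z"
    then have fm: "f \<in> module_hom R (P 1) N" unfolding ext_cocycles_def by blast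
    show "inv\<^bsub>?G\<^esub> f \<in> ?Z" using H.inv_closed[of f] f d1(1) unfolding gs ext_cocycles_def
      by (auto simp: hom_group_inv[OF r(1) N])
    fix g assume g: "g \<in> ?Z"
    then show "f \<otimes>\<^bsub>?G\<^esub> g \<in> ?Z" using f H.m_closed[of f g] d1(1) unfolding gs ext_cocycles_def by auto
  qed
  have dd: "d 0 (d 1 x) = \<zero>\<^bsub>P 0\<^esub>" if "x \<in> carrier (P 2)" for x
    using r(6)[of 0] that unfolding a_kernel_def' by (auto simp: numeral_2_eq_2)
  have BZ: "?B \<subseteq> ?Z"
  proof
    fix f assume "f \<in> ?B"
    then obtain h where h: "h \<in> module_hom R (P 0) N" "f = compose (carrier (P 1)) h (d 0)" by auto
    have "f \<in> module_hom R (P 1) N" using module_hom_compose[OF r(1) r(2) h(1)] h(2) by simp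
    moreover have "f (d 1 x) = \<zero>\<^bsub>N\<^esub>" if "x \<in> carrier (P (Suc 1))" for x
      unfolding h(2) using that d1(1) dd module_hom_zero[OF r(1) N h(1)] by (simp add: compose_def numeral_2_eq_2)
    ultimately show "f \<in> ?Z" unfolding ext_cocycles_def by simp
  qed
  have cB: "compose (carrier (P 1)) h (d 0) \<in> ?B" if "h \<in> module_hom R (P 0) N" for h using that by auto
  have B: "subgroup ?B ?G"
  proof (rule H.subgroupI)
    show "?B \<subseteq> carrier ?G" using BZ subgroup.subset[OF Z] by blast
    show "?B \<noteq> {}" using cB H0.one_closed unfolding hom_group_def by auto
    fix f assume f: "f \<in> ?B"
    then obtain h where h: "h \<in> module_hom R (P 0) N" "f = compose (carrier (P 1)) h (d 0)" by auto
    have fm: "f \<in> module_hom R (P 1) N" using f BZ unfolding ext_cocycles_def by blast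
    have "inv\<^bsub>hom_group R (P 0) N\<^esub> h \<in> module_hom R (P 0) N" using H0.inv_closed[of h] h(1) by (simp add: hom_group_def)
    from cB[OF this] show "inv\<^bsub>?G\<^esub> f \<in> ?B"
      unfolding hom_group_inv[OF r(1) N h(1)] hom_group_inv[OF r(1) N fm] unfolding h(2)
      using d0(1) by (simp add: compose_def cong: restrict_cong)
    fix g assume g: "g \<in> ?B"
    then obtain h' where h': "h' \<in> module_hom R (P 0) N" "g = compose (carrier (P 1)) h' (d 0)" by auto
    have "h \<otimes>\<^bsub>hom_group R (P 0) N\<^esub> h' \<in> module_hom R (P 0) N" using H0.m_closed[of h h'] h(1) h'(1) by (simp add: hom_group_def)
    from cB[OF this] show "f \<otimes>\<^bsub>?G\<^esub> g \<in> ?B"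
      unfolding h(2) h'(2) using d0(1) by (simp add: compose_def hom_group_def cong: restrict_cong)
  qed
  interpret Z: group "?G\<lparr>carrier := ?Z\<rparr>" by (rule H.subgroup_imp_group[OF Z])
  have "comm_group (?G\<lparr>carrier := ?Z\<rparr>)"
    by (rule Z.group_comm_groupI) (use subgroup.subset[OF Z] H.m_comm in auto)
  moreover have "subgroup ?B (?G\<lparr>carrier := ?Z\<rparr>)" by (rule H.subgroup_incl[OF B Z BZ])
  ultimately have "trivial_group (ext_group R 1 M N) \<longleftrightarrow> ?Z \<subseteq> ?B"
    unfolding eg using trivial_FactGroup_iff[of "?G\<lparr>carrier := ?Z\<rparr>" ?B] by simp
  then show ?thesis using cocycles_coboundaries_iff[OF M N res] res by blast
qed

section \<open>The functor \<open>Hom(R, -)\<close>\<close>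

lemma abelian_group_cong:
  assumes "abelian_group G" "carrier H = carrier G" "ring.add H = ring.add G" "\<zero>\<^bsub>H\<^esub> = \<zero>\<^bsub>G\<^esub>"
  shows "abelian_group H"
proof -
  interpret G: abelian_group G by fact
  show ?thesis
  proof (rule abelian_groupI, goal_cases)
    case (6 x)
    then show ?case unfolding assms(2-4) by (intro bexI[of _ "\<ominus>\<^bsub>G\<^esub> x"]) (auto simp: G.l_neg)
  qed (auto simp: assms(2-4) G.a_ac)
qed

context tri_setup
begin

lemma comp_zero_left [simp]: "f \<in> arr T X Y \<Longrightarrow> zero_arr T Y Z \<cdot> f = zero_arr T X Z"
  using zr_cmp[of "(X, Y, f)" Y Z] by (simp add: t_zr_eq)

lemma comp_zero_right [simp]: "g \<in> arr T Y Z \<Longrightarrow> g \<cdot> zero_arr T X Y = zero_arr T X Z"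
  by (rule C_zero(1))

lemma End_simps [simp]:
  "carrier (End_ring T R) = arr T R R" "a \<otimes>\<^bsub>End_ring T R\<^esub> b = a \<cdot> b" "\<one>\<^bsub>End_ring T R\<^esub> = Id T R"
  "\<zero>\<^bsub>End_ring T R\<^esub> = zero_arr T R R" "a \<oplus>\<^bsub>End_ring T R\<^esub> b = a \<oplus>\<^bsub>Hom T R R\<^esub> b"
  unfolding End_ring_def by simp_all

lemma Hom_module_simps [simp]:
  "carrier (Hom_module T R X) = arr T R X" "\<zero>\<^bsub>Hom_module T R X\<^esub> = zero_arr T R X"
  "a \<oplus>\<^bsub>Hom_module T R X\<^esub> b = a \<oplus>\<^bsub>Hom T R X\<^esub> b" "r \<odot>\<^bsub>Hom_module T R X\<^esub> a = a \<cdot> r"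
  unfolding Hom_module_def by simp_all

lemma End_ring: "ring (End_ring T R)"
proof (rule ringI)
  show "abelian_group (End_ring T R)"
    by (rule abelian_group_cong[OF Hom_group[of R R]]) (simp_all add: fun_eq_iff)
  show "Group.monoid (End_ring T R)"
    by (rule monoidI) (simp_all add: Id_closed Comp_closed[of _ R R] Comp_Id Id_Comp Comp_assoc[of _ R R _ R _ R])
qed (simp_all add: Comp_add_left[of _ R R] Comp_add_right[of _ R R])

lemma Hom_module_right: "right_module (End_ring T R) (Hom_module T R X)"
proof -
  have "abelian_group (Hom_module T R X)"
    by (rule abelian_group_cong[OF Hom_group[of R X]]) (simp_all add: fun_eq_iff)
  moreover have "right_module_axioms (End_ring T R) (Hom_module T R X)"
    by unfold_locales (simp_all add: Comp_closed[of _ R R] Comp_Id Comp_assoc[of _ R R _ R _ X]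
      Comp_add_left[of _ R R] Comp_add_right[of _ R R])
  ultimately show ?thesis unfolding right_module_def using End_ring by blast
qed

lemma Hom_module_fg: "fg_module (End_ring T R) (Hom_module T R X)"
proof -
  have "finitely_generated K (Hom T R X)" using HF unfolding hom_finite_def by simp
  then obtain S where S: "finite S" "S \<subseteq> arr T R X"
    and span: "\<forall>x \<in> arr T R X. \<exists>c \<in> S \<rightarrow> carrier K. x = (\<Oplus>\<^bsub>Hom T R X\<^esub> s \<in> S. c s \<odot>\<^bsub>Hom T R X\<^esub> s)"
    unfolding finitely_generated_def by (elim exE conjE) (rule that)
  interpret V: module K "Hom T R X" by (rule vector_space_Hom)
  interpret E: module K "Hom T R R" by (rule vector_space_Hom)
  have lift: "(\<Oplus>\<^bsub>Hom T R X\<^esub> s \<in> A. c s \<odot>\<^bsub>Hom T R X\<^esub> s) \<in> rspan (End_ring T R) (Hom_module T R X) S"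
    if "finite A" "A \<subseteq> S" "c \<in> S \<rightarrow> carrier K" for c A
    using that
  proof (induction A rule: finite_induct)
    case empty
    show ?case using rspan_zero[of "Hom_module T R X"] by simp
  next
    case (insert a A)
    have ca: "c a \<in> carrier K" "a \<in> arr T R X" "a \<in> S" using insert.prems S by auto
    have cA: "(\<lambda>s. c s \<odot>\<^bsub>Hom T R X\<^esub> s) \<in> A \<rightarrow> arr T R X" using insert.prems S by auto
    have "(\<Oplus>\<^bsub>Hom T R X\<^esub> s \<in> insert a A. c s \<odot>\<^bsub>Hom T R X\<^esub> s) = c a \<odot>\<^bsub>Hom T R X\<^esub> a \<oplus>\<^bsub>Hom T R X\<^esub> (\<Oplus>\<^bsub>Hom T R X\<^esub> s \<in> A. c s \<odot>\<^bsub>Hom T R X\<^esub> s)"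
      using insert.hyps ca cA by (intro V.finsum_insert) auto
    also have "c a \<odot>\<^bsub>Hom T R X\<^esub> a = a \<cdot> (c a \<odot>\<^bsub>Hom T R R\<^esub> Id T R)"
      using ca by (simp add: Comp_smult_right[OF _ Id_closed] Comp_Id)
    finally show ?case
      using rspan_step[of "c a \<odot>\<^bsub>Hom T R R\<^esub> Id T R" "End_ring T R" a S _ "Hom_module T R X"] insert ca Id_closed by simp
  qed
  have "arr T R X \<subseteq> rspan (End_ring T R) (Hom_module T R X) S"
  proof
    fix x assume x: "x \<in> arr T R X"
    obtain c where c: "c \<in> S \<rightarrow> carrier K" "x = (\<Oplus>\<^bsub>Hom T R X\<^esub> s \<in> S. c s \<odot>\<^bsub>Hom T R X\<^esub> s)"
      using bspec[OF span x] by (elim bexE)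
    show "x \<in> rspan (End_ring T R) (Hom_module T R X) S" unfolding c(2) by (rule lift[OF S(1) order_refl c(1)])
  qed
  then show ?thesis unfolding fg_module_def finitely_generated_iff[OF Hom_module_right]
    using Hom_module_right S by (intro conjI exI[of _ S]) auto
qed

definition push :: "'o \<Rightarrow> 'o \<Rightarrow> 'm \<Rightarrow> 'm \<Rightarrow> 'm" where
  "push R X x = restrict (\<lambda>u. x \<cdot> u) (arr T R X)"

lemma push_apply [simp]: "u \<in> arr T R X \<Longrightarrow> push R X x u = x \<cdot> u"
  unfolding push_def by simp

lemma push_hom:
  assumes x: "x \<in> arr T X Y"
  shows "push R X x \<in> module_hom (End_ring T R) (Hom_module T R X) (Hom_module T R Y)"
proof -
  have "restrict (\<lambda>u. x \<cdot> u) (carrier (Hom_module T R X)) \<in> module_hom (End_ring T R) (Hom_module T R X) (Hom_module T R Y)"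
    by (rule module_homI[OF Hom_module_right])
      (use x in \<open>simp_all add: Comp_closed[of _ R X] Comp_add_right[of _ R X] Comp_assoc[of _ R R _ X _ Y]\<close>)
  then show ?thesis unfolding push_def by simp
qed

text \<open>
  The identity of \<open>Q\<close> is a sum of composites \<open>Q \<rightarrow> R \<rightarrow> Q\<close>, and \<open>f\<close> is determined by linearity from its
  values on the second factors.
\<close>

lemma yoneda:
  assumes Q: "gen R Q" and f: "f \<in> module_hom (End_ring T R) (Hom_module T R Q) (Hom_module T R Y)"
  shows "\<exists>t \<in> arr T Q Y. \<forall>u \<in> arr T R Q. t \<cdot> u = f u"
proof -
  note F = module_homD[OF f, simplified]
  have "\<exists>t \<in> arr T Q Y. \<forall>u \<in> arr T R Q. \<forall>x'. x = (Q, Q, x') \<longrightarrow> t \<cdot> u = f (x' \<cdot> u)" if "x \<in> thru R Q Q" for x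
    using that
  proof (induction rule: thru.induct)
    case thru_zr
    have "f (zero_arr T R Q) = zero_arr T R Y"
      using module_hom_zero[OF Hom_module_right Hom_module_right f] by simp
    then show ?case by (intro bexI[of _ "zero_arr T Q Y"]) (auto simp: t_zr_eq)
  next
    case (thru_step a b r)
    obtain a' b' r' where a: "a = (Q, R, a')" "a' \<in> arr T Q R" and b: "b = (R, Q, b')" "b' \<in> arr T R Q"
      and r: "r = (Q, Q, r')" "r' \<in> arr T Q Q"
      using thru_step.hyps(1,2) thru_hm[OF thru_step.hyps(3)] unfolding hm_eq by blast
    obtain t where t: "t \<in> arr T Q Y" "\<And>u. u \<in> arr T R Q \<Longrightarrow> t \<cdot> u = f (r' \<cdot> u)"
      using thru_step.IH r(1) by blast
    have fb: "f b' \<in> arr T R Y" using F(1) b by simp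
    have "(f b' \<cdot> a' \<oplus>\<^bsub>Hom T Q Y\<^esub> t) \<cdot> u = f ((b' \<cdot> a' \<oplus>\<^bsub>Hom T Q Q\<^esub> r') \<cdot> u)" if u: "u \<in> arr T R Q" for u
    proof -
      have c: "a' \<cdot> u \<in> arr T R R" "b' \<cdot> (a' \<cdot> u) \<in> arr T R Q" "r' \<cdot> u \<in> arr T R Q" "f b' \<cdot> a' \<in> arr T Q Y" "b' \<cdot> a' \<in> arr T Q Q"
        using u a(2) b(2) r(2) fb Comp_closed by blast+
      have "(f b' \<cdot> a' \<oplus>\<^bsub>Hom T Q Y\<^esub> t) \<cdot> u = f b' \<cdot> (a' \<cdot> u) \<oplus>\<^bsub>Hom T R Y\<^esub> f (r' \<cdot> u)"
        using c u t a(2) fb by (simp add: Comp_add_left[OF u] Comp_assoc[OF u a(2) fb])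
      also have "\<dots> = f (b' \<cdot> (a' \<cdot> u) \<oplus>\<^bsub>Hom T R Q\<^esub> r' \<cdot> u)"
        using F(2)[OF c(2,3)] F(3)[OF c(1) b(2)] by simp
      also have "b' \<cdot> (a' \<cdot> u) \<oplus>\<^bsub>Hom T R Q\<^esub> r' \<cdot> u = (b' \<cdot> a' \<oplus>\<^bsub>Hom T Q Q\<^esub> r') \<cdot> u"
        using c u r(2) by (simp add: Comp_add_left[OF u] Comp_assoc[OF u a(2) b(2)])
      finally show ?thesis .
    qed
    moreover have "f b' \<cdot> a' \<oplus>\<^bsub>Hom T Q Y\<^esub> t \<in> arr T Q Y" using fb a(2) t(1) Comp_closed by (intro G_simps) auto
    ultimately show ?case unfolding a(1) b(1) r(1) by auto
  qed
  from this[OF Q[unfolded gen_def]] show ?thesis by (simp add: t_idt_eq Id_Comp)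
qed

text \<open>
  The projectivity of \<open>Hom(R, Q)\<close>: choose preimages of the values of \<open>f\<close> on the maps \<open>R \<rightarrow> Q\<close> in a
  decomposition of the identity of \<open>Q\<close>.  The carrier types of \<open>A\<close> and \<open>B\<close> are arbitrary.
\<close>

lemma Hom_lift:
  assumes Q: "gen R Q" and A: "right_module (End_ring T R) A" and B: "right_module (End_ring T R) B"
    and g: "g \<in> module_hom (End_ring T R) A B" "g ` carrier A = carrier B"
    and f: "f \<in> module_hom (End_ring T R) (Hom_module T R Q) B"
  obtains h where "h \<in> module_hom (End_ring T R) (Hom_module T R Q) A" "\<And>u. u \<in> arr T R Q \<Longrightarrow> g (h u) = f u"
proof -
  note F = module_homD[OF f, simplified] and G = module_homD[OF g(1)]
  note opsA = right_module_ops[OF A]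
  interpret A: abelian_group A using A by (rule right_module_ab)
  have "\<exists>h \<in> module_hom (End_ring T R) (Hom_module T R Q) A. \<forall>u \<in> arr T R Q. \<forall>x'. x = (Q, Q, x') \<longrightarrow> g (h u) = f (x' \<cdot> u)"
    if "x \<in> thru R Q Q" for x
    using that
  proof (induction rule: thru.induct)
    case thru_zr
    have "r \<odot>\<^bsub>A\<^esub> \<zero>\<^bsub>A\<^esub> = \<zero>\<^bsub>A\<^esub>" if "r \<in> arr T R R" for r
      using right_module.smult_module_distr[OF A, of r "\<zero>\<^bsub>A\<^esub>" "\<zero>\<^bsub>A\<^esub>"] opsA that A.add.r_cancel_one by simp
    then have "restrict (\<lambda>u. \<zero>\<^bsub>A\<^esub>) (carrier (Hom_module T R Q)) \<in> module_hom (End_ring T R) (Hom_module T R Q) A"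
      by (intro module_homI[OF Hom_module_right]) simp_all
    moreover have "f (zero_arr T R Q) = \<zero>\<^bsub>B\<^esub>" "g \<zero>\<^bsub>A\<^esub> = \<zero>\<^bsub>B\<^esub>"
      using module_hom_zero[OF Hom_module_right B f] module_hom_zero[OF A B g(1)] by simp_all
    ultimately show ?case by (intro bexI[of _ "restrict (\<lambda>u. \<zero>\<^bsub>A\<^esub>) (carrier (Hom_module T R Q))"]) (auto simp: t_zr_eq)
  next
    case (thru_step a b r)
    obtain a' b' r' where a: "a = (Q, R, a')" "a' \<in> arr T Q R" and b: "b = (R, Q, b')" "b' \<in> arr T R Q"
      and r: "r = (Q, Q, r')" "r' \<in> arr T Q Q"
      using thru_step.hyps(1,2) thru_hm[OF thru_step.hyps(3)] unfolding hm_eq by blast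
    obtain h where h: "h \<in> module_hom (End_ring T R) (Hom_module T R Q) A" "\<And>u. u \<in> arr T R Q \<Longrightarrow> g (h u) = f (r' \<cdot> u)"
      using thru_step.IH r(1) by blast
    note H = module_homD[OF h(1), simplified]
    have "f b' \<in> carrier B" using F(1) b by simp
    then obtain y where y: "y \<in> carrier A" "g y = f b'" using g(2) by (metis imageE)
    let ?h = "restrict (\<lambda>u. (a' \<cdot> u) \<odot>\<^bsub>A\<^esub> y \<oplus>\<^bsub>A\<^esub> h u) (carrier (Hom_module T R Q))"
    have c: "a' \<cdot> u \<in> arr T R R" if "u \<in> arr T R Q" for u using that a(2) Comp_closed by blast
    have "?h \<in> module_hom (End_ring T R) (Hom_module T R Q) A"
    proof (rule module_homI[OF Hom_module_right])
      fix u assume "u \<in> carrier (Hom_module T R Q)"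
      then have u: "u \<in> arr T R Q" by simp
      have su: "(a' \<cdot> u) \<odot>\<^bsub>A\<^esub> y \<in> carrier A" using opsA(5)[of "a' \<cdot> u" y] c[OF u] y(1) by simp
      then show "(a' \<cdot> u) \<odot>\<^bsub>A\<^esub> y \<oplus>\<^bsub>A\<^esub> h u \<in> carrier A" using H(1)[OF u] by simp
      fix v assume "v \<in> carrier (Hom_module T R Q)"
      then have v: "v \<in> arr T R Q" by simp
      have sv: "(a' \<cdot> v) \<odot>\<^bsub>A\<^esub> y \<in> carrier A" using opsA(5)[of "a' \<cdot> v" y] c[OF v] y(1) by simp
      show "(a' \<cdot> (u \<oplus>\<^bsub>Hom_module T R Q\<^esub> v)) \<odot>\<^bsub>A\<^esub> y \<oplus>\<^bsub>A\<^esub> h (u \<oplus>\<^bsub>Hom_module T R Q\<^esub> v) =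
        (a' \<cdot> u) \<odot>\<^bsub>A\<^esub> y \<oplus>\<^bsub>A\<^esub> h u \<oplus>\<^bsub>A\<^esub> ((a' \<cdot> v) \<odot>\<^bsub>A\<^esub> y \<oplus>\<^bsub>A\<^esub> h v)"
        using u v su sv c H(1,2) y(1) right_module.smult_ring_distr[OF A, of "a' \<cdot> u" "a' \<cdot> v" y]
        by (simp add: Comp_add_right[OF u v a(2)] A.a_ac)
    next
      fix k u assume "k \<in> carrier (End_ring T R)" "u \<in> carrier (Hom_module T R Q)"
      then have k: "k \<in> arr T R R" and u: "u \<in> arr T R Q" by simp_all
      have "(a' \<cdot> u) \<odot>\<^bsub>A\<^esub> y \<in> carrier A" using opsA(5)[of "a' \<cdot> u" y] c[OF u] y(1) by simp
      then show "(a' \<cdot> (k \<odot>\<^bsub>Hom_module T R Q\<^esub> u)) \<odot>\<^bsub>A\<^esub> y \<oplus>\<^bsub>A\<^esub> h (k \<odot>\<^bsub>Hom_module T R Q\<^esub> u) = k \<odot>\<^bsub>A\<^esub> ((a' \<cdot> u) \<odot>\<^bsub>A\<^esub> y \<oplus>\<^bsub>A\<^esub> h u)"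
        using k u c[OF u] y(1) H right_module.smult_module_distr[OF A, of k "(a' \<cdot> u) \<odot>\<^bsub>A\<^esub> y" "h u"]
          right_module.smult_assoc[OF A, of "a' \<cdot> u" k y]
        by (simp add: Comp_assoc[OF k u a(2), symmetric])
    qed
    moreover have "g (?h u) = f ((b' \<cdot> a' \<oplus>\<^bsub>Hom T Q Q\<^esub> r') \<cdot> u)" if u: "u \<in> arr T R Q" for u
    proof -
      have cc: "b' \<cdot> (a' \<cdot> u) \<in> arr T R Q" "r' \<cdot> u \<in> arr T R Q" "b' \<cdot> a' \<in> arr T Q Q"
        using c[OF u] u a(2) b(2) r(2) Comp_closed by blast+
      have su: "(a' \<cdot> u) \<odot>\<^bsub>A\<^esub> y \<in> carrier A" using opsA(5)[of "a' \<cdot> u" y] c[OF u] y(1) by simp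
      have "g (?h u) = (a' \<cdot> u) \<odot>\<^bsub>B\<^esub> f b' \<oplus>\<^bsub>B\<^esub> f (r' \<cdot> u)"
        using u su G(2)[OF su H(1)[OF u]] G(3)[of "a' \<cdot> u" y] c[OF u] y h(2) by simp
      also have "\<dots> = f (b' \<cdot> (a' \<cdot> u) \<oplus>\<^bsub>Hom T R Q\<^esub> r' \<cdot> u)"
        using F(2)[OF cc(1,2)] F(3)[OF c[OF u] b(2)] by simp
      also have "b' \<cdot> (a' \<cdot> u) \<oplus>\<^bsub>Hom T R Q\<^esub> r' \<cdot> u = (b' \<cdot> a' \<oplus>\<^bsub>Hom T Q Q\<^esub> r') \<cdot> u"
        using cc u r(2) by (simp add: Comp_add_left[OF u] Comp_assoc[OF u a(2) b(2)])
      finally show ?thesis .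
    qed
    ultimately show ?case unfolding a(1) b(1) r(1) by (intro bexI[of _ ?h]) auto
  qed
  from this[OF Q[unfolded gen_def]] show ?thesis using that by (auto simp: t_idt_eq Id_Comp)
qed

lemma Hom_copy_projective:
  assumes "gen R Q"
  shows "projective_module (End_ring T R) (small_copy (Hom_module T R Q))"
  unfolding projective_module_def
proof (intro conjI allI ballI impI)
  let ?G = "End_ring T R" and ?M = "Hom_module T R Q"
  show "fg_module ?G (small_copy ?M)" by (rule fg_small_copy[OF Hom_module_fg])
  fix A B :: "'m small_module" and g f
  assume g: "g \<in> module_hom ?G A B" and f: "f \<in> module_hom ?G (small_copy ?M) B"
    and AB: "fg_module ?G A \<and> fg_module ?G B \<and> g ` carrier A = carrier B"
  have c: "compose (carrier ?M) f (to_copy ?M) \<in> module_hom ?G ?M B"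
    by (rule module_hom_compose[OF Hom_module_right to_copy_hom[OF Hom_module_right] f])
  obtain h where h: "h \<in> module_hom ?G ?M A" "\<And>u. u \<in> arr T R Q \<Longrightarrow> g (h u) = compose (carrier ?M) f (to_copy ?M) u"
    using Hom_lift[OF assms _ _ g _ c] AB unfolding fg_module_def by metis
  have "compose (carrier (small_copy ?M)) h (of_copy ?M) \<in> module_hom ?G (small_copy ?M) A"
    by (rule module_hom_compose[OF small_copy_right_module[OF Hom_module_right] of_copy_hom[OF Hom_module_right] h(1)])
  moreover have "g (compose (carrier (small_copy ?M)) h (of_copy ?M) x) = f x" if x: "x \<in> carrier (small_copy ?M)" for x
  proof -
    have "of_copy ?M x \<in> arr T R Q" using module_homD(1)[OF of_copy_hom[OF Hom_module_right] x] by simp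
    then show ?thesis using h(2)[of "of_copy ?M x"] copy_inverse(2)[OF x] x by (simp add: compose_def)
  qed
  ultimately show "\<exists>h \<in> module_hom ?G (small_copy ?M) A. \<forall>x \<in> carrier (small_copy ?M). g (h x) = f x" by blast
qed

end

section \<open>Presentations and projective dimension\<close>

locale presented = tri_setup K T
  for K :: "'k ring" and T :: "('o, 'm, 'k, 'z) tri_cat_scheme" (structure) +
  fixes R X R1 R0 :: 'o and f g h :: 'm
  assumes rigid: "rigid T R" and gen_R1: "gen R R1" and gen_R0: "gen R R0" and tri: "triangle T R1 R0 X f g h"
begin

lemma fgh: "f \<in> arr T R1 R0" "g \<in> arr T R0 X" "h \<in> arr T X (shift T R1)"
  using triangle_closed[OF tri] by auto

lemma ttri: "t_tri R1 R0 X (R1, R0, f) (R0, X, g) (X, shift T R1, h)"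
  by (rule t_tri_tag[OF tri])

lemma rig: "rig R" using rigid rig_iff by blast

lemma gf: "u \<in> arr T V R1 \<Longrightarrow> g \<cdot> (f \<cdot> u) = zero_arr T V X"
  using tri_zero[OF ttri] fgh Comp_assoc[of u V R1 f R0 g X, symmetric] by (simp add: t_zr_eq)

lemma lift_R1:
  assumes "u \<in> arr T V R0" "g \<cdot> u = zero_arr T V X"
  obtains v where "v \<in> arr T V R1" "f \<cdot> v = u"
proof -
  obtain b where b: "b \<in> hm V R1" "t_cmp (R1, R0, f) b = (V, R0, u)"
    by (rule tri_exact1[OF ttri, of "(V, R0, u)" V]) (use assms in \<open>auto simp: t_zr_eq\<close>)
  then obtain v where v: "b = (V, R1, v)" "v \<in> arr T V R1" by (blast elim: hmE)
  show ?thesis using that[OF v(2)] b(2) unfolding v(1) by simp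
qed

text \<open>The obstruction \<open>h \<cdot> u\<close> lies in \<open>Hom(Q, R1[1]) = 0\<close>.\<close>

lemma lift_R0:
  assumes "gen R Q" "u \<in> arr T Q X"
  obtains v where "v \<in> arr T Q R0" "g \<cdot> v = u"
proof -
  have hu: "h \<cdot> u = zero_arr T Q (shift T R1)"
    using rig_gen[OF rig assms(1) gen_R1, of "(Q, shift T R1, h \<cdot> u)"] assms(2) fgh Comp_closed by (auto simp: t_zr_eq)
  obtain b where b: "b \<in> hm Q R0" "t_cmp (R0, X, g) b = (Q, X, u)"
    by (rule tri_exact2[OF ttri, of "(Q, X, u)" Q]) (use assms hu in \<open>auto simp: t_zr_eq\<close>)
  then obtain v where v: "b = (Q, R0, v)" "v \<in> arr T Q R0" by (blast elim: hmE)
  show ?thesis using that[OF v(2)] b(2) unfolding v(1) by simp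
qed

lemma factor_X:
  assumes "t \<in> arr T R0 Y" "t \<cdot> f = zero_arr T R1 Y"
  obtains x where "x \<in> arr T X Y" "x \<cdot> g = t"
proof -
  obtain b where b: "b \<in> hm X Y" "t_cmp b (R0, X, g) = (R0, Y, t)"
    by (rule tri_coexact1[OF ttri, of "(R0, Y, t)" Y]) (use assms in \<open>auto simp: t_zr_eq\<close>)
  then obtain v where v: "b = (X, Y, v)" "v \<in> arr T X Y" by (blast elim: hmE)
  show ?thesis using that[OF v(2)] b(2) unfolding v(1) by simp
qed

lemma gen_zero:
  assumes "gen R Q" "t \<in> arr T Q Y" "\<And>u. u \<in> arr T R Q \<Longrightarrow> t \<cdot> u = zero_arr T R Y"
  shows "t = zero_arr T Q Y"
proof -
  have "t_cmp (Q, Y, t) (t_idt Q) = t_zr Q Y"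
  proof (rule gen_vanish_right[OF assms(1)])
    fix v assume "v \<in> hm R Q"
    then obtain v' where "v = (R, Q, v')" "v' \<in> arr T R Q" by (rule hmE)
    then show "t_cmp (Q, Y, t) v = t_zr R Y" using assms(3) by (simp add: t_zr_eq)
  qed (use assms(2) in auto)
  then show ?thesis using assms(2) by (simp add: t_idt_eq t_zr_eq Comp_Id)
qed

text \<open>
  On \<open>Hom(R, R0)\<close> the homomorphism is composition with a morphism \<open>t\<close> by \<open>yoneda\<close>.  As \<open>t \<cdot> f\<close> vanishes on
  maps from \<open>R\<close>, it is zero, and \<open>t\<close> factors through \<open>g\<close>.
\<close>

lemma full:
  assumes p: "p \<in> module_hom (End_ring T R) (Hom_module T R X) (Hom_module T R Y)"
  obtains x where "x \<in> arr T X Y" "p = push R X x"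
proof -
  note P = module_homD[OF p, simplified]
  have "compose (carrier (Hom_module T R R0)) p (push R R0 g) \<in> module_hom (End_ring T R) (Hom_module T R R0) (Hom_module T R Y)"
    by (rule module_hom_compose[OF Hom_module_right push_hom[OF fgh(2)] p])
  then obtain t where t: "t \<in> arr T R0 Y" "\<And>u. u \<in> arr T R R0 \<Longrightarrow> t \<cdot> u = p (g \<cdot> u)"
    using yoneda[OF gen_R0] by (fastforce simp: compose_def)
  have p0: "p (zero_arr T R X) = zero_arr T R Y" using module_hom_zero[OF Hom_module_right Hom_module_right p] by simp
  have "t \<cdot> f = zero_arr T R1 Y"
  proof (rule gen_zero[OF gen_R1])
    show "t \<cdot> f \<in> arr T R1 Y" using t(1) fgh Comp_closed by blast
    fix u assume u: "u \<in> arr T R R1"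
    have "(t \<cdot> f) \<cdot> u = t \<cdot> (f \<cdot> u)" using Comp_assoc[OF u fgh(1) t(1)] .
    also have "\<dots> = p (g \<cdot> (f \<cdot> u))" using t(2)[of "f \<cdot> u"] u fgh Comp_closed by blast
    finally show "(t \<cdot> f) \<cdot> u = zero_arr T R Y" using gf[OF u] p0 by simp
  qed
  then obtain x where x: "x \<in> arr T X Y" "x \<cdot> g = t" using factor_X[OF t(1)] by metis
  have "p = push R X x"
  proof (rule module_hom_ext[OF p push_hom[OF x(1)]])
    fix u assume "u \<in> carrier (Hom_module T R X)"
    then have u: "u \<in> arr T R X" by simp
    obtain v where v: "v \<in> arr T R R0" "g \<cdot> v = u" using lift_R0[OF gen_refl u] .
    have "x \<cdot> u = (x \<cdot> g) \<cdot> v" using v x fgh Comp_assoc by metis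
    then show "p u = push R X x u" using x(2) t(2)[OF v(1)] v(2) u by simp
  qed
  then show ?thesis using that x(1) by blast
qed

text \<open>
  The injectivity of \<open>Hom(R, f)\<close>, on which all properties of \<open>Hom(R, X)\<close> will depend.
\<close>

definition mono :: bool where
  "mono \<longleftrightarrow> (\<forall>u \<in> arr T R R1. f \<cdot> u = zero_arr T R R0 \<longrightarrow> u = zero_arr T R R1)"

text \<open>
  The maps \<open>u : R \<rightarrow> R1\<close> with \<open>f \<cdot> u = 0\<close> are those whose shift lifts along \<open>h\<close> to a map \<open>R[1] \<rightarrow> X\<close>.  On
  the other side, every map \<open>X \<rightarrow> R[1]\<close> vanishes on \<open>R0\<close> by rigidity and so factors through \<open>h\<close>.  Hence
  the composites \<open>R[1] \<rightarrow> X \<rightarrow> R[1]\<close> are the composites of such \<open>u[1]\<close> with maps \<open>R1[1] \<rightarrow> R[1]\<close>, and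
  these all vanish only if \<open>u = 0\<close>, because \<open>R1\<close> lies in \<open>add R\<close>.
\<close>

lemma factoring_iff_mono:
  "factoring T X (shift T R) (shift T R) = {zero_arr T (shift T R) (shift T R)} \<longleftrightarrow> mono"
proof
  assume z: "factoring T X (shift T R) (shift T R) = {zero_arr T (shift T R) (shift T R)}"
  show mono unfolding mono_def
  proof (intro ballI impI)
    fix u assume u: "u \<in> arr T R R1" and fu: "f \<cdot> u = zero_arr T R R0"
    let ?u = "(R, R1, u)"
    have "t_cmp (t_sh (R1, R0, f)) (t_sh ?u) = t_sh (t_cmp (R1, R0, f) ?u)"
      using sh_cmp[of "(R1, R0, f)" ?u] u fgh by simp
    also have "\<dots> = t_zr (shift T R) (shift T R0)" using fu sh_zr[of R R0] by (simp add: t_zr_eq)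
    finally obtain a where a: "a \<in> hm (shift T R) X" "t_cmp (X, shift T R1, h) a = t_sh ?u"
      by (rule tri_exact3[OF ttri, of "t_sh ?u" "shift T R", rotated]) (use u shift_closed in auto)
    then obtain a' where a': "a = (shift T R, X, a')" "a' \<in> arr T (shift T R) X" by (blast elim: hmE)
    have c0: "t_cmp c ?u = t_zr R R" if c: "c \<in> hm R1 R" for c
    proof -
      have ch: "t_cmp (t_sh c) (X, shift T R1, h) \<in> hm X (shift T R)" using c fgh by simp
      then obtain b where b: "t_cmp (t_sh c) (X, shift T R1, h) = (X, shift T R, b)" "b \<in> arr T X (shift T R)" by (rule hmE)
      have "b \<cdot> a' \<in> factoring T X (shift T R) (shift T R)" unfolding factoring_iff using gen_refl b a' by blast
      then have "t_cmp (X, shift T R, b) a = t_zr (shift T R) (shift T R)" using z unfolding a' by (simp add: t_zr_eq)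
      then have "t_cmp (t_sh c) (t_sh ?u) = t_zr (shift T R) (shift T R)"
        unfolding b(1)[symmetric] using a c fgh by simp
      then have eq: "t_sh (t_cmp c ?u) = t_sh (t_zr R R)" using sh_cmp[of c ?u] c u by simp
      show ?thesis by (rule sh_inj[OF _ _ eq, of R R]) (use c u in simp_all)
    qed
    have "t_cmp (t_idt R1) ?u = t_zr R R1"
      by (rule gen_vanish_left[OF gen_R1, of ?u R R1]) (use u c0 in auto)
    then show "u = zero_arr T R R1" using u by (simp add: t_zr_eq)
  qed
next
  assume m: mono
  have e: "t_cmp b a = t_zr (shift T R) (shift T R)" if a: "a \<in> hm (shift T R) X" and b: "b \<in> hm X (shift T R)" for a b
  proof -
    have "t_cmp b (R0, X, g) = t_zr R0 (shift T R)"
      by (rule rig_gen[OF rig gen_R0 gen_refl]) (use b fgh in simp)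
    then obtain b' where b': "b' \<in> hm (shift T R1) (shift T R)" "t_cmp b' (X, shift T R1, h) = b"
      using tri_coexact2[OF ttri b] by metis
    have ha: "t_cmp (X, shift T R1, h) a \<in> hm (shift T R) (shift T R1)" using a fgh by simp
    then obtain u where u: "u \<in> hm R R1" "t_sh u = t_cmp (X, shift T R1, h) a" using sh_surj by blast
    define F where "F = (R1, R0, f)"
    have F: "F \<in> hm R1 R0" unfolding F_def using fgh by simp
    define H where "H = (X, shift T R1, h)"
    have H: "H \<in> hm X (shift T R1)" unfolding H_def using fgh by simp
    have uH: "t_sh u = t_cmp H a" using u(2) unfolding H_def .
    have z: "t_cmp (t_ng (t_sh F)) H = t_zr X (shift T R0)"
      unfolding F_def H_def by (rule tri_zero[OF tri_rotate[OF tri_rotate[OF ttri]]])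
    have "t_cmp (t_ng (t_sh F)) (t_cmp H a) = t_zr (shift T R) (shift T R0)"
      using cmp_reassoc[OF z, of a] a F H by simp
    then have "t_ng (t_sh (t_cmp F u)) = t_zr (shift T R) (shift T R0)"
      unfolding uH[symmetric] using u(1) a F sh_cmp[of F u] by simp
    then have eq: "t_sh (t_cmp F u) = t_sh (t_zr R R0)" using u(1) F by simp
    have "t_cmp F u = t_zr R R0" by (rule sh_inj[OF _ _ eq, of R R0]) (use u(1) F in simp_all)
    then have fu: "t_cmp (R1, R0, f) u = t_zr R R0" unfolding F_def .
    obtain u' where u': "u = (R, R1, u')" "u' \<in> arr T R R1" using u(1) by (rule hmE)
    have "u = t_zr R R1" using m fu u'(2) unfolding u'(1) mono_def by (simp add: t_zr_eq)
    then have "t_cmp (X, shift T R1, h) a = t_zr (shift T R) (shift T R1)" using u(2) by simp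
    then have "t_cmp b' (t_cmp (X, shift T R1, h) a) = t_zr (shift T R) (shift T R)" using b'(1) by simp
    then show ?thesis unfolding b'(2)[symmetric] using a b'(1) fgh by simp
  qed
  have t0: "x = t_zr (shift T R) (shift T R)" if "x \<in> thru X (shift T R) (shift T R)" for x
    using that
  proof (induction rule: thru.induct)
    case (thru_step a b r)
    then show ?case using e[OF thru_step.hyps(1,2)] by simp
  qed simp
  have "x = zero_arr T (shift T R) (shift T R)" if x: "x \<in> factoring T X (shift T R) (shift T R)" for x
  proof -
    obtain W a b where "gen X W" "a \<in> arr T (shift T R) W" "b \<in> arr T W (shift T R)" "x = b \<cdot> a"
      using x unfolding factoring_iff by blast
    then have "(shift T R, shift T R, x) \<in> thru X (shift T R) (shift T R)"
      using thru_gen[of X W "(shift T R, W, a)" "shift T R" "(W, shift T R, b)" "shift T R"] by simp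
    then show ?thesis using t0 by (auto simp: t_zr_eq)
  qed
  then show "factoring T X (shift T R) (shift T R) = {zero_arr T (shift T R) (shift T R)}" using zero_factoring by blast
qed

abbreviation Gam where "Gam \<equiv> End_ring T R"
abbreviation M where "M Y \<equiv> Hom_module T R Y"

definition copy_map :: "('m, 'm) module \<Rightarrow> ('m, 'm) module \<Rightarrow> ('m \<Rightarrow> 'm) \<Rightarrow> (nat \<Rightarrow> 'm) \<Rightarrow> (nat \<Rightarrow> 'm)" where
  "copy_map A B p = compose (carrier (small_copy A)) (compose (carrier A) (to_copy B) p) (of_copy A)"

lemma copy_map_hom:
  assumes "right_module G A" "right_module G B" "p \<in> module_hom G A B"
  shows "copy_map A B p \<in> module_hom G (small_copy A) (small_copy B)"
  unfolding copy_map_def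
  by (intro module_hom_compose[OF small_copy_right_module of_copy_hom] module_hom_compose[OF _ assms(3) to_copy_hom] assms)

lemma copy_map_to: "x \<in> carrier A \<Longrightarrow> copy_map A B p (to_copy A x) = to_copy B (p x)"
  unfolding copy_map_def using to_copy_surj[of A] by (auto simp: compose_def)

lemma copy_carrier: "carrier (small_copy A) = to_copy A ` carrier A"
  by (rule to_copy_surj[symmetric])

lemma to_copy_zero: "x \<in> carrier A \<Longrightarrow> \<zero>\<^bsub>A\<^esub> \<in> carrier A \<Longrightarrow> to_copy A x = \<zero>\<^bsub>small_copy A\<^esub> \<longleftrightarrow> x = \<zero>\<^bsub>A\<^esub>"
  unfolding to_copy_def by (simp add: fun_eq_iff)

text \<open>
  The resolution is \<open>0 \<rightarrow> Hom(R, R1) \<rightarrow> Hom(R, R0) \<rightarrow> Hom(R, X) \<rightarrow> 0\<close>, continued by the module of a zero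
  object.
\<close>

lemma mono_resolution:
  assumes m: mono
  obtains P d e where "projective_resolution Gam (M X) P d e" "\<forall>i > 1. carrier (P i) = {\<zero>\<^bsub>P i\<^esub>}"
proof -
  obtain Z where Z: "t_idt Z = t_zr Z Z" using zero_ob by blast
  have ZZ: "Id T Z = zero_arr T Z Z" using Z by (simp add: t_idt_eq t_zr_eq)
  have Zz: "arr T R Z = {zero_arr T R Z}"
  proof -
    have "u = zero_arr T R Z" if "u \<in> arr T R Z" for u
      using Id_Comp[OF that] that unfolding ZZ by simp
    then show ?thesis by auto
  qed
  have gZ: "gen R Z" using gen_iff_cls cls_zero[OF Z] by simp
  \<comment> \<open>the resolution is the image of a complex of objects of \<open>add R\<close>\<close>
  define Q where "Q n = (if n = 0 then R0 else if n = 1 then R1 else Z)" for n :: nat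
  define D where "D n = (if n = 0 then f else zero_arr T (Q (Suc n)) (Q n))" for n :: nat
  define P where "P n = small_copy (M (Q n))" for n
  define d where "d n = copy_map (M (Q (Suc n))) (M (Q n)) (push R (Q (Suc n)) (D n))" for n
  define e where "e = compose (carrier (P 0)) (push R R0 g) (of_copy (M R0))"
  have gQ: "gen R (Q n)" for n unfolding Q_def using gen_R0 gen_R1 gZ by simp
  have Da: "D n \<in> arr T (Q (Suc n)) (Q n)" for n unfolding D_def Q_def using fgh by simp
  have z: "zero_arr T R (Q n) \<in> arr T R (Q n)" for n by simp
  have P0: "P 0 = small_copy (M R0)" and P1: "P 1 = small_copy (M R1)" unfolding P_def Q_def by simp_all
  have Pz: "carrier (P i) = {\<zero>\<^bsub>P i\<^esub>}" if "i > 1" for i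
    unfolding P_def Q_def using that Zz by simp
  have dz: "\<zero>\<^bsub>P n\<^esub> = d n \<zero>\<^bsub>P (Suc n)\<^esub>" for n
    using module_hom_zero[OF small_copy_right_module[OF Hom_module_right] small_copy_right_module[OF Hom_module_right]
      copy_map_hom[OF Hom_module_right Hom_module_right push_hom[OF Da[of n]]]] unfolding d_def P_def by simp
  have res: "projective_resolution Gam (M X) P d e"
    unfolding projective_resolution_def
  proof (intro conjI allI)
    show "projective_module Gam (P n)" for n unfolding P_def by (rule Hom_copy_projective[OF gQ])
    show "d n \<in> module_hom Gam (P (Suc n)) (P n)" for n
      unfolding d_def P_def by (rule copy_map_hom[OF Hom_module_right Hom_module_right push_hom[OF Da]])
    show "e \<in> module_hom Gam (P 0) (M X)"
      unfolding e_def P0 by (rule module_hom_compose[OF small_copy_right_module[OF Hom_module_right] of_copy_hom[OF Hom_module_right] push_hom[OF fgh(2)]])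
    have e: "e (to_copy (M R0) u) = g \<cdot> u" if "u \<in> arr T R R0" for u
      using that to_copy_surj[of "M R0"] unfolding e_def P0 by (auto simp: compose_def)
    show "e ` carrier (P 0) = carrier (M X)"
    proof -
      have "e ` carrier (P 0) = (\<lambda>u. g \<cdot> u) ` arr T R R0" unfolding P0 copy_carrier image_image using e by simp
      also have "\<dots> = arr T R X" using lift_R0[OF gen_refl[of R]] fgh Comp_closed by (auto simp: image_iff)
      finally show ?thesis by simp
    qed
    have d0: "d 0 (to_copy (M R1) v) = to_copy (M R0) (f \<cdot> v)" if "v \<in> arr T R R1" for v
      unfolding d_def Q_def D_def using copy_map_to[of v "M R1" "M R0"] that by simp
    show "d 0 ` carrier (P 1) = a_kernel (P 0) (M X) e"
    proof
      show "d 0 ` carrier (P 1) \<subseteq> a_kernel (P 0) (M X) e"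
      proof
        fix y assume "y \<in> d 0 ` carrier (P 1)"
        then obtain v where v: "v \<in> arr T R R1" "y = to_copy (M R0) (f \<cdot> v)"
          unfolding P1 copy_carrier using d0 by auto
        have "f \<cdot> v \<in> arr T R R0" using v(1) fgh Comp_closed by blast
        then show "y \<in> a_kernel (P 0) (M X) e"
          unfolding a_kernel_iff P0 copy_carrier v(2) using e gf[OF v(1)] by auto
      qed
      show "a_kernel (P 0) (M X) e \<subseteq> d 0 ` carrier (P 1)"
      proof
        fix y assume "y \<in> a_kernel (P 0) (M X) e"
        then obtain u where u: "u \<in> arr T R R0" "y = to_copy (M R0) u" "g \<cdot> u = zero_arr T R X"
          unfolding a_kernel_iff P0 copy_carrier using e by auto
        obtain v where "v \<in> arr T R R1" "f \<cdot> v = u" using lift_R1[OF u(1,3)] .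
        then show "y \<in> d 0 ` carrier (P 1)" unfolding P1 copy_carrier u(2) using d0 by force
      qed
    qed
    show "d (Suc n) ` carrier (P (Suc (Suc n))) = a_kernel (P (Suc n)) (P n) (d n)" for n
    proof -
      have "d (Suc n) ` carrier (P (Suc (Suc n))) = {\<zero>\<^bsub>P (Suc n)\<^esub>}"
        using Pz[of "Suc (Suc n)"] dz[of "Suc n"] by simp
      also have "\<dots> = a_kernel (P (Suc n)) (P n) (d n)"
      proof (cases n)
        case 0
        have "y = \<zero>\<^bsub>P 1\<^esub>" if "y \<in> a_kernel (P 1) (P 0) (d 0)" for y
        proof -
          obtain v where v: "v \<in> arr T R R1" "y = to_copy (M R1) v" "to_copy (M R0) (f \<cdot> v) = \<zero>\<^bsub>P 0\<^esub>"
            using \<open>y \<in> a_kernel (P 1) (P 0) (d 0)\<close> d0 unfolding a_kernel_iff P1 copy_carrier by auto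
          have "f \<cdot> v \<in> arr T R R0" using v(1) fgh Comp_closed by blast
          then have "f \<cdot> v = zero_arr T R R0" using v(3) to_copy_zero[of "f \<cdot> v" "M R0"] unfolding P0 by simp
          then have "v = zero_arr T R R1" using m v(1) unfolding mono_def by blast
          then show ?thesis using v(1,2) to_copy_zero[of v "M R1"] unfolding P1 by simp
        qed
        moreover have "\<zero>\<^bsub>P 1\<^esub> \<in> a_kernel (P 1) (P 0) (d 0)"
          unfolding a_kernel_iff using dz[of 0] P_def z by simp
        ultimately have "{\<zero>\<^bsub>P 1\<^esub>} = a_kernel (P 1) (P 0) (d 0)" by blast
        then show ?thesis unfolding 0 One_nat_def .
      next
        case (Suc m)
        then have "carrier (P (Suc n)) = {\<zero>\<^bsub>P (Suc n)\<^esub>}" using Pz[of "Suc n"] by simp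
        then show ?thesis using dz[of n] unfolding a_kernel_def' by auto
      qed
      finally show ?thesis .
    qed
  qed
  show ?thesis using that[OF res] Pz by blast
qed

lemma mono_proj_dim: "mono \<Longrightarrow> proj_dim Gam (M X) \<le> 1"
proof -
  assume m: mono
  obtain P d e where "projective_resolution Gam (M X) P d e" "\<forall>i > 1. carrier (P i) = {\<zero>\<^bsub>P i\<^esub>}"
    by (rule mono_resolution[OF m])
  then have "enat 1 \<in> {enat n | n. \<exists>P d e. projective_resolution Gam (M X) P d e \<and> (\<forall>i > n. carrier (P i) = {\<zero>\<^bsub>P i\<^esub>})}"
    by blast
  then show ?thesis unfolding proj_dim_def one_enat_def by (rule Inf_lower)
qed

end

context presented
begin

subsection \<open>Extensions and \<open>R[1]\<close>-rigidity\<close>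

abbreviation quo where "quo \<equiv> push R R0 g"

lemma quo_hom: "quo \<in> module_hom Gam (M R0) (M X)" by (rule push_hom[OF fgh(2)])

lemma quo_surj: "quo ` carrier (M R0) = carrier (M X)"
proof
  show "quo ` carrier (M R0) \<subseteq> carrier (M X)" using module_homD(1)[OF quo_hom] by blast
  show "carrier (M X) \<subseteq> quo ` carrier (M R0)"
  proof
    fix u assume "u \<in> carrier (M X)"
    then have "u \<in> arr T R X" by simp
    then obtain v where "v \<in> arr T R R0" "g \<cdot> v = u" by (rule lift_R0[OF gen_refl])
    then show "u \<in> quo ` carrier (M R0)" by (intro image_eqI[of _ _ v]) auto
  qed
qed

text \<open>
  Both \<open>P 0\<close> and \<open>Hom(R, R0)\<close> are projective and map onto \<open>Hom(R, X)\<close>.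
\<close>

lemma resolution_lifts:
  assumes res: "projective_resolution Gam (M X) P d e"
  obtains a b where "a \<in> module_hom Gam (M R0) (P 0)" "\<And>u. u \<in> carrier (M R0) \<Longrightarrow> e (a u) = quo u"
    "b \<in> module_hom Gam (P 0) (M R0)" "\<And>x. x \<in> carrier (P 0) \<Longrightarrow> quo (b x) = e x"
proof -
  note r = resolution_modules[OF res]
  have p: "projective_module Gam (P 0)" using res unfolding projective_resolution_def by blast
  obtain a where a: "a \<in> module_hom Gam (M R0) (P 0)" "\<And>u. u \<in> arr T R R0 \<Longrightarrow> e (a u) = quo u"
    by (rule Hom_lift[OF gen_R0 r(1) Hom_module_right r(3,4) quo_hom]) blast
  obtain b where b: "b \<in> module_hom Gam (P 0) (M R0)" "\<And>x. x \<in> carrier (P 0) \<Longrightarrow> quo (b x) = e x"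
    by (rule projective_lift[OF p Hom_module_fg Hom_module_fg quo_hom quo_surj r(3)]) blast
  have a': "\<And>u. u \<in> carrier (M R0) \<Longrightarrow> e (a u) = quo u" using a(2) by simp
  show ?thesis by (rule that[OF a(1) a' b])
qed

text \<open>
  The kernel is \<open>Hom(R, R1)\<close>, embedded by \<open>f\<close>; homomorphisms from it to \<open>Hom(R, X)\<close> are given by
  morphisms \<open>c : R1 \<rightarrow> X\<close>, and they extend if and only if \<open>c\<close> factors through \<open>f\<close>, that is, if and only if
  \<open>c[1] \<cdot> h = 0\<close>.  The maps \<open>c[1] \<cdot> h\<close> are the elements of \<open>R[1](X, X[1])\<close>, because every map \<open>X \<rightarrow> R[1]\<close>
  factors through \<open>h\<close>.
\<close>

lemma extends_shift_rigid:
  assumes m: mono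
  shows "extends_from_kernel Gam (M R0) (M X) quo (M X) \<longleftrightarrow> shift_rigid T R X"
proof -
  let ?K = "(M R0)\<lparr>carrier := a_kernel (M R0) (M X) quo\<rparr>"
  have sK: "submodule (a_kernel (M R0) (M X) quo) Gam (M R0)" by (rule submodule_kernel[OF Hom_module_right Hom_module_right quo_hom])
  note rK = submodule_right_module[OF Hom_module_right sK]
  have fv: "f \<cdot> v \<in> arr T R R0" if "v \<in> arr T R R1" for v using that fgh Comp_closed by blast
  have fK: "f \<cdot> v \<in> a_kernel (M R0) (M X) quo" if "v \<in> arr T R R1" for v
    unfolding a_kernel_iff using fv[OF that] gf[OF that] by simp
  have Kf: "\<exists>v \<in> arr T R R1. f \<cdot> v = k" if "k \<in> a_kernel (M R0) (M X) quo" for k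
  proof -
    have k: "k \<in> arr T R R0" "g \<cdot> k = zero_arr T R X" using that unfolding a_kernel_iff by auto
    obtain v where "v \<in> arr T R R1" "f \<cdot> v = k" using lift_R1[OF k] .
    then show ?thesis by blast
  qed
  define F where "F = (R1, R0, f)"
  have F: "F \<in> hm R1 R0" unfolding F_def using fgh by simp
  define H where "H = (X, shift T R1, h)"
  have H: "H \<in> hm X (shift T R1)" unfolding H_def using fgh by simp
  define G where "G = (R0, X, g)"
  have G: "G \<in> hm R0 X" unfolding G_def using fgh by simp
  have t: "t_tri R1 R0 X F G H" unfolding F_def G_def H_def by (rule ttri)
  show ?thesis
  proof
    assume ext: "extends_from_kernel Gam (M R0) (M X) quo (M X)"
    have "erel R X X" unfolding erel_def
    proof (intro ballI)
      fix a b assume a: "a \<in> hm X (shift T R)" and b: "b \<in> hm (shift T R) (shift T X)"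
      \<comment> \<open>\<open>b \<bullet> a\<close> vanishes on \<open>R0\<close> and hence is \<open>c \<bullet> h\<close> for some \<open>c\<close>\<close>
      have "t_cmp a G = t_zr R0 (shift T R)"
        by (rule rig_gen[OF rig gen_R0 gen_refl]) (use a G in simp)
      then have "t_cmp (t_cmp b a) G = t_zr R0 (shift T X)" using a b G by simp
      then obtain c where c: "c \<in> hm (shift T R1) (shift T X)" "t_cmp c H = t_cmp b a"
        using tri_coexact2[OF t, of "t_cmp b a" "shift T X"] a b by auto
      obtain c0 where c0: "c0 \<in> hm R1 X" "t_sh c0 = c" using sh_surj c(1) by blast
      obtain c1 where c1: "c0 = (R1, X, c1)" "c1 \<in> arr T R1 X" using c0(1) by (rule hmE)
      \<comment> \<open>the class of \<open>c\<close> as a homomorphism on the kernel of the projective cover\<close>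
      define s where "s k = (SOME v. v \<in> arr T R R1 \<and> f \<cdot> v = k)" for k
      have s: "s k \<in> arr T R R1 \<and> f \<cdot> s k = k" if "k \<in> a_kernel (M R0) (M X) quo" for k
      proof -
        have "\<exists>v. v \<in> arr T R R1 \<and> f \<cdot> v = k" using Kf[OF that] by blast
        from someI_ex[OF this] show ?thesis unfolding s_def .
      qed
      have su: "s (f \<cdot> v) = v" if v: "v \<in> arr T R R1" for v
      proof -
        interpret V: abelian_group "M R1" using Hom_module_right by (rule right_module_ab)
        have w: "s (f \<cdot> v) \<in> arr T R R1" "f \<cdot> s (f \<cdot> v) = f \<cdot> v" using s[OF fK[OF v]] by auto
        have "push R R1 f (s (f \<cdot> v) \<ominus>\<^bsub>M R1\<^esub> v) = push R R1 f (s (f \<cdot> v)) \<ominus>\<^bsub>M R0\<^esub> push R R1 f v"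
          using w(1) v by (intro module_hom_minus[OF Hom_module_right Hom_module_right push_hom[OF fgh(1)]]) auto
        moreover have "s (f \<cdot> v) \<ominus>\<^bsub>M R1\<^esub> v \<in> carrier (M R1)"
          using right_module_ops(4)[OF Hom_module_right] w(1) v by simp
        moreover have "f \<cdot> v \<ominus>\<^bsub>M R0\<^esub> f \<cdot> v = \<zero>\<^bsub>M R0\<^esub>"
          using abelian_group.r_neg[OF right_module_ab[OF Hom_module_right[of R R0]]] fv[OF v] by (simp add: a_minus_def)
        ultimately have "s (f \<cdot> v) \<ominus>\<^bsub>M R1\<^esub> v = zero_arr T R R1" using m w v unfolding mono_def by simp
        moreover have "s (f \<cdot> v) = (s (f \<cdot> v) \<ominus>\<^bsub>M R1\<^esub> v) \<oplus>\<^bsub>M R1\<^esub> v"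
          using w(1) v V.a_assoc[of "s (f \<cdot> v)" "\<ominus>\<^bsub>M R1\<^esub> v" v] V.l_neg[of v] V.r_zero[of "s (f \<cdot> v)"] V.a_inv_closed[of v]
            by (simp add: a_minus_def)
        ultimately show ?thesis using v V.l_zero[of v] by simp
      qed
      let ?k = "restrict (\<lambda>k. c1 \<cdot> s k) (carrier ?K)"
      have "?k \<in> module_hom Gam ?K (M X)"
      proof (rule module_homI[OF rK])
        fix x assume x: "x \<in> carrier ?K"
        then show "c1 \<cdot> s x \<in> carrier (M X)" using s c1(2) Comp_closed by fastforce
        fix y assume y: "y \<in> carrier ?K"
        have sx: "s x \<in> arr T R R1" "f \<cdot> s x = x" and sy: "s y \<in> arr T R R1" "f \<cdot> s y = y" using s x y by auto
        have "s (x \<oplus>\<^bsub>Hom T R R0\<^esub> y) = s (f \<cdot> (s x \<oplus>\<^bsub>Hom T R R1\<^esub> s y))"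
          using Comp_add_right[OF sx(1) sy(1) fgh(1)] sx(2) sy(2) by simp
        also have "\<dots> = s x \<oplus>\<^bsub>Hom T R R1\<^esub> s y" by (rule su) (use sx sy in simp)
        finally show "c1 \<cdot> s (x \<oplus>\<^bsub>?K\<^esub> y) = c1 \<cdot> s x \<oplus>\<^bsub>M X\<^esub> c1 \<cdot> s y"
          using Comp_add_right[OF sx(1) sy(1) c1(2)] by simp
      next
        fix r x assume r: "r \<in> carrier Gam" and x: "x \<in> carrier ?K"
        have sx: "s x \<in> arr T R R1" "f \<cdot> s x = x" using s x by auto
        have r': "r \<in> arr T R R" using r by simp
        have "s (x \<cdot> r) = s (f \<cdot> (s x \<cdot> r))" using Comp_assoc[OF r' sx(1) fgh(1)] sx(2) by simp
        also have "\<dots> = s x \<cdot> r" by (rule su) (use sx r' Comp_closed in blast)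
        finally show "c1 \<cdot> s (r \<odot>\<^bsub>?K\<^esub> x) = r \<odot>\<^bsub>M X\<^esub> (c1 \<cdot> s x)" using Comp_assoc[OF r' sx(1) c1(2)] by simp
      qed
      then obtain p where p: "p \<in> module_hom Gam (M R0) (M X)" "\<forall>x \<in> a_kernel (M R0) (M X) quo. p x = ?k x"
        using ext unfolding extends_from_kernel_def by blast
      obtain t' where t': "t' \<in> arr T R0 X" "\<forall>u \<in> arr T R R0. t' \<cdot> u = p u" using yoneda[OF gen_R0 p(1)] by blast
      have eq0: "t' \<cdot> (f \<cdot> v) = c1 \<cdot> v" if v: "v \<in> arr T R R1" for v
        using t'(2) fv[OF v] p(2) fK[OF v] su[OF v] by simp
      \<comment> \<open>\<open>c0\<close> agrees with \<open>t' \<cdot> f\<close> on maps from \<open>R\<close>, hence they are equal\<close>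
      define T' where "T' = (R0, X, t')"
      have T': "T' \<in> hm R0 X" unfolding T'_def using t' by simp
      have "t_cmp (mns (t_cmp T' F) c0) (t_idt R1) = t_zr R1 X"
      proof (rule gen_vanish_right[OF gen_R1])
        fix v assume v: "v \<in> hm R R1"
        obtain v' where v': "v = (R, R1, v')" "v' \<in> arr T R R1" using v by (rule hmE)
        have "t_cmp T' (t_cmp F v) = t_cmp c0 v" using eq0[OF v'(2)] unfolding T'_def F_def v' c1 by simp
        then show "t_cmp (mns (t_cmp T' F) c0) v = t_zr R X" using v T' F c0(1) by (simp add: cmp_mns_left)
      qed (use T' F c0(1) in simp_all)
      then have "mns (t_cmp T' F) c0 = t_zr R1 X" using T' F c0(1) by simp
      then have cT: "c0 = t_cmp T' F" using T' F c0(1) by (simp add: mns_eq_zr)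
      have z: "t_cmp (t_ng (t_sh F)) H = t_zr X (shift T R0)"
        by (rule tri_zero[OF tri_rotate[OF tri_rotate[OF t]]])
      then have z': "t_cmp (t_sh F) H = t_zr X (shift T R0)" using F H by simp
      have "t_cmp b a = t_cmp (t_cmp (t_sh T') (t_sh F)) H"
        using c(2) c0(2) cT T' F sh_cmp[of T' F] by simp
      also have "\<dots> = t_cmp (t_sh T') (t_zr X (shift T R0))" using z' T' F H by simp
      finally show "t_cmp b a = t_zr X (shift T X)" using T' by simp
    qed
    then show "shift_rigid T R X" unfolding shift_rigid_iff .
  next
    assume sr: "shift_rigid T R X"
    show "extends_from_kernel Gam (M R0) (M X) quo (M X)" unfolding extends_from_kernel_def
    proof
      fix k assume k: "k \<in> module_hom Gam ?K (M X)"
      note k' = module_homD[OF k, simplified]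
      have "restrict (\<lambda>v. k (f \<cdot> v)) (carrier (M R1)) \<in> module_hom Gam (M R1) (M X)"
      proof (rule module_homI[OF Hom_module_right])
        fix x assume x: "x \<in> carrier (M R1)"
        then show "k (f \<cdot> x) \<in> carrier (M X)" using k'(1) fK by simp
        fix y assume y: "y \<in> carrier (M R1)"
        show "k (f \<cdot> (x \<oplus>\<^bsub>M R1\<^esub> y)) = k (f \<cdot> x) \<oplus>\<^bsub>M X\<^esub> k (f \<cdot> y)"
          using x y k'(2)[OF fK fK] Comp_add_right[of x R R1 y f R0] fgh by simp
      next
        fix r x assume r: "r \<in> carrier Gam" and x: "x \<in> carrier (M R1)"
        then show "k (f \<cdot> (r \<odot>\<^bsub>M R1\<^esub> x)) = r \<odot>\<^bsub>M X\<^esub> k (f \<cdot> x)"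
          using k'(3)[OF _ fK, of r x] Comp_assoc[of r R R x R1 f R0] fgh by simp
      qed
      then obtain c1 where c1: "c1 \<in> arr T R1 X" "\<And>v. v \<in> arr T R R1 \<Longrightarrow> c1 \<cdot> v = k (f \<cdot> v)"
        using yoneda[OF gen_R1] by fastforce
      define c0 where "c0 = (R1, X, c1)"
      have c0: "c0 \<in> hm R1 X" unfolding c0_def using c1 by simp
      have "t_cmp (t_sh c0) H \<in> thru (shift T R) X (shift T X)"
        by (rule thru_gen[OF gen_sh[OF gen_R1] H]) (use c0 in simp)
      then have "t_cmp (t_sh c0) H = t_zr X (shift T X)" using erel_thru sr unfolding shift_rigid_iff by blast
      then obtain b where b: "b \<in> hm (shift T R0) (shift T X)" "t_cmp b (t_sh F) = t_sh c0"
        using tri_coexact3[OF t, of "t_sh c0" "shift T X"] c0 by auto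
      obtain t0 where t0: "t0 \<in> hm R0 X" "t_sh t0 = b" using sh_surj b(1) by blast
      have eq: "t_sh (t_cmp t0 F) = t_sh c0" using b(2) t0 F sh_cmp[of t0 F] by simp
      have tF: "t_cmp t0 F = c0" by (rule sh_inj[OF _ _ eq, of R1 X]) (use t0 F c0 in simp_all)
      obtain t' where t': "t0 = (R0, X, t')" "t' \<in> arr T R0 X" using t0(1) by (rule hmE)
      have tf: "t' \<cdot> f = c1" using tF unfolding t' F_def c0_def by simp
      have "push R R0 t' x = k x" if x: "x \<in> a_kernel (M R0) (M X) quo" for x
      proof -
        obtain v where v: "v \<in> arr T R R1" "f \<cdot> v = x" using Kf[OF x] by blast
        have "t' \<cdot> x = c1 \<cdot> v" using Comp_assoc[OF v(1) fgh(1) t'(2)] tf v(2) by simp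
        then show ?thesis using c1(2)[OF v(1)] v(2) fv[OF v(1)] by simp
      qed
      then show "\<exists>h \<in> module_hom Gam (M R0) (M X). \<forall>x \<in> a_kernel (M R0) (M X) quo. h x = k x"
        using push_hom[OF t'(2)] by blast
    qed
  qed
qed

theorem trivial_ext_shift_rigid:
  assumes m: mono
  shows "trivial_group (ext_group Gam 1 (M X) (M X)) \<longleftrightarrow> shift_rigid T R X"
proof -
  obtain P0 d0 e0 where "projective_resolution Gam (M X) P0 d0 e0" "\<forall>i > 1. carrier (P0 i) = {\<zero>\<^bsub>P0 i\<^esub>}"
    by (rule mono_resolution[OF m])
  then obtain P d e where res: "projective_resolution Gam (M X) P d e"
    and tr: "trivial_group (ext_group Gam 1 (M X) (M X)) \<longleftrightarrow> extends_from_kernel Gam (P 0) (M X) e (M X)"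
    using trivial_ext_iff[OF Hom_module_right Hom_module_right] by blast
  note r = resolution_modules[OF res]
  obtain a b where ab: "a \<in> module_hom Gam (M R0) (P 0)" "\<And>u. u \<in> carrier (M R0) \<Longrightarrow> e (a u) = quo u"
    "b \<in> module_hom Gam (P 0) (M R0)" "\<And>x. x \<in> carrier (P 0) \<Longrightarrow> quo (b x) = e x"
    by (rule resolution_lifts[OF res]) blast
  note rm = Hom_module_right
  have 1: "extends_from_kernel Gam (P 0) (M X) e (M X)" if "extends_from_kernel Gam (M R0) (M X) quo (M X)"
    by (rule extends_from_kernel_transfer[OF _ _ _ _ r(3) quo_hom ab(1) _ ab(3) _ that]) (use rm r(1) ab in auto)
  have 2: "extends_from_kernel Gam (M R0) (M X) quo (M X)" if "extends_from_kernel Gam (P 0) (M X) e (M X)"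
    by (rule extends_from_kernel_transfer[OF _ _ _ _ quo_hom r(3) ab(3) _ ab(1) _ that]) (use rm r(1) ab in auto)
  have "extends_from_kernel Gam (P 0) (M X) e (M X) \<longleftrightarrow> extends_from_kernel Gam (M R0) (M X) quo (M X)"
    using 1 2 by blast
  then show ?thesis using tr extends_shift_rigid[OF m] by simp
qed

subsection \<open>Projective dimension at most one\<close>

text \<open>The infimum of a nonempty set of extended natural numbers is attained.\<close>

lemma proj_dim_le_1_resolution:
  assumes "proj_dim G N \<le> 1"
  obtains P d e where "projective_resolution G N P d e" "\<And>i. i > 1 \<Longrightarrow> carrier (P i) = {\<zero>\<^bsub>P i\<^esub>}"
proof -
  let ?S = "{enat n | n. \<exists>P d e. projective_resolution G N P d e \<and> (\<forall>i > n. carrier (P i) = {\<zero>\<^bsub>P i\<^esub>})}"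
  have "?S \<noteq> {}"
  proof
    assume "?S = {}"
    then have "proj_dim G N = Inf {}" unfolding proj_dim_def by (rule arg_cong)
    then show False using assms by (simp add: top_enat_def)
  qed
  then have "Inf ?S \<in> ?S" by (metis (no_types, lifting) ex_in_conv wellorder_InfI)
  then obtain n P d e where n: "Inf ?S = enat n" and P: "projective_resolution G N P d e" "\<forall>i > n. carrier (P i) = {\<zero>\<^bsub>P i\<^esub>}"
    by blast
  have "n \<le> 1" using assms n unfolding proj_dim_def one_enat_def by simp
  then show ?thesis using that[OF P(1)] P(2) by simp
qed

text \<open>
  Compare the presentation with a resolution of length one.  The comparison maps on \<open>Hom(R, R1)\<close> and
  \<open>P 1\<close> compose, after a correction by a map through \<open>R0\<close>, to an endomorphism \<open>s\<close> of \<open>R1\<close> with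
  \<open>f \<bullet> s = f\<close> that kills everything that \<open>f\<close> kills, because \<open>P 1 \<rightarrow> P 0\<close> is injective.  So \<open>1 - s\<close> is an
  idempotent with \<open>f \<bullet> (1 - s) = 0\<close>, and the shift of its image is a summand of \<open>X\<close> in \<open>add(R[1])\<close>.
  That summand is zero, hence \<open>s = 1\<close>, and \<open>Hom(R, f)\<close> is injective.
\<close>

theorem proj_dim_mono:
  assumes pd: "proj_dim Gam (M X) \<le> 1" and ns: "no_shift_summand T R X"
  shows mono
proof -
  obtain P d e where res: "projective_resolution Gam (M X) P d e" and Pz: "\<And>i. i > 1 \<Longrightarrow> carrier (P i) = {\<zero>\<^bsub>P i\<^esub>}"
    using proj_dim_le_1_resolution[OF pd] by blast
  note r = resolution_modules[OF res] and rm = Hom_module_right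
  obtain a b where a: "a \<in> module_hom Gam (M R0) (P 0)" "\<And>u. u \<in> carrier (M R0) \<Longrightarrow> e (a u) = quo u"
    and b: "b \<in> module_hom Gam (P 0) (M R0)" "\<And>x. x \<in> carrier (P 0) \<Longrightarrow> quo (b x) = e x"
    by (rule resolution_lifts[OF res]) blast
  note A = module_homD[OF a(1), simplified] and B = module_homD[OF b(1), simplified]
  note d0 = module_homD[OF r(2)[of 0]]
  have pP1: "projective_module Gam (P (Suc 0))" using res unfolding projective_resolution_def by blast
  let ?K = "(M R0)\<lparr>carrier := a_kernel (M R0) (M X) quo\<rparr>"
  let ?L = "(P 0)\<lparr>carrier := a_kernel (P 0) (M X) e\<rparr>"
  have sK: "submodule (a_kernel (M R0) (M X) quo) Gam (M R0)" by (rule submodule_kernel[OF rm rm quo_hom])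
  have sL: "submodule (a_kernel (P 0) (M X) e) Gam (P 0)" by (rule submodule_kernel[OF r(1) rm r(3)])
  note rK = submodule_right_module[OF rm sK] and rL = submodule_right_module[OF r(1) sL]
  have fv: "f \<cdot> v \<in> arr T R R0" if "v \<in> arr T R R1" for v using that fgh Comp_closed by blast
  have fK: "f \<cdot> v \<in> a_kernel (M R0) (M X) quo" if "v \<in> arr T R R1" for v
    unfolding a_kernel_iff using fv[OF that] gf[OF that] by simp
  have inj0: "y = \<zero>\<^bsub>P (Suc 0)\<^esub>" if y: "y \<in> carrier (P (Suc 0))" "d 0 y = \<zero>\<^bsub>P 0\<^esub>" for y
  proof -
    have "y \<in> a_kernel (P (Suc 0)) (P 0) (d 0)" unfolding a_kernel_iff using y by blast
    then have "y \<in> d (Suc 0) ` carrier (P (Suc (Suc 0)))" unfolding r(6) .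
    then have "y = d (Suc 0) \<zero>\<^bsub>P (Suc (Suc 0))\<^esub>" using Pz[of "Suc (Suc 0)"] by auto
    then show ?thesis using module_hom_zero[OF r(1) r(1) r(2)] by simp
  qed
  have restr: "p \<in> module_hom Gam V (W\<lparr>carrier := S\<rparr>)" if "p \<in> module_hom Gam V W" "\<And>x. x \<in> carrier V \<Longrightarrow> p x \<in> S"
    for p S and V :: "('m, 'x, 'y) module_scheme" and W :: "('m, 'u, 'v) module_scheme"
    using that unfolding module_hom_def PiE_def by (auto simp: Pi_iff)
  \<comment> \<open>\<open>P 1\<close> maps to \<open>Hom(R, R1)\<close> over \<open>b\<close>\<close>
  have "compose (carrier (P (Suc 0))) b (d 0) \<in> module_hom Gam (P (Suc 0)) (M R0)"
    by (rule module_hom_compose[OF r(1) r(2) b(1)])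
  then have bd: "compose (carrier (P (Suc 0))) b (d 0) \<in> module_hom Gam (P (Suc 0)) ?K"
  proof (rule restr)
    fix x assume x: "x \<in> carrier (P (Suc 0))"
    then have "d 0 x \<in> a_kernel (P 0) (M X) e" using r(5) by blast
    then show "compose (carrier (P (Suc 0))) b (d 0) x \<in> a_kernel (M R0) (M X) quo"
      using x b(2) B(1) unfolding a_kernel_iff by (auto simp: compose_def)
  qed
  have fKh: "push R R1 f \<in> module_hom Gam (M R1) ?K" by (rule restr[OF push_hom[OF fgh(1)]]) (use fK in simp)
  have fKs: "push R R1 f ` carrier (M R1) = carrier ?K"
  proof
    show "push R R1 f ` carrier (M R1) \<subseteq> carrier ?K" using module_homD(1)[OF fKh] by blast
    show "carrier ?K \<subseteq> push R R1 f ` carrier (M R1)"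
    proof
      fix k assume "k \<in> carrier ?K"
      then have k: "k \<in> arr T R R0" "g \<cdot> k = zero_arr T R X" unfolding a_kernel_def' by auto
      obtain v where "v \<in> arr T R R1" "f \<cdot> v = k" using lift_R1[OF k] .
      then show "k \<in> push R R1 f ` carrier (M R1)" by (intro image_eqI[of _ _ v]) auto
    qed
  qed
  have fgK: "fg_module Gam ?K" by (rule fg_module_image[OF Hom_module_fg rK fKh fKs])
  obtain c where c: "c \<in> module_hom Gam (P (Suc 0)) (M R1)"
    "\<And>x. x \<in> carrier (P (Suc 0)) \<Longrightarrow> push R R1 f (c x) = compose (carrier (P (Suc 0))) b (d 0) x"
    by (rule projective_lift[OF pP1 Hom_module_fg fgK fKh fKs bd]) blast
  note C = module_homD[OF c(1), simplified]
  \<comment> \<open>\<open>Hom(R, R1)\<close> maps to \<open>P 1\<close> over \<open>a\<close>\<close>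
  have "compose (carrier (M R1)) a (push R R1 f) \<in> module_hom Gam (M R1) (P 0)"
    by (rule module_hom_compose[OF rm push_hom[OF fgh(1)] a(1)])
  then have af: "compose (carrier (M R1)) a (push R R1 f) \<in> module_hom Gam (M R1) ?L"
  proof (rule restr)
    fix v assume v: "v \<in> carrier (M R1)"
    then show "compose (carrier (M R1)) a (push R R1 f) v \<in> a_kernel (P 0) (M X) e"
      using a(2) A(1) fv gf[of v R] unfolding a_kernel_iff by (simp add: compose_def)
  qed
  have dL: "d 0 \<in> module_hom Gam (P (Suc 0)) ?L" by (rule restr[OF r(2)]) (use r(5) in blast)
  obtain z where z: "z \<in> module_hom Gam (M R1) (P (Suc 0))"
    "\<And>v. v \<in> arr T R R1 \<Longrightarrow> d 0 (z v) = compose (carrier (M R1)) a (push R R1 f) v"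
    by (rule Hom_lift[OF gen_R1 r(1) rL dL _ af]) (use r(5) in auto)
  note Z = module_homD[OF z(1), simplified]
  \<comment> \<open>\<open>b \<circ> a\<close> differs from the identity by a map through \<open>f\<close>\<close>
  have "compose (carrier (M R0)) b a \<in> module_hom Gam (M R0) (M R0)"
    by (rule module_hom_compose[OF rm a(1) b(1)])
  then obtain t where t: "t \<in> arr T R0 R0" "\<And>u. u \<in> arr T R R0 \<Longrightarrow> t \<cdot> u = b (a u)"
    using yoneda[OF gen_R0] by (fastforce simp: compose_def)
  define TT where "TT = (R0, R0, t)"
  have TT: "TT \<in> hm R0 R0" unfolding TT_def using t by simp
  define F where "F = (R1, R0, f)"
  have F: "F \<in> hm R1 R0" unfolding F_def using fgh by simp
  define G where "G = (R0, X, g)"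
  have G: "G \<in> hm R0 X" unfolding G_def using fgh by simp
  define H where "H = (X, shift T R1, h)"
  have H: "H \<in> hm X (shift T R1)" unfolding H_def using fgh by simp
  have tr: "t_tri R1 R0 X F G H" unfolding F_def G_def H_def by (rule ttri)
  have gt: "t_cmp G (mns (t_idt R0) TT) = t_zr R0 X"
  proof -
    have "t_cmp (t_cmp G (mns (t_idt R0) TT)) (t_idt R0) = t_zr R0 X"
    proof (rule gen_vanish_right[OF gen_R0])
      fix v assume "v \<in> hm R R0"
      then obtain v' where v: "v = (R, R0, v')" "v' \<in> arr T R R0" by (rule hmE)
      have "b (a v') \<in> arr T R R0" using B(1) A(1) v(2) by simp
      moreover have "quo (b (a v')) = quo v'" using a(2) b(2) A(1) v(2) by simp
      ultimately have "g \<cdot> (t \<cdot> v') = g \<cdot> v'" using t(2)[OF v(2)] v(2) by simp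
      then have e: "t_cmp G (t_cmp TT v) = t_cmp G v" unfolding G_def TT_def v by simp
      have "v \<in> hm R R0" using v by simp
      then have "t_cmp (t_cmp G (mns (t_idt R0) TT)) v = mns (t_cmp G v) (t_cmp G (t_cmp TT v))"
        using G TT by (simp add: cmp_mns_left cmp_mns_right)
      then show "t_cmp (t_cmp G (mns (t_idt R0) TT)) v = t_zr R X" unfolding e using G \<open>v \<in> hm R R0\<close> by simp
    qed (use G TT in simp_all)
    then show ?thesis using G TT by simp
  qed
  obtain D where D: "D \<in> hm R0 R1" "t_cmp F D = mns (t_idt R0) TT"
    by (rule tri_exact1[OF tr _ gt]) (use TT in simp_all)
  obtain D' where D': "D = (R0, R1, D')" "D' \<in> arr T R0 R1" using D(1) by (rule hmE)
  \<comment> \<open>an endomorphism \<open>s\<close> of \<open>R1\<close> over \<open>f\<close> that kills the kernel of \<open>f\<close>\<close>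
  have cz: "compose (carrier (M R1)) c z \<in> module_hom Gam (M R1) (M R1)"
    by (rule module_hom_compose[OF rm z(1) c(1)])
  obtain s1 where s1: "s1 \<in> arr T R1 R1" "\<And>v. v \<in> arr T R R1 \<Longrightarrow> s1 \<cdot> v = c (z v)"
    using yoneda[OF gen_R1 cz] by (fastforce simp: compose_def)
  define S1 where "S1 = (R1, R1, s1)"
  have S1: "S1 \<in> hm R1 R1" unfolding S1_def using s1 by simp
  let ?s = "t_pls S1 (t_cmp D F)"
  let ?e = "mns (t_idt R1) ?s"
  have s: "?s \<in> hm R1 R1" using S1 D F by simp
  have Fs1: "t_cmp F (t_cmp S1 v) = t_cmp TT (t_cmp F v)" if v: "v \<in> hm R R1" for v
  proof -
    obtain v' where v': "v = (R, R1, v')" "v' \<in> arr T R R1" using v by (rule hmE)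
    have zc: "z v' \<in> carrier (P (Suc 0))" "c (z v') \<in> arr T R R1" using Z(1) C(1) v'(2) by simp_all
    have "f \<cdot> (s1 \<cdot> v') = push R R1 f (c (z v'))" using s1(2)[OF v'(2)] zc by simp
    also have "\<dots> = b (d 0 (z v'))" using c(2)[OF zc(1)] zc(1) by (simp add: compose_def)
    also have "\<dots> = b (a (f \<cdot> v'))" using z(2)[OF v'(2)] v'(2) by (simp add: compose_def)
    also have "\<dots> = t \<cdot> (f \<cdot> v')" using t(2)[OF fv[OF v'(2)]] by simp
    finally show ?thesis unfolding F_def S1_def TT_def v' by simp
  qed
  have Fe0: "t_cmp (t_cmp F ?e) v = t_zr R R0" if v: "v \<in> hm R R1" for v
  proof -
    have "t_cmp F (t_cmp D (t_cmp F v)) = mns (t_cmp F v) (t_cmp TT (t_cmp F v))"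
      using cmp_reassoc[OF D(2), of "t_cmp F v"] v F D(1) TT by (simp add: cmp_mns_left)
    then have "t_cmp F (t_cmp ?s v) = t_pls (t_cmp TT (t_cmp F v)) (mns (t_cmp F v) (t_cmp TT (t_cmp F v)))"
      using v F D(1) S1 Fs1[OF v] by (simp add: cmp_pls_left cmp_pls_right)
    also have "\<dots> = t_cmp F v" using v F TT by (subst pls_commute) (simp_all add: mns_pls_cancel)
    finally have *: "t_cmp F (t_cmp ?s v) = t_cmp F v" .
    have "t_cmp (t_cmp F (mns (t_idt R1) s')) v = mns (t_cmp F v) (t_cmp F (t_cmp s' v))" if "s' \<in> hm R1 R1" for s'
      using that F v by (simp add: cmp_mns_left cmp_mns_right)
    from this[OF s] show ?thesis unfolding * using F v by simp
  qed
  have Fe: "t_cmp F ?e = t_zr R1 R0"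
  proof -
    have "t_cmp (t_cmp F ?e) (t_idt R1) = t_zr R1 R0"
      by (rule gen_vanish_right[OF gen_R1 _ Fe0]) (use F s in simp_all)
    then show ?thesis using F s by simp
  qed
  have kill: "t_cmp ?s v = t_zr R R1" if v: "v \<in> hm R R1" "t_cmp F v = t_zr R R0" for v
  proof -
    obtain v' where v': "v = (R, R1, v')" "v' \<in> arr T R R1" using v(1) by (rule hmE)
    have "f \<cdot> v' = zero_arr T R R0" using v(2) unfolding F_def v' by (simp add: t_zr_eq)
    moreover have "a (zero_arr T R R0) = \<zero>\<^bsub>P 0\<^esub>" using module_hom_zero[OF rm r(1) a(1)] by simp
    ultimately have "d 0 (z v') = \<zero>\<^bsub>P 0\<^esub>" using z(2)[OF v'(2)] v'(2) by (simp add: compose_def)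
    then have "z v' = \<zero>\<^bsub>P (Suc 0)\<^esub>" using inj0 Z(1) v'(2) by simp
    then have "s1 \<cdot> v' = zero_arr T R R1" using s1(2)[OF v'(2)] module_hom_zero[OF r(1) rm c(1)] by simp
    then have "t_cmp S1 v = t_zr R R1" unfolding S1_def v' by (simp add: t_zr_eq)
    then show ?thesis using v D(1) F S1 by (simp add: cmp_pls_left)
  qed
  have eh: "?e \<in> hm R1 R1" using s by simp
  have ev: "t_cmp ?e v = v" if v: "v \<in> hm R R1" "t_cmp F v = t_zr R R0" for v
  proof -
    have "t_cmp ?e v = mns (t_cmp (t_idt R1) v) (t_cmp ?s v)" by (rule cmp_mns_left) (use s v in simp_all)
    then show ?thesis unfolding kill[OF v] using v by simp
  qed
  \<comment> \<open>\<open>E\<close> is the projection onto the part of \<open>R1\<close> that \<open>f\<close> kills\<close>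
  obtain E where E: "E = ?e" by blast
  note eh = eh[folded E] and Fe = Fe[folded E] and ev = ev[folded E]
  have ee: "t_cmp E E = E"
  proof -
    have "t_cmp (mns (t_cmp E E) E) (t_idt R1) = t_zr R1 R1"
    proof (rule gen_vanish_right[OF gen_R1])
      fix v assume v: "v \<in> hm R R1"
      have "t_cmp F (t_cmp E v) = t_zr R R0" using cmp_reassoc[OF Fe, of v] F eh v by simp
      then have "t_cmp E (t_cmp E v) = t_cmp E v" by (intro ev) (use eh v in simp_all)
      moreover have "t_cmp (mns (t_cmp E E) E) v = mns (t_cmp E (t_cmp E v)) (t_cmp E v)"
        using cmp_mns_left[of "t_cmp E E" E v] cmp_assoc[of E E v] eh v by simp
      ultimately show "t_cmp (mns (t_cmp E E) E) v = t_zr R R1" using eh v by simp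
    qed (use eh in simp_all)
    then have "mns (t_cmp E E) E = t_zr R1 R1" using cmp_idt[of "mns (t_cmp E E) E" R1] eh by simp
    then show ?thesis using mns_eq_zr[of "t_cmp E E" E R1 R1] eh by simp
  qed
  obtain Y Z' i p j q where bp: "bip R1 Y Z' i p j q" and ip: "t_cmp i p = E" using idem_split[OF eh ee] .
  note hb = bip_hm[OF bp] and eb = bip_eqs[OF bp]
  \<comment> \<open>the shift of \<open>E\<close> lifts along \<open>h\<close>, which makes \<open>Y[1]\<close> a retract of \<open>X\<close>\<close>
  have "t_cmp (t_sh F) (t_sh E) = t_zr (shift T R1) (shift T R0)"
    using sh_cmp[of F E] Fe F eh by simp
  then obtain w where w: "w \<in> hm (shift T R1) X" "t_cmp H w = t_sh E"
    using tri_exact3[OF tr, of "t_sh E" "shift T R1"] eh by auto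
  have shb: "t_sh i \<in> hm (shift T Y) (shift T R1)" "t_sh p \<in> hm (shift T R1) (shift T Y)" using hb by simp_all
  have pi1: "t_cmp (t_sh p) (t_sh i) = t_idt (shift T Y)" using sh_cmp[of p i] hb eb by simp
  have "t_cmp (t_cmp (t_sh p) H) (t_cmp w (t_sh i)) = t_cmp (t_sh p) (t_cmp (t_cmp H w) (t_sh i))"
    using shb H w(1) by simp
  also have "t_cmp H w = t_cmp (t_sh i) (t_sh p)" unfolding w(2) ip[symmetric] using hb by (simp add: sh_cmp)
  also have "t_cmp (t_sh p) (t_cmp (t_cmp (t_sh i) (t_sh p)) (t_sh i)) = t_idt (shift T Y)"
    using shb pi1 cmp_reassoc[OF pi1, of "t_cmp (t_sh p) (t_sh i)"] by simp
  finally have "direct_summand T (shift T Y) X"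
    unfolding direct_summand_iff by (intro retract_arr[of "t_cmp w (t_sh i)" _ _ "t_cmp (t_sh p) H"]) (use shb H w(1) in simp_all)
  moreover have "gen R Y" using gen_retract[OF gen_R1, of i Y p] hb eb by blast
  then have "shift T Y \<in> add_closure T (shift T R)" unfolding add_closure_iff by (rule gen_sh)
  ultimately have "t_idt (shift T Y) = t_zr (shift T Y) (shift T Y)"
    using ns unfolding no_shift_summand_def is_zero_iff by blast
  then have eq: "t_sh (t_idt Y) = t_sh (t_zr Y Y)" by simp
  have Y0: "t_idt Y = t_zr Y Y" by (rule sh_inj[OF _ _ eq, of Y Y]) simp_all
  have i0: "i = t_zr Y R1"
  proof -
    have "i = t_cmp i (t_idt Y)" using hb by simp
    then show ?thesis unfolding Y0 using hb by simp
  qed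
  have e0: "E = t_zr R1 R1" unfolding ip[symmetric] i0 using hb by simp
  show mono unfolding mono_def
  proof (intro ballI impI)
    fix u assume u: "u \<in> arr T R R1" and fu: "f \<cdot> u = zero_arr T R R0"
    have "t_cmp E (R, R1, u) = (R, R1, u)" by (rule ev) (use u fu in \<open>simp_all add: F_def t_zr_eq\<close>)
    then show "u = zero_arr T R R1" unfolding e0 using u by (simp add: t_zr_eq)
  qed
qed

end

section \<open>Direct sum decompositions of modules\<close>

lemma set_add_iff: "x \<in> A <+>\<^bsub>M\<^esub> B \<longleftrightarrow> (\<exists>a \<in> A. \<exists>b \<in> B. x = a \<oplus>\<^bsub>M\<^esub> b)"
  unfolding set_add_def' by auto

lemma module_hom_into_submodule:
  "\<lbrakk>p \<in> module_hom R V W; \<And>x. x \<in> carrier V \<Longrightarrow> p x \<in> S\<rbrakk> \<Longrightarrow> p \<in> module_hom R V (W\<lparr>carrier := S\<rparr>)"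
  unfolding module_hom_def PiE_def by (auto simp: Pi_iff)

lemma module_hom_from_submodule:
  "\<lbrakk>p \<in> module_hom R V (W\<lparr>carrier := S\<rparr>); S \<subseteq> carrier W\<rbrakk> \<Longrightarrow> p \<in> module_hom R V W"
  unfolding module_hom_def PiE_def by (auto simp: Pi_iff)

lemma module_iso_inverse:
  assumes M: "right_module R M" and N: "right_module R N" and i: "module_iso R M N"
  obtains f g where "f \<in> module_hom R M N" "g \<in> module_hom R N M"
    "\<And>x. x \<in> carrier M \<Longrightarrow> g (f x) = x" "\<And>y. y \<in> carrier N \<Longrightarrow> f (g y) = y"
proof -
  obtain f where f: "f \<in> module_hom R M N" "bij_betw f (carrier M) (carrier N)" using i unfolding module_iso_def by blast
  note F = module_homD[OF f(1)]
  let ?g = "inv_into (carrier M) f"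
  have g: "?g y \<in> carrier M" "f (?g y) = y" if "y \<in> carrier N" for y
    using that f(2) by (auto simp: bij_betw_def inv_into_into f_inv_into_f)
  have gf: "?g (f x) = x" if "x \<in> carrier M" for x
    using that f(2) by (auto simp: bij_betw_def)
  have "restrict ?g (carrier N) \<in> module_hom R N M"
  proof (rule module_homI[OF N])
    fix x assume x: "x \<in> carrier N"
    show "?g x \<in> carrier M" using g x by blast
    fix y assume y: "y \<in> carrier N"
    have "?g (x \<oplus>\<^bsub>N\<^esub> y) = ?g (f (?g x \<oplus>\<^bsub>M\<^esub> ?g y))" using F(2) g x y by simp
    also have "\<dots> = ?g x \<oplus>\<^bsub>M\<^esub> ?g y" by (rule gf) (use right_module_ops(2)[OF M] g x y in blast)
    finally show "?g (x \<oplus>\<^bsub>N\<^esub> y) = ?g x \<oplus>\<^bsub>M\<^esub> ?g y" .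
  next
    fix a x assume a: "a \<in> carrier R" and x: "x \<in> carrier N"
    have "?g (a \<odot>\<^bsub>N\<^esub> x) = ?g (f (a \<odot>\<^bsub>M\<^esub> ?g x))" using F(3) g x a by simp
    also have "\<dots> = a \<odot>\<^bsub>M\<^esub> ?g x" by (rule gf) (use right_module_ops(5)[OF M] g x a in blast)
    finally show "?g (a \<odot>\<^bsub>N\<^esub> x) = a \<odot>\<^bsub>M\<^esub> ?g x" .
  qed
  then show ?thesis using that[OF f(1), of "restrict ?g (carrier N)"] g gf F(1) by simp
qed

lemma module_isoI:
  assumes "f \<in> module_hom R M N" "g \<in> module_hom R N M"
    "\<And>x. x \<in> carrier M \<Longrightarrow> g (f x) = x" "\<And>y. y \<in> carrier N \<Longrightarrow> f (g y) = y"
  shows "module_iso R M N"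
  unfolding module_iso_def using assms module_homD(1)[OF assms(1)] module_homD(1)[OF assms(2)]
  by (intro bexI[of _ f] bij_betwI[of f _ _ g]) auto

lemma module_iso_sym: "\<lbrakk>right_module R M; right_module R N; module_iso R M N\<rbrakk> \<Longrightarrow> module_iso R N M"
  by (erule (2) module_iso_inverse) (rule module_isoI)

lemma module_iso_trans:
  assumes "right_module R M" "module_iso R M N" "module_iso R N P"
  shows "module_iso R M P"
proof -
  obtain f g where f: "f \<in> module_hom R M N" "bij_betw f (carrier M) (carrier N)"
    and g: "g \<in> module_hom R N P" "bij_betw g (carrier N) (carrier P)" using assms(2,3) unfolding module_iso_def by blast
  have "bij_betw (compose (carrier M) g f) (carrier M) (carrier P)" using bij_betw_compose[OF f(2) g(2)] .
  then show ?thesis unfolding module_iso_def using module_hom_compose[OF assms(1) f(1) g(1)] by blast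
qed

lemma submoduleI:
  assumes M: "right_module R M" and "S \<subseteq> carrier M" "\<zero>\<^bsub>M\<^esub> \<in> S" "\<And>x y. x \<in> S \<Longrightarrow> y \<in> S \<Longrightarrow> x \<oplus>\<^bsub>M\<^esub> y \<in> S"
    "\<And>x. x \<in> S \<Longrightarrow> \<ominus>\<^bsub>M\<^esub> x \<in> S" "\<And>a x. a \<in> carrier R \<Longrightarrow> x \<in> S \<Longrightarrow> a \<odot>\<^bsub>M\<^esub> x \<in> S"
  shows "submodule S R M"
  by unfold_locales (use assms in \<open>auto simp flip: a_inv_def\<close>)

lemma submodule_image:
  assumes M: "right_module R M" and N: "right_module R N" and f: "f \<in> module_hom R M N"
  shows "submodule (f ` carrier M) R N"
proof (rule submoduleI[OF N])
  note F = module_homD[OF f] and ops = right_module_ops[OF M]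
  show "f ` carrier M \<subseteq> carrier N" using F(1) by blast
  show "\<zero>\<^bsub>N\<^esub> \<in> f ` carrier M" using module_hom_zero[OF M N f] ops(1) by (metis imageI)
  show "x \<oplus>\<^bsub>N\<^esub> y \<in> f ` carrier M" if "x \<in> f ` carrier M" "y \<in> f ` carrier M" for x y
    using that F(2) ops(2) by (metis (no_types, lifting) imageE imageI)
  show "\<ominus>\<^bsub>N\<^esub> x \<in> f ` carrier M" if "x \<in> f ` carrier M" for x
    using that module_hom_neg[OF M N f] ops(3) by (metis (no_types, lifting) imageE imageI)
  show "a \<odot>\<^bsub>N\<^esub> x \<in> f ` carrier M" if "a \<in> carrier R" "x \<in> f ` carrier M" for a x
    using that F(3) ops(5) by (metis (no_types, lifting) imageE imageI)
qed

lemma internal_direct_sum_projection: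
  assumes M: "right_module R M" and s: "internal_direct_sum R M S S'"
  obtains p where "p \<in> module_hom R M M" "\<And>x. x \<in> carrier M \<Longrightarrow> p x \<in> S" "\<And>x. x \<in> carrier M \<Longrightarrow> x \<ominus>\<^bsub>M\<^esub> p x \<in> S'"
    "\<And>x. x \<in> S \<Longrightarrow> p x = x" "\<And>x. x \<in> S' \<Longrightarrow> p x = \<zero>\<^bsub>M\<^esub>"
proof -
  interpret M: abelian_group M using M by (rule right_module_ab)
  have S: "submodule S R M" "submodule S' R M" "S \<inter> S' = {\<zero>\<^bsub>M\<^esub>}" "S <+>\<^bsub>M\<^esub> S' = carrier M"
    using s unfolding internal_direct_sum_def by blast+
  note s1 = submoduleD[OF S(1)] and s2 = submoduleD[OF S(2)]
  have uniq: "a = a'" if "a \<in> S" "b \<in> S'" "a' \<in> S" "b' \<in> S'" "a \<oplus>\<^bsub>M\<^esub> b = a' \<oplus>\<^bsub>M\<^esub> b'" for a b a' b'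
  proof -
    have c: "a \<in> carrier M" "b \<in> carrier M" "a' \<in> carrier M" "b' \<in> carrier M" using that s1(1) s2(1) by auto
    have "a \<oplus>\<^bsub>M\<^esub> \<ominus>\<^bsub>M\<^esub> a' = b' \<oplus>\<^bsub>M\<^esub> \<ominus>\<^bsub>M\<^esub> b"
    proof -
      have "a \<oplus>\<^bsub>M\<^esub> \<ominus>\<^bsub>M\<^esub> a' = (a \<oplus>\<^bsub>M\<^esub> b) \<oplus>\<^bsub>M\<^esub> (\<ominus>\<^bsub>M\<^esub> b \<oplus>\<^bsub>M\<^esub> \<ominus>\<^bsub>M\<^esub> a')"
        using c by (simp add: M.a_assoc M.r_neg2)
      also have "\<dots> = a' \<oplus>\<^bsub>M\<^esub> (\<ominus>\<^bsub>M\<^esub> a' \<oplus>\<^bsub>M\<^esub> (b' \<oplus>\<^bsub>M\<^esub> \<ominus>\<^bsub>M\<^esub> b))" unfolding that(5) using c by (simp add: M.a_ac)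
      also have "\<dots> = b' \<oplus>\<^bsub>M\<^esub> \<ominus>\<^bsub>M\<^esub> b" using c by (simp add: M.r_neg2)
      finally show ?thesis .
    qed
    moreover have "a \<oplus>\<^bsub>M\<^esub> \<ominus>\<^bsub>M\<^esub> a' \<in> S" by (intro s1(3,4) that)
    moreover have "b' \<oplus>\<^bsub>M\<^esub> \<ominus>\<^bsub>M\<^esub> b \<in> S'" by (intro s2(3,4) that)
    ultimately have "a \<oplus>\<^bsub>M\<^esub> \<ominus>\<^bsub>M\<^esub> a' \<in> S \<inter> S'" by simp
    then have "a \<oplus>\<^bsub>M\<^esub> \<ominus>\<^bsub>M\<^esub> a' = \<zero>\<^bsub>M\<^esub>" unfolding S(3) by simp
    then show ?thesis using c M.minus_equality[of a "\<ominus>\<^bsub>M\<^esub> a'"] by simp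
  qed
  define P where "P x = (SOME a. a \<in> S \<and> (\<exists>b \<in> S'. x = a \<oplus>\<^bsub>M\<^esub> b))" for x
  have P: "P x \<in> S \<and> (\<exists>b \<in> S'. x = P x \<oplus>\<^bsub>M\<^esub> b)" if "x \<in> carrier M" for x
  proof -
    have "x \<in> S <+>\<^bsub>M\<^esub> S'" using that S(4) by simp
    then have "\<exists>a. a \<in> S \<and> (\<exists>b \<in> S'. x = a \<oplus>\<^bsub>M\<^esub> b)" unfolding set_add_iff by blast
    from someI_ex[OF this] show ?thesis unfolding P_def .
  qed
  have Peq: "P (a \<oplus>\<^bsub>M\<^esub> b) = a" if "a \<in> S" "b \<in> S'" for a b
  proof -
    have c: "a \<oplus>\<^bsub>M\<^esub> b \<in> carrier M" using that s1(1) s2(1) by auto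
    then obtain b' where "b' \<in> S'" "a \<oplus>\<^bsub>M\<^esub> b = P (a \<oplus>\<^bsub>M\<^esub> b) \<oplus>\<^bsub>M\<^esub> b'" using P by blast
    then show ?thesis using uniq[of a b "P (a \<oplus>\<^bsub>M\<^esub> b)" b'] that P[OF c] by auto
  qed
  have hom: "restrict P (carrier M) \<in> module_hom R M M"
  proof (rule module_homI[OF M])
    fix x assume x: "x \<in> carrier M"
    then show "P x \<in> carrier M" using P s1(1) by blast
    fix y assume y: "y \<in> carrier M"
    obtain b where b: "b \<in> S'" "x = P x \<oplus>\<^bsub>M\<^esub> b" using P[OF x] by blast
    obtain b' where b': "b' \<in> S'" "y = P y \<oplus>\<^bsub>M\<^esub> b'" using P[OF y] by blast
    have c: "P x \<in> carrier M" "P y \<in> carrier M" "b \<in> carrier M" "b' \<in> carrier M" using P x y b(1) b'(1) s1(1) s2(1) by auto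
    have "x \<oplus>\<^bsub>M\<^esub> y = (P x \<oplus>\<^bsub>M\<^esub> b) \<oplus>\<^bsub>M\<^esub> (P y \<oplus>\<^bsub>M\<^esub> b')" using b(2) b'(2) by simp
    also have "\<dots> = (P x \<oplus>\<^bsub>M\<^esub> P y) \<oplus>\<^bsub>M\<^esub> (b \<oplus>\<^bsub>M\<^esub> b')" using c by (simp add: M.a_ac)
    finally show "P (x \<oplus>\<^bsub>M\<^esub> y) = P x \<oplus>\<^bsub>M\<^esub> P y" using Peq[of "P x \<oplus>\<^bsub>M\<^esub> P y" "b \<oplus>\<^bsub>M\<^esub> b'"] P x y b b' s1(3) s2(3) by simp
  next
    fix a x assume a: "a \<in> carrier R" and x: "x \<in> carrier M"
    obtain b where b: "b \<in> S'" "x = P x \<oplus>\<^bsub>M\<^esub> b" using P[OF x] by blast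
    have c: "P x \<in> carrier M" "b \<in> carrier M" using P x b(1) s1(1) s2(1) by auto
    have "a \<odot>\<^bsub>M\<^esub> x = a \<odot>\<^bsub>M\<^esub> (P x \<oplus>\<^bsub>M\<^esub> b)" using b(2) by simp
    also have "\<dots> = a \<odot>\<^bsub>M\<^esub> P x \<oplus>\<^bsub>M\<^esub> a \<odot>\<^bsub>M\<^esub> b" using right_module.smult_module_distr[OF M a c] .
    finally show "P (a \<odot>\<^bsub>M\<^esub> x) = a \<odot>\<^bsub>M\<^esub> P x" using Peq[of "a \<odot>\<^bsub>M\<^esub> P x" "a \<odot>\<^bsub>M\<^esub> b"] P x b a s1(5) s2(5) by simp
  qed
  have zero: "\<zero>\<^bsub>M\<^esub> \<in> S" "\<zero>\<^bsub>M\<^esub> \<in> S'" using s1(2) s2(2) .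
  show ?thesis
  proof (rule that[OF hom])
    fix x assume x: "x \<in> carrier M"
    then show "restrict P (carrier M) x \<in> S" using P by simp
    obtain b where b: "b \<in> S'" "x = P x \<oplus>\<^bsub>M\<^esub> b" using P[OF x] by blast
    have c: "P x \<in> carrier M" "b \<in> carrier M" using P x b(1) s1(1) s2(1) by auto
    have "x \<ominus>\<^bsub>M\<^esub> P x = (P x \<oplus>\<^bsub>M\<^esub> b) \<ominus>\<^bsub>M\<^esub> P x" using b(2) by simp
    also have "\<dots> = b \<oplus>\<^bsub>M\<^esub> (P x \<oplus>\<^bsub>M\<^esub> \<ominus>\<^bsub>M\<^esub> P x)" using c by (simp add: a_minus_def M.a_ac)
    also have "\<dots> = b" using c by (simp add: M.r_neg)
    finally show "x \<ominus>\<^bsub>M\<^esub> restrict P (carrier M) x \<in> S'" using b(1) x by simp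
  next
    fix x assume x: "x \<in> S"
    then have "x \<in> carrier M" using s1(1) by blast
    then show "restrict P (carrier M) x = x" using Peq[OF x zero(2)] by simp
  next
    fix x assume x: "x \<in> S'"
    then have "x \<in> carrier M" using s2(1) by blast
    then show "restrict P (carrier M) x = \<zero>\<^bsub>M\<^esub>" using Peq[OF zero(1) x] by simp
  qed
qed

text \<open>
  Stated for a submodule that \<open>p\<close> preserves, in order to decompose direct summands further.
\<close>

lemma idempotent_internal_direct_sum:
  assumes M: "right_module R M" and S: "submodule S R M"
    and p: "p \<in> module_hom R M M" "\<And>x. x \<in> S \<Longrightarrow> p x \<in> S" "\<And>x. x \<in> S \<Longrightarrow> p (p x) = p x"
  shows "internal_direct_sum R (M\<lparr>carrier := S\<rparr>) (p ` S) {x \<in> S. p x = \<zero>\<^bsub>M\<^esub>}"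
proof -
  interpret M: abelian_group M using M by (rule right_module_ab)
  note s = submoduleD[OF S] and rS = submodule_right_module[OF M S] and P = module_homD[OF p(1)]
  have pS: "restrict p S \<in> module_hom R (M\<lparr>carrier := S\<rparr>) (M\<lparr>carrier := S\<rparr>)"
    using module_homI[OF rS, of p "M\<lparr>carrier := S\<rparr>"] P p(2) s by (auto simp: subset_iff)
  have 1: "submodule (p ` S) R (M\<lparr>carrier := S\<rparr>)"
    using submodule_image[OF rS rS pS] by simp
  have "a_kernel (M\<lparr>carrier := S\<rparr>) (M\<lparr>carrier := S\<rparr>) (restrict p S) = {x \<in> S. p x = \<zero>\<^bsub>M\<^esub>}" unfolding a_kernel_def' by auto
  then have 2: "submodule {x \<in> S. p x = \<zero>\<^bsub>M\<^esub>} R (M\<lparr>carrier := S\<rparr>)" using submodule_kernel[OF rS rS pS] by simp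
  have p0: "p \<zero>\<^bsub>M\<^esub> = \<zero>\<^bsub>M\<^esub>" by (rule module_hom_zero[OF M M p(1)])
  have 3: "p ` S \<inter> {x \<in> S. p x = \<zero>\<^bsub>M\<^esub>} = {\<zero>\<^bsub>M\<lparr>carrier := S\<rparr>\<^esub>}"
  proof
    show "p ` S \<inter> {x \<in> S. p x = \<zero>\<^bsub>M\<^esub>} \<subseteq> {\<zero>\<^bsub>M\<lparr>carrier := S\<rparr>\<^esub>}" using p(3) by auto
    have "\<zero>\<^bsub>M\<^esub> \<in> p ` S" using s(2) p0 by (metis imageI)
    then show "{\<zero>\<^bsub>M\<lparr>carrier := S\<rparr>\<^esub>} \<subseteq> p ` S \<inter> {x \<in> S. p x = \<zero>\<^bsub>M\<^esub>}" using s(2) p0 by simp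
  qed
  have 4: "p ` S <+>\<^bsub>M\<lparr>carrier := S\<rparr>\<^esub> {x \<in> S. p x = \<zero>\<^bsub>M\<^esub>} = carrier (M\<lparr>carrier := S\<rparr>)"
  proof
    show "p ` S <+>\<^bsub>M\<lparr>carrier := S\<rparr>\<^esub> {x \<in> S. p x = \<zero>\<^bsub>M\<^esub>} \<subseteq> carrier (M\<lparr>carrier := S\<rparr>)"
      unfolding subset_iff set_add_iff using p(2) s(3) by auto
    show "carrier (M\<lparr>carrier := S\<rparr>) \<subseteq> p ` S <+>\<^bsub>M\<lparr>carrier := S\<rparr>\<^esub> {x \<in> S. p x = \<zero>\<^bsub>M\<^esub>}"
    proof
      fix x assume "x \<in> carrier (M\<lparr>carrier := S\<rparr>)"
      then have x: "x \<in> S" by simp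
      then have c: "x \<in> carrier M" "p x \<in> carrier M" using s(1) p(2) by auto
      have d: "x \<ominus>\<^bsub>M\<^esub> p x \<in> S" unfolding a_minus_def using s(3,4) x p(2) by blast
      have "p (x \<ominus>\<^bsub>M\<^esub> p x) = p x \<ominus>\<^bsub>M\<^esub> p (p x)" by (rule module_hom_minus[OF M M p(1) c])
      then have "p (x \<ominus>\<^bsub>M\<^esub> p x) = \<zero>\<^bsub>M\<^esub>" using p(3)[OF x] c by (simp add: a_minus_def M.r_neg)
      moreover have "x = p x \<oplus>\<^bsub>M\<^esub> (x \<ominus>\<^bsub>M\<^esub> p x)" using c by (simp add: a_minus_def M.a_lcomm M.r_neg)
      ultimately show "x \<in> p ` S <+>\<^bsub>M\<lparr>carrier := S\<rparr>\<^esub> {x \<in> S. p x = \<zero>\<^bsub>M\<^esub>}"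
        unfolding set_add_iff using x d by (intro bexI[of _ "p x"] bexI[of _ "x \<ominus>\<^bsub>M\<^esub> p x"]) auto
    qed
  qed
  show ?thesis unfolding internal_direct_sum_def using 1 2 3 4 by blast
qed

lemma card_quotient_kernel: "card (A // {(x, y). x \<in> A \<and> y \<in> A \<and> F x = F y}) = card (F ` A)"
proof -
  have "A // {(x, y). x \<in> A \<and> y \<in> A \<and> F x = F y} = (\<lambda>r. {y \<in> A. F y = r}) ` (F ` A)"
  proof -
    have "{(x, y). x \<in> A \<and> y \<in> A \<and> F x = F y} `` {x} = {y \<in> A. F y = F x}" if "x \<in> A" for x
      using that by auto
    then show ?thesis unfolding quotient_def by (simp add: image_image image_UN UNION_singleton_eq_range)
  qed
  moreover have "inj_on (\<lambda>r. {y \<in> A. F y = r}) (F ` A)" by (rule inj_onI) blast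
  ultimately show ?thesis using card_image by metis
qed

section \<open>The modules \<open>Hom(R, X)\<close> as a Krull--Schmidt category\<close>

locale hom_modules = tri_setup K T
  for K :: "'k ring" and T :: "('o, 'm, 'k, 'z) tri_cat_scheme" (structure) +
  fixes R :: 'o
  assumes rigid: "rigid T R"
begin

abbreviation Gam where "Gam \<equiv> End_ring T R"
abbreviation M where "M Y \<equiv> Hom_module T R Y"
abbreviation mhom where "mhom X Y \<equiv> module_hom Gam (M X) (M Y)"

text \<open>
  The additive group of homomorphisms, as a ring record because \<open>hom_groups\<close> takes Hom groups in that form.
\<close>

definition hom_ring :: "'o \<Rightarrow> 'o \<Rightarrow> ('m \<Rightarrow> 'm) ring" where
  "hom_ring X Y = \<lparr>carrier = mhom X Y, monoid.mult = undefined, one = undefined,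
     ring.zero = restrict (\<lambda>u. zero_arr T R Y) (arr T R X),
     ring.add = (\<lambda>p q. restrict (\<lambda>u. p u \<oplus>\<^bsub>Hom T R Y\<^esub> q u) (arr T R X))\<rparr>"

lemma hom_ring_simps [simp]:
  "carrier (hom_ring X Y) = mhom X Y" "\<zero>\<^bsub>hom_ring X Y\<^esub> = restrict (\<lambda>u. zero_arr T R Y) (arr T R X)"
  "p \<oplus>\<^bsub>hom_ring X Y\<^esub> q = restrict (\<lambda>u. p u \<oplus>\<^bsub>Hom T R Y\<^esub> q u) (arr T R X)"
  unfolding hom_ring_def by simp_all

lemma hom_ring_group: "abelian_group (hom_ring X Y)"
proof -
  interpret H: comm_group "hom_group Gam (M X) (M Y)" by (rule hom_group_comm[OF Hom_module_right Hom_module_right])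
  have s: "carrier (hom_group Gam (M X) (M Y)) = mhom X Y"
    "\<And>p q. p \<otimes>\<^bsub>hom_group Gam (M X) (M Y)\<^esub> q = restrict (\<lambda>u. p u \<oplus>\<^bsub>Hom T R Y\<^esub> q u) (arr T R X)"
    "\<one>\<^bsub>hom_group Gam (M X) (M Y)\<^esub> = restrict (\<lambda>u. zero_arr T R Y) (arr T R X)" unfolding hom_group_def by simp_all
  note ax = H.m_closed[unfolded s] H.one_closed[unfolded s] H.m_assoc[unfolded s] H.m_comm[unfolded s] H.l_one[unfolded s] H.l_inv_ex[unfolded s]
  show ?thesis by (rule abelian_groupI) (unfold hom_ring_simps, (fact ax)+)
qed

definition id_map :: "'o \<Rightarrow> 'm \<Rightarrow> 'm" where "id_map X = restrict (\<lambda>u. u) (arr T R X)"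

lemma id_map_hom: "id_map X \<in> mhom X X"
  using module_homI[OF Hom_module_right, of R X "\<lambda>u. u" "M X"] unfolding id_map_def by simp

lemma mhom_arr: "p \<in> mhom X Y \<Longrightarrow> u \<in> arr T R X \<Longrightarrow> p u \<in> arr T R Y"
  using module_homD(1) by fastforce

lemma mhom_ext: "\<lbrakk>p \<in> mhom X Y; q \<in> mhom X Y; \<And>u. u \<in> arr T R X \<Longrightarrow> p u = q u\<rbrakk> \<Longrightarrow> p = q"
  by (rule module_hom_ext) auto

lemma mhom_compose: "\<lbrakk>p \<in> mhom X Y; q \<in> mhom Y Z\<rbrakk> \<Longrightarrow> compose (arr T R X) q p \<in> mhom X Z"
  using module_hom_compose[OF Hom_module_right] by fastforce

lemma mhom_addD: "\<lbrakk>p \<in> mhom X Y; u \<in> arr T R X; v \<in> arr T R X\<rbrakk> \<Longrightarrow> p (u \<oplus>\<^bsub>Hom T R X\<^esub> v) = p u \<oplus>\<^bsub>Hom T R Y\<^esub> p v"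
  using module_homD(2) by fastforce

text \<open>
  The modules \<open>Hom(R, X)\<close> and their homomorphisms, indexed by the objects \<open>X\<close>, so that the exchange lemma
  and the uniqueness of decompositions apply to them.
\<close>

sublocale N: hom_groups hom_ring "\<lambda>X Y Z q p. compose (arr T R X) q p" id_map
proof (rule hom_groups.intro, goal_cases)
  case (1 X Y) show ?case by (rule hom_ring_group)
next
  case (2 X) show ?case using id_map_hom by simp
next
  case (3 f X Y g Z) then show ?case using mhom_compose by simp
next
  case (4 f X Y) then have f: "f \<in> mhom X Y" by simp
  show ?case by (rule mhom_ext[OF mhom_compose[OF id_map_hom f] f]) (simp add: compose_def id_map_def)
next
  case (5 f X Y) then have f: "f \<in> mhom X Y" by simp
  show ?case by (rule mhom_ext[OF mhom_compose[OF f id_map_hom] f]) (simp add: compose_def id_map_def mhom_arr[OF f])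
next
  case (6 f W X g Y h Z)
  then have f: "f \<in> mhom W X" and g: "g \<in> mhom X Y" and h: "h \<in> mhom Y Z" by simp_all
  show ?case by (simp add: compose_def mhom_arr[OF f] cong: restrict_cong)
next
  case (7 f X Y g Z g')
  then have f: "f \<in> mhom X Y" by simp
  show ?case by (simp add: compose_def mhom_arr[OF f] cong: restrict_cong)
next
  case (8 f X Y f' g Z)
  then have f: "f \<in> mhom X Y" and f': "f' \<in> mhom X Y" and g: "g \<in> mhom Y Z" by simp_all
  show ?case by (simp add: compose_def mhom_addD[OF g mhom_arr[OF f] mhom_arr[OF f']] cong: restrict_cong)
qed

text \<open>The functor \<open>Hom(R, -)\<close> on tagged arrows.\<close>

definition F :: "'o \<times> 'o \<times> 'm \<Rightarrow> 'o \<times> 'o \<times> ('m \<Rightarrow> 'm)" where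
  "F = (\<lambda>(X, Y, f). (X, Y, push R X f))"

lemma F_tag [simp]: "F (X, Y, f) = (X, Y, push R X f)" unfolding F_def by simp

lemma F_hm: "u \<in> hm X Y \<Longrightarrow> F u \<in> N.hm X Y"
  using push_hom unfolding hm_eq by (auto simp: push_hom)

lemma F_cmp:
  assumes "u \<in> hm X Y" "v \<in> hm Y Z" shows "F (t_cmp v u) = N.t_cmp (F v) (F u)"
proof -
  obtain f g where u: "u = (X, Y, f)" "f \<in> arr T X Y" and v: "v = (Y, Z, g)" "g \<in> arr T Y Z"
    using assms unfolding hm_eq by blast
  have "push R X (g \<cdot> f) = compose (arr T R X) (push R Y g) (push R X f)"
    unfolding push_def compose_def using u(2) v(2) Comp_closed Comp_assoc[of _ R X f Y g Z]
    by (auto intro!: restrict_ext)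
  then show ?thesis unfolding u v by simp
qed

lemma F_pls:
  assumes "u \<in> hm X Y" "v \<in> hm X Y" shows "F (t_pls u v) = N.t_pls (F u) (F v)"
proof -
  obtain f g where u: "u = (X, Y, f)" "f \<in> arr T X Y" and v: "v = (X, Y, g)" "g \<in> arr T X Y"
    using assms unfolding hm_eq by blast
  have "push R X (f \<oplus>\<^bsub>Hom T X Y\<^esub> g) = restrict (\<lambda>w. push R X f w \<oplus>\<^bsub>Hom T R Y\<^esub> push R X g w) (arr T R X)"
    unfolding push_def using u(2) v(2) Comp_add_left by (auto intro!: restrict_ext)
  then show ?thesis unfolding u v by simp
qed

lemma F_zr: "F (t_zr X Y) = N.t_zr X Y"
  unfolding t_zr_eq[of X Y] N.t_zr_eq[of X Y] by (auto simp: push_def intro!: restrict_ext)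

lemma F_idt: "F (t_idt X) = N.t_idt X"
  unfolding t_idt_eq[of X] N.t_idt_eq[of X] by (auto simp: push_def id_map_def Id_Comp intro!: restrict_ext)

lemma F_dec: "dec X e Ys \<Longrightarrow> N.dec X (F e) Ys"
proof (induction rule: dec.induct)
  case dec_Nil
  then show ?case unfolding F_zr by (rule N.dec_Nil)
next
  case (dec_Cons c Ys i Y p)
  have c: "c \<in> hm X X" using dec_idem[OF dec_Cons.hyps(1)] by blast
  note ip = dec_Cons.hyps(2,3)
  have ipX: "t_cmp i p \<in> hm X X" using ip by simp
  have "N.dec X (N.t_pls (N.t_cmp (F i) (F p)) (F c)) (Y # Ys)"
  proof (rule N.dec_Cons[OF dec_Cons.IH F_hm[OF ip(1)] F_hm[OF ip(2)]])
    show "N.t_cmp (F p) (F i) = N.t_idt Y" using F_cmp[OF ip] dec_Cons.hyps(4) F_idt by simp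
    show "N.t_cmp (F p) (F c) = N.t_zr X Y" using F_cmp[OF c ip(2)] dec_Cons.hyps(5) F_zr by simp
    show "N.t_cmp (F c) (F i) = N.t_zr Y X" using F_cmp[OF ip(1) c] dec_Cons.hyps(6) F_zr by simp
  qed
  then show ?case using F_pls[OF ipX c] F_cmp[OF ip(2,1)] by simp
qed

lemma presentation:
  assumes "X \<in> pr T R"
  obtains R1 R0 f g h where "presented K T R X R1 R0 f g h"
proof -
  obtain R1 R0 f g h where "gen R R1" "gen R R0" "triangle T R1 R0 X f g h" using assms unfolding pr_iff by blast
  then have "presented K T R X R1 R0 f g h" using rigid tri_setup_axioms by (intro presented.intro presented_axioms.intro)
  then show ?thesis by (rule that)
qed

lemma F_full:
  assumes "X \<in> pr T R" "v \<in> N.hm X Y"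
  obtains u where "u \<in> hm X Y" "F u = v"
proof -
  obtain p where p: "v = (X, Y, p)" "p \<in> mhom X Y" using N.hmE[OF assms(2)] by auto
  obtain R1 R0 f g h where P: "presented K T R X R1 R0 f g h" using presentation[OF assms(1)] .
  obtain x where "x \<in> arr T X Y" "p = push R X x" using presented.full[OF P p(2)] .
  then show ?thesis using that[of "(X, Y, x)"] unfolding p by simp
qed

text \<open>
  If \<open>Hom(R, X) = 0\<close>, then \<open>g = 0\<close>, the identity of \<open>X\<close> factors through \<open>h\<close>, and \<open>X\<close> is itself a summand
  in \<open>add(R[1])\<close>.
\<close>

lemma no_shift_nonzero:
  assumes X: "X \<in> pr T R" "no_shift_summand T R X" "loc X"
  shows "N.t_idt X \<noteq> N.t_zr X X"
proof
  assume z: "N.t_idt X = N.t_zr X X"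
  obtain R1 R0 f g h where P: "presented K T R X R1 R0 f g h" using presentation[OF X(1)] .
  interpret P: presented K T R X R1 R0 f g h by (rule P)
  have u0: "u = zero_arr T R X" if "u \<in> arr T R X" for u
  proof -
    have "id_map X = restrict (\<lambda>u. zero_arr T R X) (arr T R X)" using z by (simp add: N.t_idt_eq N.t_zr_eq)
    from fun_cong[OF this, of u] that show ?thesis unfolding id_map_def by simp
  qed
  have "g = zero_arr T R0 X"
    by (rule P.gen_zero[OF P.gen_R0 P.fgh(2)]) (use u0 P.fgh Comp_closed in blast)
  then have "t_cmp (t_idt X) (R0, X, g) = t_zr R0 X" by (simp add: t_zr_eq t_idt_eq comp_zero_right[OF Id_closed])
  then obtain y where y: "y \<in> hm (shift T R1) X" "t_cmp y (X, shift T R1, h) = t_idt X"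
    using tri_coexact2[OF P.ttri, of "t_idt X" X] by auto
  have "gen (shift T R) X"
    by (rule gen_retract[OF gen_sh[OF P.gen_R1] _ y(1) y(2)]) (use P.fgh in simp)
  moreover have "direct_summand T X X"
    unfolding direct_summand_iff by (rule retract_arr[of "t_idt X" X X "t_idt X"]) simp_all
  ultimately have "is_zero T X" using X(2) unfolding no_shift_summand_def add_closure_iff by blast
  then show False using X(3) unfolding is_zero_iff loc_def by blast
qed

lemma F_iso: "iso_arw u \<Longrightarrow> N.iso_arw (F u)"
proof -
  assume "iso_arw u"
  then obtain v X Y where h: "u \<in> hm X Y" "v \<in> hm Y X" "t_cmp v u = t_idt X" "t_cmp u v = t_idt Y"
    unfolding iso_arw_def inv_arws_hm by blast
  then have "N.inv_arws (F u) (F v)"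
    unfolding N.inv_arws_hm using F_hm[OF h(1)] F_hm[OF h(2)] F_cmp[OF h(1,2)] F_cmp[OF h(2,1)] F_idt
    by (intro exI[of _ X] exI[of _ Y]) simp
  then show ?thesis unfolding N.iso_arw_def by blast
qed

lemma F_mns:
  assumes "u \<in> hm X Y" "v \<in> hm X Y" shows "F (mns u v) = N.mns (F u) (F v)"
proof -
  have m: "mns u v \<in> hm X Y" using assms by simp
  have "N.t_pls (F (mns u v)) (F v) = F u" using F_pls[OF m assms(2)] assms mns_pls_cancel by simp
  then show ?thesis using N.eq_mns_iff[of "F u" "F v" "F (mns u v)"] F_hm[OF m] F_hm[OF assms(1)] F_hm[OF assms(2)] by simp
qed

text \<open>
  By fullness every endomorphism of \<open>Hom(R, X)\<close> is induced by one of \<open>X\<close>.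
\<close>

lemma F_loc:
  assumes X: "X \<in> pr T R" "no_shift_summand T R X" "loc X"
  shows "N.loc X"
  unfolding N.loc_def
proof (intro conjI ballI)
  show "N.t_idt X \<noteq> N.t_zr X X" by (rule no_shift_nonzero[OF X])
  fix v assume v: "v \<in> N.hm X X"
  obtain u where u: "u \<in> hm X X" "F u = v" using F_full[OF X(1) v] .
  have "iso_arw u \<or> iso_arw (mns (t_idt X) u)" using X(3) u(1) unfolding loc_def by blast
  moreover have "F (mns (t_idt X) u) = N.mns (N.t_idt X) v" using F_mns[of "t_idt X" X X u] u F_idt by simp
  ultimately show "N.iso_arw v \<or> N.iso_arw (N.mns (N.t_idt X) v)" using F_iso u(2) by metis
qed

text \<open>Otherwise \<open>1 - u\<close> would be invertible, although it is sent to zero.\<close>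

lemma F_reflects_endo:
  assumes X: "X \<in> pr T R" "no_shift_summand T R X" "loc X" and u: "u \<in> hm X X" "F u = N.t_idt X"
  shows "iso_arw u"
proof (rule ccontr)
  assume "\<not> iso_arw u"
  then have i: "iso_arw (mns (t_idt X) u)" using X(3) u(1) unfolding loc_def by blast
  have z: "F (mns (t_idt X) u) = N.t_zr X X" using F_mns[of "t_idt X" X X u] u F_idt by simp
  have "N.iso_arw (N.t_zr X X)" using F_iso[OF i] unfolding z .
  then obtain v where v: "v \<in> N.hm X X" "N.t_cmp (N.t_zr X X) v = N.t_idt X"
    by (metis N.iso_endoE N.src_zr N.tgt_zr)
  then have "N.t_idt X = N.t_zr X X" by simp
  then show False using no_shift_nonzero[OF X] by blast
qed

text \<open>
  The two inverse module maps lift by fullness, and \<open>F_reflects_endo\<close> applies to both composites.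
\<close>

lemma F_reflects_isom:
  assumes X: "X \<in> pr T R" "no_shift_summand T R X" "loc X" and Y: "Y \<in> pr T R" "no_shift_summand T R Y" "loc Y"
    and i: "N.isom X Y"
  shows "isom X Y"
proof -
  obtain p q where pq: "p \<in> N.hm X Y" "q \<in> N.hm Y X" "N.t_cmp q p = N.t_idt X" "N.t_cmp p q = N.t_idt Y"
    using i by (rule N.isomE)
  obtain u where u: "u \<in> hm X Y" "F u = p" using F_full[OF X(1) pq(1)] .
  obtain v where v: "v \<in> hm Y X" "F v = q" using F_full[OF Y(1) pq(2)] .
  have "iso_arw (t_cmp v u)" by (rule F_reflects_endo[OF X]) (use u v pq F_cmp[OF u(1) v(1)] in simp_all)
  then obtain a where a: "a \<in> hm X X" "t_cmp (t_cmp v u) a = t_idt X" "t_cmp a (t_cmp v u) = t_idt X"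
    by (rule iso_endoE) (use u v in auto)
  have "iso_arw (t_cmp u v)" by (rule F_reflects_endo[OF Y]) (use u v pq F_cmp[OF v(1) u(1)] in simp_all)
  then obtain b where b: "b \<in> hm Y Y" "t_cmp (t_cmp u v) b = t_idt Y" "t_cmp b (t_cmp u v) = t_idt Y"
    by (rule iso_endoE) (use u v in auto)
  let ?l = "t_cmp a v" and ?r = "t_cmp v b"
  have l: "t_cmp ?l u = t_idt X" and r: "t_cmp u ?r = t_idt Y" using a b u v by simp_all
  have "?l = t_cmp ?l (t_cmp u ?r)" unfolding r using a v by simp
  also have "\<dots> = t_cmp (t_cmp ?l u) ?r" by (rule cmp_assoc[symmetric]) (use a b u v in simp_all)
  also have "\<dots> = ?r" unfolding l using b v by simp
  finally have lr: "?l = ?r" .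
  have "?l \<in> hm Y X" using a v by simp
  moreover have "t_cmp u ?l = t_idt Y" using r unfolding lr .
  ultimately show ?thesis using isomI[OF u(1) _ l] by blast
qed

lemma F_isom: "isom X Y \<Longrightarrow> N.isom X Y"
  unfolding isom_def N.isom_def using F_iso by (force simp: F_def)

lemma summand_conditions:
  assumes X: "X \<in> pr T R" "no_shift_summand T R X" and i: "i \<in> hm Y X" "p \<in> hm X Y" "t_cmp p i = t_idt Y"
  shows "Y \<in> pr T R" "no_shift_summand T R Y"
proof -
  show "Y \<in> pr T R" using pres_retract[OF _ i] X(1) pres_pr[OF rigid] by blast
  show "no_shift_summand T R Y" unfolding no_shift_summand_def
  proof (intro allI impI, elim conjE)
    fix V assume V: "direct_summand T V Y" "V \<in> add_closure T (shift T R)"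
    then obtain j q where "j \<in> arr T V Y" "q \<in> arr T Y V" "q \<cdot> j = Id T V" unfolding direct_summand_iff by blast
    then have j: "(V, Y, j) \<in> hm V Y" "(Y, V, q) \<in> hm Y V" "t_cmp (Y, V, q) (V, Y, j) = t_idt V" by (simp_all add: t_idt_eq)
    define J Q where "J = (V, Y, j)" "Q = (Y, V, q)"
    have J: "J \<in> hm V Y" "Q \<in> hm Y V" "t_cmp Q J = t_idt V" unfolding J_Q_def using j by simp_all
    have "t_cmp (t_cmp Q p) (t_cmp i J) = t_cmp Q (t_cmp (t_cmp p i) J)" using J(1,2) i(1,2) by simp
    also have "\<dots> = t_idt V" unfolding i(3) using J by simp
    finally have "direct_summand T V X" unfolding direct_summand_iff
      by (intro retract_arr[of "t_cmp i J" V X "t_cmp Q p"]) (use J i in simp_all)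
    then show "is_zero T V" using X(2) V(2) unfolding no_shift_summand_def by blast
  qed
qed

end

section \<open>The direct summands of \<open>Hom(R, X)\<close>\<close>

lemma set_add_swap:
  assumes "\<And>a b. a \<in> A \<Longrightarrow> b \<in> B \<Longrightarrow> a \<oplus>\<^bsub>M\<^esub> b = b \<oplus>\<^bsub>M\<^esub> a"
  shows "A <+>\<^bsub>M\<^esub> B = B <+>\<^bsub>M\<^esub> A"
proof (intro subset_antisym subsetI)
  fix x assume "x \<in> A <+>\<^bsub>M\<^esub> B"
  then show "x \<in> B <+>\<^bsub>M\<^esub> A" unfolding set_add_iff using assms by blast
next
  fix x assume "x \<in> B <+>\<^bsub>M\<^esub> A"
  then show "x \<in> A <+>\<^bsub>M\<^esub> B" unfolding set_add_iff using assms by (metis (no_types))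
qed

lemma singleton_eqI: "\<lbrakk>\<And>x. x \<in> A \<Longrightarrow> x = a; a \<in> A\<rbrakk> \<Longrightarrow> A = {a}"
  by blast

context hom_modules
begin

lemmas rm = Hom_module_right

lemma mhom_zero: "p \<in> mhom X Y \<Longrightarrow> p (zero_arr T R X) = zero_arr T R Y"
  using module_hom_zero[OF rm rm] by fastforce

lemma cmp_idtD: "\<lbrakk>N.t_cmp (X, A, p) (A, X, i) = N.t_idt A; u \<in> arr T R A\<rbrakk> \<Longrightarrow> p (i u) = u"
proof -
  assume a: "N.t_cmp (X, A, p) (A, X, i) = N.t_idt A" and u: "u \<in> arr T R A"
  have "compose (arr T R A) p i = id_map A" using a by (simp add: N.t_idt_eq)
  from fun_cong[OF this, of u] u show ?thesis by (simp add: compose_def id_map_def)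
qed

lemma cmp_zrD: "\<lbrakk>N.t_cmp (Y, Z, q) (X, Y, p) = N.t_zr X Z; u \<in> arr T R X\<rbrakk> \<Longrightarrow> q (p u) = zero_arr T R Z"
proof -
  assume a: "N.t_cmp (Y, Z, q) (X, Y, p) = N.t_zr X Z" and u: "u \<in> arr T R X"
  have "compose (arr T R X) q p = restrict (\<lambda>u. zero_arr T R Z) (arr T R X)" using a by (simp add: N.t_zr_eq)
  from fun_cong[OF this, of u] u show ?thesis by (simp add: compose_def)
qed

lemma cmp_eqD: "\<lbrakk>N.t_cmp (Y, Z, q) (X, Y, p) = (X, Z, r); u \<in> arr T R X\<rbrakk> \<Longrightarrow> q (p u) = r u"
proof -
  assume a: "N.t_cmp (Y, Z, q) (X, Y, p) = (X, Z, r)" and u: "u \<in> arr T R X"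
  have "compose (arr T R X) q p = r" using a by simp
  from fun_cong[OF this, of u] u show ?thesis by (simp add: compose_def)
qed

lemma cmp_idtI: "(\<And>u. u \<in> arr T R A \<Longrightarrow> p (i u) = u) \<Longrightarrow> N.t_cmp (X, A, p) (A, X, i) = N.t_idt A"
proof -
  assume a: "\<And>u. u \<in> arr T R A \<Longrightarrow> p (i u) = u"
  have "compose (arr T R A) p i = id_map A" unfolding compose_def id_map_def by (rule restrict_ext) (rule a)
  then show ?thesis by (simp add: N.t_idt_eq)
qed

lemma cmp_zrI: "(\<And>u. u \<in> arr T R X \<Longrightarrow> q (p u) = zero_arr T R Z) \<Longrightarrow> N.t_cmp (Y, Z, q) (X, Y, p) = N.t_zr X Z"
proof -
  assume a: "\<And>u. u \<in> arr T R X \<Longrightarrow> q (p u) = zero_arr T R Z"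
  have "compose (arr T R X) q p = restrict (\<lambda>u. zero_arr T R Z) (arr T R X)" unfolding compose_def by (rule restrict_ext) (rule a)
  then show ?thesis by (simp add: N.t_zr_eq)
qed

lemma cmp_eqI:
  assumes r: "r \<in> mhom X Z" and a: "\<And>u. u \<in> arr T R X \<Longrightarrow> q (p u) = r u"
  shows "N.t_cmp (Y, Z, q) (X, Y, p) = (X, Z, r)"
proof -
  have "compose (arr T R X) q p = r"
  proof (rule extensionalityI)
    show "compose (arr T R X) q p \<in> extensional (arr T R X)" by (rule compose_extensional)
    show "r \<in> extensional (arr T R X)" using module_homD(4)[OF r] by simp
    show "compose (arr T R X) q p u = r u" if "u \<in> arr T R X" for u using a[OF that] that by (simp add: compose_def)
  qed
  then show ?thesis by simp
qed

lemma idt_zrI: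
  assumes a: "\<And>u. u \<in> arr T R A \<Longrightarrow> u = zero_arr T R A"
  shows "N.t_idt A = N.t_zr A A"
proof -
  have "id_map A = restrict (\<lambda>u. zero_arr T R A) (arr T R A)" unfolding id_map_def by (rule restrict_ext) (rule a)
  then show ?thesis by (simp add: N.t_idt_eq N.t_zr_eq)
qed

text \<open>
  The first member \<open>A\<close> of \<open>As\<close> embeds as a nonzero direct summand of the image \<open>S\<close>, so it is all of \<open>S\<close>;
  the other idempotents are then zero, and no further members are left.
\<close>

lemma summand_of_indecomposable_image:
  assumes e: "e \<in> mhom X X" "\<And>u. u \<in> arr T R X \<Longrightarrow> e (e u) = e u"
    and S: "S = e ` arr T R X" "indecomposable_module Gam ((M X)\<lparr>carrier := S\<rparr>)"
    and d: "N.dec X (X, X, e) As" "\<forall>A \<in> set As. N.loc A"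
  obtains A where "As = [A]" "module_iso Gam (M A) ((M X)\<lparr>carrier := S\<rparr>)"
proof -
  have sS: "submodule S Gam (M X)" unfolding S(1) using submodule_image[OF rm rm e(1)] by simp
  note rS = submodule_right_module[OF rm sS]
  have S0: "S \<noteq> {zero_arr T R X}" using S(2) unfolding indecomposable_module_def by simp
  have zS: "zero_arr T R X \<in> S" using submoduleD(2)[OF sS] by simp
  have "As \<noteq> []"
  proof
    assume "As = []"
    then have "(X, X, e) = N.t_zr X X" using d(1) by (auto elim: N.dec.cases)
    then have "e u = zero_arr T R X" if "u \<in> arr T R X" for u using that by (simp add: N.t_zr_eq)
    then show False using S0 zS unfolding S(1) by auto
  qed
  then obtain A As' where As: "As = A # As'" by (cases As) auto
  obtain i p c where dc: "N.dec X c As'" and i: "i \<in> N.hm A X" and p: "p \<in> N.hm X A" and pi: "N.t_cmp p i = N.t_idt A"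
    and pc: "N.t_cmp p c = N.t_zr X A" and ci: "N.t_cmp c i = N.t_zr A X" and eq: "(X, X, e) = N.t_pls (N.t_cmp i p) c"
    using d(1) unfolding As by (rule N.dec_split)
  have c: "c \<in> N.hm X X" "N.t_cmp c c = c" using N.dec_idem[OF dc] by auto
  obtain i' where i': "i = (A, X, i')" "i' \<in> mhom A X" using N.hmE[OF i] by auto
  obtain p' where p': "p = (X, A, p')" "p' \<in> mhom X A" using N.hmE[OF p] by auto
  obtain c' where c': "c = (X, X, c')" "c' \<in> mhom X X" using N.hmE[OF c(1)] by auto
  note ar = mhom_arr[OF i'(2)] mhom_arr[OF p'(2)] mhom_arr[OF c'(2)] mhom_arr[OF e(1)]
  have pi': "p' (i' u) = u" if "u \<in> arr T R A" for u
    by (rule cmp_idtD[OF pi[unfolded i'(1) p'(1)] that])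
  have pc': "p' (c' u) = zero_arr T R A" if "u \<in> arr T R X" for u
    by (rule cmp_zrD[OF pc[unfolded p'(1) c'(1)] that])
  have ci': "c' (i' u) = zero_arr T R X" if "u \<in> arr T R A" for u
    by (rule cmp_zrD[OF ci[unfolded i'(1) c'(1)] that])
  have cc': "c' (c' u) = c' u" if "u \<in> arr T R X" for u
    by (rule cmp_eqD[OF c(2)[unfolded c'(1)] that])
  have e': "e u = i' (p' u) \<oplus>\<^bsub>Hom T R X\<^esub> c' u" if "u \<in> arr T R X" for u
  proof -
    have "e = restrict (\<lambda>u. compose (arr T R X) i' p' u \<oplus>\<^bsub>Hom T R X\<^esub> c' u) (arr T R X)" using eq unfolding c'(1) i'(1) p'(1) by simp
    from fun_cong[OF this, of u] that show ?thesis by (simp add: compose_def)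
  qed
  have iS: "i' u \<in> S" "e (i' u) = i' u" if u: "u \<in> arr T R A" for u
  proof -
    show "e (i' u) = i' u" using e'[of "i' u"] pi'[OF u] ci'[OF u] ar(1)[OF u] by simp
    then show "i' u \<in> S" unfolding S(1) using ar(1)[OF u] by (metis imageI)
  qed
  have cS: "c' u \<in> S" if u: "u \<in> arr T R X" for u
  proof -
    have "e (c' u) = c' u" using e'[of "c' u"] pc'[OF u] cc'[OF u] ar(3)[OF u] mhom_zero[OF i'(2)] by simp
    then show "c' u \<in> S" unfolding S(1) using ar(3)[OF u] by (metis imageI)
  qed
  have SX: "S \<subseteq> arr T R X" using submoduleD(1)[OF sS] by simp
  have eS: "e u = u" if "u \<in> S" for u using that e(2) unfolding S(1) by auto
  \<comment> \<open>\<open>i' \<circ> p'\<close> is an idempotent with image \<open>Hom(R, A)\<close>\<close>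
  let ?q = "compose (arr T R X) i' p'"
  have q: "?q \<in> mhom X X" by (rule mhom_compose[OF p'(2) i'(2)])
  have qu: "?q u = i' (p' u)" if "u \<in> arr T R X" for u using that by (simp add: compose_def)
  have "internal_direct_sum Gam ((M X)\<lparr>carrier := S\<rparr>) (?q ` S) {x \<in> S. ?q x = \<zero>\<^bsub>M X\<^esub>}"
  proof (rule idempotent_internal_direct_sum[OF rm sS q])
    fix x assume "x \<in> S"
    then have x: "x \<in> arr T R X" using SX by blast
    show "?q x \<in> S" unfolding qu[OF x] by (rule iS(1)[OF ar(2)[OF x]])
    show "?q (?q x) = ?q x" using x ar pi' by (simp add: compose_def)
  qed
  then have alt: "?q ` S = {zero_arr T R X} \<or> {x \<in> S. ?q x = zero_arr T R X} = {zero_arr T R X}"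
    using S(2) unfolding indecomposable_module_def by simp
  have lA: "N.loc A" using d(2) As by simp
  have n1: "?q ` S \<noteq> {zero_arr T R X}"
  proof
    assume z: "?q ` S = {zero_arr T R X}"
    have "u = zero_arr T R A" if u: "u \<in> arr T R A" for u
    proof -
      have "?q (i' u) = i' u" using qu[OF ar(1)[OF u]] pi'[OF u] by simp
      then have "i' u = zero_arr T R X" using z iS(1)[OF u] by (metis imageI singletonD)
      then show ?thesis using pi'[OF u] mhom_zero[OF p'(2)] by simp
    qed
    then have "N.t_idt A = N.t_zr A A" by (rule idt_zrI)
    then show False using lA unfolding N.loc_def by blast
  qed
  have c0: "c' u = zero_arr T R X" if u: "u \<in> arr T R X" for u
  proof -
    have "?q (c' u) = zero_arr T R X" using qu[OF ar(3)[OF u]] pc'[OF u] mhom_zero[OF i'(2)] by simp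
    then have "c' u \<in> {x \<in> S. ?q x = zero_arr T R X}" using cS[OF u] by simp
    then show ?thesis using alt n1 by auto
  qed
  have "c = N.t_zr X X"
    unfolding c'(1) N.t_zr_eq[of X X] using c0 module_homD(4)[OF c'(2)] by (auto intro: extensionalityI[of _ "arr T R X"])
  then have "image_mset N.icl (mset As') = image_mset N.icl (mset [])"
    using dc d(2) As by (intro N.krull_schmidt_unique[OF _ N.dec_Nil]) auto
  then have "As' = []" by simp
  moreover have "module_iso Gam (M A) ((M X)\<lparr>carrier := S\<rparr>)"
  proof (rule module_isoI)
    show "i' \<in> module_hom Gam (M A) ((M X)\<lparr>carrier := S\<rparr>)" by (rule module_hom_into_submodule[OF i'(2)]) (use iS in simp)
    show "restrict p' S \<in> module_hom Gam ((M X)\<lparr>carrier := S\<rparr>) (M A)"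
      using module_homI[OF rS, of p' "M A"] module_homD[OF p'(2)] SX by (auto simp: subset_iff)
    show "restrict p' S (i' x) = x" if "x \<in> carrier (M A)" for x using that pi' iS by simp
    show "i' (restrict p' S y) = y" if "y \<in> carrier ((M X)\<lparr>carrier := S\<rparr>)" for y
    proof -
      have y: "y \<in> S" "y \<in> arr T R X" using that SX by auto
      show ?thesis using e'[OF y(2)] eS[OF y(1)] c0[OF y(2)] ar(1)[OF ar(2)[OF y(2)]] y(1) by simp
    qed
  qed
  ultimately show ?thesis using that As by simp
qed

lemma dec_of_iso_image:
  assumes e: "e \<in> mhom X X" "\<And>u. u \<in> arr T R X \<Longrightarrow> e u \<in> S" "\<And>u. u \<in> S \<Longrightarrow> e u = u"
    and S: "submodule S Gam (M X)" and i: "module_iso Gam (M A) ((M X)\<lparr>carrier := S\<rparr>)"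
  shows "N.dec X (X, X, e) [A]"
proof -
  note rS = submodule_right_module[OF rm S]
  have SX: "S \<subseteq> arr T R X" using submoduleD(1)[OF S] by simp
  obtain f g where f: "f \<in> module_hom Gam (M A) ((M X)\<lparr>carrier := S\<rparr>)" and g: "g \<in> module_hom Gam ((M X)\<lparr>carrier := S\<rparr>) (M A)"
    and gf: "\<And>x. x \<in> carrier (M A) \<Longrightarrow> g (f x) = x" and fg: "\<And>y. y \<in> carrier ((M X)\<lparr>carrier := S\<rparr>) \<Longrightarrow> f (g y) = y"
    by (rule module_iso_inverse[OF rm rS i]) blast
  have fX: "f \<in> mhom A X" by (rule module_hom_from_submodule[OF f]) (use SX in simp)
  have eS: "e \<in> module_hom Gam (M X) ((M X)\<lparr>carrier := S\<rparr>)" by (rule module_hom_into_submodule[OF e(1)]) (use e(2) in simp)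
  have "compose (carrier (M X)) g e \<in> mhom X A" by (rule module_hom_compose[OF rm eS g])
  then have p: "compose (arr T R X) g e \<in> mhom X A" by simp
  have fS: "f u \<in> S" if "u \<in> arr T R A" for u using module_homD(1)[OF f] that by simp
  let ?i = "(A, X, f)" and ?p = "(X, A, compose (arr T R X) g e)"
  have pi: "N.t_cmp ?p ?i = N.t_idt A"
  proof (rule cmp_idtI)
    fix u assume u: "u \<in> arr T R A"
    then show "compose (arr T R X) g e (f u) = u" using gf[of u] e(3)[OF fS[OF u]] subsetD[OF SX fS[OF u]] by (simp add: compose_def)
  qed
  have ip: "N.t_cmp ?i ?p = (X, X, e)"
    by (rule cmp_eqI[OF e(1)]) (use e(2) fg in \<open>simp add: compose_def\<close>)
  have eh: "(X, X, e) \<in> N.hm X X" using e(1) by simp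
  have "N.dec X (N.t_pls (N.t_cmp ?i ?p) (N.t_zr X X)) [A]"
    by (rule N.dec_Cons[OF N.dec_Nil _ _ pi]) (use fX p in simp_all)
  then show ?thesis unfolding ip using N.pls_zr[of "(X, X, e)" X X] eh by (metis N.hm_iff)
qed

lemma isom_module_iso: "N.isom A B \<longleftrightarrow> module_iso Gam (M A) (M B)"
proof
  assume "N.isom A B"
  then obtain p q where p: "p \<in> N.hm A B" and q: "q \<in> N.hm B A" and qp: "N.t_cmp q p = N.t_idt A" and pq: "N.t_cmp p q = N.t_idt B"
    by (rule N.isomE)
  obtain p' where p': "p = (A, B, p')" "p' \<in> mhom A B" using N.hmE[OF p] by auto
  obtain q' where q': "q = (B, A, q')" "q' \<in> mhom B A" using N.hmE[OF q] by auto
  show "module_iso Gam (M A) (M B)"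
  proof (rule module_isoI[OF p'(2) q'(2)])
    show "q' (p' x) = x" if "x \<in> carrier (M A)" for x
      using cmp_idtD[OF qp[unfolded p'(1) q'(1)]] that by simp
    show "p' (q' x) = x" if "x \<in> carrier (M B)" for x
      using cmp_idtD[OF pq[unfolded p'(1) q'(1)]] that by simp
  qed
next
  assume "module_iso Gam (M A) (M B)"
  then obtain f g where f: "f \<in> mhom A B" and g: "g \<in> mhom B A"
    and gf: "\<And>x. x \<in> carrier (M A) \<Longrightarrow> g (f x) = x" and fg: "\<And>y. y \<in> carrier (M B) \<Longrightarrow> f (g y) = y"
    by (rule module_iso_inverse[OF rm rm]) blast
  show "N.isom A B"
  proof (rule N.isomI[of "(A, B, f)" A B "(B, A, g)"])
    show "(A, B, f) \<in> N.hm A B" "(B, A, g) \<in> N.hm B A" using f g by simp_all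
    show "N.t_cmp (B, A, g) (A, B, f) = N.t_idt A" by (rule cmp_idtI) (use gf in simp)
    show "N.t_cmp (A, B, f) (B, A, g) = N.t_idt B" by (rule cmp_idtI) (use fg in simp)
  qed
qed

end

text \<open>
  A decomposition of \<open>X\<close> into local objects, for comparison with the direct summands of \<open>Hom(R, X)\<close>.
\<close>

locale hom_summands = hom_modules K T R
  for K :: "'k ring" and T :: "('o, 'm, 'k, 'z) tri_cat_scheme" (structure) and R :: 'o +
  fixes X :: 'o and Ys :: "'o list"
  assumes X: "X \<in> pr T R" "no_shift_summand T R X"
    and Ys: "dec X (t_idt X) Ys" "\<forall>Y \<in> set Ys. loc Y"
begin

lemma summand: "Y \<in> set Ys \<Longrightarrow> Y \<in> pr T R \<and> no_shift_summand T R Y \<and> loc Y"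
  using dec_retract_member[OF Ys(1)] summand_conditions[OF X] Ys(2) by metis

lemma NYs: "N.dec X (N.t_idt X) Ys" "\<forall>Y \<in> set Ys. N.loc Y"
  using F_dec[OF Ys(1)] F_idt summand F_loc by auto

lemma reflects: "\<lbrakk>A \<in> set Ys; B \<in> set Ys\<rbrakk> \<Longrightarrow> module_iso Gam (M A) (M B) \<longleftrightarrow> icl A = icl B"
  unfolding isom_module_iso[symmetric] icl_eq using F_reflects_isom F_isom summand by blast

lemma projection_hm:
  assumes "p \<in> mhom X X" "\<And>u. u \<in> arr T R X \<Longrightarrow> p (p u) = p u"
  shows "(X, X, p) \<in> N.hm X X" "N.t_cmp (X, X, p) (X, X, p) = (X, X, p)"
proof -
  show "(X, X, p) \<in> N.hm X X" using assms by simp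
  show "N.t_cmp (X, X, p) (X, X, p) = (X, X, p)" by (rule cmp_eqI[OF assms(1)]) (rule assms(2))
qed

text \<open>
  The projection onto the summand is idempotent, so by the exchange lemma some of the modules
  \<open>Hom(R, Y)\<close> with \<open>Y\<close> among \<open>Ys\<close> decompose its image.
\<close>

lemma indecomposable_summand_iso:
  assumes "S \<in> indecomposable_summands Gam (M X)"
  shows "\<exists>A \<in> set Ys. module_iso Gam (M A) ((M X)\<lparr>carrier := S\<rparr>)"
proof -
  obtain S' where s: "internal_direct_sum Gam (M X) S S'" and ind: "indecomposable_module Gam ((M X)\<lparr>carrier := S\<rparr>)"
    using assms unfolding indecomposable_summands_def by blast
  have SX: "S \<subseteq> arr T R X" using s submoduleD(1) unfolding internal_direct_sum_def by fastforce
  obtain p where p: "p \<in> mhom X X" "\<And>x. x \<in> arr T R X \<Longrightarrow> p x \<in> S" "\<And>x. x \<in> S \<Longrightarrow> p x = x"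
    by (rule internal_direct_sum_projection[OF rm s]) auto
  have im: "S = p ` arr T R X" using p(2,3) SX by force
  have pp: "p (p u) = p u" if "u \<in> arr T R X" for u using p that by blast
  note h = projection_hm[OF p(1) pp]
  obtain As Bs where A: "N.dec X (X, X, p) As" "mset Ys = mset As + mset Bs"
    using N.exchange[OF NYs h] h(1) N.cmp_idt[of "(X, X, p)" X] N.idt_cmp[of "(X, X, p)" X] by auto
  have sub: "set As \<subseteq> set Ys" using A(2) by (metis set_mset_mset set_mset_union sup_ge1)
  obtain B where "As = [B]" "module_iso Gam (M B) ((M X)\<lparr>carrier := S\<rparr>)"
    using summand_of_indecomposable_image[OF p(1) pp im ind A(1)] NYs(2) sub by blast
  then show ?thesis using sub by auto
qed

text \<open>
  The summand is the image of \<open>Hom(R, A)\<close>.  A decomposition of it would give an idempotent endomorphism of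
  \<open>Hom(R, A)\<close>, which is trivial because \<open>A\<close> stays local.
\<close>

lemma indecomposable_summand_exists:
  assumes A: "A \<in> set Ys"
  shows "\<exists>S \<in> indecomposable_summands Gam (M X). module_iso Gam (M A) ((M X)\<lparr>carrier := S\<rparr>)"
proof -
  obtain i p where ip: "i \<in> N.hm A X" "p \<in> N.hm X A" "N.t_cmp p i = N.t_idt A"
    using N.dec_retract_member[OF NYs(1) A] by metis
  obtain i' where i': "i = (A, X, i')" "i' \<in> mhom A X" using N.hmE[OF ip(1)] by auto
  obtain p' where p': "p = (X, A, p')" "p' \<in> mhom X A" using N.hmE[OF ip(2)] by auto
  note ar = mhom_arr[OF i'(2)] mhom_arr[OF p'(2)]
  have pi': "p' (i' u) = u" if "u \<in> arr T R A" for u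
    by (rule cmp_idtD[OF ip(3)[unfolded i'(1) p'(1)] that])
  let ?S = "i' ` arr T R A"
  have sS: "submodule ?S Gam (M X)" using submodule_image[OF rm rm i'(2)] by simp
  note rS = submodule_right_module[OF rm sS]
  have SX: "?S \<subseteq> arr T R X" using ar by blast
  let ?q = "compose (arr T R X) i' p'"
  have q: "?q \<in> mhom X X" by (rule mhom_compose[OF p'(2) i'(2)])
  have whole: "submodule (arr T R X) Gam (M X)"
    by (rule submoduleI[OF rm]) (use right_module_ops[OF rm[of R X]] in auto)
  have "internal_direct_sum Gam ((M X)\<lparr>carrier := arr T R X\<rparr>) (?q ` arr T R X) {x \<in> arr T R X. ?q x = \<zero>\<^bsub>M X\<^esub>}"
  proof (rule idempotent_internal_direct_sum[OF rm whole q])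
    fix x assume x: "x \<in> arr T R X"
    show "?q x \<in> arr T R X" by (rule mhom_arr[OF q x])
    show "?q (?q x) = ?q x" using x ar pi' by (simp add: compose_def)
  qed
  moreover have "(M X)\<lparr>carrier := arr T R X\<rparr> = M X" by (simp add: Hom_module_def)
  moreover have "?q ` arr T R X = ?S"
  proof -
    have "?q (i' u) = i' u" if "u \<in> arr T R A" for u using that ar pi' by (simp add: compose_def)
    then have sub: "?S \<subseteq> ?q ` arr T R X" using image_eqI[OF sym ar(1), of ?q] by (intro image_subsetI) blast
    have "?q u \<in> ?S" if "u \<in> arr T R X" for u using imageI[OF ar(2)[OF that], of i'] that by (simp add: compose_def)
    then have "?q ` arr T R X \<subseteq> ?S" by (intro image_subsetI)
    with sub show ?thesis by (intro subset_antisym)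
  qed
  ultimately have s: "\<exists>S'. internal_direct_sum Gam (M X) ?S S'" by auto
  have lA: "N.loc A" using NYs(2) A by blast
  have ind: "indecomposable_module Gam ((M X)\<lparr>carrier := ?S\<rparr>)"
    unfolding indecomposable_module_def
  proof (intro conjI allI impI)
    show "carrier ((M X)\<lparr>carrier := ?S\<rparr>) \<noteq> {\<zero>\<^bsub>(M X)\<lparr>carrier := ?S\<rparr>\<^esub>}"
    proof
      assume z: "carrier ((M X)\<lparr>carrier := ?S\<rparr>) = {\<zero>\<^bsub>(M X)\<lparr>carrier := ?S\<rparr>\<^esub>}"
      have "u = zero_arr T R A" if u: "u \<in> arr T R A" for u
      proof -
        have "i' u = zero_arr T R X" using z u by auto
        then show ?thesis using pi'[OF u] mhom_zero[OF p'(2)] by simp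
      qed
      then have "N.t_idt A = N.t_zr A A" by (rule idt_zrI)
      then show False using lA unfolding N.loc_def by blast
    qed
    fix N1 N2 assume ds: "internal_direct_sum Gam ((M X)\<lparr>carrier := ?S\<rparr>) N1 N2"
    obtain r where r: "r \<in> module_hom Gam ((M X)\<lparr>carrier := ?S\<rparr>) ((M X)\<lparr>carrier := ?S\<rparr>)"
      "\<And>x. x \<in> ?S \<Longrightarrow> r x \<in> N1" "\<And>x. x \<in> N1 \<Longrightarrow> r x = x" "\<And>x. x \<in> N2 \<Longrightarrow> r x = zero_arr T R X"
      by (rule internal_direct_sum_projection[OF rS ds]) auto
    have sub: "submodule N1 Gam ((M X)\<lparr>carrier := ?S\<rparr>)" "submodule N2 Gam ((M X)\<lparr>carrier := ?S\<rparr>)"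
      using ds unfolding internal_direct_sum_def by blast+
    have N12: "N1 \<subseteq> ?S" "N2 \<subseteq> ?S" "zero_arr T R X \<in> N1" "zero_arr T R X \<in> N2"
      using submoduleD(1,2)[OF sub(1)] submoduleD(1,2)[OF sub(2)] by auto
    have iS: "i' \<in> module_hom Gam (M A) ((M X)\<lparr>carrier := ?S\<rparr>)" by (rule module_hom_into_submodule[OF i'(2)]) simp
    have rX: "r \<in> module_hom Gam ((M X)\<lparr>carrier := ?S\<rparr>) (M X)" by (rule module_hom_from_submodule[OF r(1)]) (use SX in simp)
    \<comment> \<open>the projection onto \<open>N1\<close>, transported to an idempotent of \<open>Hom(R, A)\<close>\<close>
    let ?v = "compose (arr T R A) p' (compose (arr T R A) r i')"
    have "compose (carrier (M A)) r i' \<in> mhom A X" by (rule module_hom_compose[OF rm iS rX])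
    then have v: "?v \<in> mhom A A" using mhom_compose p'(2) by simp
    have vu: "?v u = p' (r (i' u))" if "u \<in> arr T R A" for u using that by (simp add: compose_def)
    have vv: "?v (?v u) = ?v u" if u: "u \<in> arr T R A" for u
    proof -
      have ru: "r (i' u) \<in> N1" using r(2) u by blast
      then obtain w where w: "w \<in> arr T R A" "r (i' u) = i' w" using N12(1) by blast
      have vw: "?v u = w" unfolding vu[OF u] w(2) by (rule pi'[OF w(1)])
      have "?v w = w" unfolding vu[OF w(1)] using r(3)[OF ru] pi'[OF w(1)] unfolding w(2) by simp
      then show ?thesis unfolding vw .
    qed
    have "N.t_cmp (A, A, ?v) (A, A, ?v) = (A, A, ?v)" by (rule cmp_eqI[OF v]) (rule vv)
    then consider "(A, A, ?v) = N.t_zr A A" | "(A, A, ?v) = N.t_idt A"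
      using N.loc_idem[OF lA, of "(A, A, ?v)"] v by auto
    then show "N1 = {\<zero>\<^bsub>(M X)\<lparr>carrier := ?S\<rparr>\<^esub>} \<or> N2 = {\<zero>\<^bsub>(M X)\<lparr>carrier := ?S\<rparr>\<^esub>}"
    proof cases
      case 1
      have "n = zero_arr T R X" if n: "n \<in> N1" for n
      proof -
        obtain u where u: "u \<in> arr T R A" "n = i' u" using n N12(1) by blast
        have "?v u = zero_arr T R A" using 1 u(1) by (simp add: N.t_zr_eq)
        then have "u = zero_arr T R A" using vu[OF u(1)] r(3)[OF n] pi'[OF u(1)] unfolding u(2) by simp
        then show ?thesis using u(2) mhom_zero[OF i'(2)] by simp
      qed
      then have "N1 = {zero_arr T R X}" by (rule singleton_eqI[OF _ N12(3)])
      then show ?thesis by simp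
    next
      case 2
      have "n = zero_arr T R X" if n: "n \<in> N2" for n
      proof -
        obtain u where u: "u \<in> arr T R A" "n = i' u" using n N12(2) by blast
        have "?v u = u" using 2 u(1) by (simp add: N.t_idt_eq id_map_def)
        then have "u = zero_arr T R A" using vu[OF u(1)] r(4)[OF n] mhom_zero[OF p'(2)] unfolding u(2) by simp
        then show ?thesis using u(2) mhom_zero[OF i'(2)] by simp
      qed
      then have "N2 = {zero_arr T R X}" by (rule singleton_eqI[OF _ N12(4)])
      then show ?thesis by simp
    qed
  qed
  have "module_iso Gam (M A) ((M X)\<lparr>carrier := ?S\<rparr>)"
  proof (rule module_isoI)
    show "i' \<in> module_hom Gam (M A) ((M X)\<lparr>carrier := ?S\<rparr>)" by (rule module_hom_into_submodule[OF i'(2)]) simp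
    show "restrict p' ?S \<in> module_hom Gam ((M X)\<lparr>carrier := ?S\<rparr>) (M A)"
      using module_homI[OF rS, of p' "M A"] module_homD[OF p'(2)] SX by (auto simp: subset_iff)
  qed (use pi' in auto)
  then show ?thesis using s ind unfolding indecomposable_summands_def by blast
qed

text \<open>
  The direct summands of \<open>Hom(R, X)\<close> and the objects \<open>Ys\<close> realise the same isomorphism types, and by
  \<open>reflects\<close> the modules are isomorphic exactly when the objects are.
\<close>

theorem num_summands_eq: "num_summands Gam (M X) = card (set_mset (cls X))"
proof -
  let ?I = "indecomposable_summands Gam (M X)" and ?MS = "\<lambda>S. (M X)\<lparr>carrier := S\<rparr>"
  define c where "c S = (SOME A. A \<in> set Ys \<and> module_iso Gam (M A) (?MS S))" for S
  have c: "c S \<in> set Ys \<and> module_iso Gam (M (c S)) (?MS S)" if "S \<in> ?I" for S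
  proof -
    have "\<exists>A. A \<in> set Ys \<and> module_iso Gam (M A) (?MS S)" using indecomposable_summand_iso[OF that] by blast
    from someI_ex[OF this] show ?thesis unfolding c_def .
  qed
  have rS: "right_module Gam (?MS S)" if "S \<in> ?I" for S
    using that submodule_right_module[OF rm] unfolding indecomposable_summands_def internal_direct_sum_def by blast
  have uniq: "icl (c S) = icl A" if "S \<in> ?I" "A \<in> set Ys" "module_iso Gam (M A) (?MS S)" for S A
    using reflects[of "c S" A] c[OF that(1)] that module_iso_trans[OF rm _ module_iso_sym[OF rm rS[OF that(1)] that(3)]] by blast
  have rel: "module_iso Gam (?MS S) (?MS S') \<longleftrightarrow> icl (c S) = icl (c S')" if S: "S \<in> ?I" and S': "S' \<in> ?I" for S S'
  proof
    assume i: "module_iso Gam (?MS S) (?MS S')"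
    have "module_iso Gam (M (c S)) (?MS S')" using module_iso_trans[OF rm _ i] c[OF S] by blast
    then show "icl (c S) = icl (c S')" using uniq[OF S', of "c S"] c[OF S] by simp
  next
    assume "icl (c S) = icl (c S')"
    then have "module_iso Gam (M (c S)) (M (c S'))" using reflects c[OF S] c[OF S'] by blast
    then have "module_iso Gam (M (c S)) (?MS S')" using module_iso_trans[OF rm] c[OF S'] by blast
    moreover have "module_iso Gam (?MS S) (M (c S))" using module_iso_sym[OF rm rS[OF S]] c[OF S] by blast
    ultimately show "module_iso Gam (?MS S) (?MS S')" using module_iso_trans[OF rS[OF S]] by blast
  qed
  have "(\<lambda>S. icl (c S)) ` ?I = icl ` set Ys"
  proof
    show "(\<lambda>S. icl (c S)) ` ?I \<subseteq> icl ` set Ys" using c by blast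
    show "icl ` set Ys \<subseteq> (\<lambda>S. icl (c S)) ` ?I"
    proof
      fix r assume "r \<in> icl ` set Ys"
      then obtain A where A: "A \<in> set Ys" "r = icl A" by blast
      obtain S where S: "S \<in> ?I" "module_iso Gam (M A) (?MS S)" using indecomposable_summand_exists[OF A(1)] by blast
      show "r \<in> (\<lambda>S. icl (c S)) ` ?I" using uniq[OF S(1) A(1) S(2)] S(1) A(2) by blast
    qed
  qed
  moreover have "{(S, S'). S \<in> ?I \<and> S' \<in> ?I \<and> module_iso Gam (?MS S) (?MS S')} = {(S, S'). S \<in> ?I \<and> S' \<in> ?I \<and> icl (c S) = icl (c S')}"
    using rel by blast
  ultimately have "num_summands Gam (M X) = card (icl ` set Ys)"
    unfolding num_summands_def using card_quotient_kernel[of ?I "\<lambda>S. icl (c S)"] by simp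
  then show ?thesis using cls_eq[OF Ys] by simp
qed

text \<open>
  Two isomorphic summands \<open>S\<close> and \<open>S'\<close> of the module give two orthogonal idempotents.  Exchanging with
  one after the other finds two members of \<open>Ys\<close> whose modules are isomorphic to \<open>S\<close>, so a class of
  summands of \<open>X\<close> has multiplicity at least two.
\<close>

theorem basic_module_Hom:
  assumes b: "basic T X"
  shows "basic_module Gam (M X)"
  unfolding basic_module_def
proof (intro notI, elim exE conjE)
  fix S S' C
  assume S: "submodule S Gam (M X)" and S': "submodule S' Gam (M X)" and int: "S \<inter> S' = {\<zero>\<^bsub>M X\<^esub>}"
    and ds: "internal_direct_sum Gam (M X) (S <+>\<^bsub>M X\<^esub> S') C"
    and ind: "indecomposable_module Gam ((M X)\<lparr>carrier := S\<rparr>)"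
    and iso: "module_iso Gam ((M X)\<lparr>carrier := S\<rparr>) ((M X)\<lparr>carrier := S'\<rparr>)"
  let ?P = "S <+>\<^bsub>M X\<^esub> S'" and ?MP = "(M X)\<lparr>carrier := S <+>\<^bsub>M X\<^esub> S'\<rparr>"
  interpret MX: abelian_group "M X" using rm by (rule right_module_ab)
  have sP: "submodule ?P Gam (M X)" using ds unfolding internal_direct_sum_def by blast
  note rP = submodule_right_module[OF rm sP]
  note s = submoduleD[OF S] and s' = submoduleD[OF S'] and sp = submoduleD[OF sP]
  have SP: "S \<subseteq> ?P" "S' \<subseteq> ?P"
  proof -
    show "S \<subseteq> ?P" unfolding subset_iff set_add_iff using s(1) s'(2) MX.r_zero by (metis subsetD)
    show "S' \<subseteq> ?P" unfolding subset_iff set_add_iff using s'(1) s(2) MX.l_zero by (metis subsetD)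
  qed
  have neg: "\<ominus>\<^bsub>?MP\<^esub> x = \<ominus>\<^bsub>M X\<^esub> x" if "x \<in> ?P" for x
  proof -
    interpret P: abelian_group ?MP using rP by (rule right_module_ab)
    show ?thesis by (rule P.minus_equality) (use that sp MX.l_neg in auto)
  qed
  have sub: "submodule V Gam ?MP" if "submodule V Gam (M X)" "V \<subseteq> ?P" for V
    by (rule submoduleI[OF rP]) (use submoduleD[OF that(1)] that(2) neg in auto)
  have d1: "internal_direct_sum Gam ?MP S S'"
    unfolding internal_direct_sum_def using sub[OF S SP(1)] sub[OF S' SP(2)] int by (auto simp: set_add_iff)
  have comm: "S' <+>\<^bsub>M X\<^esub> S = ?P"
    by (rule set_add_swap) (rule MX.a_comm[OF subsetD[OF s'(1)] subsetD[OF s(1)]])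
  have d2: "internal_direct_sum Gam ?MP S' S"
    unfolding internal_direct_sum_def using sub[OF S SP(1)] sub[OF S' SP(2)] int comm by (auto simp: set_add_iff)
  obtain p where p: "p \<in> mhom X X" "\<And>x. x \<in> arr T R X \<Longrightarrow> p x \<in> ?P" "\<And>x. x \<in> ?P \<Longrightarrow> p x = x"
    by (rule internal_direct_sum_projection[OF rm ds]) auto
  have pP: "p \<in> module_hom Gam (M X) ?MP" by (rule module_hom_into_submodule[OF p(1)]) (use p(2) in simp)
  obtain r where r: "r \<in> module_hom Gam ?MP ?MP" "\<And>x. x \<in> ?P \<Longrightarrow> r x \<in> S" "\<And>x. x \<in> S \<Longrightarrow> r x = x" "\<And>x. x \<in> S' \<Longrightarrow> r x = zero_arr T R X"
    by (rule internal_direct_sum_projection[OF rP d1]) auto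
  obtain r' where r': "r' \<in> module_hom Gam ?MP ?MP" "\<And>x. x \<in> ?P \<Longrightarrow> r' x \<in> S'" "\<And>x. x \<in> S' \<Longrightarrow> r' x = x" "\<And>x. x \<in> S \<Longrightarrow> r' x = zero_arr T R X"
    by (rule internal_direct_sum_projection[OF rP d2]) auto
  let ?e = "compose (arr T R X) r p" and ?e' = "compose (arr T R X) r' p"
  have PX: "?P \<subseteq> arr T R X" "S \<subseteq> arr T R X" "S' \<subseteq> arr T R X" using sp(1) s(1) s'(1) by auto
  have e: "?e \<in> mhom X X" "?e' \<in> mhom X X"
    using module_hom_compose[OF rm pP module_hom_from_submodule[OF r(1)]] module_hom_compose[OF rm pP module_hom_from_submodule[OF r'(1)]] sp(1) by simp_all
  have eu: "?e u = r (p u)" "?e' u = r' (p u)" if "u \<in> arr T R X" for u using that by (simp_all add: compose_def)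
  have eS: "?e u \<in> S" "?e' u \<in> S'" if "u \<in> arr T R X" for u unfolding eu[OF that] using r(2) r'(2) p(2) that by blast+
  have eid: "?e u = u" "?e' u = zero_arr T R X" if u: "u \<in> S" for u
  proof -
    have "u \<in> arr T R X" "u \<in> ?P" using u PX SP by blast+
    then show "?e u = u" "?e' u = zero_arr T R X" using eu p(3) r(3) r'(4) u by simp_all
  qed
  have eid': "?e' u = u" "?e u = zero_arr T R X" if u: "u \<in> S'" for u
  proof -
    have "u \<in> arr T R X" "u \<in> ?P" using u PX SP by blast+
    then show "?e' u = u" "?e u = zero_arr T R X" using eu p(3) r'(3) r(4) u by simp_all
  qed
  note h = projection_hm[OF e(1) eid(1)[OF eS(1)]] and h' = projection_hm[OF e(2) eid'(1)[OF eS(2)]]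
  let ?E = "(X, X, ?e)" and ?E' = "(X, X, ?e')"
  have z1: "N.t_cmp ?E ?E' = N.t_zr X X"
    by (rule cmp_zrI) (rule eid'(2)[OF eS(2)])
  have z2: "N.t_cmp ?E' ?E = N.t_zr X X"
    by (rule cmp_zrI) (rule eid(2)[OF eS(1)])
  \<comment> \<open>first exchange: \<open>S\<close> is the module of one member of \<open>Ys\<close>, and \<open>Bs\<close> decomposes the complement of \<open>e\<close>\<close>
  obtain As Bs where A: "N.dec X ?E As" "N.dec X (N.mns (N.t_idt X) ?E) Bs" "mset Ys = mset As + mset Bs"
    using N.exchange[OF NYs h] h(1) N.cmp_idt[of ?E X] N.idt_cmp[of ?E X] by auto
  have sA: "set As \<subseteq> set Ys" "set Bs \<subseteq> set Ys" using A(3) by (metis set_mset_mset set_mset_union sup_ge1 sup_ge2)+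
  have lA: "\<forall>A \<in> set As. N.loc A" and lB: "\<forall>A \<in> set Bs. N.loc A" using NYs(2) sA by blast+
  have im: "S = ?e ` arr T R X"
  proof
    show "S \<subseteq> ?e ` arr T R X"
    proof
      fix u assume u: "u \<in> S"
      show "u \<in> ?e ` arr T R X" by (rule image_eqI[of _ ?e, OF eid(1)[OF u, symmetric] subsetD[OF PX(2) u]])
    qed
    show "?e ` arr T R X \<subseteq> S" by (rule image_subsetI) (rule eS(1))
  qed
  obtain A0 where A0: "As = [A0]" "module_iso Gam (M A0) ((M X)\<lparr>carrier := S\<rparr>)"
    by (rule summand_of_indecomposable_image[OF e(1) eid(1)[OF eS(1)] im ind A(1) lA])
  have "module_iso Gam (M A0) ((M X)\<lparr>carrier := S'\<rparr>)" by (rule module_iso_trans[OF rm A0(2) iso])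
  then have dE': "N.dec X ?E' [A0]" by (intro dec_of_iso_image[OF e(2) eS(2) eid'(1) S'])
  have hE: "?E \<in> N.hm X X" "?E' \<in> N.hm X X" by (rule h(1), assumption) (rule h'(1), assumption)
  define E E' where "E = ?E" "E' = ?E'"
  have EE: "E \<in> N.hm X X" "E' \<in> N.hm X X" "N.t_cmp E E' = N.t_zr X X" "N.t_cmp E' E = N.t_zr X X" "N.t_cmp E' E' = E'"
    unfolding E_E'_def using hE z1 z2 h'(2) by blast+
  \<comment> \<open>second exchange, inside the complement: \<open>S'\<close> is the module of another member\<close>
  have "\<exists>As' Bs'. N.dec X E' As' \<and> N.dec X (N.mns (N.mns (N.t_idt X) E) E') Bs' \<and> mset Bs = mset As' + mset Bs'"
    by (rule N.exchange[OF A(2)[folded E_E'_def] lB EE(2,5)]) (use EE in \<open>simp_all add: N.cmp_mns_left N.cmp_mns_right\<close>)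
  then obtain As' Bs' where A': "N.dec X E' As'" "mset Bs = mset As' + mset Bs'" by blast
  have sA': "set As' \<subseteq> set Ys" using A'(2) sA(2) by (metis set_mset_mset set_mset_union sup_ge1 subset_trans)
  have lA': "\<forall>A \<in> set As'. N.loc A" using NYs(2) sA' by blast
  have "image_mset N.icl (mset As') = image_mset N.icl (mset [A0])"
    by (rule N.krull_schmidt_unique[OF A'(1)[unfolded E_E'_def] dE' lA']) (use lA A0(1) in simp)
  then obtain A1 where A1: "As' = [A1]" "N.icl A1 = N.icl A0"
    by (cases As') auto
  have m: "A0 \<in> set Ys" "A1 \<in> set Ys" using sA(1) sA' A0(1) A1(1) by auto
  have "module_iso Gam (M A1) (M A0)" using A1(2) unfolding N.icl_eq isom_module_iso .
  then have "icl A1 = icl A0" using reflects m by blast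
  then have "count (cls X) (icl A0) \<ge> 2" unfolding cls_eq[OF Ys] A(3) A'(2) A0(1) A1(1) by simp
  then show False using basic_count[OF b, of "icl A0"] by simp
qed

end

section \<open>Tilting modules\<close>

text \<open>
  The regular module of \<open>End(R)\<close> and the module \<open>Hom(R, R)\<close> are different records with the same carrier,
  addition and action.
\<close>

lemma num_summands_cong:
  fixes M N :: "('a, 'b) module"
  assumes eq: "carrier M = carrier N" "\<zero>\<^bsub>M\<^esub> = \<zero>\<^bsub>N\<^esub>" "ring.add M = ring.add N" "smult M = smult N"
  shows "num_summands G M = num_summands G N"
proof -
  have sub: "submodule A G (M\<lparr>carrier := C\<rparr>) \<longleftrightarrow> submodule A G (N\<lparr>carrier := C\<rparr>)" for A C
    unfolding submodule_def submodule_axioms_def using eq by simp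
  have sub': "submodule A G M \<longleftrightarrow> submodule A G N" for A
    unfolding submodule_def submodule_axioms_def using eq by simp
  have hom: "module_hom G (M\<lparr>carrier := A\<rparr>) (M\<lparr>carrier := B\<rparr>) = module_hom G (N\<lparr>carrier := A\<rparr>) (N\<lparr>carrier := B\<rparr>)" for A B
    unfolding module_hom_def using eq by simp
  have sum: "internal_direct_sum G (M\<lparr>carrier := C\<rparr>) A B \<longleftrightarrow> internal_direct_sum G (N\<lparr>carrier := C\<rparr>) A B" for A B C
    unfolding internal_direct_sum_def sub set_add_def set_mult_def using eq by simp
  have sum': "internal_direct_sum G M A B \<longleftrightarrow> internal_direct_sum G N A B" for A B
    unfolding internal_direct_sum_def sub' set_add_def set_mult_def using eq by simp
  have "indecomposable_module G (M\<lparr>carrier := C\<rparr>) \<longleftrightarrow> indecomposable_module G (N\<lparr>carrier := C\<rparr>)" for C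
    unfolding indecomposable_module_def sum using eq by simp
  then have "indecomposable_summands G M = indecomposable_summands G N"
    unfolding indecomposable_summands_def sum' by simp
  then show ?thesis unfolding num_summands_def module_iso_def hom by simp
qed

context hom_modules
begin

lemma num_summands_Hom:
  assumes X: "X \<in> pr T R" "no_shift_summand T R X"
  shows "num_summands Gam (M X) = card (set_mset (cls X))"
proof -
  obtain Ys where "dec X (t_idt X) Ys" "\<forall>Y \<in> set Ys. loc Y" using ks by blast
  then interpret hom_summands K T R X Ys using X by unfold_locales
  show ?thesis by (rule num_summands_eq)
qed

lemma basic_Hom:
  assumes X: "X \<in> pr T R" "no_shift_summand T R X" and b: "basic T X"
  shows "basic_module Gam (M X)"
proof -
  obtain Ys where "dec X (t_idt X) Ys" "\<forall>Y \<in> set Ys. loc Y" using ks by blast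
  then interpret hom_summands K T R X Ys using X by unfold_locales
  show ?thesis by (rule basic_module_Hom[OF b])
qed

text \<open>
  An object in \<open>add R\<close> and in \<open>add(R[1])\<close> is zero, because \<open>Hom(R, R[1]) = 0\<close>.
\<close>

lemma self_presented: "R \<in> pr T R" "no_shift_summand T R R"
proof -
  show "R \<in> pr T R" using pres_gen[OF gen_refl, of R] pres_pr[OF rigid] by blast
  show "no_shift_summand T R R" unfolding no_shift_summand_def
  proof (intro allI impI, elim conjE)
    fix V assume V: "direct_summand T V R" "V \<in> add_closure T (shift T R)"
    have g: "gen R V" "gen (shift T R) V" using V direct_summand_gen add_closure_iff by blast+
    have "f = t_zr R V" if "f \<in> hm R V" for f
      by (rule gen_zero_left[OF g(2) _ that]) (use rigid rig_iff rig_def in blast)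
    then show "is_zero T V" unfolding is_zero_iff by (intro gen_zero_right[OF g(1), of V "t_idt V"]) simp_all
  qed
qed

lemma num_summands_regular: "num_summands Gam (regular_module Gam) = card (set_mset (cls R))"
proof -
  have "num_summands Gam (regular_module Gam) = num_summands Gam (M R)"
    by (rule num_summands_cong) (simp_all add: regular_module_def Hom_module_def End_ring_def)
  then show ?thesis using num_summands_Hom[OF self_presented] by simp
qed

theorem proj_dim_le_1_iff:
  assumes X: "X \<in> pr T R" "no_shift_summand T R X"
  shows "proj_dim Gam (M X) \<le> 1 \<longleftrightarrow> factoring T X (shift T R) (shift T R) = {zero_arr T (shift T R) (shift T R)}"
proof -
  obtain R1 R0 f g h where P: "presented K T R X R1 R0 f g h" using presentation[OF X(1)] .
  interpret P: presented K T R X R1 R0 f g h by (rule P)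
  show ?thesis using P.proj_dim_mono[OF _ X(2)] P.mono_proj_dim P.factoring_iff_mono by blast
qed

theorem tilting_iff:
  assumes X: "X \<in> pr T R" "no_shift_summand T R X" and b: "basic T X"
  shows "tilting_module Gam (M X) \<longleftrightarrow>
    factoring T X (shift T R) (shift T R) = {zero_arr T (shift T R) (shift T R)} \<and> maximal_shift_rigid T R X"
proof -
  obtain R1 R0 f g h where P: "presented K T R X R1 R0 f g h" using presentation[OF X(1)] .
  interpret P: presented K T R X R1 R0 f g h by (rule P)
  have "tilting_module Gam (M X) \<longleftrightarrow> P.mono \<and> trivial_group (ext_group Gam 1 (M X) (M X)) \<and>
      card (set_mset (cls X)) = card (set_mset (cls R))"
    unfolding tilting_module_def proj_dim_le_1_iff[OF X] P.factoring_iff_mono num_summands_Hom[OF X] num_summands_regular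
    using Hom_module_fg[of R X] basic_Hom[OF X b] by blast
  also have "\<dots> \<longleftrightarrow> P.mono \<and> shift_rigid T R X \<and> card (set_mset (cls X)) = card (set_mset (cls R))"
    using P.trivial_ext_shift_rigid by blast
  also have "\<dots> \<longleftrightarrow> P.mono \<and> maximal_shift_rigid T R X"
    using maximal_shift_rigid_iff[OF rigid X(1)] maximal_shift_rigid_def[of T R X] by blast
  finally show ?thesis unfolding P.factoring_iff_mono .
qed

end

theorem theorem2p9:
  fixes K :: "'k ring" and T :: "('o, 'm, 'k) tri_cat" and R :: 'o
  assumes "algebraically_closed K"
    and "triangulated_category K T"
    and "krull_schmidt T"
    and "hom_finite K T"
    and "basic T R"
    and "rigid T R"
  shows "(\<forall>X \<in> pr T R. no_shift_summand T R X \<longrightarrow>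
            (proj_dim (End_ring T R) (Hom_module T R X) \<le> 1 \<longleftrightarrow>
             factoring T X (shift T R) (shift T R) = {zero_arr T (shift T R) (shift T R)}))
       \<and> (\<forall>X \<in> pr T R. basic T X \<and> no_shift_summand T R X \<longrightarrow>
            (tilting_module (End_ring T R) (Hom_module T R X) \<longleftrightarrow>
             factoring T X (shift T R) (shift T R) = {zero_arr T (shift T R) (shift T R)} \<and>
             maximal_shift_rigid T R X))"
proof -
  interpret triangulated_category K T by fact
  interpret hom_modules K T R
    using assms(3,4,6) by unfold_locales
  show ?thesis using proj_dim_le_1_iff tilting_iff by blast
qed

end
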